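(* Let $\Lambda(\Omega)\subset\mathbb{R}^m$ be a simple generic model set with $\Omega$ symmetric around the origin, let $\Delta\subset\mathbb{R}^m$ be relatively dense and uniformly discrete, and let $g_1,\dots,g_L\in W(L^2,\ell^1)$. The Gabor system $$\mathcal{G}(g,\Lambda(\Omega),\Delta)=\{T_\lambda M_\beta g_l: l=1,\dots,L,\ \lambda\in\Lambda(\Omega),\ \beta\in\Delta\}$$ is a normalized tight frame for $L^2(\mathbb{R}^m)$ if and only if, for each $\eta\in\Gamma^*$, $$D(\Lambda(\Omega))\,\Phi(-p_2^*(\eta))\sum_{l=1}^L\sum_{\beta\in\Delta}\overline{\widehat{g_l}(t-\beta)}\,\widehat{g_l}(t-\beta-p_1^*(\eta))=\delta_{\eta,0}\quad\text{for a.e. } t\in\mathbb{R}^m,$$ where $\delta$ is the Kronecker delta.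
   Context: Notation: $T_\lambda f(t)=f(t-\lambda)$, $M_\beta f(t)=e^{2\pi i\beta\cdot t}f(t)$; $\widehat f(\omega)=\int_{\mathbb{R}^m} f(t)e^{-2\pi i t\cdot\omega}\,dt$. $W(L^p,\ell^q)$ is the space of measurable functions $f$ on $\mathbb{R}^m$ with $\|f\|_{p,q}=\big(\sum_{k\in\mathbb{Z}^m}\|f\mathbf{1}_{k+[0,1]^m}\|_p^q\big)^{1/q}<\infty$. A family $\{e_j\}$ is a normalized tight frame if $\sum_j|\langle f,e_j\rangle|^2=\|f\|_2^2$ for all $f\in L^2(\mathbb{R}^m)$. A set is uniformly discrete if distinct points are at distance at least some $r>0$, and relatively dense if for some $r>0$ it meets every cube $t+r[0,1]^m$. Model sets: let $\Gamma\subset\mathbb{R}^m\times\mathbb{R}$ be a lattice and $p_1:\mathbb{R}^m\times\mathbb{R}\to\mathbb{R}^m$, $p_2:\mathbb{R}^m\times\mathbb{R}\to\mathbb{R}$ the orthogonal projections; assume $p_1|_\Gamma$ and $p_2|_\Gamma$ are injective with dense images. $\Gamma^*=\{y:\gamma\cdot y\in\mathbb{Z}\ \forall\gamma\in\Gamma\}$ is the dual lattice and $p_1^*,p_2^*$ are the same projections used on $\Gamma^*$ (also injective on $\Gamma^*$ with dense images). For a compact interval $\Omega\subset\mathbb{R}$ with non-empty interior, $\Lambda(\Omega)=\{p_1(\gamma):\gamma\in\Gamma,\ p_2(\gamma)\in\Omega\}$ is a simple model set; it is generic if $p_2(\Gamma)\cap\partial\Omega=\emptyset$. Standing assumption: also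 $p_2^*(\Gamma^* )\cap\partial\Omega=\emptyset$. Its density is $D(\Lambda(\Omega))=\lim_{R\to\infty}\#(\Lambda(\Omega)\cap(x+R[0,1]^m))/R^m=|\Omega|/\mathrm{vol}(\Gamma)$. The function $\Phi$: fix $0<\epsilon<1$, put $\Omega_n=(1-\epsilon^n)\Omega$ and let $\psi_n$ be the infinite convolution product over $s=0,1,2,\dots$ of the functions $\mathbf{1}_{\epsilon^{ns}\Omega_n}/|\epsilon^{ns}\Omega_n|$ (convergent in $L^1(\mathbb{R})$), so that $\widehat{\psi_n}(t)=\prod_{s=0}^\infty\mathrm{sinc}(t|\epsilon^{ns}\Omega_n|)$ with $\mathrm{sinc}(t)=\sin(\pi t)/(\pi t)$. Let $\Psi$ be the uniform limit of $\widehat{\psi_n}$ as $n\to\infty$ (namely $\Psi(t)=\mathrm{sinc}(|\Omega|t)$, the Fourier transform of $\mathbf{1}_\Omega/|\Omega|$), and set $\Phi=|\Omega|\cdot(\Psi*\Psi)$. Then $\Phi(0)=1$. *)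

theory Defs
  imports "HOL-Analysis.Analysis"
begin

section \<open>Lebesgue and amalgam spaces\<close>

text \<open>Spaces of functions, not of equivalence classes; all exponents are finite.\<close>

definition Lp_space :: "real \<Rightarrow> ('a::euclidean_space \<Rightarrow> complex) set" where
  "Lp_space p = {f \<in> borel_measurable lebesgue. integrable lebesgue (\<lambda>t. norm (f t) powr p)}"

definition Lp_norm :: "real \<Rightarrow> ('a::euclidean_space \<Rightarrow> complex) \<Rightarrow> real" where
  "Lp_norm p f = (\<integral>t. norm (f t) powr p \<partial>lebesgue) powr (1 / p)"

definition L2_inner :: "('a::euclidean_space \<Rightarrow> complex) \<Rightarrow> ('a \<Rightarrow> complex) \<Rightarrow> complex" where
  "L2_inner f h = (\<integral>t. f t * cnj (h t) \<partial>lebesgue)"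

definition cube :: "real ^ 'm \<Rightarrow> real \<Rightarrow> (real ^ 'm) set" where
  "cube x r = (\<lambda>u. x + r *\<^sub>R u) ` cbox 0 1"

definition integer_points :: "(real ^ 'm) set" where
  "integer_points = {k. \<forall>i. k $ i \<in> \<int>}"

definition wiener_amalgam :: "real \<Rightarrow> real \<Rightarrow> (real ^ 'm \<Rightarrow> complex) set" where
  "wiener_amalgam p q =
     {f \<in> borel_measurable lebesgue.
        (\<forall>k\<in>integer_points. (\<lambda>t. f t * indicator (cube k 1) t) \<in> Lp_space p) \<and>
        (\<lambda>k. Lp_norm p (\<lambda>t. f t * indicator (cube k 1) t) powr q) summable_on integer_points}"

section \<open>Fourier transform, translations, modulations, frames\<close>

definition fourier :: "('a::euclidean_space \<Rightarrow> complex) \<Rightarrow> 'a \<Rightarrow> complex" where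
  "fourier f w = (\<integral>t. f t * cis (- 2 * pi * (t \<bullet> w)) \<partial>lebesgue)"

definition translate :: "'a::euclidean_space \<Rightarrow> ('a \<Rightarrow> complex) \<Rightarrow> 'a \<Rightarrow> complex" where
  "translate l f t = f (t - l)"

definition modulate :: "'a::euclidean_space \<Rightarrow> ('a \<Rightarrow> complex) \<Rightarrow> 'a \<Rightarrow> complex" where
  "modulate b f t = cis (2 * pi * (b \<bullet> t)) * f t"

text \<open>A frame is an indexed family: repeated members count with multiplicity.\<close>

definition normalized_tight_frame :: "'j set \<Rightarrow> ('j \<Rightarrow> 'a::euclidean_space \<Rightarrow> complex) \<Rightarrow> bool" where
  "normalized_tight_frame J e \<longleftrightarrow>
     (\<forall>f\<in>Lp_space 2. ((\<lambda>j. (cmod (L2_inner f (e j)))\<^sup>2) has_sum (Lp_norm 2 f)\<^sup>2) J)"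

definition gabor_index ::
    "nat \<Rightarrow> 'a set \<Rightarrow> 'a set \<Rightarrow> (nat \<times> 'a \<times> 'a) set" where
  "gabor_index L X Y = {1..L} \<times> X \<times> Y"

definition gabor_system ::
    "(nat \<Rightarrow> 'a::euclidean_space \<Rightarrow> complex) \<Rightarrow> nat \<times> 'a \<times> 'a \<Rightarrow> 'a \<Rightarrow> complex" where
  "gabor_system g = (\<lambda>(l, x, b). translate x (modulate b (g l)))"

section \<open>Discrete sets, lattices and model sets\<close>

definition relatively_dense :: "(real ^ 'm) set \<Rightarrow> bool" where
  "relatively_dense S \<longleftrightarrow> (\<exists>r>0. \<forall>t. S \<inter> cube t r \<noteq> {})"

definition is_lattice :: "'a::euclidean_space set \<Rightarrow> bool" where
  "is_lattice G \<longleftrightarrow>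
     (\<exists>B. independent B \<and> span B = UNIV \<and>
          G = {(\<Sum>b\<in>B. of_int (c b) *\<^sub>R b) | c :: 'a \<Rightarrow> int. True})"

definition dual_lattice :: "'a::euclidean_space set \<Rightarrow> 'a set" where
  "dual_lattice G = {y. \<forall>x\<in>G. x \<bullet> y \<in> \<int>}"

definition model_set :: "('a \<times> real) set \<Rightarrow> real set \<Rightarrow> 'a set" where
  "model_set G W = {fst x | x. x \<in> G \<and> snd x \<in> W}"

text \<open>The limit is required to exist and to be the same for every corner point \<open>x\<close>.\<close>

definition point_density :: "(real ^ 'm) set \<Rightarrow> real" where
  "point_density S =
     (THE D. \<forall>x. ((\<lambda>R. real (card (S \<inter> cube x R)) / R ^ CARD('m)) \<longlongrightarrow> D) at_top)"

section \<open>The function \<open>\<Phi>\<close>\<close>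

definition convolve :: "(real \<Rightarrow> complex) \<Rightarrow> (real \<Rightarrow> complex) \<Rightarrow> real \<Rightarrow> complex" where
  "convolve f h x = (\<integral>y. f y * h (x - y) \<partial>lebesgue)"

primrec partial_convolution :: "(nat \<Rightarrow> real \<Rightarrow> complex) \<Rightarrow> nat \<Rightarrow> real \<Rightarrow> complex" where
  "partial_convolution k 0 = k 0"
| "partial_convolution k (Suc N) = convolve (partial_convolution k N) (k (Suc N))"

text \<open>The \<open>L\<^sup>1\<close> limit of the partial convolutions is unique up to a null set only; some
  representative is chosen.\<close>

definition infinite_convolution :: "(nat \<Rightarrow> real \<Rightarrow> complex) \<Rightarrow> real \<Rightarrow> complex" where
  "infinite_convolution k =
     (SOME f. integrable lebesgue f \<and>
        (\<lambda>N. \<integral>\<^sup>+x. norm (partial_convolution k N x - f x) \<partial>lebesgue) \<longlonglongrightarrow> 0)"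

definition normalized_indicator :: "real set \<Rightarrow> real \<Rightarrow> complex" where
  "normalized_indicator A x = of_real (indicator A x / measure lebesgue A)"

text \<open>In the next definition the window is \<open>(1 - \<epsilon>\<^sup>n)W\<close>, which degenerates to a null set for
  \<open>n = 0\<close>; only the limit \<open>n \<rightarrow> \<infinity>\<close> is used.\<close>

definition psi :: "real \<Rightarrow> real set \<Rightarrow> nat \<Rightarrow> real \<Rightarrow> complex" where
  "psi \<epsilon> W n =
     infinite_convolution
       (\<lambda>s. normalized_indicator ((\<lambda>x. \<epsilon> ^ (n * s) * ((1 - \<epsilon> ^ n) * x)) ` W))"

definition Psi :: "real \<Rightarrow> real set \<Rightarrow> real \<Rightarrow> complex" where
  "Psi \<epsilon> W = (THE P. uniform_limit UNIV (\<lambda>n. fourier (psi \<epsilon> W n)) P sequentially)"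

definition Phi :: "real \<Rightarrow> real set \<Rightarrow> real \<Rightarrow> complex" where
  "Phi \<epsilon> W t = of_real (measure lebesgue W) * convolve (Psi \<epsilon> W) (Psi \<epsilon> W) t"

end

theory Submission
  imports Defs "HOL-Probability.Probability"
begin

text \<open>
  For bounded \<open>f\<close> of bounded support let \<open>q(x)\<close> be the sum over \<open>l\<close> and \<open>\<beta>\<close> of the squared
  coefficients of \<open>f\<close> against \<open>T\<^sub>x M\<^sub>\<beta> g\<^sub>l\<close>. Cut and project: the frame sum of \<open>f\<close> is the value at \<open>0\<close> of
  the \<open>\<Gamma>\<close>-periodization of \<open>(x, s) \<mapsto> q(x) 1\<^sub>\<Omega>(s)\<close>. Up to the factor \<open>vol(\<Gamma>)\<close>, the Fourier
  coefficient of the periodization at \<open>\<eta> \<in> \<Gamma>\<^sup>*\<close> is \<open>|\<Omega>| \<Phi>(-p\<^sub>2\<^sup>*(\<eta>))\<close> times the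
  integral of \<open>F(t) cnj (F(t - p\<^sub>1\<^sup>*(\<eta>)))\<close> against the sum in the frame condition, where \<open>F\<close> is the
  Fourier transform of \<open>f\<close>; here \<open>\<Phi>\<close> is just the Fourier transform of \<open>1\<^sub>\<Omega>/|\<Omega>|\<close>, by Plancherel. Genericity of the window makes the periodization
  continuous at \<open>0\<close> and almost everywhere. So if all coefficients at \<open>\<eta> \<noteq> 0\<close> vanish and the one at
  \<open>0\<close> is right, the value at \<open>0\<close> is the squared norm of \<open>f\<close>. Conversely, a tight frame
  forces the periodization to be constant, by translating \<open>f\<close> and by density of \<open>p\<^sub>2(\<Gamma>)\<close>, and
  the vanishing of its coefficients for all \<open>f\<close> yields the pointwise conditions by polarization.
\<close>

text \<open>The indicator of the window has a Fourier transform that decays only like the inverse of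
  the frequency, so the Fourier series of the periodization need not converge absolutely and Poisson
  summation is not at hand. The series is therefore never summed: Fourier coefficients of two
  bounded periodic functions are compared, and equality is concluded at one point of continuity.
  This shifts the work to the periodization itself. Bounded support of \<open>f\<close> turns the
  sum over \<beta> into samples of the transform of a function of bounded support on a uniformly
  discrete set, whence a Bessel bound; it makes q continuous and bounds q(x) by the mass of the
  windows near -x. Lattice points in balls of fixed radius are uniformly bounded in number, so these
  local masses add up to a bounded multiple of the squared norms. The passage from such
  \<open>f\<close> to all of L2 needs Bessel's inequality for the system first, which Fatou's lemma
  supplies. Bounded functions of bounded support are closed under translation and linear
  combination, as the converse direction requires. The amalgam condition enters through its
  embedding into L1 and L2.\<close>

section \<open>Affine substitution and continuity of translations in L1 and L2\<close>

lemma integral_lborel_affine: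
  fixes F :: "'a::euclidean_space \<Rightarrow> 'b::{banach, second_countable_topology}"
  assumes [measurable]: "F \<in> borel_measurable borel" and c: "c \<noteq> 0"
  shows "(\<integral>x. F x \<partial>lborel) = \<bar>c\<bar> ^ DIM('a) *\<^sub>R (\<integral>x. F (t + c *\<^sub>R x) \<partial>lborel)"
  by (subst lborel_affine[OF c, of t]) (simp add: integral_density integral_distr)

lemma integrable_lborel_affine:
  fixes F :: "'a::euclidean_space \<Rightarrow> 'b::{banach, second_countable_topology}"
  assumes [measurable]: "F \<in> borel_measurable borel" and c: "c \<noteq> 0"
  shows "integrable lborel F \<longleftrightarrow> integrable lborel (\<lambda>x. F (t + c *\<^sub>R x))"
proof -
  have "integrable lborel F \<longleftrightarrow> integrable lborel (\<lambda>x. \<bar>c\<bar> ^ DIM('a) *\<^sub>R F (t + c *\<^sub>R x))"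
    by (subst lborel_affine[OF c, of t]) (simp add: integrable_density integrable_distr_eq)
  also have "\<dots> \<longleftrightarrow> integrable lborel (\<lambda>x. F (t + c *\<^sub>R x))"
    using integrable_scaleR_right[of "inverse (\<bar>c\<bar> ^ DIM('a))" lborel "\<lambda>x. \<bar>c\<bar> ^ DIM('a) *\<^sub>R F (t + c *\<^sub>R x)"] c
    by auto
  finally show ?thesis .
qed

lemma nn_integral_lborel_affine:
  fixes F :: "'a::euclidean_space \<Rightarrow> ennreal"
  assumes [measurable]: "F \<in> borel_measurable borel" and c: "c \<noteq> 0"
  shows "(\<integral>\<^sup>+x. F x \<partial>lborel) = ennreal (\<bar>c\<bar> ^ DIM('a)) * (\<integral>\<^sup>+x. F (t + c *\<^sub>R x) \<partial>lborel)"
  by (subst lborel_affine[OF c, of t]) (simp add: nn_integral_density nn_integral_distr nn_integral_cmult)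

text \<open>The three members, selected by position later on, concern the Bochner integral,
  integrability and the nonnegative integral. The same order holds for
  \<open>lborel_reflect\<close>, which substitutes \<open>t - x\<close>.\<close>

lemmas lborel_shift =
  integral_lborel_affine[where c=1, simplified]
  integrable_lborel_affine[where c=1, simplified]
  nn_integral_lborel_affine[where c=1, simplified]

lemmas lborel_reflect =
  integral_lborel_affine[where c="-1", simplified]
  integrable_lborel_affine[where c="-1", simplified]
  nn_integral_lborel_affine[where c="-1", simplified]

text \<open>Translations are isometries of L1, so replacing \<open>f\<close> by \<open>h\<close>
  changes the modulus of continuity by at most twice their distance; hence the three parts of size
  \<open>e/3\<close>. The sequence \<open>y\<close> is fixed throughout, and \<open>h\<close> has to
  be good for this sequence only.\<close>

lemma L1_translation_approx:
  fixes f :: "'a::euclidean_space \<Rightarrow> complex"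
  assumes f: "integrable lborel f"
    and approx: "\<And>e. e > 0 \<Longrightarrow> \<exists>h. integrable lborel h \<and> (\<integral>x. cmod (f x - h x) \<partial>lborel) < e \<and>
       (\<lambda>n. \<integral>x. cmod (h (x - y n) - h x) \<partial>lborel) \<longlonglongrightarrow> 0"
  shows "(\<lambda>n. \<integral>x. cmod (f (x - y n) - f x) \<partial>lborel) \<longlonglongrightarrow> 0"
proof (rule LIMSEQ_I)
  fix e :: real assume "e > 0"
  then obtain h where h: "integrable lborel h" "(\<integral>x. cmod (f x - h x) \<partial>lborel) < e/3"
    "(\<lambda>n. \<integral>x. cmod (h (x - y n) - h x) \<partial>lborel) \<longlonglongrightarrow> 0"
    using approx[of "e/3"] by auto
  have [measurable]: "f \<in> borel_measurable borel" "h \<in> borel_measurable borel"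
    using f h(1) by auto
  obtain N where N: "\<And>n. n \<ge> N \<Longrightarrow> (\<integral>x. cmod (h (x - y n) - h x) \<partial>lborel) < e/3"
    using LIMSEQ_D[OF h(3), of "e/3"] \<open>e > 0\<close> by auto
  have "(\<integral>x. cmod (f (x - y n) - f x) \<partial>lborel) < e" if "n \<ge> N" for n
  proof -
    have sh: "integrable lborel (\<lambda>x. F (x - y n))" if "integrable lborel F" for F :: "'a \<Rightarrow> complex"
      using that lborel_shift(2)[of F "- y n"] by simp
    have i1: "integrable lborel (\<lambda>x. cmod (f (x - y n) - h (x - y n)))"
      and i2: "integrable lborel (\<lambda>x. cmod (h (x - y n) - h x))"
      and i3: "integrable lborel (\<lambda>x. cmod (f x - h x))"
      and i4: "integrable lborel (\<lambda>x. cmod (f (x - y n) - f x))"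
      using f h(1) sh[of f] sh[of h] by auto
    have "(\<integral>x. cmod (f (x - y n) - f x) \<partial>lborel) \<le>
      (\<integral>x. cmod (f (x - y n) - h (x - y n)) + (cmod (h (x - y n) - h x) + cmod (f x - h x)) \<partial>lborel)"
    proof (rule integral_mono)
      fix x
      have "cmod (f (x - y n) - f x) = cmod (((f (x - y n) - h (x - y n)) + (h (x - y n) - h x)) - (f x - h x))"
        by simp
      also have "\<dots> \<le> cmod ((f (x - y n) - h (x - y n)) + (h (x - y n) - h x)) + cmod (f x - h x)"
        by (rule norm_triangle_ineq4)
      also have "cmod ((f (x - y n) - h (x - y n)) + (h (x - y n) - h x)) \<le> cmod (f (x - y n) - h (x - y n)) + cmod (h (x - y n) - h x)"
        by (rule norm_triangle_ineq)
      finally show "cmod (f (x - y n) - f x) \<le> cmod (f (x - y n) - h (x - y n)) +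
          (cmod (h (x - y n) - h x) + cmod (f x - h x))"
        by simp
    qed (use i1 i2 i3 i4 in auto)
    also have "\<dots> = (\<integral>x. cmod (f (x - y n) - h (x - y n)) \<partial>lborel) +
        ((\<integral>x. cmod (h (x - y n) - h x) \<partial>lborel) + (\<integral>x. cmod (f x - h x) \<partial>lborel))"
      using i1 i2 i3 by simp
    also have "(\<integral>x. cmod (f (x - y n) - h (x - y n)) \<partial>lborel) = (\<integral>x. cmod (f x - h x) \<partial>lborel)"
      using lborel_shift(1)[of "\<lambda>x. cmod (f x - h x)" "- y n"] by simp
    finally show ?thesis using h(2) N[OF that] by linarith
  qed
  then show "\<exists>no. \<forall>n\<ge>no. norm ((\<integral>x. cmod (f (x - y n) - f x) \<partial>lborel) - 0) < e"
    by (auto simp: abs_of_nonneg intro!: exI[of _ N])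
qed

text \<open>The product of the two indicators converges pointwise because \<open>U\<close> is open:
  points of \<open>U\<close> eventually stay inside, elsewhere the product vanishes. An arbitrary
  measurable set offers no such pointwise convergence, which is why open sets come first.\<close>

lemma L1_translation_open:
  fixes U :: "'a::euclidean_space set"
  assumes U: "open U" "emeasure lborel U < \<infinity>" and y: "y \<longlonglongrightarrow> 0"
  shows "(\<lambda>n. \<integral>x. cmod (indicator U (x - y n) *\<^sub>R c - indicator U x *\<^sub>R c) \<partial>lborel) \<longlonglongrightarrow> 0"
proof -
  have [measurable]: "U \<in> sets borel" using U by auto
  let ?u = "indicator U :: 'a \<Rightarrow> real"
  have iU: "integrable lborel ?u" using U by (simp add: integrable_indicator_iff)
  have sh: "integrable lborel (\<lambda>x. ?u (x - y n))" "(\<integral>x. ?u (x - y n) \<partial>lborel) = (\<integral>x. ?u x \<partial>lborel)" for n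
    using iU lborel_shift(1,2)[of ?u "- y n"] by simp_all
  have iP: "integrable lborel (\<lambda>x. ?u (x - y n) * ?u x)" for n
    by (rule Bochner_Integration.integrable_bound[OF iU]) (auto simp: indicator_def)
  \<comment> \<open>For a, b in {0,1} one has |a - b| = a + b - 2ab; this reduces the convergence to
    that of the overlap of \<open>U\<close> with its translate.\<close>
  have eq: "cmod (?u (x - y n) *\<^sub>R c - ?u x *\<^sub>R c) =
      (?u (x - y n) + ?u x - 2 * (?u (x - y n) * ?u x)) * cmod c" for x n
    by (auto simp: indicator_def)
  have eq2: "(\<integral>x. cmod (?u (x - y n) *\<^sub>R c - ?u x *\<^sub>R c) \<partial>lborel) =
      (2 * (\<integral>x. ?u x \<partial>lborel) - 2 * (\<integral>x. ?u (x - y n) * ?u x \<partial>lborel)) * cmod c" for n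
    unfolding eq using iU sh iP by simp
  have lim: "(\<lambda>n. \<integral>x. ?u (x - y n) * ?u x \<partial>lborel) \<longlonglongrightarrow> (\<integral>x. ?u x \<partial>lborel)"
  proof (rule integral_dominated_convergence[where w="?u"])
    show "AE x in lborel. (\<lambda>n. ?u (x - y n) * ?u x) \<longlonglongrightarrow> ?u x"
    proof (rule AE_I2)
      fix x
      show "(\<lambda>n. ?u (x - y n) * ?u x) \<longlonglongrightarrow> ?u x"
      proof (cases "x \<in> U")
        case True
        have "(\<lambda>n. x - y n) \<longlonglongrightarrow> x" using tendsto_diff[OF tendsto_const[of x] y] by simp
        then have "\<forall>\<^sub>F n in sequentially. x - y n \<in> U"
          using U True by (metis topological_tendstoD)
        then have "\<forall>\<^sub>F n in sequentially. ?u (x - y n) * ?u x = ?u x"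
          by eventually_elim (use True in auto)
        then show ?thesis by (rule tendsto_eventually)
      qed auto
    qed
  qed (use iU in \<open>auto simp: indicator_def\<close>)
  show ?thesis unfolding eq2
    by (rule tendsto_eq_intros lim refl | simp)+
qed

text \<open>Induction over integrable functions; outer regularity passes from open sets to
  measurable sets of finite measure.\<close>

lemma L1_translation:
  fixes f :: "'a::euclidean_space \<Rightarrow> complex"
  assumes f: "integrable lborel f" and y: "y \<longlonglongrightarrow> 0"
  shows "(\<lambda>n. \<integral>x. cmod (f (x - y n) - f x) \<partial>lborel) \<longlonglongrightarrow> 0"
  using f
proof (induction rule: integrable_induct)
  case (base A c)
  have [measurable]: "A \<in> sets borel" using base by auto
  show ?case
  proof (rule L1_translation_approx)
    show "integrable lborel (\<lambda>x. indicator A x *\<^sub>R c)"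
      using base by (simp add: integrable_indicator_iff)
    fix e :: real assume e: "e > 0"
    \<comment> \<open>The summand 1 keeps the denominator positive for \<open>c = 0\<close>.\<close>
    define d where "d = e / (cmod c + 1)"
    have d: "d > 0" using e by (simp add: d_def add_nonneg_pos)
    from outer_regular_lborel[OF \<open>A \<in> sets borel\<close> this]
    obtain U where U: "open U" "A \<subseteq> U" "emeasure lborel (U - A) < d" by blast
    have [measurable]: "U \<in> sets borel" using U by auto
    have "emeasure lborel U = emeasure lborel (A \<union> (U - A))"
      using U(2) by (simp add: Un_absorb1)
    also have "\<dots> \<le> emeasure lborel A + emeasure lborel (U - A)"
      by (rule emeasure_subadditive) auto
    also have "\<dots> < \<infinity>" using base U(3) by (auto simp: less_top[symmetric] top_unique)
    finally have Uf: "emeasure lborel U < \<infinity>" .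
    have md: "measure lborel (U - A) < d"
    proof -
      have "emeasure lborel (U - A) = ennreal (measure lborel (U - A))"
        by (rule emeasure_eq_ennreal_measure) (use U(3) in auto)
      then show ?thesis using U(3) by (simp add: ennreal_less_iff)
    qed
    have "(\<integral>x. cmod (indicator A x *\<^sub>R c - indicator U x *\<^sub>R c) \<partial>lborel) =
        (\<integral>x. indicator (U - A) x * cmod c \<partial>lborel)"
      by (rule Bochner_Integration.integral_cong) (use U(2) in \<open>auto simp: indicator_def\<close>)
    also have "\<dots> = measure lborel (U - A) * cmod c" by simp
    also have "\<dots> < e"
    proof -
      have "measure lborel (U - A) * cmod c \<le> d * cmod c"
        using md by (intro mult_right_mono) auto
      also have "\<dots> < e"
      proof -
        have "cmod c + 1 > 0" by (simp add: add_nonneg_pos)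
        then show ?thesis using e by (simp add: d_def divide_simps algebra_simps)
      qed
      finally show ?thesis .
    qed
    finally show "\<exists>h. integrable lborel h \<and> (\<integral>x. cmod (indicator A x *\<^sub>R c - h x) \<partial>lborel) < e \<and>
       (\<lambda>n. \<integral>x. cmod (h (x - y n) - h x) \<partial>lborel) \<longlonglongrightarrow> 0"
      using L1_translation_open[OF U(1) Uf y, of c] Uf
      by (intro exI[of _ "\<lambda>x. indicator U x *\<^sub>R c"]) (simp add: integrable_indicator_iff)
  qed
next
  case (add f g)
  have [measurable]: "f \<in> borel_measurable borel" "g \<in> borel_measurable borel"
    using add by auto
  have sh: "integrable lborel (\<lambda>x. F (x - y n))" if "integrable lborel F" for F :: "'a \<Rightarrow> complex" and n
    using that lborel_shift(2)[of F "- y n"] by simp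
  have lim: "(\<lambda>n. (\<integral>x. cmod (f (x - y n) - f x) \<partial>lborel) + (\<integral>x. cmod (g (x - y n) - g x) \<partial>lborel)) \<longlonglongrightarrow> 0"
    using tendsto_add[OF add.IH] by simp
  show ?case
  proof (rule tendsto_sandwich[OF _ _ tendsto_const lim])
    show "\<forall>\<^sub>F n in sequentially. (\<integral>x. cmod (f (x - y n) + g (x - y n) - (f x + g x)) \<partial>lborel)
        \<le> (\<integral>x. cmod (f (x - y n) - f x) \<partial>lborel) + (\<integral>x. cmod (g (x - y n) - g x) \<partial>lborel)"
    proof (rule always_eventually, rule allI)
      fix n
      have "(\<integral>x. cmod (f (x - y n) + g (x - y n) - (f x + g x)) \<partial>lborel) \<le>
        (\<integral>x. cmod (f (x - y n) - f x) + cmod (g (x - y n) - g x) \<partial>lborel)"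
        using add.hyps sh[of f n] sh[of g n]
        by (intro integral_mono) (auto intro!: norm_diff_triangle_ineq)
      then show "(\<integral>x. cmod (f (x - y n) + g (x - y n) - (f x + g x)) \<partial>lborel)
        \<le> (\<integral>x. cmod (f (x - y n) - f x) \<partial>lborel) + (\<integral>x. cmod (g (x - y n) - g x) \<partial>lborel)"
        using add.hyps sh[of f n] sh[of g n] by (subst (asm) Bochner_Integration.integral_add) auto
    qed
  qed auto
next
  case (lim f s)
  show ?case
  proof (rule L1_translation_approx[OF lim.hyps(4)])
    fix e :: real assume e: "e > 0"
    \<comment> \<open>The approximants satisfy |s i x| \<le> 2 |f x|, hence the factor 3 in the
      dominating function.\<close>
    have "(\<lambda>i. \<integral>x. cmod (f x - s i x) \<partial>lborel) \<longlonglongrightarrow> (\<integral>x. 0 \<partial>(lborel :: 'a measure))"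
    proof (rule integral_dominated_convergence[where w="\<lambda>x. 3 * cmod (f x)"])
      show "AE x in lborel. (\<lambda>i. cmod (f x - s i x)) \<longlonglongrightarrow> 0"
        using lim.hyps(2) by (auto intro!: AE_I2 tendsto_eq_intros)
      show "AE x in lborel. norm (cmod (f x - s i x)) \<le> 3 * cmod (f x)" for i
      proof (rule AE_I2)
        fix x show "norm (cmod (f x - s i x)) \<le> 3 * cmod (f x)"
          using norm_triangle_ineq4[of "f x" "s i x"] lim.hyps(3)[of x i] by simp
      qed
    qed (use lim.hyps in auto)
    from LIMSEQ_D[OF this e] obtain i where "(\<integral>x. cmod (f x - s i x) \<partial>lborel) < e"
      by (auto)
    then show "\<exists>h. integrable lborel h \<and> (\<integral>x. cmod (f x - h x) \<partial>lborel) < e \<and>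
       (\<lambda>n. \<integral>x. cmod (h (x - y n) - h x) \<partial>lborel) \<longlonglongrightarrow> 0"
      using lim.hyps lim.IH by blast
  qed
qed

text \<open>Cutting in height and in radius at once gives a bounded function of bounded support, to
  which L1 arguments and later the \<open>test_fun\<close> results apply; these functions
  approximate \<open>f\<close> in L2.\<close>

definition truncation :: "nat \<Rightarrow> ('a::euclidean_space \<Rightarrow> complex) \<Rightarrow> 'a \<Rightarrow> complex" where
  "truncation k f x = (if cmod (f x) \<le> real k \<and> norm x \<le> real k then f x else 0)"

lemma truncation_measurable[measurable]:
  assumes [measurable]: "f \<in> borel_measurable borel"
  shows "truncation k f \<in> borel_measurable borel"
  unfolding truncation_def[abs_def] by measurable

lemma truncation_bound: "cmod (truncation k f x) \<le> real k"
  by (auto simp: truncation_def)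

lemma truncation_support: "truncation k f x \<noteq> 0 \<Longrightarrow> norm x \<le> real k"
  by (auto simp: truncation_def split: if_splits)

lemma truncation_le: "cmod (truncation k f x) \<le> cmod (f x)" "cmod (f x - truncation k f x) \<le> cmod (f x)"
  by (auto simp: truncation_def)

lemma truncation_tendsto: "(\<lambda>k. truncation k f x) \<longlonglongrightarrow> f x"
proof (rule tendsto_eventually)
  obtain N :: nat where "real N \<ge> max (cmod (f x)) (norm x)" using real_arch_simple by blast
  then show "\<forall>\<^sub>F k in sequentially. truncation k f x = f x"
    by (auto simp: eventually_at_top_linorder truncation_def intro!: exI[of _ N])
qed

lemma truncation_L2:
  assumes [measurable]: "f \<in> borel_measurable borel" and f: "integrable lborel (\<lambda>x. (cmod (f x))\<^sup>2)"
  shows "(\<lambda>k. \<integral>x. (cmod (f x - truncation k f x))\<^sup>2 \<partial>lborel) \<longlonglongrightarrow> 0"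
proof -
  have "(\<lambda>k. \<integral>x. (cmod (f x - truncation k f x))\<^sup>2 \<partial>lborel) \<longlonglongrightarrow> (\<integral>x. 0 \<partial>(lborel::'a measure))"
  proof (rule integral_dominated_convergence[where w="\<lambda>x. (cmod (f x))\<^sup>2"])
    show "AE x in lborel. (\<lambda>k. (cmod (f x - truncation k f x))\<^sup>2) \<longlonglongrightarrow> 0"
      by (auto intro!: AE_I2 tendsto_eq_intros truncation_tendsto)
  qed (use f truncation_le in \<open>auto intro!: AE_I2 power_mono\<close>)
  then show ?thesis by simp
qed

lemma bounded_support_integrable:
  fixes h :: "'a::euclidean_space \<Rightarrow> 'b::{banach, second_countable_topology}"
  assumes [measurable]: "h \<in> borel_measurable borel"
    and "\<And>x. norm (h x) \<le> M" "\<And>x. h x \<noteq> 0 \<Longrightarrow> norm x \<le> r"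
  shows "integrable lborel h"
proof (rule Bochner_Integration.integrable_bound[where f="\<lambda>x. M * indicator (cball 0 r) x"])
  have "integrable lborel (indicator (cball 0 r) :: 'a \<Rightarrow> real)"
    using emeasure_bounded_finite[of "cball (0::'a) r"] by (simp add: integrable_indicator_iff less_top)
  then show "integrable lborel (\<lambda>x. M * indicator (cball 0 r :: 'a set) x :: real)" by simp
  show "AE x in lborel. norm (h x) \<le> norm (M * indicator (cball 0 r) x :: real)"
  proof (rule AE_I2)
    fix x
    have "0 \<le> M" using assms(2)[of x] norm_ge_zero order_trans by blast
    then show "norm (h x) \<le> norm (M * indicator (cball 0 r) x :: real)"
      using assms(2)[of x] assms(3)[of x] by (cases "h x = 0") (auto simp: indicator_def)
  qed
qed simp

lemma cmod_sum3_power2: "(cmod (a + b + c))\<^sup>2 \<le> 3 * ((cmod a)\<^sup>2 + (cmod b)\<^sup>2 + (cmod c)\<^sup>2)"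
proof -
  have "(cmod (a + b + c))\<^sup>2 \<le> (cmod a + cmod b + cmod c)\<^sup>2"
    using norm_triangle_ineq[of "a + b" c] norm_triangle_ineq[of a b] by (intro power_mono) auto
  also have "\<dots> \<le> 3 * ((cmod a)\<^sup>2 + (cmod b)\<^sup>2 + (cmod c)\<^sup>2)"
    using sum_squares_ge_zero[of "cmod a - cmod b" "cmod b - cmod c"] zero_le_power2[of "cmod a - cmod c"]
    by (simp add: power2_eq_square algebra_simps)
  finally show ?thesis .
qed

lemma square_integrable_mult:
  fixes f g :: "'a \<Rightarrow> complex"
  assumes [measurable]: "f \<in> borel_measurable M" "g \<in> borel_measurable M"
    and f: "integrable M (\<lambda>x. (cmod (f x))\<^sup>2)" and g: "integrable M (\<lambda>x. (cmod (g x))\<^sup>2)"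
  shows "integrable M (\<lambda>x. f x * g x)"
proof (rule Bochner_Integration.integrable_bound)
  show "integrable M (\<lambda>x. (cmod (f x))\<^sup>2 + (cmod (g x))\<^sup>2)" using f g by simp
  have "a * b \<le> a\<^sup>2 + b\<^sup>2" if "a \<ge> 0" "b \<ge> 0" for a b :: real
  proof -
    have "0 \<le> a * b" using that by simp
    then show ?thesis using sum_squares_bound[of a b] by linarith
  qed
  then show "AE x in M. norm (f x * g x) \<le> norm ((cmod (f x))\<^sup>2 + (cmod (g x))\<^sup>2)"
    by (intro AE_I2) (simp add: norm_mult)
qed simp

lemma square_integrable_add:
  fixes f g :: "'a \<Rightarrow> complex"
  assumes [measurable]: "f \<in> borel_measurable M" "g \<in> borel_measurable M"
    and f: "integrable M (\<lambda>x. (cmod (f x))\<^sup>2)" and g: "integrable M (\<lambda>x. (cmod (g x))\<^sup>2)"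
  shows "integrable M (\<lambda>x. (cmod (f x + g x))\<^sup>2)"
proof (rule Bochner_Integration.integrable_bound)
  show "integrable M (\<lambda>x. 3 * ((cmod (f x))\<^sup>2 + (cmod (g x))\<^sup>2))" using f g by simp
  show "AE x in M. norm ((cmod (f x + g x))\<^sup>2) \<le> norm (3 * ((cmod (f x))\<^sup>2 + (cmod (g x))\<^sup>2))"
    using cmod_sum3_power2[of "f _" "g _" 0] by (intro AE_I2) simp
qed simp

lemma square_integrable_diff:
  fixes f g :: "'a \<Rightarrow> complex"
  assumes [measurable]: "f \<in> borel_measurable M" "g \<in> borel_measurable M"
    and f: "integrable M (\<lambda>x. (cmod (f x))\<^sup>2)" and g: "integrable M (\<lambda>x. (cmod (g x))\<^sup>2)"
  shows "integrable M (\<lambda>x. (cmod (f x - g x))\<^sup>2)"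
  using square_integrable_add[of f M "\<lambda>x. - g x"] assms by simp

text \<open>The truncation \<open>h\<close> is bounded by \<open>k\<close>, so its squared
  increments are at most \<open>2 * k\<close> times the plain increments and
  \<open>L1_translation\<close> applies; the remainder \<open>f - h\<close> is small in L2 uniformly
  in the translation.\<close>

lemma L2_translation:
  fixes f :: "'a::euclidean_space \<Rightarrow> complex"
  assumes [measurable]: "f \<in> borel_measurable borel" and f: "integrable lborel (\<lambda>x. (cmod (f x))\<^sup>2)"
    and y: "y \<longlonglongrightarrow> 0"
  shows "(\<lambda>n. \<integral>x. (cmod (f (x - y n) - f x))\<^sup>2 \<partial>lborel) \<longlonglongrightarrow> 0"
proof (rule LIMSEQ_I)
  fix e :: real assume e: "e > 0"
  \<comment> \<open>The estimate below ends as 6 times this integral plus \<open>6 * real k\<close>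
    times the L1 increment of \<open>h\<close>; the factors 1/12 make each contribution at most
    \<open>e/2\<close>, the first one strictly less.\<close>
  obtain k where k: "(\<integral>x. (cmod (f x - truncation k f x))\<^sup>2 \<partial>lborel) < e / 12"
    using LIMSEQ_D[OF truncation_L2[OF assms(1) f], of "e / 12"] e by auto
  define h where "h = truncation k f"
  have [measurable]: "h \<in> borel_measurable borel" unfolding h_def by simp
  have h1: "integrable lborel h"
    unfolding h_def by (rule bounded_support_integrable[OF _ truncation_bound truncation_support]) auto
  have h2: "integrable lborel (\<lambda>x. (cmod (h x))\<^sup>2)"
    by (rule Bochner_Integration.integrable_bound[OF f]) (auto simp: h_def truncation_le intro!: AE_I2 power_mono)
  have d: "integrable lborel (\<lambda>x. (cmod (f x - h x))\<^sup>2)"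
    using square_integrable_diff[of f lborel h] f h2 by auto
  obtain N where N: "\<And>n. n \<ge> N \<Longrightarrow> (\<integral>x. cmod (h (x - y n) - h x) \<partial>lborel) < e / (12 * (real k + 1))"
    using LIMSEQ_D[OF L1_translation[OF h1 y], of "e / (12 * (real k + 1))"] e by auto
  have "(\<integral>x. (cmod (f (x - y n) - f x))\<^sup>2 \<partial>lborel) < e" if "n \<ge> N" for n
  proof -
    have i1: "integrable lborel (\<lambda>x. (cmod (f (x - y n) - h (x - y n)))\<^sup>2)"
      "(\<integral>x. (cmod (f (x - y n) - h (x - y n)))\<^sup>2 \<partial>lborel) = (\<integral>x. (cmod (f x - h x))\<^sup>2 \<partial>lborel)"
      using d lborel_shift(1,2)[of "\<lambda>x. (cmod (f x - h x))\<^sup>2" "- y n"] by simp_all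
    have i2: "integrable lborel (\<lambda>x. cmod (h (x - y n) - h x))"
      using h1 lborel_shift(2)[of h "- y n"] by simp
    have pt: "(cmod (f (x - y n) - f x))\<^sup>2 \<le> 3 * ((cmod (f (x - y n) - h (x - y n)))\<^sup>2 +
      (2 * real k * cmod (h (x - y n) - h x) + (cmod (f x - h x))\<^sup>2))" for x
    proof -
      have "(cmod (h (x - y n) - h x))\<^sup>2 \<le> 2 * real k * cmod (h (x - y n) - h x)"
        unfolding power2_eq_square h_def
        using norm_triangle_ineq4[of "truncation k f (x - y n)" "truncation k f x"]
          truncation_bound[of k f "x - y n"] truncation_bound[of k f x]
        by (intro mult_right_mono) (linarith, simp)
      then show ?thesis
        using cmod_sum3_power2[of "f (x - y n) - h (x - y n)" "h (x - y n) - h x" "h x - f x"]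
        by (simp add: norm_minus_commute)
    qed
    have "(\<integral>x. (cmod (f (x - y n) - f x))\<^sup>2 \<partial>lborel) \<le>
      (\<integral>x. 3 * ((cmod (f (x - y n) - h (x - y n)))\<^sup>2 +
      (2 * real k * cmod (h (x - y n) - h x) + (cmod (f x - h x))\<^sup>2)) \<partial>lborel)"
      using pt i1 i2 d by (intro integral_mono') auto
    also have "\<dots> = 6 * (\<integral>x. (cmod (f x - h x))\<^sup>2 \<partial>lborel) + 6 * real k * (\<integral>x. cmod (h (x - y n) - h x) \<partial>lborel)"
      using i1 i2 d by simp
    also have "\<dots> < e"
    proof -
      have "6 * real k * (\<integral>x. cmod (h (x - y n) - h x) \<partial>lborel) \<le> 6 * real k * (e / (12 * (real k + 1)))"
        using N[OF that] by (intro mult_left_mono) auto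
      also have "\<dots> \<le> e / 2" using e by (simp add: field_simps)
      finally show ?thesis using k unfolding h_def by linarith
    qed
    finally show ?thesis .
  qed
  then show "\<exists>no. \<forall>n\<ge>no. norm ((\<integral>x. (cmod (f (x - y n) - f x))\<^sup>2 \<partial>lborel) - 0) < e"
    by (auto simp: abs_of_nonneg intro!: exI[of _ N])
qed

section \<open>The Fourier transform: Gaussians, Plancherel, Parseval and uniqueness\<close>

lemma cis_measurable[measurable (raw)]:
  "f \<in> borel_measurable M \<Longrightarrow> (\<lambda>x. cis (f x)) \<in> borel_measurable M"
  by (erule measurable_compose[OF _ borel_measurable_continuous_onI]) (rule continuous_on_cis[OF continuous_on_id])

lemma cnj_measurable[measurable (raw)]:
  "f \<in> borel_measurable M \<Longrightarrow> (\<lambda>x. cnj (f x)) \<in> borel_measurable M"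
  by (erule measurable_compose[OF _ borel_measurable_continuous_onI]) (rule continuous_on_cnj[OF continuous_on_id])

lemma fourier_eq_lborel:
  assumes [measurable]: "f \<in> borel_measurable borel"
  shows "fourier f w = (\<integral>t. f t * cis (- 2 * pi * (t \<bullet> w)) \<partial>lborel)"
  unfolding fourier_def by (rule integral_completion) simp

lemma fourier_measurable[measurable]:
  fixes f :: "'a::euclidean_space \<Rightarrow> complex"
  assumes [measurable]: "f \<in> borel_measurable borel"
  shows "fourier f \<in> borel_measurable borel"
proof -
  have "fourier f = (\<lambda>w. \<integral>t. f t * cis (- 2 * pi * (t \<bullet> w)) \<partial>lborel)"
    by (rule ext, rule fourier_eq_lborel) simp
  also have "\<dots> \<in> borel_measurable borel" by measurable
  finally show ?thesis .
qed

lemma integrable_mult_cis: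
  assumes "integrable M f" and [measurable]: "h \<in> borel_measurable M"
  shows "integrable M (\<lambda>x. f x * cis (h x))"
  by (rule Bochner_Integration.integrable_bound[OF assms(1)]) (use assms in \<open>auto simp: norm_mult\<close>)

lemma norm_fourier_le:
  fixes f :: "'a::euclidean_space \<Rightarrow> complex"
  assumes [measurable]: "f \<in> borel_measurable borel" and "integrable lborel f"
  shows "cmod (fourier f w) \<le> (\<integral>t. cmod (f t) \<partial>lborel)"
  unfolding fourier_eq_lborel[OF assms(1)]
  by (rule order_trans[OF integral_norm_bound]) (simp add: norm_mult)

lemma cauchy_schwarz_integral:
  fixes f g :: "'a \<Rightarrow> complex"
  assumes [measurable]: "f \<in> borel_measurable M" "g \<in> borel_measurable M"
    and f: "integrable M (\<lambda>x. (cmod (f x))\<^sup>2)" and g: "integrable M (\<lambda>x. (cmod (g x))\<^sup>2)"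
  shows "(cmod (\<integral>x. f x * g x \<partial>M))\<^sup>2 \<le> (\<integral>x. (cmod (f x))\<^sup>2 \<partial>M) * (\<integral>x. (cmod (g x))\<^sup>2 \<partial>M)"
proof -
  have "ennreal (cmod (\<integral>x. f x * g x \<partial>M)) \<le> (\<integral>\<^sup>+x. norm (f x * g x) \<partial>M)"
    by (rule integral_norm_bound_ennreal) (rule square_integrable_mult[OF assms])
  then have "(ennreal (cmod (\<integral>x. f x * g x \<partial>M)))\<^sup>2 \<le> (\<integral>\<^sup>+x. ennreal (cmod (f x)) * ennreal (cmod (g x)) \<partial>M)\<^sup>2"
    by (intro power_mono) (auto simp: norm_mult ennreal_mult)
  also have "\<dots> \<le> (\<integral>\<^sup>+x. (ennreal (cmod (f x)))\<^sup>2 \<partial>M) * (\<integral>\<^sup>+x. (ennreal (cmod (g x)))\<^sup>2 \<partial>M)"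
    by (rule Cauchy_Schwarz_nn_integral) auto
  also have "\<dots> = ennreal ((\<integral>x. (cmod (f x))\<^sup>2 \<partial>M) * (\<integral>x. (cmod (g x))\<^sup>2 \<partial>M))"
    using f g by (simp add: ennreal_power nn_integral_eq_integral ennreal_mult)
  finally show ?thesis by (simp add: ennreal_power)
qed

lemma
  fixes f :: "'a::euclidean_space \<Rightarrow> real \<Rightarrow> complex"
  assumes int: "\<And>b. b \<in> Basis \<Longrightarrow> integrable lborel (f b)"
  shows integrable_prod_Basis: "integrable lborel (\<lambda>x. \<Prod>b\<in>Basis. f b (x \<bullet> b))"
    and integral_prod_Basis: "(\<integral>x. (\<Prod>b\<in>Basis. f b (x \<bullet> b)) \<partial>lborel) = (\<Prod>b\<in>Basis. \<integral>x. f b x \<partial>lborel)"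
proof -
  interpret P: product_sigma_finite "\<lambda>_::'a. lborel :: real measure" ..
  have [measurable]: "f b \<in> borel_measurable borel" if "b \<in> Basis" for b using int[OF that] by auto
  have [measurable]: "(\<lambda>x. \<Prod>b\<in>Basis. f b (x \<bullet> b)) \<in> borel_measurable borel"
  proof (intro borel_measurable_prod)
    fix b :: 'a assume "b \<in> Basis"
    then have [measurable]: "f b \<in> borel_measurable borel" using int by auto
    show "(\<lambda>x. f b (x \<bullet> b)) \<in> borel_measurable borel" by measurable
  qed
  have eq: "(\<Prod>b\<in>Basis. f b ((\<Sum>c\<in>Basis. y c *\<^sub>R c) \<bullet> b)) = (\<Prod>b\<in>Basis. f b (y b))" for y
    by (intro prod.cong) (auto simp: inner_sum_left inner_Basis if_distrib cong: if_cong)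
  show "integrable lborel (\<lambda>x. \<Prod>b\<in>Basis. f b (x \<bullet> b))"
    by (subst lborel_eq, subst integrable_distr_eq) (use P.product_integrable_prod[OF finite_Basis int] in \<open>simp_all add: eq\<close>)
  show "(\<integral>x. (\<Prod>b\<in>Basis. f b (x \<bullet> b)) \<partial>lborel) = (\<Prod>b\<in>Basis. \<integral>x. f b x \<partial>lborel)"
    by (subst lborel_eq, subst integral_distr) (use P.product_integral_prod[OF finite_Basis int] in \<open>simp_all add: eq\<close>)
qed

lemma norm_power2_Basis: "(norm x)\<^sup>2 = (\<Sum>b\<in>Basis. (x \<bullet> b)\<^sup>2)"
  by (subst power2_norm_eq_inner, subst euclidean_inner) (simp add: power2_eq_square)

text \<open>The joint density of independent standard normal coordinates: its total mass is 1, and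
  its one-dimensional transform is the known characteristic function of the normal law.\<close>

definition gauss :: "'a::euclidean_space \<Rightarrow> real" where
  "gauss x = (\<Prod>b\<in>Basis. std_normal_density (x \<bullet> b))"

lemma gauss_eq: "gauss (x :: 'a::euclidean_space) = exp (- (norm x)\<^sup>2 / 2) / sqrt (2 * pi) ^ DIM('a)"
proof -
  have "gauss x = (\<Prod>b\<in>(Basis::'a set). 1 / sqrt (2 * pi)) * (\<Prod>b\<in>Basis. exp (- (x \<bullet> b)\<^sup>2 / 2))"
    unfolding gauss_def std_normal_density_def by (simp only: prod.distrib)
  also have "(\<Prod>b\<in>Basis. exp (- (x \<bullet> b)\<^sup>2 / 2)) = exp (\<Sum>b\<in>Basis. - (x \<bullet> b)\<^sup>2 / 2)"
    by (simp add: exp_sum)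
  also have "(\<Sum>b\<in>Basis. - (x \<bullet> b)\<^sup>2 / 2) = - (norm x)\<^sup>2 / 2"
    by (simp add: norm_power2_Basis sum_negf flip: sum_divide_distrib)
  finally show ?thesis by (simp add: power_divide)
qed

lemma gauss_measurable[measurable]: "gauss \<in> borel_measurable borel"
  unfolding gauss_eq[abs_def] by measurable

lemma gauss_nonneg: "gauss x \<ge> 0"
  unfolding gauss_eq by simp

lemma std_normal_cis:
  "(\<integral>x. complex_of_real (std_normal_density x) * cis (t * x) \<partial>lborel) = of_real (exp (- t\<^sup>2 / 2))"
proof -
  have "of_real (exp (- t\<^sup>2 / 2)) = char std_normal_distribution t"
    by (simp add: char_std_normal_distribution)
  also have "\<dots> = (\<integral>x. std_normal_density x *\<^sub>R iexp (t * x) \<partial>lborel)"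
    unfolding char_def by (subst integral_density) (auto simp: normal_density_nonneg)
  finally show ?thesis by (simp add: scaleR_conv_of_real cis_conv_exp)
qed

lemma
  shows gauss_integrable: "integrable lborel (gauss :: 'a::euclidean_space \<Rightarrow> real)"
    and gauss_cis: "(\<integral>x. of_real (gauss x) * cis (y \<bullet> (x::'a)) \<partial>lborel) = of_real (exp (- (norm y)\<^sup>2 / 2))"
proof -
  have int: "integrable lborel (\<lambda>x. complex_of_real (std_normal_density x) * cis (t * x))" for t
    by (intro integrable_mult_cis integrable_of_real integrable_normal_density) auto
  have cis_sum: "(\<Prod>b\<in>A. cis (h b)) = cis (\<Sum>b\<in>A. h b)" for h :: "'a \<Rightarrow> real" and A
    by (induction A rule: infinite_finite_induct) (auto simp: cis_mult)
  have eq: "(\<Prod>b\<in>Basis. complex_of_real (std_normal_density (x \<bullet> b)) * cis ((y \<bullet> b) * (x \<bullet> b)))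
     = of_real (gauss x) * cis (y \<bullet> x)" for x y :: 'a
    by (simp add: prod.distrib gauss_def cis_sum euclidean_inner[of y x])
  have "integrable lborel (\<lambda>x::'a. complex_of_real (gauss x) * cis (0 \<bullet> x))"
    using integrable_prod_Basis[of "\<lambda>b x. complex_of_real (std_normal_density x) * cis (((0::'a) \<bullet> b) * x)"]
    using int[of 0] eq[of _ 0] by simp
  then have "integrable lborel (\<lambda>x::'a. complex_of_real (gauss x))" by simp
  then show "integrable lborel (gauss :: 'a \<Rightarrow> real)" by (simp add: complex_of_real_integrable_eq)
  have "(\<integral>x. of_real (gauss x) * cis (y \<bullet> (x::'a)) \<partial>lborel) = (\<Prod>b\<in>Basis. of_real (exp (- (y \<bullet> b)\<^sup>2 / 2)))"
    unfolding eq[symmetric]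
    by (subst integral_prod_Basis[of "\<lambda>b x. complex_of_real (std_normal_density x) * cis ((y \<bullet> b) * x)"])
      (auto simp: int std_normal_cis simp del: of_real_exp)
  also have "\<dots> = of_real (exp (\<Sum>b\<in>Basis. - (y \<bullet> b)\<^sup>2 / 2))"
    by (simp add: exp_sum flip: of_real_prod)
  also have "(\<Sum>b\<in>Basis. - (y \<bullet> b)\<^sup>2 / 2) = - (norm y)\<^sup>2 / 2"
    by (simp add: norm_power2_Basis sum_negf flip: sum_divide_distrib)
  finally show "(\<integral>x. of_real (gauss x) * cis (y \<bullet> (x::'a)) \<partial>lborel) = of_real (exp (- (norm y)\<^sup>2 / 2))" .
qed

lemma gauss_integral: "(\<integral>x. gauss (x::'a::euclidean_space) \<partial>lborel) = 1"
proof -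
  have "complex_of_real (\<integral>x. gauss (x::'a) \<partial>lborel) = 1"
    using gauss_cis[of "0::'a"] by simp
  then show ?thesis using of_real_eq_1_iff by blast
qed

text \<open>The Gaussian damping factor and the approximate identity of width \<open>d\<close> are a
  Fourier pair. Plancherel and uniqueness both damp on the frequency side and read off an average on
  the other.\<close>

lemma fourier_gauss_scaled:
  assumes d: "d > 0"
  shows "fourier (\<lambda>w::'a::euclidean_space. of_real (exp (- (norm ((2 * pi * d) *\<^sub>R w))\<^sup>2 / 2))) y
     = of_real (gauss (inverse d *\<^sub>R y) / d ^ DIM('a))"
proof -
  let ?s = "sqrt (2 * pi) ^ DIM('a)" and ?k = "2 * pi * d"
  have k: "?k > 0" using d by simp
  \<comment> \<open>Both the damping factor and the known value of the transform are rewritten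
    through \<open>gauss\<close>; the two resulting factors \<open>?s\<close> multiply to the power
    of 2\<pi> that the substitution by \<open>?k\<close> contributes.\<close>
  have E: "exp (- (norm x)\<^sup>2 / 2) = ?s * gauss x" for x :: 'a
    by (simp add: gauss_eq)
  let ?F = "\<lambda>v::'a. of_real (gauss v) * cis ((- (inverse d *\<^sub>R y)) \<bullet> v) :: complex"
  have "of_real (exp (- (norm (inverse d *\<^sub>R y))\<^sup>2 / 2)) = (\<integral>v. ?F v \<partial>lborel)"
    using gauss_cis[of "- (inverse d *\<^sub>R y)"] by simp
  also have "\<dots> = ?k ^ DIM('a) *\<^sub>R (\<integral>w. ?F (0 + ?k *\<^sub>R w) \<partial>lborel)"
    using k by (subst integral_lborel_affine[where c="?k" and t=0]) auto
  also have "(\<lambda>w. ?F (0 + ?k *\<^sub>R w)) = (\<lambda>w. of_real (gauss (?k *\<^sub>R w)) * cis (- 2 * pi * (w \<bullet> y)))"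
  proof
    fix w
    have eq: "(- (inverse d *\<^sub>R y)) \<bullet> (0 + ?k *\<^sub>R w) = - 2 * pi * (w \<bullet> y)"
      using d by (simp add: inner_commute)
    then show "?F (0 + ?k *\<^sub>R w) = of_real (gauss (?k *\<^sub>R w)) * cis (- 2 * pi * (w \<bullet> y))"
      by (simp only: eq) (simp only: add_0)
  qed
  finally have *: "of_real (?s * gauss (inverse d *\<^sub>R y)) =
      ?k ^ DIM('a) *\<^sub>R (\<integral>w. complex_of_real (gauss (?k *\<^sub>R w)) * cis (- 2 * pi * (w \<bullet> y)) \<partial>lborel)"
    unfolding E .
  define I where "I = (\<integral>w. complex_of_real (gauss (?k *\<^sub>R w)) * cis (- 2 * pi * (w \<bullet> y)) \<partial>lborel)"
  define \<phi> where "\<phi> = fourier (\<lambda>w::'a. of_real (exp (- (norm (?k *\<^sub>R w))\<^sup>2 / 2))) y"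
  have \<phi>: "\<phi> = of_real ?s * I"
    unfolding E \<phi>_def I_def by (subst fourier_eq_lborel) (simp_all add: mult.assoc)
  have "?k ^ DIM('a) *\<^sub>R \<phi> = of_real ?s * (?k ^ DIM('a) *\<^sub>R I)"
    unfolding \<phi> by (simp only: mult_scaleR_right)
  also have "\<dots> = of_real (?s * ?s * gauss (inverse d *\<^sub>R y))"
    unfolding *[folded I_def, symmetric] of_real_mult by (simp only: mult.assoc)
  finally have "?k ^ DIM('a) *\<^sub>R \<phi> = of_real (?s * ?s * gauss (inverse d *\<^sub>R y))" .
  also have "?s * ?s = (2 * pi) ^ DIM('a)"
    unfolding power_mult_distrib[symmetric] by simp
  also have "?k ^ DIM('a) = (2 * pi) ^ DIM('a) * d ^ DIM('a)"
    by (simp add: power_mult_distrib)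
  finally have "of_real ((2 * pi) ^ DIM('a)) * (of_real (d ^ DIM('a)) * \<phi>) =
      of_real ((2 * pi) ^ DIM('a)) * of_real (gauss (inverse d *\<^sub>R y))"
    by (simp only: scaleR_conv_of_real of_real_mult mult.assoc)
  then have "of_real (d ^ DIM('a)) * \<phi> = of_real (gauss (inverse d *\<^sub>R y))"
    by (subst (asm) mult_left_cancel) auto
  then show ?thesis
    using d unfolding \<phi>_def[symmetric] of_real_divide by (simp add: eq_divide_eq mult.commute)
qed

text \<open>Fubini for the kernel \<open>f t * cis (...) * g w\<close>. Plancherel, uniqueness and
  the Bessel bound rest on moving the transform between the factors: with a Gaussian in place of
  \<open>g\<close> it replaces inversion, with the indicator of a ball it localizes.\<close>

lemma fourier_multiplication:
  fixes f g :: "'a::euclidean_space \<Rightarrow> complex"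
  assumes f: "integrable lborel f" and g: "integrable lborel g"
  shows "(\<integral>w. fourier f w * g w \<partial>lborel) = (\<integral>t. f t * fourier g t \<partial>lborel)"
proof -
  have [measurable]: "f \<in> borel_measurable borel" "g \<in> borel_measurable borel" using f g by auto
  let ?K = "\<lambda>(w, t). (f t * cis (- 2 * pi * (t \<bullet> w))) * g w"
  have i1: "integrable lborel (\<lambda>t. cmod (?K (w, t)))" for w
    using f by (simp add: norm_mult)
  have i2: "integrable lborel (\<lambda>w. \<integral>t. cmod (?K (w, t)) \<partial>lborel)"
    using f g by (simp add: norm_mult)
  have int: "integrable (lborel \<Otimes>\<^sub>M lborel) ?K"
    by (rule lborel_pair.Fubini_integrable)
      (use i1 i2 in \<open>auto simp: case_prod_beta intro!: integrable_norm_cancel[OF i1, simplified]\<close>)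
  have "(\<integral>w. fourier f w * g w \<partial>lborel) = (\<integral>w. \<integral>t. ?K (w, t) \<partial>lborel \<partial>lborel)"
    by (subst fourier_eq_lborel) simp_all
  also have "\<dots> = (\<integral>t. \<integral>w. ?K (w, t) \<partial>lborel \<partial>lborel)"
    using lborel_pair.Fubini_integral[of "\<lambda>w t. ?K (w, t)"] int by simp
  also have "\<dots> = (\<integral>t. f t * fourier g t \<partial>lborel)"
    by (subst fourier_eq_lborel) (simp_all add: inner_commute mult_ac)
  finally show ?thesis .
qed

text \<open>This is the inner product of \<open>f\<close> with the translate of \<open>g\<close> by
  \<open>x\<close>, so Gabor coefficients are correlations with modulated windows. As a function of
  \<open>x\<close> it is the convolution of \<open>f\<close> with the reflected conjugate of
  \<open>g\<close>, which the Fourier transform turns into a product.\<close>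

definition correlation :: "('a::euclidean_space \<Rightarrow> complex) \<Rightarrow> ('a \<Rightarrow> complex) \<Rightarrow> 'a \<Rightarrow> complex" where
  "correlation f g x = (\<integral>t. f t * cnj (g (t - x)) \<partial>lborel)"

lemma
  fixes f g :: "'a::euclidean_space \<Rightarrow> complex"
  assumes f: "integrable lborel f" and g: "integrable lborel g"
  shows correlation_measurable: "correlation f g \<in> borel_measurable borel"
    and correlation_integrable: "integrable lborel (correlation f g)"
    and fourier_correlation: "fourier (correlation f g) w = fourier f w * cnj (fourier g w)"
proof -
  have [measurable]: "f \<in> borel_measurable borel" "g \<in> borel_measurable borel" using f g by auto
  show [measurable]: "correlation f g \<in> borel_measurable borel"
    unfolding correlation_def[abs_def] by measurable
  let ?K = "\<lambda>(t, x). f t * cnj (g (t - x))"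
  let ?L = "\<lambda>(t, x). (f t * cnj (g (t - x))) * cis (- 2 * pi * (x \<bullet> w))"
  have g': "integrable lborel (\<lambda>x. cnj (g (t - x)))" for t
    using g lborel_reflect(2)[of "\<lambda>x. cnj (g x)" t] by simp
  have i0: "integrable lborel (\<lambda>x. ?K (t, x))" for t using g'[of t] by simp
  have "(\<integral>x. cmod (g (t - x)) \<partial>lborel) = (\<integral>x. cmod (g x) \<partial>lborel)" for t
    using lborel_reflect(1)[of "\<lambda>x. cmod (g x)" t] by simp
  then have i2: "integrable lborel (\<lambda>t. \<integral>x. cmod (?K (t, x)) \<partial>lborel)"
    using f by (simp add: norm_mult)
  have int: "integrable (lborel \<Otimes>\<^sub>M lborel) ?K"
    by (rule lborel_pair.Fubini_integrable) (use i0 i2 in \<open>auto simp: case_prod_beta\<close>)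
  have intL: "integrable (lborel \<Otimes>\<^sub>M lborel) ?L"
    using integrable_mult_cis[OF int, of "\<lambda>p. - 2 * pi * (snd p \<bullet> w)"] by (simp add: case_prod_beta')
  have "integrable (lborel \<Otimes>\<^sub>M lborel) (\<lambda>(x, t). ?K (t, x))"
    using int by (subst lborel_pair.integrable_product_swap_iff[symmetric]) (simp add: case_prod_beta)
  from lborel_pair.integrable_fst[OF this]
  show "integrable lborel (correlation f g)"
    by (simp add: correlation_def[abs_def])
  have "fourier (correlation f g) w = (\<integral>x. \<integral>t. ?L (t, x) \<partial>lborel \<partial>lborel)"
    by (subst fourier_eq_lborel) (simp_all add: correlation_def)
  also have "\<dots> = (\<integral>t. \<integral>x. ?L (t, x) \<partial>lborel \<partial>lborel)"
    using lborel_pair.Fubini_integral[of "\<lambda>t x. ?L (t, x)"] intL by simp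
  also have "\<dots> = (\<integral>t. f t * cis (- 2 * pi * (t \<bullet> w)) * cnj (fourier g w) \<partial>lborel)"
  proof (rule Bochner_Integration.integral_cong[OF refl])
    fix t
    have "(\<integral>x. ?L (t, x) \<partial>lborel) = f t * (\<integral>x. cnj (g (t - x)) * cis (- 2 * pi * (x \<bullet> w)) \<partial>lborel)"
      by (simp add: mult.assoc)
    also have "(\<integral>x. cnj (g (t - x)) * cis (- 2 * pi * (x \<bullet> w)) \<partial>lborel) =
        (\<integral>u. cnj (g u) * cis (- 2 * pi * ((t - u) \<bullet> w)) \<partial>lborel)"
      by (subst lborel_reflect(1)[of _ t]) simp_all
    also have "\<dots> = (\<integral>u. cis (- 2 * pi * (t \<bullet> w)) * cnj (g u * cis (- 2 * pi * (u \<bullet> w))) \<partial>lborel)"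
      by (intro Bochner_Integration.integral_cong refl)
        (simp add: cis_mult inner_diff_left right_diff_distrib cis_cnj mult.left_commute)
    also have "\<dots> = cis (- 2 * pi * (t \<bullet> w)) * cnj (fourier g w)"
      by (subst fourier_eq_lborel) (simp_all del: complex_cnj_mult)
    finally show "(\<integral>x. ?L (t, x) \<partial>lborel) = f t * cis (- 2 * pi * (t \<bullet> w)) * cnj (fourier g w)"
      by (simp add: mult.assoc)
  qed
  also have "\<dots> = fourier f w * cnj (fourier g w)"
    by (subst (2) fourier_eq_lborel) simp_all
  finally show "fourier (correlation f g) w = fourier f w * cnj (fourier g w)" .
qed

lemma square_integrable_shift:
  fixes g :: "'a::euclidean_space \<Rightarrow> complex"
  assumes [measurable]: "g \<in> borel_measurable borel" and g: "integrable lborel (\<lambda>x. (cmod (g x))\<^sup>2)"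
  shows "integrable lborel (\<lambda>t. (cmod (g (t - x)))\<^sup>2)"
    and "(\<integral>t. (cmod (g (t - x)))\<^sup>2 \<partial>lborel) = (\<integral>t. (cmod (g t))\<^sup>2 \<partial>lborel)"
  using g lborel_shift(1,2)[of "\<lambda>t. (cmod (g t))\<^sup>2" "- x"] by simp_all

text \<open>By Cauchy-Schwarz the increment is at most the norm of \<open>f\<close> times the L2
  modulus of continuity of \<open>g\<close>.\<close>

lemma correlation_tendsto:
  fixes f g :: "'a::euclidean_space \<Rightarrow> complex"
  assumes [measurable]: "f \<in> borel_measurable borel" "g \<in> borel_measurable borel"
    and f: "integrable lborel (\<lambda>x. (cmod (f x))\<^sup>2)" and g: "integrable lborel (\<lambda>x. (cmod (g x))\<^sup>2)"
    and x: "x \<longlonglongrightarrow> x0"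
  shows "(\<lambda>n. correlation f g (x n)) \<longlonglongrightarrow> correlation f g x0"
proof -
  let ?F = "\<integral>t. (cmod (f t))\<^sup>2 \<partial>lborel" and ?G = "\<lambda>n. \<integral>t. (cmod (g (t - (x n - x0)) - g t))\<^sup>2 \<partial>lborel"
  have gs: "integrable lborel (\<lambda>t. (cmod (g (t - a) - g (t - b)))\<^sup>2)" for a b
    using square_integrable_diff[of "\<lambda>t. g (t - a)" lborel "\<lambda>t. g (t - b)"] square_integrable_shift(1)[OF _ g] by simp
  have le: "(cmod (correlation f g (x n) - correlation f g x0))\<^sup>2 \<le> ?F * ?G n" for n
  proof -
    have gi: "integrable lborel (\<lambda>t. f t * cnj (g (t - a)))" for a
      using square_integrable_mult[of f lborel "\<lambda>t. cnj (g (t - a))"] f square_integrable_shift(1)[OF _ g] by simp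
    have "correlation f g (x n) - correlation f g x0 =
        (\<integral>t. f t * cnj (g (t - x n) - g (t - x0)) \<partial>lborel)"
      unfolding correlation_def using gi by (simp add: right_diff_distrib)
    also have "(cmod \<dots>)\<^sup>2 \<le> ?F * (\<integral>t. (cmod (cnj (g (t - x n) - g (t - x0))))\<^sup>2 \<partial>lborel)"
      by (rule cauchy_schwarz_integral) (use f gs[of "x n" x0] in \<open>simp_all del: complex_cnj_diff\<close>)
    also have "(\<integral>t. (cmod (cnj (g (t - x n) - g (t - x0))))\<^sup>2 \<partial>lborel) = ?G n"
      unfolding complex_mod_cnj
      by (subst lborel_shift(1)[of _ x0]) (simp_all add: algebra_simps)
    finally show ?thesis .
  qed
  have "(\<lambda>n. x n - x0) \<longlonglongrightarrow> 0" using x by (simp add: LIM_zero)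
  from tendsto_mult[OF tendsto_const L2_translation[OF assms(2) g this], of ?F]
  have lim: "(\<lambda>n. ?F * ?G n) \<longlonglongrightarrow> 0" by simp
  have "(\<lambda>n. (cmod (correlation f g (x n) - correlation f g x0))\<^sup>2) \<longlonglongrightarrow> 0"
    by (rule tendsto_sandwich[OF _ _ tendsto_const lim]) (use le in auto)
  then have "(\<lambda>n. sqrt ((cmod (correlation f g (x n) - correlation f g x0))\<^sup>2)) \<longlonglongrightarrow> sqrt 0"
    by (intro tendsto_intros)
  then have "(\<lambda>n. correlation f g (x n) - correlation f g x0) \<longlonglongrightarrow> 0"
    by (simp add: tendsto_norm_zero_iff)
  then show ?thesis by (simp add: LIM_zero_iff)
qed

lemma norm_correlation_le:
  fixes f g :: "'a::euclidean_space \<Rightarrow> complex"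
  assumes [measurable]: "f \<in> borel_measurable borel" "g \<in> borel_measurable borel"
    and f: "integrable lborel (\<lambda>x. (cmod (f x))\<^sup>2)" and g: "integrable lborel (\<lambda>x. (cmod (g x))\<^sup>2)"
  shows "(cmod (correlation f g x))\<^sup>2 \<le> (\<integral>t. (cmod (f t))\<^sup>2 \<partial>lborel) * (\<integral>t. (cmod (g t))\<^sup>2 \<partial>lborel)"
  using cauchy_schwarz_integral[of f lborel "\<lambda>t. cnj (g (t - x))"] f square_integrable_shift[OF _ g, of x]
  unfolding correlation_def by simp

text \<open>The autocorrelation \<open>h\<close> is continuous, its value at 0 is the squared norm
  of \<open>f\<close>, and its transform is the squared modulus of the transform of
  \<open>f\<close>, hence nonnegative. Gaussian damping turns the integral of this transform into an
  average of \<open>h\<close> near 0; as the damping fades, monotone convergence yields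
  integrability and value at once.\<close>

lemma
  fixes f :: "'a::euclidean_space \<Rightarrow> complex"
  assumes f1: "integrable lborel f" and f2: "integrable lborel (\<lambda>x. (cmod (f x))\<^sup>2)"
  shows fourier_square_integrable: "integrable lborel (\<lambda>w. (cmod (fourier f w))\<^sup>2)"
    and plancherel: "(\<integral>w. (cmod (fourier f w))\<^sup>2 \<partial>lborel) = (\<integral>t. (cmod (f t))\<^sup>2 \<partial>lborel)"
proof -
  have [measurable]: "f \<in> borel_measurable borel" using f1 by auto
  define h where "h = correlation f f"
  define N where "N = (\<integral>t. (cmod (f t))\<^sup>2 \<partial>lborel)"
  have [measurable]: "h \<in> borel_measurable borel" and h1: "integrable lborel h"
    unfolding h_def using correlation_measurable[OF f1 f1] correlation_integrable[OF f1 f1] by auto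
  have h0: "h 0 = of_real N"
    unfolding h_def correlation_def N_def by (simp only: diff_0_right complex_norm_square[symmetric] integral_complex_of_real)
  have hb: "cmod (h x) \<le> N" for x
  proof (rule power2_le_imp_le)
    show "(cmod (h x))\<^sup>2 \<le> N\<^sup>2"
      unfolding h_def N_def using norm_correlation_le[of f f x] f2 by (simp add: power2_eq_square)
  qed (simp add: N_def)
  define E where "E d w = exp (- (norm ((2 * pi * d) *\<^sub>R w))\<^sup>2 / 2)" for d and w :: 'a
  have [measurable]: "E d \<in> borel_measurable borel" for d unfolding E_def by measurable
  have E_int: "integrable lborel (E d)" if "d > 0" for d
  proof -
    have "integrable lborel (\<lambda>w::'a. gauss (0 + (2 * pi * d) *\<^sub>R w))"
      using that gauss_integrable by (subst integrable_lborel_affine[symmetric]) auto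
    then have "integrable lborel (\<lambda>w::'a. sqrt (2 * pi) ^ DIM('a) * gauss (0 + (2 * pi * d) *\<^sub>R w))"
      by (rule integrable_mult_right)
    moreover have "E d = (\<lambda>w::'a. sqrt (2 * pi) ^ DIM('a) * gauss (0 + (2 * pi * d) *\<^sub>R w))"
      unfolding E_def[abs_def] gauss_eq add_0 by simp
    ultimately show ?thesis by simp
  qed
  \<comment> \<open>The multiplication formula trades the damping \<open>E d\<close> for the
    approximate identity of width \<open>d\<close>; the substitution t = d z then moves the scale
    into the argument of \<open>h\<close>, ready for dominated convergence.\<close>
  have step: "(\<integral>w. (cmod (fourier f w))\<^sup>2 * E d w \<partial>lborel) = Re (\<integral>z. h (d *\<^sub>R z) * of_real (gauss z) \<partial>lborel)" if d: "d > 0" for d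
  proof -
    have "of_real (\<integral>w. (cmod (fourier f w))\<^sup>2 * E d w \<partial>lborel) = (\<integral>w. fourier h w * of_real (E d w) \<partial>lborel)"
      unfolding h_def fourier_correlation[OF f1 f1]
      by (subst integral_complex_of_real[symmetric]) (simp only: of_real_mult complex_norm_square)
    also have "\<dots> = (\<integral>t. h t * fourier (\<lambda>w. of_real (E d w)) t \<partial>lborel)"
      by (rule fourier_multiplication[OF h1]) (use E_int[OF d] in simp)
    also have "\<dots> = (\<integral>t. h t * of_real (gauss (inverse d *\<^sub>R t) / d ^ DIM('a)) \<partial>lborel)"
      unfolding E_def fourier_gauss_scaled[OF d] ..
    also have "\<dots> = (\<integral>z. h (d *\<^sub>R z) * of_real (gauss z) \<partial>lborel)"
      using d by (subst integral_lborel_affine[where c=d and t=0]) (simp_all add: scaleR_conv_of_real)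
    finally show ?thesis by (metis Re_complex_of_real)
  qed
  define d where "d n = inverse (real (Suc n))" for n
  have d0: "d n > 0" for n by (simp add: d_def)
  have dl: "d \<longlonglongrightarrow> 0" unfolding d_def by (rule LIMSEQ_inverse_real_of_nat)
  have Ed_int: "integrable lborel (\<lambda>w. (cmod (fourier f w))\<^sup>2 * E (d n) w)" for n
  proof (rule Bochner_Integration.integrable_bound)
    show "integrable lborel (\<lambda>w. (\<integral>t. cmod (f t) \<partial>lborel)\<^sup>2 * E (d n) w)"
      using E_int[OF d0] by simp
    show "AE w in lborel. norm ((cmod (fourier f w))\<^sup>2 * E (d n) w) \<le> norm ((\<integral>t. cmod (f t) \<partial>lborel)\<^sup>2 * E (d n) w)"
      using norm_fourier_le[OF _ f1]
      by (intro AE_I2) (auto simp: E_def abs_mult intro!: mult_right_mono power_mono)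
  qed simp
  have lim: "(\<lambda>n. \<integral>w. (cmod (fourier f w))\<^sup>2 * E (d n) w \<partial>lborel) \<longlonglongrightarrow> N"
  proof -
    have "(\<lambda>n. \<integral>z. h (d n *\<^sub>R z) * of_real (gauss z) \<partial>lborel) \<longlonglongrightarrow> (\<integral>z. of_real N * of_real (gauss (z::'a)) \<partial>lborel)"
    proof (rule integral_dominated_convergence[where w="\<lambda>z. N * gauss z"])
      have "(\<lambda>n. h (d n *\<^sub>R z)) \<longlonglongrightarrow> of_real N" for z
        unfolding h0[symmetric] unfolding h_def
        by (rule correlation_tendsto) (use f2 tendsto_scaleR[OF dl tendsto_const, of z] in auto)
      then show "AE z in lborel. (\<lambda>n. h (d n *\<^sub>R z) * of_real (gauss z)) \<longlonglongrightarrow> of_real N * of_real (gauss z)"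
        by (intro AE_I2 tendsto_mult tendsto_const)
      show "AE z in lborel. norm (h (d n *\<^sub>R z) * of_real (gauss z)) \<le> N * gauss z" for n
        using hb gauss_nonneg by (intro AE_I2) (auto simp: norm_mult abs_of_nonneg[OF gauss_nonneg] intro!: mult_right_mono)
    qed (use gauss_integrable in auto)
    also have "(\<integral>z. of_real N * of_real (gauss (z::'a)) \<partial>lborel) = complex_of_real N"
      by (simp add: gauss_integral)
    finally have "(\<lambda>n. Re (\<integral>z. h (d n *\<^sub>R z) * of_real (gauss z) \<partial>lborel)) \<longlonglongrightarrow> N"
      by (metis tendsto_Re Re_complex_of_real)
    then show ?thesis using step[OF d0] by simp
  qed
  have mono: "AE w in lborel. mono (\<lambda>n. (cmod (fourier f w))\<^sup>2 * E (d n) w)"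
  proof (intro AE_I2 monoI mult_left_mono)
    fix w :: 'a and n m :: nat assume "n \<le> m"
    then have "d m \<le> d n" by (simp add: d_def field_simps)
    then have "(norm ((2 * pi * d m) *\<^sub>R w))\<^sup>2 \<le> (norm ((2 * pi * d n) *\<^sub>R w))\<^sup>2"
      using d0[of m] by (intro power_mono) (auto intro!: mult_right_mono)
    then show "E (d n) w \<le> E (d m) w" by (simp add: E_def)
  qed simp
  have ptw: "AE w in lborel. (\<lambda>n. (cmod (fourier f w))\<^sup>2 * E (d n) w) \<longlonglongrightarrow> (cmod (fourier f w))\<^sup>2"
  proof (rule AE_I2)
    fix w :: 'a
    have "(\<lambda>n. (cmod (fourier f w))\<^sup>2 * E (d n) w) \<longlonglongrightarrow> (cmod (fourier f w))\<^sup>2 * exp (- (norm ((2 * pi * 0) *\<^sub>R w))\<^sup>2 / 2)"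
      unfolding E_def by (intro tendsto_intros dl) auto
    then show "(\<lambda>n. (cmod (fourier f w))\<^sup>2 * E (d n) w) \<longlonglongrightarrow> (cmod (fourier f w))\<^sup>2" by simp
  qed
  show "integrable lborel (\<lambda>w. (cmod (fourier f w))\<^sup>2)"
    by (rule integrable_monotone_convergence[OF Ed_int mono ptw lim]) simp
  show "(\<integral>w. (cmod (fourier f w))\<^sup>2 \<partial>lborel) = (\<integral>t. (cmod (f t))\<^sup>2 \<partial>lborel)"
    using integral_monotone_convergence[OF Ed_int mono ptw lim] by (simp add: N_def)
qed

lemma fourier_add_scaled:
  fixes f g :: "'a::euclidean_space \<Rightarrow> complex"
  assumes "integrable lborel f" "integrable lborel g"
  shows "fourier (\<lambda>x. f x + c * g x) w = fourier f w + c * fourier g w"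
proof -
  have [measurable]: "f \<in> borel_measurable borel" "g \<in> borel_measurable borel" using assms by auto
  have "(\<integral>t. (f t + c * g t) * cis (- 2 * pi * (t \<bullet> w)) \<partial>lborel) =
     (\<integral>t. f t * cis (- 2 * pi * (t \<bullet> w)) + c * (g t * cis (- 2 * pi * (t \<bullet> w))) \<partial>lborel)"
    by (simp add: algebra_simps)
  also have "\<dots> = (\<integral>t. f t * cis (- 2 * pi * (t \<bullet> w)) \<partial>lborel) + (\<integral>t. c * (g t * cis (- 2 * pi * (t \<bullet> w))) \<partial>lborel)"
    using assms by (intro Bochner_Integration.integral_add integrable_mult_right integrable_mult_cis) auto
  finally show ?thesis by (simp add: fourier_eq_lborel)
qed

lemma integral_norm_add_scaled:
  fixes u v :: "'a \<Rightarrow> complex"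
  assumes [measurable]: "u \<in> borel_measurable M" "v \<in> borel_measurable M"
    and u: "integrable M (\<lambda>x. (cmod (u x))\<^sup>2)" and v: "integrable M (\<lambda>x. (cmod (v x))\<^sup>2)"
  shows "(\<integral>x. (cmod (u x + c * v x))\<^sup>2 \<partial>M) =
    (\<integral>x. (cmod (u x))\<^sup>2 \<partial>M) + (cmod c)\<^sup>2 * (\<integral>x. (cmod (v x))\<^sup>2 \<partial>M) + 2 * Re (cnj c * (\<integral>x. u x * cnj (v x) \<partial>M))"
proof -
  have i: "integrable M (\<lambda>x. u x * cnj (v x))"
    using square_integrable_mult[of u M "\<lambda>x. cnj (v x)"] u v by simp
  define r where "r x = Re (cnj c * (u x * cnj (v x)))" for x
  have eq: "(cmod (u x + c * v x))\<^sup>2 = (cmod (u x))\<^sup>2 + (cmod c)\<^sup>2 * (cmod (v x))\<^sup>2 + 2 * r x" for x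
    unfolding r_def by (simp add: cmod_power2) (simp add: power2_eq_square algebra_simps)
  have "integrable M r" "(\<integral>x. r x \<partial>M) = Re (cnj c * (\<integral>x. u x * cnj (v x) \<partial>M))"
    using i unfolding r_def by (auto simp del: complex_cnj_mult mult_eq_0_iff times_complex.sel)
  then show ?thesis unfolding eq using u v by simp
qed

text \<open>Polarization: Plancherel for \<open>f + c * g\<close> determines the real part of
  \<open>cnj c\<close> times the inner product, and \<open>c = 1\<close> and \<open>c = \<i>\<close>
  give its real and imaginary part.\<close>

lemma parseval:
  fixes f g :: "'a::euclidean_space \<Rightarrow> complex"
  assumes f: "integrable lborel f" "integrable lborel (\<lambda>x. (cmod (f x))\<^sup>2)"
    and g: "integrable lborel g" "integrable lborel (\<lambda>x. (cmod (g x))\<^sup>2)"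
  shows "(\<integral>w. fourier f w * cnj (fourier g w) \<partial>lborel) = (\<integral>t. f t * cnj (g t) \<partial>lborel)"
proof -
  have [measurable]: "f \<in> borel_measurable borel" "g \<in> borel_measurable borel" using f g by auto
  let ?A = "\<integral>w. fourier f w * cnj (fourier g w) \<partial>lborel" and ?B = "\<integral>t. f t * cnj (g t) \<partial>lborel"
  have *: "Re (cnj c * ?A) = Re (cnj c * ?B)" for c
  proof -
    have "integrable lborel (\<lambda>x. f x + c * g x)" using f g by auto
    moreover have "integrable lborel (\<lambda>x. (cmod (f x + c * g x))\<^sup>2)"
      using square_integrable_add[of f lborel "\<lambda>x. c * g x"] f g by (simp add: norm_mult power_mult_distrib)
    ultimately have "(\<integral>w. (cmod (fourier f w + c * fourier g w))\<^sup>2 \<partial>lborel) = (\<integral>x. (cmod (f x + c * g x))\<^sup>2 \<partial>lborel)"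
      using plancherel[of "\<lambda>x. f x + c * g x"] fourier_add_scaled[OF f(1) g(1), of c] by simp
    then show ?thesis
      using plancherel[OF f] plancherel[OF g] fourier_square_integrable[OF f] fourier_square_integrable[OF g] f g
      by (simp add: integral_norm_add_scaled)
  qed
  show ?thesis using *[of 1] *[of \<i>] by (simp add: complex_eq_iff)
qed

lemma fourier_mult_cis:
  fixes f :: "'a::euclidean_space \<Rightarrow> complex"
  assumes [measurable]: "f \<in> borel_measurable borel"
  shows "fourier (\<lambda>t. f t * cis (2 * pi * (t \<bullet> x))) w = fourier f (w - x)"
  by (simp add: fourier_eq_lborel mult.assoc cis_mult inner_diff_right right_diff_distrib)

lemma gauss_le_1: "gauss x \<le> 1"
  unfolding gauss_eq
proof (rule divide_le_eq_1_pos[THEN iffD2])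
  have "1 \<le> sqrt (2 * pi)" using pi_gt3 by simp
  then have "1 \<le> sqrt (2 * pi) ^ DIM('a)" by (rule one_le_power)
  moreover have "exp (- (norm x)\<^sup>2 / 2) \<le> 1" by simp
  ultimately show "exp (- (norm x)\<^sup>2 / 2) \<le> sqrt (2 * pi) ^ DIM('a)" by linarith
qed simp

text \<open>All Gaussian averages of \<open>f\<close> vanish, at every point and every scale. So
  -f(x) is the average of f(x + d z) - f(x), and the L1 norm of \<open>f\<close> is at most the
  Gaussian average of its L1 moduli of continuity, which tends to 0 with \<open>d\<close>.\<close>

lemma fourier_eq_0_imp_AE_eq_0:
  fixes f :: "'a::euclidean_space \<Rightarrow> complex"
  assumes f: "integrable lborel f" and zero: "\<And>w. fourier f w = 0"
  shows "AE x in lborel. f x = 0"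
proof -
  have [measurable]: "f \<in> borel_measurable borel" using f by auto
  have int: "integrable lborel (\<lambda>z. of_real (gauss z) * f (x + d *\<^sub>R z))" if d: "d > 0" for d x
  proof (rule Bochner_Integration.integrable_bound)
    show "integrable lborel (\<lambda>z. f (x + d *\<^sub>R z))"
      using f d integrable_lborel_affine[of f d x] by simp
  qed (auto simp: norm_mult abs_of_nonneg[OF gauss_nonneg] gauss_le_1 intro!: mult_left_le_one_le gauss_nonneg)
  \<comment> \<open>The damping factor is modulated by \<open>x\<close>, so that its transform is
    the Gaussian around \<open>x\<close>; pairing it with the vanishing transform of
    \<open>f\<close> gives the average near \<open>x\<close>.\<close>
  have conv0: "(\<integral>z. of_real (gauss z) * f (x + d *\<^sub>R z) \<partial>lborel) = 0" if d: "d > 0" for d x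
  proof -
    let ?E = "\<lambda>w::'a. complex_of_real (exp (- (norm ((2 * pi * d) *\<^sub>R w))\<^sup>2 / 2))"
    have "integrable lborel (\<lambda>w::'a. gauss (0 + (2 * pi * d) *\<^sub>R w))"
      using d gauss_integrable by (subst integrable_lborel_affine[symmetric]) auto
    then have "integrable lborel (\<lambda>w::'a. complex_of_real (sqrt (2 * pi) ^ DIM('a) * gauss (0 + (2 * pi * d) *\<^sub>R w)))"
      by (intro integrable_of_real integrable_mult_right)
    moreover have "?E = (\<lambda>w::'a. complex_of_real (sqrt (2 * pi) ^ DIM('a) * gauss (0 + (2 * pi * d) *\<^sub>R w)))"
      unfolding gauss_eq add_0 by simp
    ultimately have E: "integrable lborel ?E" by simp
    have "0 = (\<integral>w. fourier f w * (?E w * cis (2 * pi * (w \<bullet> x))) \<partial>lborel)"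
      by (simp add: zero)
    also have "\<dots> = (\<integral>t. f t * fourier (\<lambda>w. ?E w * cis (2 * pi * (w \<bullet> x))) t \<partial>lborel)"
      by (rule fourier_multiplication[OF f]) (rule integrable_mult_cis[OF E], simp)
    also have "\<dots> = (\<integral>t. f t * of_real (gauss (inverse d *\<^sub>R (t - x)) / d ^ DIM('a)) \<partial>lborel)"
      by (subst fourier_mult_cis) (simp_all only: fourier_gauss_scaled[OF d], measurable)
    also have "\<dots> = (\<integral>z. of_real (gauss z) * f (x + d *\<^sub>R z) \<partial>lborel)"
      using d by (subst integral_lborel_affine[where c=d and t=x]) (simp_all add: scaleR_conv_of_real mult_ac)
    finally show ?thesis by simp
  qed
  define d where "d n = inverse (real (Suc n))" for n
  have d0: "d n > 0" for n by (simp add: d_def)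
  have dl: "d \<longlonglongrightarrow> 0" unfolding d_def by (rule LIMSEQ_inverse_real_of_nat)
  \<comment> \<open>The L1 modulus of continuity of \<open>f\<close> in the direction
    \<open>z\<close> at scale \<open>d n\<close>. It is bounded by twice the norm of
    \<open>f\<close>, which dominates the limit in \<open>n\<close>.\<close>
  define \<omega> where "\<omega> n z = (\<integral>x. cmod (f (x + d n *\<^sub>R z) - f x) \<partial>lborel)" for n z
  have sh: "integrable lborel (\<lambda>x. f (x + y))" "(\<integral>x. cmod (f (x + y)) \<partial>lborel) = (\<integral>x. cmod (f x) \<partial>lborel)" for y
    using f lborel_shift(2)[of f y] lborel_shift(1)[of "\<lambda>x. cmod (f x)" y] by (simp_all add: add.commute)
  have [measurable]: "\<omega> n \<in> borel_measurable borel" for n unfolding \<omega>_def[abs_def] by measurable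
  have \<omega>b: "\<omega> n z \<le> 2 * (\<integral>x. cmod (f x) \<partial>lborel)" "0 \<le> \<omega> n z" for n z
  proof -
    have "\<omega> n z \<le> (\<integral>x. cmod (f (x + d n *\<^sub>R z)) + cmod (f x) \<partial>lborel)"
      unfolding \<omega>_def using sh[of "d n *\<^sub>R z"] f by (intro integral_mono) (auto intro: norm_triangle_ineq4)
    also have "\<dots> = 2 * (\<integral>x. cmod (f x) \<partial>lborel)" using sh[of "d n *\<^sub>R z"] f by simp
    finally show "\<omega> n z \<le> 2 * (\<integral>x. cmod (f x) \<partial>lborel)" .
  qed (simp add: \<omega>_def)
  have \<omega>l: "(\<lambda>n. \<omega> n z) \<longlonglongrightarrow> 0" for z
  proof -
    have "(\<lambda>n. - d n *\<^sub>R z) \<longlonglongrightarrow> - 0 *\<^sub>R z" by (intro tendsto_intros dl)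
    then show ?thesis using L1_translation[OF f, of "\<lambda>n. - d n *\<^sub>R z"] by (simp add: \<omega>_def)
  qed
  have g\<omega>: "integrable lborel (\<lambda>z. gauss z * \<omega> n z)" for n
  proof (rule Bochner_Integration.integrable_bound)
    show "integrable lborel (\<lambda>z::'a. (2 * (\<integral>x. cmod (f x) \<partial>lborel)) * gauss z)"
      by (intro integrable_mult_right gauss_integrable)
    show "AE z in lborel. norm (gauss z * \<omega> n z) \<le> norm ((2 * (\<integral>x. cmod (f x) \<partial>lborel)) * gauss z)"
    proof (rule AE_I2)
      fix z :: 'a
      have "\<omega> n z * gauss z \<le> (2 * (\<integral>x. cmod (f x) \<partial>lborel)) * gauss z"
        using \<omega>b(1) gauss_nonneg by (rule mult_right_mono)
      then show "norm (gauss z * \<omega> n z) \<le> norm ((2 * (\<integral>x. cmod (f x) \<partial>lborel)) * gauss z)"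
        using \<omega>b[of n z] gauss_nonneg[of z] by (simp add: abs_mult mult.commute)
    qed
  qed simp
  have lim: "(\<lambda>n. \<integral>z. gauss z * \<omega> n z \<partial>lborel) \<longlonglongrightarrow> (\<integral>z. 0 \<partial>(lborel :: 'a measure))"
  proof (rule integral_dominated_convergence[where w="\<lambda>z. gauss z * (2 * (\<integral>x. cmod (f x) \<partial>lborel))"])
    show "AE z in lborel. (\<lambda>n. gauss z * \<omega> n z) \<longlonglongrightarrow> 0"
      using \<omega>l by (auto intro!: AE_I2 tendsto_eq_intros)
    show "AE z in lborel. norm (gauss z * \<omega> n z) \<le> gauss z * (2 * (\<integral>x. cmod (f x) \<partial>lborel))" for n
      using \<omega>b gauss_nonneg by (auto intro!: AE_I2 mult_left_mono simp: abs_mult abs_of_nonneg[OF gauss_nonneg])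
  qed (use gauss_integrable in auto)
  have bound: "(\<integral>\<^sup>+x. cmod (f x) \<partial>lborel) \<le> ennreal (\<integral>z. gauss z * \<omega> n z \<partial>lborel)" for n
  proof -
    have "ennreal (cmod (f x)) \<le> (\<integral>\<^sup>+z. ennreal (gauss z * cmod (f (x + d n *\<^sub>R z) - f x)) \<partial>lborel)" for x
    proof -
      have i: "integrable lborel (\<lambda>z. of_real (gauss z) * f x)"
        by (intro integrable_mult_left integrable_of_real gauss_integrable)
      have "(\<integral>z. of_real (gauss z) * (f (x + d n *\<^sub>R z) - f x) \<partial>lborel) = - f x"
      proof -
        have "(\<integral>z. of_real (gauss z) * f x \<partial>lborel) = f x"
          by (simp add: gauss_integral gauss_integrable)
        then show ?thesis
          unfolding right_diff_distrib by (subst Bochner_Integration.integral_diff[OF int[OF d0] i]) (simp add: conv0[OF d0])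
      qed
      then have "cmod (f x) = cmod (\<integral>z. of_real (gauss z) * (f (x + d n *\<^sub>R z) - f x) \<partial>lborel)"
        by simp
      also have "ennreal \<dots> \<le> (\<integral>\<^sup>+z. norm (of_real (gauss z) * (f (x + d n *\<^sub>R z) - f x)) \<partial>lborel)"
        unfolding right_diff_distrib
        by (intro integral_norm_bound_ennreal Bochner_Integration.integrable_diff int[OF d0] i)
      finally show ?thesis by (simp add: norm_mult abs_of_nonneg[OF gauss_nonneg])
    qed
    then have "(\<integral>\<^sup>+x. cmod (f x) \<partial>lborel) \<le> (\<integral>\<^sup>+x. \<integral>\<^sup>+z. ennreal (gauss z * cmod (f (x + d n *\<^sub>R z) - f x)) \<partial>lborel \<partial>lborel)"
      by (intro nn_integral_mono) auto
    also have "\<dots> = (\<integral>\<^sup>+z. \<integral>\<^sup>+x. ennreal (gauss z * cmod (f (x + d n *\<^sub>R z) - f x)) \<partial>lborel \<partial>lborel)"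
      by (rule lborel_pair.Fubini') measurable
    also have "\<dots> = (\<integral>\<^sup>+z. ennreal (gauss z * \<omega> n z) \<partial>lborel)"
    proof (intro nn_integral_cong)
      fix z
      have "(\<integral>\<^sup>+x. ennreal (cmod (f (x + d n *\<^sub>R z) - f x)) \<partial>lborel) = ennreal (\<omega> n z)"
        unfolding \<omega>_def using sh[of "d n *\<^sub>R z"] f by (intro nn_integral_eq_integral) auto
      then show "(\<integral>\<^sup>+x. ennreal (gauss z * cmod (f (x + d n *\<^sub>R z) - f x)) \<partial>lborel) = ennreal (gauss z * \<omega> n z)"
        by (simp add: ennreal_mult gauss_nonneg \<omega>b nn_integral_cmult)
    qed
    also have "\<dots> = ennreal (\<integral>z. gauss z * \<omega> n z \<partial>lborel)"
      by (intro nn_integral_eq_integral g\<omega> AE_I2 mult_nonneg_nonneg \<omega>b gauss_nonneg)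
    finally show ?thesis .
  qed
  have "(\<lambda>n. ennreal (\<integral>z. gauss z * \<omega> n z \<partial>lborel)) \<longlonglongrightarrow> ennreal 0"
    using lim by (intro tendsto_ennrealI) simp
  then have "(\<integral>\<^sup>+x. cmod (f x) \<partial>lborel) \<le> ennreal 0"
    by (rule LIMSEQ_le_const) (use bound in auto)
  then show ?thesis
    by (simp add: nn_integral_0_iff_AE)
qed

section \<open>Uniformly discrete sets and the Bessel bound for exponentials\<close>

lemma uniform_discrete_imp_countable:
  fixes S :: "'a::euclidean_space set"
  assumes "uniform_discrete S"
  shows "countable S"
proof -
  obtain e where e: "e > 0" "\<And>x y. x \<in> S \<Longrightarrow> y \<in> S \<Longrightarrow> dist x y < e \<Longrightarrow> x = y"
    using assms unfolding uniform_discrete_def by blast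
  let ?B = "\<lambda>x. ball x (e/2)"
  have inj: "inj_on ?B S"
    using e by (intro inj_onI) (simp add: ball_eq_ball_iff)
  have "countable (?B ` S)"
  proof (rule countable_disjoint_open_subsets)
    show "pairwise disjnt (?B ` S)"
    proof (clarsimp simp: pairwise_def)
      fix x y assume xy: "x \<in> S" "y \<in> S" "ball x (e/2) \<noteq> ball y (e/2)"
      show "disjnt (ball x (e/2)) (ball y (e/2))"
        unfolding disjnt_iff
      proof (intro allI notI)
        fix z assume "z \<in> ball x (e/2) \<and> z \<in> ball y (e/2)"
        then have "dist x y < e" using dist_triangle_less_add[of x z "e/2" y "e/2"] by (auto simp: dist_commute)
        then show False using e(2) xy by blast
      qed
    qed
  qed auto
  then show ?thesis using inj countable_image_inj_on by blast
qed

text \<open>On the ball the phase stays so small that the cosine is at least 1/2. The transform of a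
  small ball thus has no zeros within a prescribed radius and may be divided by there.\<close>

lemma fourier_indicator_ball_ge:
  fixes t :: "'a::euclidean_space"
  assumes \<delta>: "\<delta> > 0" "r * \<delta> \<le> 1/8" and t: "norm t \<le> r"
  shows "measure lborel (ball (0::'a) \<delta>) / 2 \<le> cmod (fourier (indicator (ball 0 \<delta>)) t)"
proof -
  define B where "B = ball (0::'a) \<delta>"
  have [measurable]: "B \<in> sets borel" by (simp add: B_def)
  define \<mu> where "\<mu> = measure lborel B"
  have Bf: "emeasure lborel B < \<infinity>" using emeasure_bounded_finite[of B] by (simp add: B_def)
  define one where "one = (indicator B :: 'a \<Rightarrow> complex)"
  have [measurable]: "one \<in> borel_measurable borel" by (simp add: one_def)
  have "one = (\<lambda>x. complex_of_real (indicator B x))" by (auto simp: one_def indicator_def)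
  then have one1: "integrable lborel one" using Bf by (simp add: integrable_indicator_iff)
  have ii: "integrable lborel (\<lambda>x. one x * cis (- 2 * pi * (x \<bullet> t)))"
    by (rule integrable_mult_cis[OF one1]) simp
  have i1: "integrable lborel (\<lambda>x. indicator B x / 2 :: real)" using Bf by (simp add: integrable_indicator_iff)
  have "\<mu> / 2 = (\<integral>x. indicator B x / 2 \<partial>lborel)" using Bf by (simp add: \<mu>_def)
  also have "\<dots> \<le> (\<integral>x. Re (one x * cis (- 2 * pi * (x \<bullet> t))) \<partial>lborel)"
  proof (rule integral_mono[OF i1 integrable_Re[OF ii]])
    fix x :: 'a
    show "indicator B x / 2 \<le> Re (one x * cis (- 2 * pi * (x \<bullet> t)))"
    proof (cases "x \<in> B")
      case True
      have "\<bar>x \<bullet> t\<bar> \<le> norm x * norm t" by (rule Cauchy_Schwarz_ineq2)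
      also have "\<dots> \<le> \<delta> * r" using True t \<delta>(1) by (intro mult_mono) (auto simp: B_def)
      also have "\<dots> \<le> 1/8" using \<delta>(2) by (simp add: mult.commute)
      \<comment> \<open>The phase is at most 2\<pi>/8, which lies below \<pi>/3, where the cosine
        equals 1/2.\<close>
      finally have "\<bar>2 * pi * (x \<bullet> t)\<bar> \<le> pi / 3" by (simp add: abs_mult)
      then have "cos (pi / 3) \<le> cos \<bar>2 * pi * (x \<bullet> t)\<bar>" by (intro cos_monotone_0_pi_le) auto
      then show ?thesis using True by (simp add: one_def cos_60)
    qed (simp add: one_def)
  qed
  also have "\<dots> = Re (fourier one t)" unfolding fourier_eq_lborel[OF \<open>one \<in> _\<close>] by (rule integral_Re[OF ii])
  also have "\<dots> \<le> cmod (fourier one t)" by (rule complex_Re_le_cmod)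
  finally show ?thesis unfolding \<mu>_def one_def B_def .
qed

text \<open>Write \<open>h = H k\<close>, where \<open>k\<close> is the transform of the indicator of a small ball, bounded away
  from \<open>0\<close> on the support of \<open>h\<close>. Then the transform of \<open>h\<close> at \<open>\<beta>\<close> is an integral of that of \<open>H\<close>
  over the ball around \<open>\<beta>\<close>, and these balls are disjoint.\<close>

lemma bessel_exponentials:
  fixes S :: "'a::euclidean_space set"
  assumes S: "uniform_discrete S" and r: "r > 0"
  obtains C where "C > 0"
    "\<And>h. \<lbrakk>h \<in> borel_measurable borel; integrable lborel (\<lambda>t. (cmod (h t))\<^sup>2); \<And>t. h t \<noteq> 0 \<Longrightarrow> norm t \<le> r\<rbrakk>
       \<Longrightarrow> (\<integral>\<^sup>+\<beta>. ennreal ((cmod (fourier h \<beta>))\<^sup>2) \<partial>count_space S) \<le> ennreal (C * (\<integral>t. (cmod (h t))\<^sup>2 \<partial>lborel))"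
proof -
  obtain e where e: "e > 0" "\<And>x y. x \<in> S \<Longrightarrow> y \<in> S \<Longrightarrow> dist x y < e \<Longrightarrow> x = y"
    using S unfolding uniform_discrete_def by blast
  \<comment> \<open>The first entry makes the balls around the points of \<open>S\<close> disjoint,
    the second keeps the transform of the ball indicator away from 0 up to radius
    \<open>r\<close>.\<close>
  define \<delta> where "\<delta> = min (e/2) (1 / (8 * r))"
  have \<delta>: "\<delta> > 0" "2 * \<delta> \<le> e" "r * \<delta> \<le> 1/8"
    using e r by (auto simp: \<delta>_def min_def field_simps)
  define B where "B = ball (0::'a) \<delta>"
  have [measurable]: "B \<in> sets borel" by (simp add: B_def)
  define \<mu> where "\<mu> = measure lborel B"
  have Bf: "emeasure lborel B < \<infinity>" using emeasure_bounded_finite[of B] by (simp add: B_def)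
  have \<mu>: "\<mu> > 0"
    using \<delta>(1) by (simp add: \<mu>_def B_def content_ball_pos)
  define one where "one = (indicator B :: 'a \<Rightarrow> complex)"
  have [measurable]: "one \<in> borel_measurable borel" by (simp add: one_def)
  have "one = (\<lambda>x. complex_of_real (indicator B x))" by (auto simp: one_def indicator_def)
  then have one1: "integrable lborel one" using Bf by (simp add: integrable_indicator_iff)
  define k where "k = fourier one"
  have [measurable]: "k \<in> borel_measurable borel" by (simp add: k_def)
  have k: "\<mu> / 2 \<le> cmod (k t)" if "norm t \<le> r" for t
    unfolding k_def one_def \<mu>_def B_def using \<delta>(1,3) that by (rule fourier_indicator_ball_ge)
  have cS: "countable S" using S by (rule uniform_discrete_imp_countable)
  show thesis
  proof (rule that)
    \<comment> \<open>The constant is \<open>4 / \<mu>\<^sup>2\<close> from dividing by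
      \<open>k\<close>, whose modulus is at least \<open>\<mu> / 2\<close>, times \<mu> from
      Cauchy-Schwarz over the ball.\<close>
    show "4 / \<mu> > 0" using \<mu> by simp
    fix h :: "'a \<Rightarrow> complex"
    assume [measurable]: "h \<in> borel_measurable borel" and h2: "integrable lborel (\<lambda>t. (cmod (h t))\<^sup>2)"
      and supp: "\<And>t. h t \<noteq> 0 \<Longrightarrow> norm t \<le> r"
    define H where "H t = h t / k t" for t
    have [measurable]: "H \<in> borel_measurable borel" unfolding H_def by measurable
    have Hh: "(cmod (H t))\<^sup>2 \<le> 4 / \<mu>\<^sup>2 * (cmod (h t))\<^sup>2" for t
    proof (cases "h t = 0")
      case False
      then have kt: "\<mu> / 2 \<le> cmod (k t)" using k supp by blast
      then have "cmod (H t) \<le> cmod (h t) / (\<mu> / 2)"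
        unfolding H_def norm_divide using \<mu> by (intro divide_left_mono mult_pos_pos) auto
      then have "(cmod (H t))\<^sup>2 \<le> (cmod (h t) / (\<mu> / 2))\<^sup>2" by (intro power_mono) auto
      then show ?thesis by (simp add: power_divide field_simps)
    qed (simp add: H_def)
    have H2: "integrable lborel (\<lambda>t. (cmod (H t))\<^sup>2)"
      by (rule Bochner_Integration.integrable_bound[where f="\<lambda>t. 4 / \<mu>\<^sup>2 * (cmod (h t))\<^sup>2"])
        (use h2 Hh in auto)
    have H1: "integrable lborel H"
    proof (rule Bochner_Integration.integrable_bound)
      have "integrable lborel (indicator (cball 0 r) :: 'a \<Rightarrow> real)"
        using emeasure_bounded_finite[of "cball (0::'a) r"] by (simp add: integrable_indicator_iff less_top)
      then show "integrable lborel (\<lambda>t. indicator (cball 0 r) t + (cmod (H t))\<^sup>2)" using H2 by simp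
      \<comment> \<open>\<open>H\<close> vanishes outside the ball of radius \<open>r\<close>, and
        inside it this elementary bound derives integrability from square integrability.\<close>
      have le: "x \<le> 1 + x\<^sup>2" for x :: real using sum_squares_bound[of x 1] zero_le_power2[of x] unfolding power_one mult_1_right by linarith
      show "AE t in lborel. norm (H t) \<le> norm (indicator (cball 0 r) t + (cmod (H t))\<^sup>2)"
      proof (rule AE_I2)
        fix t
        show "norm (H t) \<le> norm (indicator (cball 0 r) t + (cmod (H t))\<^sup>2)"
          using le[of "cmod (H t)"] supp[of t] by (cases "h t = 0") (auto simp: H_def)
      qed
    qed simp
    have hH: "h t = H t * k t" for t
      using supp[of t] k[of t] \<mu> by (cases "h t = 0") (auto simp: H_def)
    have rep: "fourier h \<beta> = (\<integral>w. one w * fourier H (w + \<beta>) \<partial>lborel)" for \<beta>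
    proof -
      have "(\<integral>w. fourier (\<lambda>t. H t * cis (2 * pi * (t \<bullet> (- \<beta>)))) w * one w \<partial>lborel) =
          (\<integral>t. (H t * cis (2 * pi * (t \<bullet> (- \<beta>)))) * fourier one t \<partial>lborel)"
        by (rule fourier_multiplication[OF integrable_mult_cis[OF H1] one1]) simp
      also have "\<dots> = fourier h \<beta>"
        by (subst fourier_eq_lborel) (simp_all add: hH k_def mult_ac)
      finally show ?thesis
        unfolding fourier_mult_cis[OF \<open>H \<in> _\<close>] by (simp add: mult.commute)
    qed
    have FH2: "integrable lborel (\<lambda>w. (cmod (fourier H w))\<^sup>2)" by (rule fourier_square_integrable[OF H1 H2])
    have pw: "ennreal ((cmod (fourier h \<beta>))\<^sup>2) \<le> ennreal \<mu> * (\<integral>\<^sup>+w. of_bool (dist w \<beta> < \<delta>) * ennreal ((cmod (fourier H w))\<^sup>2) \<partial>lborel)" for \<beta>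
    proof -
      have i: "integrable lborel (\<lambda>w. (cmod (one w * fourier H (w + \<beta>)))\<^sup>2)"
      proof (rule Bochner_Integration.integrable_bound)
        show "integrable lborel (\<lambda>w. (cmod (fourier H (w + \<beta>)))\<^sup>2)"
          using FH2 lborel_shift(2)[of "\<lambda>w. (cmod (fourier H w))\<^sup>2" \<beta>] by (simp add: add.commute)
      qed (auto simp: one_def indicator_def)
      \<comment> \<open>The indicator is doubled so that Cauchy-Schwarz leaves one copy in each
        factor: one yields \<mu>, the other keeps the second integral on the ball.\<close>
      have oo: "one w * (one w * x) = one w * x" for w x by (auto simp: one_def indicator_def)
      have o2: "integrable lborel (\<lambda>w. (cmod (one w))\<^sup>2)" "(\<integral>w. (cmod (one w))\<^sup>2 \<partial>lborel) = \<mu>"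
      proof -
        have "(\<lambda>w. (cmod (one w))\<^sup>2) = indicator B" by (auto simp: one_def indicator_def)
        then show "integrable lborel (\<lambda>w. (cmod (one w))\<^sup>2)" "(\<integral>w. (cmod (one w))\<^sup>2 \<partial>lborel) = \<mu>"
          using Bf by (simp_all add: \<mu>_def integrable_indicator_iff)
      qed
      have "(cmod (fourier h \<beta>))\<^sup>2 \<le> \<mu> * (\<integral>w. (cmod (one w * fourier H (w + \<beta>)))\<^sup>2 \<partial>lborel)"
        using cauchy_schwarz_integral[of one lborel "\<lambda>w. one w * fourier H (w + \<beta>)"] o2 i
        by (simp add: rep oo)
      then have "ennreal ((cmod (fourier h \<beta>))\<^sup>2) \<le> ennreal \<mu> * ennreal (\<integral>w. (cmod (one w * fourier H (w + \<beta>)))\<^sup>2 \<partial>lborel)"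
        using \<mu> by (simp add: ennreal_leI flip: ennreal_mult)
      also have "ennreal (\<integral>w. (cmod (one w * fourier H (w + \<beta>)))\<^sup>2 \<partial>lborel) =
          (\<integral>\<^sup>+w. ennreal ((cmod (one w * fourier H (w + \<beta>)))\<^sup>2) \<partial>lborel)"
        using i by (intro nn_integral_eq_integral[symmetric]) auto
      also have "\<dots> = (\<integral>\<^sup>+w. ennreal ((cmod (one (w - \<beta>) * fourier H w))\<^sup>2) \<partial>lborel)"
        by (subst lborel_shift(3)[of _ "- \<beta>"]) (simp_all add: add.commute)
      also have "\<dots> = (\<integral>\<^sup>+w. of_bool (dist w \<beta> < \<delta>) * ennreal ((cmod (fourier H w))\<^sup>2) \<partial>lborel)"
        by (intro nn_integral_cong) (auto simp: one_def B_def indicator_def dist_norm norm_minus_commute)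
      finally show ?thesis .
    qed
    have "(\<integral>\<^sup>+\<beta>. ennreal ((cmod (fourier h \<beta>))\<^sup>2) \<partial>count_space S) \<le>
        (\<integral>\<^sup>+\<beta>. ennreal \<mu> * (\<integral>\<^sup>+w. of_bool (dist w \<beta> < \<delta>) * ennreal ((cmod (fourier H w))\<^sup>2) \<partial>lborel) \<partial>count_space S)"
      by (intro nn_integral_mono pw)
    also have "\<dots> = ennreal \<mu> * (\<integral>\<^sup>+w. \<integral>\<^sup>+\<beta>. of_bool (dist w \<beta> < \<delta>) * ennreal ((cmod (fourier H w))\<^sup>2) \<partial>count_space S \<partial>lborel)"
      by (subst nn_integral_count_space_nn_integral[OF cS]) (simp_all add: nn_integral_cmult)
    also have "\<dots> \<le> ennreal \<mu> * (\<integral>\<^sup>+w. ennreal ((cmod (fourier H w))\<^sup>2) \<partial>lborel)"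
    proof (intro mult_left_mono nn_integral_mono)
      fix w
      have "(\<integral>\<^sup>+\<beta>. of_bool (dist w \<beta> < \<delta>) * ennreal ((cmod (fourier H w))\<^sup>2) \<partial>count_space S) =
         (\<integral>\<^sup>+\<beta>. of_bool (dist w \<beta> < \<delta>) \<partial>count_space S) * ennreal ((cmod (fourier H w))\<^sup>2)"
        by (rule nn_integral_multc) simp
      also have "(\<integral>\<^sup>+\<beta>. of_bool (dist w \<beta> < \<delta>) \<partial>count_space S) = of_bool (\<exists>\<beta>\<in>S. dist w \<beta> < \<delta>)"
      proof (rule of_bool_Bex_eq_nn_integral[symmetric])
        fix x y assume "x \<in> S" "y \<in> S" "dist w x < \<delta>" "dist w y < \<delta>"
        then show "x = y" using e(2) \<delta>(2) dist_triangle_less_add[of x w \<delta> y \<delta>] by (simp add: dist_commute)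
      qed
      also have "\<dots> * ennreal ((cmod (fourier H w))\<^sup>2) \<le> ennreal ((cmod (fourier H w))\<^sup>2)" by simp
      finally show "(\<integral>\<^sup>+\<beta>. of_bool (dist w \<beta> < \<delta>) * ennreal ((cmod (fourier H w))\<^sup>2) \<partial>count_space S) \<le> \<dots>" .
    qed simp
    also have "(\<integral>\<^sup>+w. ennreal ((cmod (fourier H w))\<^sup>2) \<partial>lborel) = ennreal (\<integral>t. (cmod (H t))\<^sup>2 \<partial>lborel)"
      using FH2 plancherel[OF H1 H2] by (simp add: nn_integral_eq_integral)
    also have "\<dots> \<le> ennreal (4 / \<mu>\<^sup>2 * (\<integral>t. (cmod (h t))\<^sup>2 \<partial>lborel))"
    proof (rule ennreal_leI)
      have "(\<integral>t. (cmod (H t))\<^sup>2 \<partial>lborel) \<le> (\<integral>t. 4 / \<mu>\<^sup>2 * (cmod (h t))\<^sup>2 \<partial>lborel)"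
        using Hh H2 h2 by (intro integral_mono) auto
      then show "(\<integral>t. (cmod (H t))\<^sup>2 \<partial>lborel) \<le> 4 / \<mu>\<^sup>2 * (\<integral>t. (cmod (h t))\<^sup>2 \<partial>lborel)" by simp
    qed
    also have "ennreal \<mu> * ennreal (4 / \<mu>\<^sup>2 * (\<integral>t. (cmod (h t))\<^sup>2 \<partial>lborel)) = ennreal (4 / \<mu> * (\<integral>t. (cmod (h t))\<^sup>2 \<partial>lborel))"
      using \<mu> by (subst ennreal_mult[symmetric]) (auto simp: power2_eq_square field_simps)
    finally show "(\<integral>\<^sup>+\<beta>. ennreal ((cmod (fourier h \<beta>))\<^sup>2) \<partial>count_space S) \<le> ennreal (4 / \<mu> * (\<integral>t. (cmod (h t))\<^sup>2 \<partial>lborel))"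
      by (simp add: mult_left_mono)
  qed
qed

section \<open>Lattices: fundamental cells, unfolding, and periodic functions with vanishing Fourier
  coefficients\<close>

lemma borel_measurable_nn_integral_count_space:
  fixes f :: "'i \<Rightarrow> 'a \<Rightarrow> ennreal"
  assumes I: "countable I" and f: "\<And>i. i \<in> I \<Longrightarrow> f i \<in> borel_measurable M"
  shows "(\<lambda>x. \<integral>\<^sup>+i. f i x \<partial>count_space I) \<in> borel_measurable M"
proof (cases "finite I")
  case True
  then show ?thesis using f by (simp add: nn_integral_count_space_finite)
next
  case False
  note * = bij_betw_from_nat_into[OF I False]
  have "(\<integral>\<^sup>+i. f i x \<partial>count_space I) = (\<Sum>n. f (from_nat_into I n) x)" for x
    by (simp add: nn_integral_bij_count_space[symmetric, OF *] nn_integral_count_space_nat)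
  moreover have "from_nat_into I n \<in> I" for n
    using False by (intro from_nat_into) auto
  ultimately show ?thesis using f by (simp add: borel_measurable_suminf_order)
qed

text \<open>Complex combinations of characters with frequencies in \<open>D\<close>. An inductive
  predicate lets linear facts, such as the vanishing of an integral, spread from single characters
  by induction.\<close>

inductive trig_poly :: "'a::euclidean_space set \<Rightarrow> ('a \<Rightarrow> complex) \<Rightarrow> bool" for D where
  character: "\<eta> \<in> D \<Longrightarrow> trig_poly D (\<lambda>y. c * cis (2 * pi * (y \<bullet> \<eta>)))"
| add: "trig_poly D f \<Longrightarrow> trig_poly D g \<Longrightarrow> trig_poly D (\<lambda>y. f y + g y)"

lemma trig_poly_mult:
  assumes D: "\<And>x y. x \<in> D \<Longrightarrow> y \<in> D \<Longrightarrow> x + y \<in> D"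
    and f: "trig_poly D f" and g: "trig_poly D g"
  shows "trig_poly D (\<lambda>y. f y * g y)"
  using f
proof induction
  case (character \<eta> c)
  from g show ?case
  proof induction
    case (character \<theta> d)
    have "(\<lambda>y. c * cis (2 * pi * (y \<bullet> \<eta>)) * (d * cis (2 * pi * (y \<bullet> \<theta>)))) =
      (\<lambda>y. (c * d) * cis (2 * pi * (y \<bullet> (\<eta> + \<theta>))))"
      by (auto simp: cis_mult[symmetric] inner_add_right distrib_left)
    then show ?case using trig_poly.character[OF D[OF \<open>\<eta> \<in> D\<close> \<open>\<theta> \<in> D\<close>]] by simp
  next
    case (add f g)
    then show ?case using trig_poly.add[OF add.IH] by (simp add: distrib_left)
  qed
next
  case (add f h)
  then show ?case using trig_poly.add[OF add.IH] by (simp add: distrib_right)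
qed

lemma trig_poly_const: "0 \<in> D \<Longrightarrow> trig_poly D (\<lambda>y. c)"
  using trig_poly.character[of 0 D c] by simp

lemma trig_poly_prod:
  assumes "\<And>x y. x \<in> D \<Longrightarrow> y \<in> D \<Longrightarrow> x + y \<in> D" "0 \<in> D" "\<And>i. i \<in> I \<Longrightarrow> trig_poly D (f i)"
  shows "trig_poly D (\<lambda>y. \<Prod>i\<in>I. f i y)"
  using assms(3)
proof (induction I rule: infinite_finite_induct)
  case (insert i I)
  then show ?case using trig_poly_mult[OF assms(1), of "f i" "\<lambda>y. \<Prod>i\<in>I. f i y"] by simp
qed (use trig_poly_const[OF assms(2)] in auto)

lemma trig_poly_power:
  assumes "\<And>x y. x \<in> D \<Longrightarrow> y \<in> D \<Longrightarrow> x + y \<in> D" "0 \<in> D" "trig_poly D f"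
  shows "trig_poly D (\<lambda>y. f y ^ n)"
  using trig_poly_prod[of D "{..<n}" "\<lambda>_. f"] assms by simp

lemma half_one_plus_cos: "0 \<le> (1 + cos t) / 2" "(1 + cos t) / 2 \<le> 1" for t :: real
proof -
  have "0 \<le> 1 + cos t" "1 + cos t \<le> 2" using cos_ge_minus_one[of t] cos_le_one[of t] by linarith+
  then show "0 \<le> (1 + cos t) / 2" "(1 + cos t) / 2 \<le> 1" by simp_all
qed

text \<open>A lattice basis \<open>B\<close> with its dual basis \<open>d\<close>. The coordinates
  \<open>d b \<bullet> y\<close> serve for everything: integrality describes the lattice, the range
  [0,1) the fundamental cell, and the vectors \<open>d b\<close> themselves lie in the dual
  lattice.\<close>

locale lattice_frame =
  fixes B :: "'a::euclidean_space set" and d :: "'a \<Rightarrow> 'a"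
  assumes fin: "finite B"
    and dual: "\<And>b c. b \<in> B \<Longrightarrow> c \<in> B \<Longrightarrow> d b \<bullet> c = (if b = c then 1 else 0)"
    and expand: "\<And>y. (\<Sum>b\<in>B. (d b \<bullet> y) *\<^sub>R b) = y"
begin

definition lat :: "'a set" where
  "lat = {(\<Sum>b\<in>B. of_int (c b) *\<^sub>R b) | c :: 'a \<Rightarrow> int. True}"

lemma coord_sum: "b \<in> B \<Longrightarrow> d b \<bullet> (\<Sum>c\<in>B. f c *\<^sub>R c) = f b"
  using fin by (simp add: inner_sum_right dual if_distrib cong: if_cong)

lemma coord_eqI: "(\<And>b. b \<in> B \<Longrightarrow> d b \<bullet> x = d b \<bullet> y) \<Longrightarrow> x = y"
  using expand[of x] expand[of y] by (metis (no_types, lifting) sum.cong)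

lemma mem_lat: "y \<in> lat \<longleftrightarrow> (\<forall>b\<in>B. d b \<bullet> y \<in> \<int>)"
proof
  assume "y \<in> lat" then show "\<forall>b\<in>B. d b \<bullet> y \<in> \<int>"
    by (auto simp: lat_def coord_sum)
next
  assume *: "\<forall>b\<in>B. d b \<bullet> y \<in> \<int>"
  have "y = (\<Sum>b\<in>B. of_int \<lfloor>d b \<bullet> y\<rfloor> *\<^sub>R b)"
    by (subst expand[symmetric]) (intro sum.cong, auto simp: * of_int_floor_cancel)
  then show "y \<in> lat" unfolding lat_def by (auto intro!: exI[of _ "\<lambda>b. \<lfloor>d b \<bullet> y\<rfloor>"])
qed

lemma lat_add: "x \<in> lat \<Longrightarrow> y \<in> lat \<Longrightarrow> x + y \<in> lat"
  and lat_minus: "x \<in> lat \<Longrightarrow> - x \<in> lat" and lat_diff: "x \<in> lat \<Longrightarrow> y \<in> lat \<Longrightarrow> x - y \<in> lat"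
  by (auto simp: mem_lat inner_add_right inner_diff_right)

lemma countable_lat: "countable lat"
proof -
  have "lat \<subseteq> (\<lambda>c. \<Sum>b\<in>B. of_int (c b) *\<^sub>R b) ` (B \<rightarrow>\<^sub>E (UNIV :: int set))"
  proof
    fix y assume "y \<in> lat"
    then obtain c :: "'a \<Rightarrow> int" where "y = (\<Sum>b\<in>B. of_int (c b) *\<^sub>R b)" by (auto simp: lat_def)
    then show "y \<in> (\<lambda>c. \<Sum>b\<in>B. of_int (c b) *\<^sub>R b) ` (B \<rightarrow>\<^sub>E (UNIV :: int set))"
      by (intro image_eqI[of _ _ "restrict c B"]) (auto intro!: sum.cong)
  qed
  moreover have "countable (B \<rightarrow>\<^sub>E (UNIV :: int set))" using fin by (intro countable_PiE) auto
  ultimately show ?thesis by (meson countable_image countable_subset)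
qed

lemma dual_mem: "b \<in> B \<Longrightarrow> d b \<in> dual_lattice lat"
  unfolding dual_lattice_def using mem_lat by (auto simp: inner_commute)

text \<open>Half-open, so that the lattice translates tile the space. The corner is arbitrary
  because the uniqueness argument wants a given point in the interior.\<close>

definition cell :: "'a \<Rightarrow> 'a set" where
  "cell z = {y. \<forall>b\<in>B. 0 \<le> d b \<bullet> (y - z) \<and> d b \<bullet> (y - z) < 1}"

lemma cell_measurable[measurable]: "cell z \<in> sets borel"
proof -
  have "cell z = (\<Inter>b\<in>B. {y. 0 \<le> d b \<bullet> (y - z) \<and> d b \<bullet> (y - z) < 1}) \<inter> UNIV" by (auto simp: cell_def)
  also have "\<dots> \<in> sets borel"
    using fin by (cases "B = {}") (auto intro!: sets.finite_INT)
  finally show ?thesis .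
qed

definition reduce :: "'a \<Rightarrow> 'a \<Rightarrow> 'a" where
  "reduce z y = y - (\<Sum>b\<in>B. of_int \<lfloor>d b \<bullet> (y - z)\<rfloor> *\<^sub>R b)"

lemma reduce_measurable[measurable]: "reduce z \<in> borel_measurable borel"
  unfolding reduce_def[abs_def] by measurable

lemma reduce_lat: "y - reduce z y \<in> lat"
  unfolding reduce_def lat_def by (auto intro!: exI[of _ "\<lambda>b. \<lfloor>d b \<bullet> (y - z)\<rfloor>"])

lemma reduce_cell: "reduce z y \<in> cell z"
  unfolding cell_def
proof (intro CollectI ballI)
  fix b assume b: "b \<in> B"
  have "d b \<bullet> (reduce z y - z) = d b \<bullet> (y - z) - of_int \<lfloor>d b \<bullet> (y - z)\<rfloor>"
    using b by (simp add: reduce_def inner_diff_right coord_sum)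
  then show "0 \<le> d b \<bullet> (reduce z y - z) \<and> d b \<bullet> (reduce z y - z) < 1"
    by linarith
qed

lemma cell_unique:
  assumes "x \<in> cell z" "y \<in> cell z" "x - y \<in> lat"
  shows "x = y"
proof (rule coord_eqI)
  fix b assume b: "b \<in> B"
  obtain k where k: "d b \<bullet> (x - y) = of_int k" using assms(3) b by (auto simp: mem_lat elim: Ints_cases)
  have "\<bar>d b \<bullet> (x - y)\<bar> < 1"
    using assms(1,2) b by (auto simp: cell_def inner_diff_right abs_less_iff dest!: bspec[of _ _ b])
  then have "k = 0" using k by simp
  then show "d b \<bullet> x = d b \<bullet> y" using k by (simp add: inner_diff_right)
qed

lemma reduce_add:
  assumes "y \<in> cell z" "\<gamma> \<in> lat"
  shows "reduce z (y + \<gamma>) = y"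
proof (rule cell_unique[OF reduce_cell assms(1)])
  have "reduce z (y + \<gamma>) - y = \<gamma> - (y + \<gamma> - reduce z (y + \<gamma>))" by simp
  then show "reduce z (y + \<gamma>) - y \<in> lat" using lat_diff[OF assms(2) reduce_lat] by metis
qed

lemma nn_integral_cell_count: "(\<integral>\<^sup>+\<gamma>. indicator (cell z) (y - \<gamma>) \<partial>count_space lat) = 1"
proof -
  have "(\<integral>\<^sup>+\<gamma>. indicator (cell z) (y - \<gamma>) \<partial>count_space lat) = (\<integral>\<^sup>+\<gamma>. of_bool (y - \<gamma> \<in> cell z) \<partial>count_space lat)"
    by (intro nn_integral_cong) (auto simp: indicator_def)
  also have "\<dots> = of_bool (\<exists>\<gamma>\<in>lat. y - \<gamma> \<in> cell z)"
  proof (rule of_bool_Bex_eq_nn_integral[symmetric])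
    fix \<gamma> \<theta> assume "\<gamma> \<in> lat" "\<theta> \<in> lat" "y - \<gamma> \<in> cell z" "y - \<theta> \<in> cell z"
    then have "y - \<gamma> = y - \<theta>" using lat_diff[of \<theta> \<gamma>] by (intro cell_unique[of _ z]) auto
    then show "\<gamma> = \<theta>" by simp
  qed
  also have "\<dots> = 1"
    using reduce_lat[of y z] reduce_cell[of z y] by (auto intro!: bexI[of _ "y - reduce z y"])
  finally show ?thesis .
qed

text \<open>Unfolding: the translates of the cell partition the space, so inserting the sum of their
  indicators changes nothing, and shifting each term by its lattice vector collects everything in
  one cell.\<close>

lemma nn_integral_fold:
  assumes [measurable]: "G \<in> borel_measurable borel"
  shows "(\<integral>\<^sup>+y. G y \<partial>lborel) = (\<integral>\<^sup>+y. indicator (cell z) y * (\<integral>\<^sup>+\<gamma>. G (y + \<gamma>) \<partial>count_space lat) \<partial>lborel)"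
proof -
  have "(\<integral>\<^sup>+y. indicator (cell z) y * (\<integral>\<^sup>+\<gamma>. G (y + \<gamma>) \<partial>count_space lat) \<partial>lborel) =
     (\<integral>\<^sup>+y. (\<integral>\<^sup>+\<gamma>. indicator (cell z) y * G (y + \<gamma>) \<partial>count_space lat) \<partial>lborel)"
    by (simp add: nn_integral_cmult)
  also have "\<dots> = (\<integral>\<^sup>+\<gamma>. (\<integral>\<^sup>+y. indicator (cell z) y * G (y + \<gamma>) \<partial>lborel) \<partial>count_space lat)"
    by (rule nn_integral_count_space_nn_integral[OF countable_lat]) measurable
  also have "\<dots> = (\<integral>\<^sup>+\<gamma>. (\<integral>\<^sup>+y. indicator (cell z) (y - \<gamma>) * G y \<partial>lborel) \<partial>count_space lat)"
  proof (rule nn_integral_cong)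
    fix \<gamma>
    show "(\<integral>\<^sup>+y. indicator (cell z) y * G (y + \<gamma>) \<partial>lborel) = (\<integral>\<^sup>+y. indicator (cell z) (y - \<gamma>) * G y \<partial>lborel)"
      using lborel_shift(3)[of "\<lambda>y. indicator (cell z) (y - \<gamma>) * G y" \<gamma>] by (simp add: add.commute)
  qed
  also have "\<dots> = (\<integral>\<^sup>+y. (\<integral>\<^sup>+\<gamma>. indicator (cell z) (y - \<gamma>) * G y \<partial>count_space lat) \<partial>lborel)"
    by (rule nn_integral_count_space_nn_integral[OF countable_lat, symmetric]) measurable
  also have "\<dots> = (\<integral>\<^sup>+y. G y \<partial>lborel)"
    by (simp add: nn_integral_multc nn_integral_cell_count)
  finally show ?thesis ..
qed

text \<open>Unfolding as an identity of measures: reduction modulo the lattice pushes a density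
  forward to its periodization on the cell. Bochner integrals of periodic functions are then
  transferred by image measures, without a Fubini argument for complex functions.\<close>

lemma distr_reduce:
  assumes [measurable]: "G \<in> borel_measurable borel"
  shows "distr (density lborel G) borel (reduce z) =
    density lborel (\<lambda>y. indicator (cell z) y * (\<integral>\<^sup>+\<gamma>. G (y + \<gamma>) \<partial>count_space lat))" (is "?L = ?R")
proof (rule measure_eqI)
  have m[measurable]: "(\<lambda>y. \<integral>\<^sup>+\<gamma>. G (y + \<gamma>) \<partial>count_space lat) \<in> borel_measurable borel"
    by (rule borel_measurable_nn_integral_count_space[OF countable_lat]) measurable
  fix A assume "A \<in> sets ?L"
  then have [measurable]: "A \<in> sets borel" by simp
  have [measurable]: "reduce z -` A \<in> sets borel"
    using measurable_sets[OF reduce_measurable \<open>A \<in> sets borel\<close>] by simp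
  have "emeasure ?L A = (\<integral>\<^sup>+y. G y * indicator A (reduce z y) \<partial>lborel)"
    by (subst emeasure_distr) (auto simp: emeasure_density indicator_vimage[symmetric] intro!: nn_integral_cong split: split_indicator)
  also have "\<dots> = (\<integral>\<^sup>+y. indicator (cell z) y * (\<integral>\<^sup>+\<gamma>. G (y + \<gamma>) * indicator A (reduce z (y + \<gamma>)) \<partial>count_space lat) \<partial>lborel)"
    by (rule nn_integral_fold) measurable
  also have "\<dots> = (\<integral>\<^sup>+y. indicator (cell z) y * (\<integral>\<^sup>+\<gamma>. G (y + \<gamma>) \<partial>count_space lat) * indicator A y \<partial>lborel)"
  proof (rule nn_integral_cong)
    fix y
    show "indicator (cell z) y * (\<integral>\<^sup>+\<gamma>. G (y + \<gamma>) * indicator A (reduce z (y + \<gamma>)) \<partial>count_space lat) =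
      indicator (cell z) y * (\<integral>\<^sup>+\<gamma>. G (y + \<gamma>) \<partial>count_space lat) * (indicator A y :: ennreal)"
    proof (cases "y \<in> cell z")
      case True
      have "(\<integral>\<^sup>+\<gamma>. G (y + \<gamma>) * indicator A (reduce z (y + \<gamma>)) \<partial>count_space lat) =
        (\<integral>\<^sup>+\<gamma>. G (y + \<gamma>) * indicator A y \<partial>count_space lat)"
        by (intro nn_integral_cong) (simp add: reduce_add[OF True])
      also have "\<dots> = (\<integral>\<^sup>+\<gamma>. G (y + \<gamma>) \<partial>count_space lat) * indicator A y"
        by (rule nn_integral_multc) simp
      finally show ?thesis using True by simp
    qed simp
  qed
  also have "\<dots> = emeasure ?R A" by (subst emeasure_density) auto
  finally show "emeasure ?L A = emeasure ?R A" .
qed simp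


text \<open>A periodic \<open>P\<close> factors through \<open>reduce z\<close>, so integrating it
  against \<open>g\<close> only sees the image of the density \<open>g\<close>. If the integrand
  fails to be integrable, both sides default to 0 together.\<close>

lemma fold_integral:
  fixes P :: "'a \<Rightarrow> complex"
  assumes [measurable]: "P \<in> borel_measurable borel" "g \<in> borel_measurable borel" "N \<in> borel_measurable borel"
    and periodic: "\<And>y \<gamma>. \<gamma> \<in> lat \<Longrightarrow> P (y + \<gamma>) = P y"
    and nonneg: "\<And>y. 0 \<le> g y" "\<And>y. 0 \<le> N y"
    and N: "\<And>y. y \<in> cell z \<Longrightarrow> (\<integral>\<^sup>+\<gamma>. ennreal (g (y + \<gamma>)) \<partial>count_space lat) = ennreal (N y)"
  shows "(\<integral>y. g y *\<^sub>R P y \<partial>lborel) = (\<integral>y. (indicator (cell z) y * N y) *\<^sub>R P y \<partial>lborel)"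
proof -
  have red: "P (reduce z y) = P y" for y
    using periodic[OF reduce_lat[of y z], of "reduce z y"] by simp
  have eq: "density lborel (\<lambda>y. indicator (cell z) y * (\<integral>\<^sup>+\<gamma>. ennreal (g (y + \<gamma>)) \<partial>count_space lat)) =
      density lborel (\<lambda>y. ennreal (indicator (cell z) y * N y))"
    by (rule density_cong) (auto simp: N nonneg split: split_indicator intro!: borel_measurable_nn_integral_count_space[OF countable_lat] borel_measurable_times_ennreal)
  have "(\<integral>y. g y *\<^sub>R P y \<partial>lborel) = (\<integral>y. P (reduce z y) \<partial>density lborel (\<lambda>y. ennreal (g y)))"
    unfolding red by (subst integral_density) (auto simp: nonneg)
  also have "\<dots> = (\<integral>y. P y \<partial>distr (density lborel (\<lambda>y. ennreal (g y))) borel (reduce z))"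
    by (subst integral_distr) auto
  also have "\<dots> = (\<integral>y. P y \<partial>density lborel (\<lambda>y. ennreal (indicator (cell z) y * N y)))"
    by (simp add: distr_reduce eq)
  also have "\<dots> = (\<integral>y. (indicator (cell z) y * N y) *\<^sub>R P y \<partial>lborel)"
    by (subst integral_density) (auto simp: nonneg)
  finally show ?thesis .
qed

lemma cell_bounded: "bounded (cell z)"
proof (rule boundedI)
  fix y assume y: "y \<in> cell z"
  have "norm (y - z) = norm (\<Sum>b\<in>B. (d b \<bullet> (y - z)) *\<^sub>R b)" by (simp only: expand)
  also have "\<dots> \<le> (\<Sum>b\<in>B. norm b)"
    using y by (intro sum_norm_le) (auto simp: cell_def intro!: mult_left_le_one_le)
  finally show "norm y \<le> norm z + (\<Sum>b\<in>B. norm b)"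
    using norm_triangle_ineq2[of y z] by linarith
qed

lemma cell_translate: "y \<in> cell (z + w) \<longleftrightarrow> y - w \<in> cell z"
  by (simp add: cell_def algebra_simps)

definition vol :: real where "vol = measure lborel (cell 0)"

lemma emeasure_cell: "emeasure lborel (cell z) = ennreal vol"
proof -
  have "emeasure lborel (cell z) = (\<integral>\<^sup>+y. indicator (cell z) y \<partial>lborel)" by simp
  also have "\<dots> = (\<integral>\<^sup>+y. indicator (cell z) (z + y) \<partial>lborel)" by (rule lborel_shift(3)) simp
  also have "\<dots> = (\<integral>\<^sup>+y. indicator (cell 0) y \<partial>lborel)"
    by (intro nn_integral_cong) (auto simp: indicator_def cell_def)
  also have "\<dots> = emeasure lborel (cell 0)" by simp
  also have "\<dots> = ennreal vol"
    unfolding vol_def using emeasure_bounded_finite[OF cell_bounded, of 0] by (intro emeasure_eq_ennreal_measure) simp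
  finally show ?thesis .
qed

lemma measure_cell: "measure lborel (cell z) = vol"
proof -
  have "0 \<le> vol" by (simp add: vol_def)
  then show ?thesis by (simp add: measure_def[of lborel "cell z"] emeasure_cell)
qed

text \<open>The shift that centres \<open>cell (x - mid)\<close> at \<open>x\<close>: coordinates
  relative to \<open>x\<close> then range over [-1/2, 1/2).\<close>

definition mid :: 'a where "mid = (1/2) *\<^sub>R (\<Sum>b\<in>B. b)"

lemma coord_mid: "b \<in> B \<Longrightarrow> d b \<bullet> mid = 1/2"
  using coord_sum[of b "\<lambda>_. 1"] by (simp add: mid_def)

lemma cell_mid: "y \<in> cell (x - mid) \<longleftrightarrow> (\<forall>b\<in>B. -1/2 \<le> d b \<bullet> (y - x) \<and> d b \<bullet> (y - x) < 1/2)"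
proof -
  have "d b \<bullet> (y - (x - mid)) = d b \<bullet> (y - x) + 1/2" if "b \<in> B" for b
    using coord_mid[OF that] by (simp add: inner_diff_right)
  then show ?thesis unfolding cell_def mem_Collect_eq by (intro ball_cong refl) auto
qed

lemma ball_subset_cell: "\<exists>r>0. ball x r \<subseteq> cell (x - mid)"
proof -
  let ?U = "\<Inter>b\<in>B. {y. -1/2 < d b \<bullet> (y - x) \<and> d b \<bullet> (y - x) < 1/2}"
  have "open ?U"
    using fin by (intro open_INT ballI open_Collect_conj open_Collect_less continuous_intros) auto
  moreover have "x \<in> ?U" by simp
  ultimately obtain r where "r > 0" "ball x r \<subseteq> ?U" by (meson open_contains_ball)
  then show ?thesis unfolding subset_iff cell_mid by (force simp: less_imp_le)
qed

lemma vol_pos: "vol > 0"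
proof -
  obtain r where r: "r > 0" "ball 0 r \<subseteq> cell (0 - mid)" using ball_subset_cell by blast
  have "0 < measure lborel (ball (0::'a) r)" using r by (simp add: content_ball_pos)
  also have "\<dots> \<le> measure lborel (cell (0 - mid))"
    using r(2) emeasure_cell by (intro measure_mono_fmeasurable) (auto simp: fmeasurable_def)
  finally show ?thesis by (simp add: measure_cell)
qed

lemma integrable_cell_cis:
  fixes N :: "'a \<Rightarrow> real"
  assumes [measurable]: "N \<in> borel_measurable borel" and "\<And>y. \<bar>N y\<bar> \<le> M"
    and [measurable]: "T \<in> borel_measurable borel" and "\<And>y. cmod (T y) \<le> 1"
  shows "integrable lborel (\<lambda>y. (indicator (cell z) y * N y) *\<^sub>R T y)"
proof -
  have M: "0 \<le> M" using assms(2)[of 0] by linarith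
  have "integrable lborel (\<lambda>y. M * indicator (cell z) y :: real)"
    using emeasure_cell by (simp add: integrable_indicator_iff)
  then show ?thesis
  proof (rule Bochner_Integration.integrable_bound)
    show "AE y in lborel. norm ((indicator (cell z) y * N y) *\<^sub>R T y) \<le> norm (M * indicator (cell z) y :: real)"
    proof (rule AE_I2)
      fix y
      have "\<bar>N y\<bar> * cmod (T y) \<le> M * 1" using assms(2,4) M by (intro mult_mono) auto
      then show "norm ((indicator (cell z) y * N y) *\<^sub>R T y) \<le> norm (M * indicator (cell z) y :: real)"
        using M by (auto split: split_indicator)
    qed
  qed simp
qed

lemma periodic_cis:
  assumes "\<eta> \<in> dual_lattice lat" "\<gamma> \<in> lat"
  shows "cis (2 * pi * ((y + \<gamma>) \<bullet> \<eta>)) = cis (2 * pi * (y \<bullet> \<eta>))"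
proof -
  obtain k where "\<gamma> \<bullet> \<eta> = of_int k" using assms unfolding dual_lattice_def by (auto elim: Ints_cases)
  then have "cis (2 * pi * ((y + \<gamma>) \<bullet> \<eta>)) = cis (2 * pi * (y \<bullet> \<eta>)) * cis (2 * pi * of_int k)"
    by (simp only: inner_add_left distrib_left cis_mult)
  then show ?thesis by (simp add: cis_multiple_2pi)
qed


lemma nn_integral_lat_minus: "(\<integral>\<^sup>+\<gamma>. f (- \<gamma>) \<partial>count_space lat) = (\<integral>\<^sup>+\<gamma>. f \<gamma> \<partial>count_space lat)"
proof -
  have "bij_betw uminus lat lat"
    by (rule bij_betwI[where g=uminus]) (auto simp: lat_minus)
  then show ?thesis by (rule nn_integral_bij_count_space)
qed

text \<open>Unfolding with the indicator of one cell as density: its periodization is the constant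
  1.\<close>

lemma integral_cell_eq:
  fixes P :: "'a \<Rightarrow> complex"
  assumes [measurable]: "P \<in> borel_measurable borel" and "\<And>y \<gamma>. \<gamma> \<in> lat \<Longrightarrow> P (y + \<gamma>) = P y"
  shows "(\<integral>y. indicator (cell z) y *\<^sub>R P y \<partial>lborel) = (\<integral>y. indicator (cell w) y *\<^sub>R P y \<partial>lborel)"
proof -
  have "(\<integral>\<^sup>+\<gamma>. ennreal (indicator (cell z) (y + \<gamma>)) \<partial>count_space lat) = ennreal 1" for y
    using nn_integral_cell_count[of z y] nn_integral_lat_minus[of "\<lambda>\<gamma>. indicator (cell z) (y + \<gamma>)"]
    by (simp add: ennreal_indicator)
  then show ?thesis
    using fold_integral[of P "indicator (cell z)" "\<lambda>_. 1" w] assms by simp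
qed

text \<open>For \<eta> \<noteq> 0 a shift of the cell by \<open>w\<close> with
  \<open>w \<bullet> \<eta> = 1/2\<close> reverses the sign of the character, while the integral of
  a periodic function does not depend on the cell; so the integral equals its negative.\<close>

lemma integral_cell_cis:
  assumes \<eta>: "\<eta> \<in> dual_lattice lat"
  shows "(\<integral>y. indicator (cell z) y *\<^sub>R cis (2 * pi * (y \<bullet> \<eta>)) \<partial>lborel) = (if \<eta> = 0 then of_real vol else 0)"
proof (cases "\<eta> = 0")
  case True
  then show ?thesis
    using emeasure_cell[of z] by (simp add: integrable_indicator_iff measure_cell scaleR_conv_of_real)
next
  case False
  define w where "w = (1 / (2 * (\<eta> \<bullet> \<eta>))) *\<^sub>R \<eta>"
  have w: "w \<bullet> \<eta> = 1/2" using False by (simp add: w_def)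
  let ?I = "\<lambda>z. \<integral>y. indicator (cell z) y *\<^sub>R cis (2 * pi * (y \<bullet> \<eta>)) \<partial>lborel"
  have "?I (z + w) = (\<integral>y. indicator (cell (z + w)) (w + y) *\<^sub>R cis (2 * pi * ((w + y) \<bullet> \<eta>)) \<partial>lborel)"
    by (rule lborel_shift(1)) simp
  also have "\<dots> = (\<integral>y. - (indicator (cell z) y *\<^sub>R cis (2 * pi * (y \<bullet> \<eta>))) \<partial>lborel)"
  proof (intro Bochner_Integration.integral_cong refl)
    fix y
    have "cis (2 * pi * ((w + y) \<bullet> \<eta>)) = cis pi * cis (2 * pi * (y \<bullet> \<eta>))"
      by (simp only: cis_mult) (simp add: inner_add_left w distrib_left)
    then show "indicator (cell (z + w)) (w + y) *\<^sub>R cis (2 * pi * ((w + y) \<bullet> \<eta>)) = - (indicator (cell z) y *\<^sub>R cis (2 * pi * (y \<bullet> \<eta>)))"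
      by (simp add: indicator_def cell_translate)
  qed
  finally have "?I (z + w) = - ?I z" by simp
  moreover have "?I (z + w) = ?I z"
    by (rule integral_cell_eq) (use periodic_cis[OF \<eta>] in auto)
  ultimately have "?I z = 0" by simp
  then show ?thesis using False by simp
qed

text \<open>The trigonometric polynomials \<open>(\<Prod>b\<in>B. (1 + cos (2\<pi> (d b \<bullet> (y - x)))) / 2)\<^sup>N\<close> concentrate at \<open>x\<close>,
  so only continuity of \<open>H\<close> at the single point \<open>x\<close> is needed.\<close>

lemma zero_fourier_coeffs_imp_not_pos:
  fixes H :: "'a \<Rightarrow> real"
  assumes [measurable]: "H \<in> borel_measurable borel" and M: "\<And>y. \<bar>H y\<bar> \<le> M"
    and coeffs: "\<And>\<eta>. \<eta> \<in> dual_lattice lat \<Longrightarrow>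
       (\<integral>y. (indicator (cell (x - mid)) y * H y) *\<^sub>R cis (2 * pi * (y \<bullet> \<eta>)) \<partial>lborel) = 0"
    and cont: "isCont H x"
  shows "H x \<le> 0"
proof (rule ccontr)
  assume "\<not> H x \<le> 0"
  define \<delta> where "\<delta> = H x / 2"
  have \<delta>: "\<delta> > 0" "\<delta> < H x" using \<open>\<not> H x \<le> 0\<close> by (auto simp: \<delta>_def)
  define Q where "Q = cell (x - mid)"
  have [measurable]: "Q \<in> sets borel" by (simp add: Q_def)
  have Qe: "emeasure lborel Q < \<infinity>" by (simp add: Q_def emeasure_cell)
  have D: "x + y \<in> dual_lattice lat" if "x \<in> dual_lattice lat" "y \<in> dual_lattice lat" for x y
    using that by (auto simp: dual_lattice_def inner_add_right)
  have D0: "0 \<in> dual_lattice lat" by (simp add: dual_lattice_def)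
  have Dm: "- y \<in> dual_lattice lat" if "y \<in> dual_lattice lat" for y
    using that by (auto simp: dual_lattice_def)
  \<comment> \<open>By linearity the vanishing extends from characters to trigonometric polynomials;
    measurability and integrability are carried along so that sums can be split.\<close>
  have tp: "T \<in> borel_measurable borel \<and> integrable lborel (\<lambda>y. (indicator Q y * H y) *\<^sub>R T y) \<and>
      (\<integral>y. (indicator Q y * H y) *\<^sub>R T y \<partial>lborel) = 0" if "trig_poly (dual_lattice lat) T" for T
    using that
  proof induction
    case (character \<eta> c)
    have i: "integrable lborel (\<lambda>y. (indicator Q y * H y) *\<^sub>R cis (2 * pi * (y \<bullet> \<eta>)))"
      unfolding Q_def by (rule integrable_cell_cis[OF _ M]) auto
    have eq: "(indicator Q y * H y) *\<^sub>R (c * cis (2 * pi * (y \<bullet> \<eta>))) = c * ((indicator Q y * H y) *\<^sub>R cis (2 * pi * (y \<bullet> \<eta>)))" for y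
      by (simp only: mult_scaleR_right)
    show ?case
    proof (intro conjI)
      show "integrable lborel (\<lambda>y. (indicator Q y * H y) *\<^sub>R (c * cis (2 * pi * (y \<bullet> \<eta>))))"
        unfolding eq by (rule integrable_mult_right[OF i])
      show "(\<integral>y. (indicator Q y * H y) *\<^sub>R (c * cis (2 * pi * (y \<bullet> \<eta>))) \<partial>lborel) = 0"
        unfolding eq integral_mult_right_zero using coeffs[OF character] by (simp only: Q_def mult_zero_right)
    qed measurable
  next
    case (add f g)
    then show ?case by (auto simp: scaleR_add_right)
  qed
  define K where "K y = (\<Prod>b\<in>B. (1 + cos (2 * pi * (d b \<bullet> (y - x)))) / 2)" for y
  have [measurable]: "K \<in> borel_measurable borel" unfolding K_def by measurable
  have K01: "0 \<le> K y" "K y \<le> 1" for y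
  proof -
    show "0 \<le> K y" unfolding K_def by (intro prod_nonneg half_one_plus_cos)
    show "K y \<le> 1" unfolding K_def by (intro prod_le_1 conjI half_one_plus_cos)
  qed
  have Kx: "K x = 1" by (simp add: K_def)
  have Kc: "continuous_on UNIV K" unfolding K_def by (intro continuous_intros) auto
  have tK: "trig_poly (dual_lattice lat) (\<lambda>y. of_real (K y) ^ n)" for n
  proof (rule trig_poly_power[OF D D0])
    have "trig_poly (dual_lattice lat) (\<lambda>y. of_real ((1 + cos (2 * pi * (d b \<bullet> (y - x)))) / 2))" if b: "b \<in> B" for b
    proof -
      let ?e = "cis (- 2 * pi * (x \<bullet> d b)) / 4" and ?f = "cis (2 * pi * (x \<bullet> d b)) / 4"
      \<comment> \<open>(1 + cos a)/2 is 1/2 plus a quarter of each of the exponentials of ia and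
        -ia; the shift by \<open>x\<close> goes into the coefficients.\<close>
      have *: "complex_of_real ((1 + cos (2 * pi * (d b \<bullet> (y - x)))) / 2) =
          1/2 + (?e * cis (2 * pi * (y \<bullet> d b)) + ?f * cis (2 * pi * (y \<bullet> (- d b))))" for y
      proof -
        have A: "?e * cis (2 * pi * (y \<bullet> d b)) = cis (2 * pi * (d b \<bullet> (y - x))) / 4"
          by (simp add: cis_mult inner_diff_right inner_commute algebra_simps)
        have B: "?f * cis (2 * pi * (y \<bullet> (- d b))) = cis (- (2 * pi * (d b \<bullet> (y - x)))) / 4"
          by (simp add: cis_mult inner_diff_right inner_commute algebra_simps)
        show ?thesis unfolding A B by (simp add: complex_eq_iff add_divide_distrib)
      qed
      show ?thesis unfolding *
        by (intro trig_poly.add trig_poly.character trig_poly_const D0 Dm dual_mem b)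
    qed
    then have "trig_poly (dual_lattice lat) (\<lambda>y. \<Prod>b\<in>B. of_real ((1 + cos (2 * pi * (d b \<bullet> (y - x)))) / 2))"
      by (intro trig_poly_prod[OF D D0])
    then show "trig_poly (dual_lattice lat) (\<lambda>y. of_real (K y))" by (simp add: K_def)
  qed auto
  have intK: "integrable lborel (\<lambda>y. indicator Q y * H y * K y ^ n)" and zeroK: "(\<integral>y. indicator Q y * H y * K y ^ n \<partial>lborel) = 0" for n
  proof -
    have eq: "(indicator Q y * H y) *\<^sub>R (of_real (K y) ^ n) = complex_of_real (indicator Q y * H y * K y ^ n)" for y
      by (simp add: scaleR_conv_of_real)
    from tp[OF tK[of n]] have "integrable lborel (\<lambda>y. complex_of_real (indicator Q y * H y * K y ^ n)) \<and>
       (\<integral>y. complex_of_real (indicator Q y * H y * K y ^ n) \<partial>lborel) = 0" unfolding eq by blast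
    then show "integrable lborel (\<lambda>y. indicator Q y * H y * K y ^ n)" "(\<integral>y. indicator Q y * H y * K y ^ n \<partial>lborel) = 0"
      by (simp_all only: complex_of_real_integrable_eq integral_complex_of_real of_real_eq_0_iff)
  qed
  obtain r where r: "r > 0" "\<And>y. dist y x < r \<Longrightarrow> H y > \<delta>"
  proof -
    have "\<forall>\<^sub>F y in at x. H y > \<delta>"
      using cont \<delta>(2) unfolding isCont_def by (rule order_tendstoD)
    then obtain r where "r > 0" "\<And>y. y \<noteq> x \<Longrightarrow> dist y x < r \<Longrightarrow> H y > \<delta>"
      unfolding eventually_at by auto
    then show ?thesis using \<delta>(2) by (intro that[of r]) (metis)+
  qed
  \<comment> \<open>On the closed centred cell all coordinates stay in [-1/2, 1/2], and there a
    factor equals 1 only where its coordinate vanishes. So \<open>K\<close> is below 1 away from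
    \<open>x\<close>, and compactness makes the gap uniform.\<close>
  obtain \<rho> where \<rho>: "0 < \<rho>" "\<rho> < 1" "\<And>y. y \<in> Q \<Longrightarrow> dist y x \<ge> r \<Longrightarrow> K y \<le> \<rho>"
  proof -
    let ?S = "closure Q - ball x r"
    have cQ: "closure Q \<subseteq> {y. \<forall>b\<in>B. \<bar>d b \<bullet> (y - x)\<bar> \<le> 1/2}"
    proof (rule closure_minimal)
      show "Q \<subseteq> {y. \<forall>b\<in>B. \<bar>d b \<bullet> (y - x)\<bar> \<le> 1/2}" by (force simp: Q_def cell_mid)
      show "closed {y. \<forall>b\<in>B. \<bar>d b \<bullet> (y - x)\<bar> \<le> 1/2}"
        unfolding Collect_ball_eq by (intro closed_INT ballI closed_Collect_le continuous_intros)
    qed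
    have cS: "compact ?S" using cell_bounded unfolding Q_def by (intro compact_diff) auto
    have lt: "K y < 1" if y: "y \<in> ?S" for y
    proof -
      have "y \<noteq> x" using y r(1) by auto
      then obtain b where b: "b \<in> B" "d b \<bullet> (y - x) \<noteq> 0"
        using coord_eqI[of y x] by (auto simp: inner_diff_right)
      have t: "\<bar>d b \<bullet> (y - x)\<bar> \<le> 1/2" using y cQ b(1) by auto
      have "cos \<bar>2 * pi * (d b \<bullet> (y - x))\<bar> < cos 0"
        using t b(2) by (intro cos_monotone_0_pi) (auto simp: abs_mult)
      then have c: "(1 + cos (2 * pi * (d b \<bullet> (y - x)))) / 2 < 1" by simp
      have "K y = (1 + cos (2 * pi * (d b \<bullet> (y - x)))) / 2 * (\<Prod>b\<in>B - {b}. (1 + cos (2 * pi * (d b \<bullet> (y - x)))) / 2)"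
        unfolding K_def using b(1) fin by (rule prod.remove[rotated])
      also have "\<dots> \<le> (1 + cos (2 * pi * (d b \<bullet> (y - x)))) / 2 * 1"
        by (intro mult_left_mono prod_le_1 conjI half_one_plus_cos)
      finally show ?thesis using c by simp
    qed
    show ?thesis
    proof (cases "?S = {}")
      case True
      have "y \<notin> Q \<or> \<not> dist y x \<ge> r" for y
        using True closure_subset[of Q] by (auto simp: dist_commute)
      then show ?thesis by (intro that[of "1/2"]) auto
    next
      case False
      then obtain s where s: "s \<in> ?S" "\<forall>y\<in>?S. K y \<le> K s"
        using continuous_attains_sup[OF cS False continuous_on_subset[OF Kc subset_UNIV]] by blast
      \<comment> \<open>The maximum with 1/2 keeps the bound positive.\<close>
      show ?thesis
      proof (rule that[of "max (1/2) (K s)"])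
        fix y assume "y \<in> Q" "dist y x \<ge> r"
        then have "y \<in> ?S" using closure_subset[of Q] by (auto simp: dist_commute)
        then show "K y \<le> max (1/2) (K s)" using s(2) by (simp add: le_max_iff_disj)
      qed (use lt[OF s(1)] in auto)
    qed
  qed
  \<comment> \<open>Any number strictly between \<rho> and 1 would do: \<open>K y ^ n\<close> is at
    least \<open>\<sigma> ^ n\<close> near \<open>x\<close> and at most \<open>\<rho> ^ n\<close>
    far away, and the quotient of the two tends to the side of \<open>x\<close>.\<close>
  define \<sigma> where "\<sigma> = (1 + \<rho>) / 2"
  have \<sigma>: "\<rho> < \<sigma>" "\<sigma> < 1" "0 < \<sigma>" using \<rho> by (auto simp: \<sigma>_def)
  obtain s where s: "s > 0" "s \<le> r" "ball x s \<subseteq> Q" "\<And>y. dist y x < s \<Longrightarrow> K y > \<sigma>"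
  proof -
    have "\<forall>\<^sub>F y in at x. K y > \<sigma>"
      using Kc \<sigma> Kx by (metis (no_types) UNIV_I continuous_on_eq_continuous_at isCont_def open_UNIV order_tendstoD(1))
    then obtain s1 where s1: "s1 > 0" "\<And>y. y \<noteq> x \<Longrightarrow> dist y x < s1 \<Longrightarrow> K y > \<sigma>"
      unfolding eventually_at by auto
    obtain s2 where s2: "s2 > 0" "ball x s2 \<subseteq> Q" using ball_subset_cell Q_def by blast
    show ?thesis
    proof (rule that[of "min s1 (min s2 r)"])
      show "K y > \<sigma>" if "dist y x < min s1 (min s2 r)" for y
        using that s1(2)[of y] Kx \<sigma> by (cases "y = x") auto
      show "ball x (min s1 (min s2 r)) \<subseteq> Q" using s2(2) by auto
    qed (use s1 s2 r in auto)
  qed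
  define \<mu> where "\<mu> = measure lborel (ball x s)"
  have \<mu>: "\<mu> > 0" using s(1) by (simp add: \<mu>_def content_ball_pos)
  have bf: "emeasure lborel (ball x s) < \<infinity>" using emeasure_bounded_finite[of "ball x s"] by simp
  \<comment> \<open>The integral of \<open>H y * K y ^ n\<close> over the cell is 0. The integrand
    is at least \<open>\<delta> * \<sigma> ^ n\<close> on the small ball, nonnegative on the rest of
    the ball of radius \<open>r\<close>, and at least \<open>- (M * \<rho> ^ n)\<close>
    elsewhere.\<close>
  have bound: "\<delta> * \<sigma> ^ n * \<mu> \<le> M * \<rho> ^ n * vol" for n
  proof -
    have M0: "0 \<le> M" using M[of 0] by linarith
    have i1: "integrable lborel (\<lambda>y. \<delta> * \<sigma> ^ n * indicator (ball x s) y)"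
      using bf by (simp add: integrable_indicator_iff)
    have i2: "integrable lborel (\<lambda>y. M * \<rho> ^ n * indicator Q y)"
      using Qe by (simp add: integrable_indicator_iff)
    have "(\<integral>y. \<delta> * \<sigma> ^ n * indicator (ball x s) y \<partial>lborel) \<le>
       (\<integral>y. indicator Q y * H y * K y ^ n + M * \<rho> ^ n * indicator Q y \<partial>lborel)"
    proof (rule integral_mono[OF i1 Bochner_Integration.integrable_add[OF intK i2]])
      fix y
      show "\<delta> * \<sigma> ^ n * indicator (ball x s) y \<le> indicator Q y * H y * K y ^ n + M * \<rho> ^ n * indicator Q y"
      proof (cases "y \<in> Q")
        case True
        have Mr: "0 \<le> M * \<rho> ^ n" using M0 \<rho> by simp
        show ?thesis
        proof (cases "dist y x < r")
          case True
          have H: "H y > \<delta>" using r True by blast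
          have HK: "0 \<le> H y * K y ^ n" using H \<delta> K01[of y] by (intro mult_nonneg_nonneg) auto
          show ?thesis
          proof (cases "y \<in> ball x s")
            case True
            then have "\<sigma> ^ n \<le> K y ^ n" using s(4)[of y] \<sigma> by (intro power_mono) (auto simp: dist_commute)
            then have "\<delta> * \<sigma> ^ n \<le> H y * K y ^ n" using H \<delta> \<sigma> by (intro mult_mono) auto
            then show ?thesis using \<open>y \<in> Q\<close> True Mr by simp
          next
            case False
            then show ?thesis using \<open>y \<in> Q\<close> Mr HK by simp
          qed
        next
          case False
          then have "K y \<le> \<rho>" using \<rho>(3) \<open>y \<in> Q\<close> by simp
          then have "K y ^ n \<le> \<rho> ^ n" using K01 by (intro power_mono) auto
          then have "\<bar>H y\<bar> * K y ^ n \<le> M * \<rho> ^ n" using M K01[of y] M0 by (intro mult_mono) auto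
          then have "\<bar>H y * K y ^ n\<bar> \<le> M * \<rho> ^ n" using K01[of y] by (simp add: abs_mult)
          then have "0 \<le> H y * K y ^ n + M * \<rho> ^ n" by linarith
          moreover have "y \<notin> ball x s" using False s(2) by (auto simp: dist_commute)
          ultimately show ?thesis using \<open>y \<in> Q\<close> by simp
        qed
      next
        case False
        then have "y \<notin> ball x s" using s(3) by auto
        then show ?thesis using False by simp
      qed
    qed
    also have "\<dots> = M * \<rho> ^ n * vol"
      using intK[of n] zeroK[of n] i2 by (simp add: Q_def measure_cell)
    finally show ?thesis using bf by (simp add: \<mu>_def)
  qed
  have "(\<lambda>n. M * vol * (\<rho> / \<sigma>) ^ n) \<longlonglongrightarrow> M * vol * 0"
    using \<rho> \<sigma> by (intro tendsto_intros LIMSEQ_power_zero) auto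
  moreover have "\<delta> * \<mu> \<le> M * vol * (\<rho> / \<sigma>) ^ n" for n
    using bound[of n] \<sigma> by (simp add: power_divide field_simps)
  ultimately have "\<delta> * \<mu> \<le> M * vol * 0"
    by (intro LIMSEQ_le_const) auto
  then show False using \<delta> \<mu> by (simp add: mult_le_0_iff)
qed

lemma zero_fourier_coeffs_imp_zero:
  fixes H :: "'a \<Rightarrow> real"
  assumes [measurable]: "H \<in> borel_measurable borel" and M: "\<And>y. \<bar>H y\<bar> \<le> M"
    and coeffs: "\<And>\<eta>. \<eta> \<in> dual_lattice lat \<Longrightarrow>
       (\<integral>y. (indicator (cell (x - mid)) y * H y) *\<^sub>R cis (2 * pi * (y \<bullet> \<eta>)) \<partial>lborel) = 0"
    and cont: "isCont H x"
  shows "H x = 0"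
proof -
  have "H x \<le> 0" using zero_fourier_coeffs_imp_not_pos[OF assms] .
  moreover have "- H x \<le> 0"
    by (rule zero_fourier_coeffs_imp_not_pos[where M=M]) (use M coeffs cont in \<open>auto intro: continuous_intros\<close>)
  ultimately show ?thesis by simp
qed

end

lemma is_lattice_imp_lattice_frame:
  fixes G :: "'a::euclidean_space set"
  assumes "is_lattice G"
  obtains B d where "lattice_frame B d" "G = lattice_frame.lat B"
proof -
  obtain B where B: "independent B" "span B = UNIV"
    and G: "G = {(\<Sum>b\<in>B. of_int (c b) *\<^sub>R b) | c :: 'a \<Rightarrow> int. True}"
    using assms unfolding is_lattice_def by blast
  have fin: "finite B" using B(1) by (rule independent_imp_finite)
  have "\<exists>g. linear g \<and> (\<forall>x\<in>B. g x = (if b = x then 1 else 0 :: real))" for b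
    by (rule linear_independent_extend[OF B(1)])
  then obtain f :: "'a \<Rightarrow> 'a \<Rightarrow> real" where f: "\<And>b. linear (f b)" "\<And>b x. x \<in> B \<Longrightarrow> f b x = (if b = x then 1 else 0)"
    by metis
  \<comment> \<open>The coordinate functionals of the basis, represented as vectors through the
    inner product, form the dual basis.\<close>
  define d where "d b = (\<Sum>i\<in>Basis. f b i *\<^sub>R i)" for b
  have d: "d b \<bullet> y = f b y" for b y
  proof -
    have "f b y = f b (\<Sum>i\<in>Basis. (y \<bullet> i) *\<^sub>R i)" by (simp add: euclidean_representation)
    also have "\<dots> = (\<Sum>i\<in>Basis. (y \<bullet> i) * f b i)"
      using f(1)[of b] by (simp add: linear_sum linear_cmul)
    finally show ?thesis
      unfolding d_def inner_sum_left inner_scaleR_left by (simp add: inner_commute[of y] mult.commute)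
  qed
  have "(\<Sum>b\<in>B. (d b \<bullet> y) *\<^sub>R b) = y" for y
  proof -
    have "y \<in> span B" using B by simp
    then show ?thesis
    proof (induction rule: span_induct_alt)
      case (step c x y)
      have "(\<Sum>b\<in>B. (d b \<bullet> (c *\<^sub>R x + y)) *\<^sub>R b) = c *\<^sub>R (\<Sum>b\<in>B. (d b \<bullet> x) *\<^sub>R b) + (\<Sum>b\<in>B. (d b \<bullet> y) *\<^sub>R b)"
        by (simp add: inner_add_right scaleR_add_left sum.distrib scaleR_sum_right)
      also have "(\<Sum>b\<in>B. (d b \<bullet> x) *\<^sub>R b) = x"
        using fin step by (simp add: d f(2) if_distrib[of "\<lambda>r. r *\<^sub>R _"] cong: if_cong)
      finally show ?case using step by simp
    qed simp
  qed
  then have L: "lattice_frame B d"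
    using fin d f(2) by unfold_locales auto
  show ?thesis
    by (rule that[OF L]) (simp add: G lattice_frame.lat_def[OF L])
qed

section \<open>Counting lattice points over a strip and the density of model sets\<close>

lemma cube_eq_cbox:
  fixes x :: "real ^ 'm"
  assumes "0 \<le> R"
  shows "cube x R = cbox x (x + R *\<^sub>R 1)"
proof -
  have "cube x R = (\<lambda>u. R *\<^sub>R u + x) ` cbox 0 1" by (simp add: cube_def add.commute)
  also have "\<dots> = cbox x (x + R *\<^sub>R 1)"
  proof -
    have "cbox (0 :: real ^ 'm) 1 \<noteq> {}" by (simp add: interval_ne_empty_cart)
    then show ?thesis using assms image_affinity_cbox[of R x 0 1] by (simp add: add.commute[of "R *\<^sub>R 1" x])
  qed
  finally show ?thesis .
qed

lemma mem_cube: "0 \<le> R \<Longrightarrow> y \<in> cube x R \<longleftrightarrow> (\<forall>i. x $ i \<le> y $ i \<and> y $ i \<le> x $ i + R)"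
  by (simp add: cube_eq_cbox mem_box_cart)

lemma emeasure_cube:
  fixes x :: "real ^ 'm"
  assumes "0 \<le> R"
  shows "emeasure lborel (cube x R) = ennreal (R ^ CARD('m))"
proof -
  have "cbox x (x + R *\<^sub>R 1) \<noteq> {}" using assms by (auto simp: interval_eq_empty_cart not_less)
  then have "measure lborel (cbox x (x + R *\<^sub>R 1)) = R ^ CARD('m)"
    by (simp add: content_cbox_cart)
  moreover have "emeasure lborel (cbox x (x + R *\<^sub>R 1)) = ennreal (measure lborel (cbox x (x + R *\<^sub>R 1)))"
    by (rule emeasure_eq_ennreal_measure) (use emeasure_lborel_cbox_finite[of x "x + R *\<^sub>R 1"] in auto)
  ultimately show ?thesis
    by (simp only: cube_eq_cbox[OF assms])
qed

lemma cube_measurable: "0 \<le> R \<Longrightarrow> cube x R \<in> sets borel"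
  by (simp add: cube_eq_cbox)

lemma emeasure_cube_times:
  fixes x :: "real ^ 'm"
  assumes "0 \<le> R" "a \<le> b"
  shows "emeasure lborel (cube x R \<times> {a..b}) = ennreal (R ^ CARD('m) * (b - a))"
  using assms cube_measurable[OF assms(1), of x]
  by (simp add: lborel_prod[symmetric] lborel.emeasure_pair_measure_Times emeasure_cube ennreal_mult)

lemma tendsto_shifted_ratio: "((\<lambda>R. (X::real) * ((R + K) / R) ^ n) \<longlongrightarrow> X) at_top"
proof -
  have "((\<lambda>R. (R + K) / R) \<longlongrightarrow> 1) at_top"
  proof (rule Lim_transform_eventually)
    have "((\<lambda>R. 1 + K * inverse R) \<longlongrightarrow> 1 + K * 0) at_top"
      by (intro tendsto_intros tendsto_inverse_0_at_top filterlim_ident)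
    then show "((\<lambda>R. 1 + K * inverse R) \<longlongrightarrow> 1) at_top" by simp
    show "\<forall>\<^sub>F R in at_top. 1 + K * inverse R = (R + K) / R"
      using eventually_gt_at_top[of 0] by eventually_elim (simp add: field_simps)
  qed
  from tendsto_mult[OF tendsto_const tendsto_power[OF this]] show ?thesis by simp
qed

context lattice_frame
begin

lemma cell_size: obtains \<rho> where "\<rho> > 0" "\<And>y. norm (reduce 0 y) \<le> \<rho>"
  using cell_bounded[of 0] reduce_cell[of 0] unfolding bounded_pos by blast

lemma emeasure_UN_cells:
  assumes "finite F" "F \<subseteq> lat"
  shows "emeasure lborel (\<Union>\<gamma>\<in>F. cell \<gamma>) = ennreal (vol * card F)"
proof -
  have "disjoint_family_on cell F"
  proof (unfold disjoint_family_on_def, intro ballI impI)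
    fix \<gamma> \<theta> assume g: "\<gamma> \<in> F" "\<theta> \<in> F" "\<gamma> \<noteq> \<theta>"
    show "cell \<gamma> \<inter> cell \<theta> = {}"
    proof (rule ccontr)
      assume "cell \<gamma> \<inter> cell \<theta> \<noteq> {}"
      then obtain y where "y - \<gamma> \<in> cell 0" "y - \<theta> \<in> cell 0"
        using cell_translate[of _ 0] by auto
      moreover have "(y - \<gamma>) - (y - \<theta>) \<in> lat" using lat_diff[of \<theta> \<gamma>] g assms(2) by auto
      ultimately have "y - \<gamma> = y - \<theta>" by (rule cell_unique)
      then show False using g by simp
    qed
  qed
  then have "emeasure lborel (\<Union>\<gamma>\<in>F. cell \<gamma>) = (\<Sum>\<gamma>\<in>F. emeasure lborel (cell \<gamma>))"
    using assms(1) by (intro sum_emeasure[symmetric]) auto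
  then show ?thesis
    using vol_pos by (simp add: emeasure_cell ennreal_mult ennreal_of_nat_eq_real_of_nat mult.commute)
qed

text \<open>The cells attached to the lattice points in \<open>S\<close> are disjoint, have volume
  \<open>vol\<close> and lie in \<open>S'\<close>. Finiteness follows because the bound holds for
  every finite subset.\<close>

lemma card_lat_le:
  assumes [measurable]: "S' \<in> sets borel" and S': "emeasure lborel S' \<le> ennreal V" "0 \<le> V"
    and sub: "\<And>y. y - reduce 0 y \<in> S \<Longrightarrow> y \<in> S'"
  shows "finite (lat \<inter> S)" "vol * card (lat \<inter> S) \<le> V"
proof -
  have *: "vol * card F \<le> V" if "finite F" "F \<subseteq> lat \<inter> S" for F
  proof -
    have "(\<Union>\<gamma>\<in>F. cell \<gamma>) \<subseteq> S'"
    proof (safe)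
      fix \<gamma> y assume g: "\<gamma> \<in> F" "y \<in> cell \<gamma>"
      then have "reduce 0 ((y - \<gamma>) + \<gamma>) = y - \<gamma>"
        using that cell_translate[of y 0 \<gamma>] by (intro reduce_add) auto
      then have "y - reduce 0 y = \<gamma>" by simp
      then show "y \<in> S'" using g that by (intro sub) auto
    qed
    then have "emeasure lborel (\<Union>\<gamma>\<in>F. cell \<gamma>) \<le> emeasure lborel S'" by (rule emeasure_mono) simp
    also note S'(1)
    finally show ?thesis using that S'(2) by (subst (asm) emeasure_UN_cells) auto
  qed
  have "card F \<le> nat \<lceil>V / vol\<rceil>" if "F \<subseteq> lat \<inter> S" "finite F" for F
  proof -
    have "real (card F) \<le> V / vol" using *[OF that(2,1)] vol_pos by (simp add: field_simps)
    then show ?thesis by linarith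
  qed
  then show fin: "finite (lat \<inter> S)"
    using finite_if_finite_subsets_card_bdd[of "lat \<inter> S"] by metis
  show "vol * card (lat \<inter> S) \<le> V" using *[OF fin] by simp
qed

text \<open>Here the cells attached to the lattice points in \<open>S\<close> cover
  \<open>S'\<close>.\<close>

lemma card_lat_ge:
  assumes [measurable]: "S' \<in> sets borel" and S': "ennreal V \<le> emeasure lborel S'"
    and fin: "finite (lat \<inter> S)"
    and sub: "\<And>y. y \<in> S' \<Longrightarrow> y - reduce 0 y \<in> S"
  shows "V \<le> vol * card (lat \<inter> S)"
proof -
  have "S' \<subseteq> (\<Union>\<gamma>\<in>lat \<inter> S. cell \<gamma>)"
  proof
    fix y assume "y \<in> S'"
    then have "y - reduce 0 y \<in> lat \<inter> S" using sub reduce_lat by auto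
    moreover have "y \<in> cell (y - reduce 0 y)" using cell_translate[of y 0 "y - reduce 0 y"] reduce_cell[of 0 y] by simp
    ultimately show "y \<in> (\<Union>\<gamma>\<in>lat \<inter> S. cell \<gamma>)" by blast
  qed
  then have "emeasure lborel S' \<le> emeasure lborel (\<Union>\<gamma>\<in>lat \<inter> S. cell \<gamma>)"
    using fin by (intro emeasure_mono) (auto intro!: sets.finite_UN)
  with S' have "ennreal V \<le> ennreal (vol * card (lat \<inter> S))"
    using emeasure_UN_cells[OF fin] by simp
  then show ?thesis using vol_pos by simp
qed

end

locale lattice_frame_strip = lattice_frame B d
  for B :: "((real ^ 'm) \<times> real) set" and d
begin

text \<open>\<rho> bounds the vectors of the cell at 0, so a point and the lattice point of its cell
  differ by at most \<rho> in each coordinate: the box is compared with the one widened or narrowed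
  by \<rho> on every side.\<close>

lemma count_bounds:
  obtains \<rho> where "\<rho> > 0"
    "\<And>x R a b. \<lbrakk>0 \<le> R; a \<le> b\<rbrakk> \<Longrightarrow> finite (lat \<inter> cube x R \<times> {a..b}) \<and>
       vol * card (lat \<inter> cube x R \<times> {a..b}) \<le> (R + 2 * \<rho>) ^ CARD('m) * (b - a + 2 * \<rho>)"
    "\<And>x R a b. \<lbrakk>2 * \<rho> \<le> R; 2 * \<rho> \<le> b - a\<rbrakk> \<Longrightarrow>
       (R - 2 * \<rho>) ^ CARD('m) * (b - a - 2 * \<rho>) \<le> vol * card (lat \<inter> cube x R \<times> {a..b})"
proof -
  obtain \<rho> where \<rho>: "\<rho> > 0" "\<And>y. norm (reduce 0 y) \<le> \<rho>" using cell_size by blast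
  have comp: "\<bar>fst (reduce 0 y) $ i\<bar> \<le> \<rho>" "\<bar>snd (reduce 0 y)\<bar> \<le> \<rho>" for y i
    using \<rho>(2)[of y] component_le_norm_cart[of "fst (reduce 0 y)" i]
      norm_fst_le[of "fst (reduce 0 y)" "snd (reduce 0 y)"] norm_snd_le[of "snd (reduce 0 y)" "fst (reduce 0 y)"] by auto
  have le: "finite (lat \<inter> cube x R \<times> {a..b}) \<and>
       vol * card (lat \<inter> cube x R \<times> {a..b}) \<le> (R + 2 * \<rho>) ^ CARD('m) * (b - a + 2 * \<rho>)" if "0 \<le> R" "a \<le> b" for x R a b
  proof -
    let ?S = "cube x R \<times> {a..b}" and ?S' = "cube (x - \<rho> *\<^sub>R 1) (R + 2 * \<rho>) \<times> {a - \<rho>..b + \<rho>}"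
    let ?V = "(R + 2 * \<rho>) ^ CARD('m) * (b - a + 2 * \<rho>)"
    have m: "?S' \<in> sets borel" using that \<rho> by (auto simp: cube_eq_cbox intro!: borel_closed closed_Times)
    have "emeasure lborel ?S' \<le> ennreal ?V"
      using that \<rho>(1) by (subst emeasure_cube_times) (auto simp: algebra_simps)
    moreover have "0 \<le> ?V" using that \<rho> by simp
    moreover have "y \<in> ?S'" if y: "y - reduce 0 y \<in> ?S" for y
    proof -
      have "x $ i - \<rho> \<le> fst y $ i \<and> fst y $ i \<le> x $ i - \<rho> + (R + 2 * \<rho>)" for i
        using y comp(1)[of y i] \<open>0 \<le> R\<close> by (auto simp: mem_Times_iff mem_cube dest!: spec[of _ i])
      moreover have "a - \<rho> \<le> snd y \<and> snd y \<le> b + \<rho>"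
        using y comp(2)[of y] by (auto simp: mem_Times_iff)
      ultimately show ?thesis using \<rho> \<open>0 \<le> R\<close> by (auto simp: mem_Times_iff mem_cube)
    qed
    ultimately show ?thesis using card_lat_le[OF m, of ?V ?S] by blast
  qed
  have ge: "(R - 2 * \<rho>) ^ CARD('m) * (b - a - 2 * \<rho>) \<le> vol * card (lat \<inter> cube x R \<times> {a..b})"
    if "2 * \<rho> \<le> R" "2 * \<rho> \<le> b - a" for x R a b
  proof -
    let ?S = "cube x R \<times> {a..b}" and ?S' = "cube (x + \<rho> *\<^sub>R 1) (R - 2 * \<rho>) \<times> {a + \<rho>..b - \<rho>}"
    let ?V = "(R - 2 * \<rho>) ^ CARD('m) * (b - a - 2 * \<rho>)"
    have R: "0 \<le> R" using that \<rho> by linarith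
    have m: "?S' \<in> sets borel" using that \<rho> by (auto simp: cube_eq_cbox intro!: borel_closed closed_Times)
    have "ennreal ?V \<le> emeasure lborel ?S'"
      using that \<rho>(1) by (subst emeasure_cube_times) (auto simp: algebra_simps)
    moreover have "finite (lat \<inter> ?S)" using le[OF R, of a b x] that \<rho> by auto
    moreover have "y - reduce 0 y \<in> ?S" if y: "y \<in> ?S'" for y
    proof -
      have "x $ i \<le> fst (y - reduce 0 y) $ i \<and> fst (y - reduce 0 y) $ i \<le> x $ i + R" for i
        using y comp(1)[of y i] \<open>2 * \<rho> \<le> R\<close> by (auto simp: mem_Times_iff mem_cube dest!: spec[of _ i])
      moreover have "a \<le> snd (y - reduce 0 y) \<and> snd (y - reduce 0 y) \<le> b"
        using y comp(2)[of y] by (auto simp: mem_Times_iff)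
      ultimately show ?thesis using R by (auto simp: mem_Times_iff mem_cube)
    qed
    ultimately show ?thesis using card_lat_ge[OF m, of ?V ?S] by blast
  qed
  show ?thesis using that[OF \<rho>(1)] le ge by blast
qed

lemma dense_snd:
  assumes "closure (snd ` lat) = UNIV" "p < q"
  obtains \<gamma> where "\<gamma> \<in> lat" "p < snd \<gamma>" "snd \<gamma> < q"
proof -
  have "(p + q) / 2 \<in> closure (snd ` lat)" using assms(1) by simp
  then obtain y where "y \<in> snd ` lat" "dist y ((p + q) / 2) < (q - p) / 2"
    using assms(2) unfolding closure_approachable by (metis diff_gt_0_iff_gt half_gt_zero)
  then show ?thesis using that by (auto simp: dist_real_def abs_less_iff field_simps)
qed

text \<open>Density prescribes only the second coordinates. The first coordinates of the
  \<open>k\<close> vectors are uncontrolled but finite in number, and their bound \<sigma> costs a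
  boundary layer of fixed width that disappears in the limit of large cubes.\<close>

lemma dense_snd_family:
  assumes dense: "closure (snd ` lat) = UNIV" and e: "e > 0"
  obtains s \<sigma> where "\<And>j::nat. s j \<in> lat" "\<And>j. p j < snd (s j)" "\<And>j. snd (s j) < p j + e"
    "\<sigma> > 0" "\<And>j i. j < k \<Longrightarrow> \<bar>fst (s j) $ i\<bar> \<le> \<sigma>"
proof -
  have "\<exists>\<gamma>\<in>lat. p j < snd \<gamma> \<and> snd \<gamma> < p j + e" for j
    using dense_snd[OF dense, of "p j" "p j + e"] e by auto
  then obtain s where s: "\<And>j. s j \<in> lat" "\<And>j. p j < snd (s j)" "\<And>j. snd (s j) < p j + e" by metis
  define \<sigma> where "\<sigma> = 1 + (\<Sum>j<k. norm (fst (s j)))"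
  have "\<bar>fst (s j) $ i\<bar> \<le> \<sigma>" if "j < k" for j i
  proof -
    have "\<bar>fst (s j) $ i\<bar> \<le> norm (fst (s j))" by (rule component_le_norm_cart)
    also have "\<dots> \<le> (\<Sum>j<k. norm (fst (s j)))" using that by (intro member_le_sum) auto
    finally show ?thesis by (simp add: \<sigma>_def)
  qed
  moreover have "\<sigma> > 0" by (simp add: \<sigma>_def add_pos_nonneg sum_nonneg)
  ultimately show ?thesis using that s by blast
qed

text \<open>Volume comparison counts lattice points well only in long strips. Lattice vectors with second
  coordinate close to \<open>j * l\<close>, \<open>j < k\<close>, stack \<open>k\<close> copies of the short strip to a long one.\<close>

lemma count_lower:
  assumes dense: "closure (snd ` lat) = UNIV" and ab: "a < b" and y: "y < (b - a) / vol"
  shows "\<exists>X K::real. X > y \<and> (\<forall>x R. R \<ge> K \<longrightarrow> X * (R - K) ^ CARD('m) \<le> real (card (lat \<inter> cube x R \<times> {a..b})))"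
proof -
  obtain \<rho> where \<rho>: "\<rho> > 0" and
    fin: "\<And>x R a b. \<lbrakk>0 \<le> R; a \<le> b\<rbrakk> \<Longrightarrow> finite (lat \<inter> cube x R \<times> {a..b}) \<and>
       vol * card (lat \<inter> cube x R \<times> {a..b}) \<le> (R + 2 * \<rho>) ^ CARD('m) * (b - a + 2 * \<rho>)" and
    ge: "\<And>x R a b. \<lbrakk>2 * \<rho> \<le> R; 2 * \<rho> \<le> b - a\<rbrakk> \<Longrightarrow>
       (R - 2 * \<rho>) ^ CARD('m) * (b - a - 2 * \<rho>) \<le> vol * card (lat \<inter> cube x R \<times> {a..b})"
    using count_bounds by blast
  \<comment> \<open>The slack pays both for the shortened step \<open>l\<close> and for the volume
    error 2\<rho>/k, each at most \<open>e\<close>. The other bound keeps \<open>l\<close>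
    positive.\<close>
  define e where "e = min ((b - a - y * vol) / 4) ((b - a) / 2)"
  have e: "0 < e" "e \<le> (b - a - y * vol) / 4" "e \<le> (b - a) / 2"
  proof -
    have "0 < b - a - y * vol" using y vol_pos by (simp add: field_simps)
    then show "0 < e" using ab by (simp add: e_def)
  qed (unfold e_def, rule min.cobounded1, rule min.cobounded2)
  obtain k :: nat where k: "2 * \<rho> / e < real k" using reals_Archimedean2 by blast
  have "0 < 2 * \<rho> / e" using \<rho> e(1) by simp
  then have k0: "k > 0" using k by (cases k) auto
  have ke: "2 * \<rho> < real k * e" using k e(1) by (simp add: field_simps)
  \<comment> \<open>Steps shorter than the strip by \<open>e\<close> leave no gap between the
    copies, although each second coordinate may exceed \<open>real j * l\<close> by up to
    \<open>e\<close>.\<close>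
  define l where "l = b - a - e"
  have l: "e \<le> l" "0 < l" using e by (auto simp: l_def)
  obtain s \<sigma> where s: "\<And>j. s j \<in> lat" "\<And>j. real j * l < snd (s j)" "\<And>j. snd (s j) < real j * l + e"
    and \<sigma>: "\<sigma> > 0" "\<And>j i. j < k \<Longrightarrow> \<bar>fst (s j) $ i\<bar> \<le> \<sigma>"
    using dense_snd_family[OF dense e(1), of "\<lambda>j. real j * l" k] by metis
  define X where "X = (l - 2 * \<rho> / k) / vol"
  have "2 * \<rho> / k < e" using ke k0 by (simp add: field_simps)
  moreover have "e + e < b - a - y * vol"
  proof -
    have "4 * e \<le> b - a - y * vol" using e(2) by simp
    then show ?thesis using e(1) by linarith
  qed
  ultimately have "y * vol < l - 2 * \<rho> / k" unfolding l_def by linarith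
  then have X: "y < X" using vol_pos by (simp add: X_def field_simps)
  have "X * (R - (2 * \<sigma> + 2 * \<rho>)) ^ CARD('m) \<le> real (card (lat \<inter> cube x R \<times> {a..b}))" if R: "R \<ge> 2 * \<sigma> + 2 * \<rho>" for x R
  proof -
    let ?A = "lat \<inter> cube x R \<times> {a..b}"
    \<comment> \<open>The long strip starts at \<open>a + e\<close> and its cube is narrowed by
      \<sigma>, so that subtracting \<open>s j\<close> leads back into the short strip over the full
      cube.\<close>
    let ?C = "lat \<inter> cube (x + \<sigma> *\<^sub>R 1) (R - 2 * \<sigma>) \<times> {a + e..a + e + real k * l}"
    have R0: "0 \<le> R" "0 \<le> R - 2 * \<sigma>" using R \<sigma> \<rho> by auto
    have finA: "finite ?A" using fin[OF R0(1), of a b x] ab by auto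
    have "?C \<subseteq> (\<Union>j<k. (\<lambda>\<gamma>. \<gamma> + s j) ` ?A)"
    proof
      fix \<gamma> assume \<gamma>: "\<gamma> \<in> ?C"
      define t where "t = snd \<gamma> - a - e"
      have t: "0 \<le> t" "t \<le> real k * l" using \<gamma> by (auto simp: t_def mem_Times_iff)
      obtain j where j: "j < k" "real j * l \<le> t" "t \<le> (real j + 1) * l"
      proof (cases "t = real k * l")
        case True
        have "real (k - 1) = real k - 1" using k0 by simp
        then show ?thesis using True k0 l by (intro that[of "k - 1"]) (auto simp: algebra_simps)
      next
        case False
        then have tl: "0 \<le> t / l" "t / l < real k" using t l by (auto simp: field_simps)
        then have "real (nat \<lfloor>t / l\<rfloor>) \<le> t / l" "t / l \<le> real (nat \<lfloor>t / l\<rfloor>) + 1" "nat \<lfloor>t / l\<rfloor> < k"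
          by linarith+
        then show ?thesis using l by (intro that[of "nat \<lfloor>t / l\<rfloor>"]) (auto simp: field_simps)
      qed
      have "\<gamma> - s j \<in> lat" using \<gamma> s(1) lat_diff by auto
      moreover have "fst (\<gamma> - s j) \<in> cube x R"
      proof -
        have "x $ i \<le> fst (\<gamma> - s j) $ i \<and> fst (\<gamma> - s j) $ i \<le> x $ i + R" for i
          using \<gamma> R0 \<sigma>(2)[OF j(1), of i] by (auto simp: mem_Times_iff mem_cube dest!: spec[of _ i])
        then show ?thesis using R0 by (simp add: mem_cube)
      qed
      moreover have "snd (\<gamma> - s j) \<in> {a..b}"
        using s(2)[of j] s(3)[of j] j(2,3) by (auto simp: t_def l_def algebra_simps)
      ultimately have "\<gamma> - s j \<in> ?A" by (simp add: mem_Times_iff)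
      then have "\<gamma> \<in> (\<lambda>\<gamma>. \<gamma> + s j) ` ?A" by (rule rev_image_eqI) simp
      then show "\<gamma> \<in> (\<Union>j<k. (\<lambda>\<gamma>. \<gamma> + s j) ` ?A)" using j(1) by blast
    qed
    then have "card ?C \<le> card (\<Union>j<k. (\<lambda>\<gamma>. \<gamma> + s j) ` ?A)"
      using finA by (intro card_mono) auto
    also have "\<dots> \<le> (\<Sum>j<k. card ((\<lambda>\<gamma>. \<gamma> + s j) ` ?A))" by (rule card_UN_le) simp
    also have "\<dots> = k * card ?A" by (simp add: card_image)
    finally have "real (card ?C) \<le> real k * card ?A" by (metis of_nat_le_iff of_nat_mult)
    then have "vol * real (card ?C) \<le> vol * (real k * card ?A)" using vol_pos by (intro mult_left_mono) auto
    moreover have "(R - 2 * \<sigma> - 2 * \<rho>) ^ CARD('m) * (real k * l - 2 * \<rho>) \<le> vol * card ?C"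
    proof -
      have "real k * e \<le> real k * l" using l by (intro mult_left_mono) auto
      then show ?thesis using ge[of "R - 2 * \<sigma>" "a + e + real k * l" "a + e" "x + \<sigma> *\<^sub>R 1"] R ke by simp
    qed
    ultimately have "(R - 2 * \<sigma> - 2 * \<rho>) ^ CARD('m) * (real k * l - 2 * \<rho>) \<le> vol * (real k * card ?A)" by linarith
    then show ?thesis using vol_pos k0 by (simp add: X_def field_simps diff_diff_eq)
  qed
  then show ?thesis using X by blast
qed

text \<open>The reverse stacking: steps longer than the strip by \<open>e\<close> keep the
  \<open>k\<close> shifted copies disjoint, and all of them fit into a strip of length
  \<open>real k * l\<close> over the cube widened by \<sigma>.\<close>

lemma count_upper:
  assumes dense: "closure (snd ` lat) = UNIV" and ab: "a < b" and y: "(b - a) / vol < y"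
  shows "\<exists>X K::real. X < y \<and> K \<ge> 0 \<and> (\<forall>x R. R \<ge> 0 \<longrightarrow> real (card (lat \<inter> cube x R \<times> {a..b})) \<le> X * (R + K) ^ CARD('m))"
proof -
  obtain \<rho> where \<rho>: "\<rho> > 0" and
    fin: "\<And>x R a b. \<lbrakk>0 \<le> R; a \<le> b\<rbrakk> \<Longrightarrow> finite (lat \<inter> cube x R \<times> {a..b}) \<and>
       vol * card (lat \<inter> cube x R \<times> {a..b}) \<le> (R + 2 * \<rho>) ^ CARD('m) * (b - a + 2 * \<rho>)" and
    "\<And>x R a b. \<lbrakk>2 * \<rho> \<le> R; 2 * \<rho> \<le> b - a\<rbrakk> \<Longrightarrow>
       (R - 2 * \<rho>) ^ CARD('m) * (b - a - 2 * \<rho>) \<le> vol * card (lat \<inter> cube x R \<times> {a..b})"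
    using count_bounds by blast
  define e where "e = (y * vol - (b - a)) / 4"
  have e: "0 < e" using y vol_pos by (auto simp: e_def field_simps)
  obtain k :: nat where k: "2 * \<rho> / e < real k" using reals_Archimedean2 by blast
  have "0 < 2 * \<rho> / e" using \<rho> e by simp
  then have k0: "k > 0" using k by (cases k) auto
  have ke: "2 * \<rho> < real k * e" using k e by (simp add: field_simps)
  define l where "l = b - a + e"
  have l: "0 < l" using e ab by (auto simp: l_def)
  obtain s \<sigma> where s: "\<And>j. s j \<in> lat" "\<And>j. real j * l < snd (s j)" "\<And>j. snd (s j) < real j * l + e"
    and \<sigma>: "\<sigma> > 0" "\<And>j i. j < k \<Longrightarrow> \<bar>fst (s j) $ i\<bar> \<le> \<sigma>"
    using dense_snd_family[OF dense e, of "\<lambda>j. real j * l" k] by metis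
  define X where "X = (l + 2 * \<rho> / k) / vol"
  have "2 * \<rho> / k < e" using ke k0 by (simp add: field_simps)
  moreover have "4 * e = y * vol - (b - a)" by (simp add: e_def)
  ultimately have "l + 2 * \<rho> / k < y * vol" unfolding l_def using e by linarith
  then have X: "X < y" using vol_pos by (simp add: X_def field_simps)
  have "real (card (lat \<inter> cube x R \<times> {a..b})) \<le> X * (R + (2 * \<sigma> + 2 * \<rho>)) ^ CARD('m)" if R: "R \<ge> 0" for x R
  proof -
    let ?A = "lat \<inter> cube x R \<times> {a..b}"
    let ?C = "lat \<inter> cube (x - \<sigma> *\<^sub>R 1) (R + 2 * \<sigma>) \<times> {a..a + real k * l}"
    have R0: "0 \<le> R + 2 * \<sigma>" using R \<sigma> by auto
    have kl: "0 \<le> real k * l" using l by simp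
    have C: "finite ?C" "vol * card ?C \<le> (R + 2 * \<sigma> + 2 * \<rho>) ^ CARD('m) * (real k * l + 2 * \<rho>)"
      using fin[OF R0, of a "a + real k * l" "x - \<sigma> *\<^sub>R 1"] kl by auto
    have finA: "finite ?A" using fin[OF R, of a b x] ab by auto
    have sub: "(\<Union>j<k. (\<lambda>\<gamma>. \<gamma> + s j) ` ?A) \<subseteq> ?C"
    proof
      fix \<gamma> assume "\<gamma> \<in> (\<Union>j<k. (\<lambda>\<gamma>. \<gamma> + s j) ` ?A)"
      then obtain j \<theta> where j: "j < k" and \<theta>: "\<theta> \<in> ?A" and \<gamma>: "\<gamma> = \<theta> + s j" by blast
      have "\<gamma> \<in> lat" using \<theta> s(1) lat_add \<gamma> by auto
      moreover have "(x - \<sigma> *\<^sub>R 1) $ i \<le> fst \<gamma> $ i \<and> fst \<gamma> $ i \<le> (x - \<sigma> *\<^sub>R 1) $ i + (R + 2 * \<sigma>)" for i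
        using \<theta> R \<sigma>(2)[OF j, of i] by (auto simp: \<gamma> mem_cube mem_Times_iff dest!: spec[of _ i])
      moreover have "a \<le> snd \<gamma> \<and> snd \<gamma> \<le> a + real k * l"
      proof -
        have "real j * l \<ge> 0" using l by simp
        moreover have "(real j + 1) * l \<le> real k * l" using j l by (intro mult_right_mono) auto
        ultimately show ?thesis using \<theta> s(2)[of j] s(3)[of j] by (auto simp: \<gamma> mem_Times_iff l_def algebra_simps)
      qed
      ultimately show "\<gamma> \<in> ?C"
        using R0 by (simp add: mem_Times_iff mem_cube)
    qed
    have disj: "(\<lambda>\<gamma>. \<gamma> + s i) ` ?A \<inter> (\<lambda>\<gamma>. \<gamma> + s j) ` ?A = {}" if ij: "i < j" for i j
    proof (rule ccontr)
      assume "(\<lambda>\<gamma>. \<gamma> + s i) ` ?A \<inter> (\<lambda>\<gamma>. \<gamma> + s j) ` ?A \<noteq> {}"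
      then obtain \<gamma> \<theta> where g: "\<gamma> \<in> ?A" "\<theta> \<in> ?A" "\<gamma> + s i = \<theta> + s j" by blast
      then have "snd \<gamma> + snd (s i) = snd \<theta> + snd (s j)" by (metis snd_add)
      moreover have "snd \<gamma> \<le> b" "a \<le> snd \<theta>" using g by (auto simp: mem_Times_iff)
      moreover have "(real i + 1) * l \<le> real j * l" using ij l by (intro mult_right_mono) auto
      ultimately show False using s(2)[of j] s(3)[of i] by (auto simp: l_def algebra_simps)
    qed
    have "k * card ?A = (\<Sum>j<k. card ((\<lambda>\<gamma>. \<gamma> + s j) ` ?A))" by (simp add: card_image)
    also have "\<dots> = card (\<Union>j<k. (\<lambda>\<gamma>. \<gamma> + s j) ` ?A)"
    proof (rule card_UN_disjoint[symmetric])
      show "\<forall>i\<in>{..<k}. \<forall>j\<in>{..<k}. i \<noteq> j \<longrightarrow> (\<lambda>\<gamma>. \<gamma> + s i) ` ?A \<inter> (\<lambda>\<gamma>. \<gamma> + s j) ` ?A = {}"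
        using disj by (metis Int_commute linorder_neq_iff)
    qed (use finA in auto)
    also have "\<dots> \<le> card ?C" using C sub by (intro card_mono)
    finally have "real k * card ?A \<le> card ?C" by (metis of_nat_le_iff of_nat_mult)
    then have "vol * (real k * card ?A) \<le> vol * card ?C" using vol_pos by (intro mult_left_mono) auto
    then have "vol * (real k * card ?A) \<le> (R + 2 * \<sigma> + 2 * \<rho>) ^ CARD('m) * (real k * l + 2 * \<rho>)" using C by linarith
    then show ?thesis using vol_pos k0 by (simp add: X_def field_simps add.assoc)
  qed
  then show ?thesis using X \<sigma> \<rho> by (intro exI[of _ X] exI[of _ "2 * \<sigma> + 2 * \<rho>"]) auto
qed

lemma count_tendsto:
  assumes dense: "closure (snd ` lat) = UNIV" and ab: "a < b"
  shows "((\<lambda>R. real (card (lat \<inter> cube x R \<times> {a..b})) / R ^ CARD('m)) \<longlongrightarrow> (b - a) / vol) at_top"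
proof (rule order_tendstoI)
  fix y assume "y < (b - a) / vol"
  then obtain X K where X: "y < X" "\<And>x R. R \<ge> K \<Longrightarrow> X * (R - K) ^ CARD('m) \<le> real (card (lat \<inter> cube x R \<times> {a..b}))"
    using count_lower[OF dense ab] by blast
  have "\<forall>\<^sub>F R in at_top. y < X * ((R + (- K)) / R) ^ CARD('m)"
    using tendsto_shifted_ratio X(1) by (rule order_tendstoD)
  then show "\<forall>\<^sub>F R in at_top. y < real (card (lat \<inter> cube x R \<times> {a..b})) / R ^ CARD('m)"
    using eventually_gt_at_top[of 0] eventually_ge_at_top[of K]
  proof eventually_elim
    case (elim R)
    have "X * ((R + (- K)) / R) ^ CARD('m) = X * (R - K) ^ CARD('m) / R ^ CARD('m)" by (simp add: power_divide)
    also have "\<dots> \<le> real (card (lat \<inter> cube x R \<times> {a..b})) / R ^ CARD('m)"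
      using X(2)[of R x] elim by (intro divide_right_mono) auto
    finally show ?case using elim by linarith
  qed
next
  fix y assume "(b - a) / vol < y"
  then obtain X K where X: "X < y" "\<And>x R. R \<ge> 0 \<Longrightarrow> real (card (lat \<inter> cube x R \<times> {a..b})) \<le> X * (R + K) ^ CARD('m)"
    using count_upper[OF dense ab] by blast
  have "\<forall>\<^sub>F R in at_top. X * ((R + K) / R) ^ CARD('m) < y"
    using tendsto_shifted_ratio X(1) by (rule order_tendstoD)
  then show "\<forall>\<^sub>F R in at_top. real (card (lat \<inter> cube x R \<times> {a..b})) / R ^ CARD('m) < y"
    using eventually_gt_at_top[of 0]
  proof eventually_elim
    case (elim R)
    have "real (card (lat \<inter> cube x R \<times> {a..b})) / R ^ CARD('m) \<le> X * (R + K) ^ CARD('m) / R ^ CARD('m)"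
      using X(2)[of R x] elim by (intro divide_right_mono) auto
    also have "\<dots> = X * ((R + K) / R) ^ CARD('m)" by (simp add: power_divide)
    finally show ?case using elim by linarith
  qed
qed

text \<open>Injectivity of the first projection turns counting points of the model set into counting
  lattice points over the strip; uniqueness of limits settles the definite description.\<close>

theorem point_density_model_set:
  assumes dense: "closure (snd ` lat) = UNIV" and inj: "inj_on fst lat" and ab: "a < b"
  shows "point_density (model_set lat {a..b}) = (b - a) / vol"
proof -
  have "model_set lat {a..b} \<inter> cube x R = fst ` (lat \<inter> cube x R \<times> {a..b})" for x R
    by (force simp: model_set_def mem_Times_iff)
  moreover have "inj_on fst (lat \<inter> cube x R \<times> {a..b})" for x R
    using inj by (rule inj_on_subset) auto
  ultimately have card: "card (model_set lat {a..b} \<inter> cube x R) = card (lat \<inter> cube x R \<times> {a..b})" for x R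
    by (simp add: card_image)
  show ?thesis
    unfolding point_density_def card
  proof (rule the_equality)
    show "\<forall>x. ((\<lambda>R. real (card (lat \<inter> cube x R \<times> {a..b})) / R ^ CARD('m)) \<longlongrightarrow> (b - a) / vol) at_top"
      using count_tendsto[OF dense ab] by blast
    fix D assume "\<forall>x. ((\<lambda>R. real (card (lat \<inter> cube x R \<times> {a..b})) / R ^ CARD('m)) \<longlongrightarrow> D) at_top"
    then show "D = (b - a) / vol"
      using tendsto_unique[OF _ _ count_tendsto[OF dense ab]] trivial_limit_at_top_linorder by blast
  qed
qed

end

section \<open>The function \<Phi>: infinite convolutions of uniform densities and their
  limit\<close>

abbreviation box_density :: "real \<Rightarrow> real \<Rightarrow> complex" where
  "box_density c \<equiv> normalized_indicator {- c..c}"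

lemma box_density_eq: "c > 0 \<Longrightarrow> box_density c x = of_real (indicator {- c..c} x / (2 * c))"
  by (simp add: normalized_indicator_def)

lemma cmod_box_density: "c > 0 \<Longrightarrow> cmod (box_density c x) = indicator {- c..c} x / (2 * c)"
  unfolding box_density_eq norm_of_real by simp

lemma box_density_measurable[measurable]: "box_density c \<in> borel_measurable borel"
  unfolding normalized_indicator_def[abs_def] by measurable

lemma nn_integral_box_density:
  assumes "c > 0"
  shows "(\<integral>\<^sup>+x. ennreal (cmod (box_density c x)) \<partial>lborel) = 1"
proof -
  have "(\<integral>\<^sup>+x. ennreal (cmod (box_density c x)) \<partial>lborel) = (\<integral>\<^sup>+x. ennreal (1 / (2 * c)) * indicator {- c..c} x \<partial>lborel)"
    using assms by (intro nn_integral_cong) (auto simp: cmod_box_density indicator_def)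
  also have "\<dots> = ennreal (1 / (2 * c)) * ennreal (2 * c)"
    using assms by (simp add: nn_integral_cmult_indicator)
  also have "\<dots> = 1" using assms by (simp flip: ennreal_mult)
  finally show ?thesis .
qed

lemma integrable_box_density: "c > 0 \<Longrightarrow> integrable lborel (box_density c)"
  using nn_integral_box_density[of c] by (intro integrableI_bounded) auto

lemma integral_box_density: "c > 0 \<Longrightarrow> (\<integral>x. box_density c x \<partial>lborel) = 1"
proof -
  assume c: "c > 0"
  have "(\<integral>x. box_density c x \<partial>lborel) = of_real (\<integral>x. indicator {- c..c} x / (2 * c) \<partial>lborel)"
    using c by (simp add: box_density_eq flip: integral_complex_of_real)
  then show ?thesis using c by simp
qed

text \<open>Minkowski's inequality for an average over \<open>z\<close> in [-c, c]: the L1 norm of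
  the average is at most any common bound of the L1 norms. A slice that is not integrable has
  Bochner integral 0 and satisfies the bound trivially.\<close>

lemma nn_integral_average_le:
  fixes u :: "real \<Rightarrow> real \<Rightarrow> complex"
  assumes [measurable]: "(\<lambda>p. u (fst p) (snd p)) \<in> borel_measurable (borel \<Otimes>\<^sub>M borel)"
    and c: "c > 0" and u: "\<And>z. \<bar>z\<bar> \<le> c \<Longrightarrow> (\<integral>\<^sup>+x. ennreal (cmod (u x z)) \<partial>lborel) \<le> K"
  shows "(\<integral>\<^sup>+x. ennreal (cmod (\<integral>z. u x z * box_density c z \<partial>lborel)) \<partial>lborel) \<le> K"
proof -
  have [measurable]: "(\<lambda>z. u x z) \<in> borel_measurable borel" "(\<lambda>x. u x z) \<in> borel_measurable borel" for x z
    using measurable_compose[OF _ assms(1), of "\<lambda>z. (x, z)" borel] measurable_compose[OF _ assms(1), of "\<lambda>x. (x, z)" borel] by simp_all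
  have [measurable]: "(\<lambda>p. u (snd p) (fst p)) \<in> borel_measurable (borel \<Otimes>\<^sub>M borel)"
    using measurable_compose[OF measurable_Pair[OF measurable_snd measurable_fst] assms(1)] by simp
  have "ennreal (cmod (\<integral>z. u x z * box_density c z \<partial>lborel)) \<le> (\<integral>\<^sup>+z. ennreal (cmod (u x z)) * ennreal (cmod (box_density c z)) \<partial>lborel)" for x
  proof (cases "integrable lborel (\<lambda>z. u x z * box_density c z)")
    case True
    from integral_norm_bound_ennreal[OF this] show ?thesis by (simp add: norm_mult ennreal_mult)
  qed (simp add: not_integrable_integral_eq)
  then have "(\<integral>\<^sup>+x. ennreal (cmod (\<integral>z. u x z * box_density c z \<partial>lborel)) \<partial>lborel) \<le>
     (\<integral>\<^sup>+x. \<integral>\<^sup>+z. ennreal (cmod (u x z)) * ennreal (cmod (box_density c z)) \<partial>lborel \<partial>lborel)"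
    by (intro nn_integral_mono)
  also have "\<dots> = (\<integral>\<^sup>+z. \<integral>\<^sup>+x. ennreal (cmod (u x z)) * ennreal (cmod (box_density c z)) \<partial>lborel \<partial>lborel)"
    by (rule lborel_pair.Fubini') measurable
  also have "\<dots> = (\<integral>\<^sup>+z. (\<integral>\<^sup>+x. ennreal (cmod (u x z)) \<partial>lborel) * ennreal (cmod (box_density c z)) \<partial>lborel)"
    by (intro nn_integral_cong nn_integral_multc) measurable
  also have "\<dots> \<le> (\<integral>\<^sup>+z. K * ennreal (cmod (box_density c z)) \<partial>lborel)"
  proof (rule nn_integral_mono)
    fix z
    show "(\<integral>\<^sup>+x. ennreal (cmod (u x z)) \<partial>lborel) * ennreal (cmod (box_density c z)) \<le> K * ennreal (cmod (box_density c z))"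
    proof (cases "\<bar>z\<bar> \<le> c")
      case True
      then show ?thesis using u by (intro mult_right_mono) auto
    next
      case False
      then have "box_density c z = 0" using c by (auto simp: box_density_eq indicator_def)
      then show ?thesis by simp
    qed
  qed
  also have "\<dots> = K" using nn_integral_box_density[OF c] by (simp add: nn_integral_cmult)
  finally show ?thesis .
qed

text \<open>A quantitative L1 continuity of translations, as it holds for integrable functions of
  bounded variation. Averaging preserves it with the same constant, which makes it the invariant of
  repeated convolution.\<close>

definition L1_lipschitz :: "real \<Rightarrow> (real \<Rightarrow> complex) \<Rightarrow> bool" where
  "L1_lipschitz C f \<longleftrightarrow> f \<in> borel_measurable borel \<and> integrable lborel f \<and>
     (\<forall>y. (\<integral>\<^sup>+x. ennreal (cmod (f (x - y) - f x)) \<partial>lborel) \<le> ennreal (C * \<bar>y\<bar>))"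

text \<open>The indicator and its translate differ only within |y| of the two endpoints, by the
  height 1/(2c): two intervals of length 2|y| give 4|y|/(2c).\<close>

lemma L1_lipschitz_box_density:
  assumes c: "c > 0"
  shows "L1_lipschitz (2 / c) (box_density c)"
  unfolding L1_lipschitz_def
proof (intro conjI allI)
  fix y :: real
  let ?A = "{c - \<bar>y\<bar>..c + \<bar>y\<bar>}" and ?B = "{- c - \<bar>y\<bar>..- c + \<bar>y\<bar>}"
  have "ennreal (cmod (box_density c (x - y) - box_density c x)) \<le> ennreal (1 / (2 * c)) * (indicator ?A x + indicator ?B x)" for x
  proof -
    have "cmod (box_density c (x - y) - box_density c x) = \<bar>indicator {- c..c} (x - y) - indicator {- c..c} x\<bar> / (2 * c)"
      using c unfolding box_density_eq[OF c] of_real_diff[symmetric] norm_of_real diff_divide_distrib[symmetric]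
      by (simp add: abs_divide)
    also have "\<dots> \<le> (indicator ?A x + indicator ?B x) / (2 * c)"
      using c by (intro divide_right_mono) (auto simp: indicator_def)
    finally have "ennreal (cmod (box_density c (x - y) - box_density c x)) \<le> ennreal ((1 / (2 * c)) * (indicator ?A x + indicator ?B x))"
      by (intro ennreal_leI) simp
    also have "\<dots> = ennreal (1 / (2 * c)) * (indicator ?A x + indicator ?B x)"
      using c by (subst ennreal_mult) (auto simp: ennreal_indicator)
    finally show ?thesis .
  qed
  then have "(\<integral>\<^sup>+x. ennreal (cmod (box_density c (x - y) - box_density c x)) \<partial>lborel) \<le>
      (\<integral>\<^sup>+x. ennreal (1 / (2 * c)) * (indicator ?A x + indicator ?B x) \<partial>lborel)"
    by (intro nn_integral_mono)
  also have "\<dots> = ennreal (1 / (2 * c)) * (ennreal (2 * \<bar>y\<bar>) + ennreal (2 * \<bar>y\<bar>))"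
    by (simp add: nn_integral_cmult nn_integral_add)
  also have "\<dots> = ennreal (2 / c * \<bar>y\<bar>)"
    using c by (simp flip: ennreal_mult ennreal_plus)
  finally show "(\<integral>\<^sup>+x. ennreal (cmod (box_density c (x - y) - box_density c x)) \<partial>lborel) \<le> ennreal (2 / c * \<bar>y\<bar>)" .
qed (use integrable_box_density[OF c] in auto)

text \<open>Convolving with \<open>box_density c\<close> averages the translates of \<open>f\<close>
  by |z| \<le> c. Averages inherit the constant \<open>C\<close>, and each translate is within C|z|
  \<le> C c of \<open>f\<close>.\<close>

lemma
  assumes f: "L1_lipschitz C f" and c: "c > 0" and C: "C \<ge> 0"
  shows L1_lipschitz_convolve: "L1_lipschitz C (convolve f (box_density c))"
    and convolve_box_density_close:
      "(\<integral>\<^sup>+x. ennreal (cmod (convolve f (box_density c) x - f x)) \<partial>lborel) \<le> ennreal (C * c)"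
proof -
  have [measurable]: "f \<in> borel_measurable borel" and f1: "integrable lborel f"
    and lip: "\<And>y. (\<integral>\<^sup>+x. ennreal (cmod (f (x - y) - f x)) \<partial>lborel) \<le> ennreal (C * \<bar>y\<bar>)"
    using f unfolding L1_lipschitz_def by auto
  have conv: "convolve f (box_density c) x = (\<integral>z. f (x - z) * box_density c z \<partial>lborel)" for x
  proof -
    have "convolve f (box_density c) x = (\<integral>y. f y * box_density c (x - y) \<partial>lborel)"
      unfolding convolve_def by (rule integral_completion) simp
    also have "\<dots> = (\<integral>z. f (x - z) * box_density c z \<partial>lborel)"
      by (subst lborel_reflect(1)[of _ x]) simp_all
    finally show ?thesis .
  qed
  have int: "integrable lborel (\<lambda>z. f (x - z) * box_density c z)" for x
  proof (rule Bochner_Integration.integrable_bound)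
    show "integrable lborel (\<lambda>z. (1 / (2 * c)) *\<^sub>R f (x - z))"
      using f1 lborel_reflect(2)[of f x] by auto
    show "AE z in lborel. norm (f (x - z) * box_density c z) \<le> norm ((1 / (2 * c)) *\<^sub>R f (x - z))"
      using c by (intro AE_I2) (auto simp: cmod_box_density norm_mult indicator_def)
  qed simp
  have m[measurable]: "convolve f (box_density c) \<in> borel_measurable borel"
    unfolding conv[abs_def] by measurable
  have "(\<integral>\<^sup>+x. ennreal (cmod (convolve f (box_density c) x)) \<partial>lborel) \<le> (\<integral>\<^sup>+x. ennreal (cmod (f x)) \<partial>lborel)"
    unfolding conv
  proof (rule nn_integral_average_le[OF _ c])
    fix z
    show "(\<integral>\<^sup>+x. ennreal (cmod (f (x - z))) \<partial>lborel) \<le> (\<integral>\<^sup>+x. ennreal (cmod (f x)) \<partial>lborel)"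
      using lborel_shift(3)[of "\<lambda>x. ennreal (cmod (f x))" "- z"] by simp
  qed measurable
  also have "\<dots> < \<infinity>" using f1 by (simp add: integrable_iff_bounded)
  finally have i: "integrable lborel (convolve f (box_density c))" by (intro integrableI_bounded) auto
  have "(\<integral>\<^sup>+x. ennreal (cmod (convolve f (box_density c) (x - y) - convolve f (box_density c) x)) \<partial>lborel) \<le> ennreal (C * \<bar>y\<bar>)" for y
  proof -
    have "convolve f (box_density c) (x - y) - convolve f (box_density c) x =
        (\<integral>z. (f (x - y - z) - f (x - z)) * box_density c z \<partial>lborel)" for x
      unfolding conv left_diff_distrib by (rule Bochner_Integration.integral_diff[symmetric, OF int int])
    then have "(\<integral>\<^sup>+x. ennreal (cmod (convolve f (box_density c) (x - y) - convolve f (box_density c) x)) \<partial>lborel) =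
       (\<integral>\<^sup>+x. ennreal (cmod (\<integral>z. (f (x - y - z) - f (x - z)) * box_density c z \<partial>lborel)) \<partial>lborel)" by simp
    also have "\<dots> \<le> ennreal (C * \<bar>y\<bar>)"
    proof (rule nn_integral_average_le[OF _ c])
      fix z
      have "(\<integral>\<^sup>+x. ennreal (cmod (f (x - y - z) - f (x - z))) \<partial>lborel) = (\<integral>\<^sup>+x. ennreal (cmod (f (x - y) - f x)) \<partial>lborel)"
        by (subst lborel_shift(3)[of _ z]) (simp_all add: algebra_simps)
      then show "(\<integral>\<^sup>+x. ennreal (cmod (f (x - y - z) - f (x - z))) \<partial>lborel) \<le> ennreal (C * \<bar>y\<bar>)"
        using lip by simp
    qed measurable
    finally show ?thesis .
  qed
  then show "L1_lipschitz C (convolve f (box_density c))"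
    unfolding L1_lipschitz_def using i m by blast
  have "convolve f (box_density c) x - f x = (\<integral>z. (f (x - z) - f x) * box_density c z \<partial>lborel)" for x
  proof -
    have i: "integrable lborel (\<lambda>z. f x * box_density c z)" using integrable_box_density[OF c] by simp
    have "(\<integral>z. (f (x - z) - f x) * box_density c z \<partial>lborel) =
       convolve f (box_density c) x - (\<integral>z. f x * box_density c z \<partial>lborel)"
      unfolding conv left_diff_distrib by (rule Bochner_Integration.integral_diff[OF int i])
    then show ?thesis by (simp add: integral_box_density[OF c])
  qed
  then have "(\<integral>\<^sup>+x. ennreal (cmod (convolve f (box_density c) x - f x)) \<partial>lborel) =
     (\<integral>\<^sup>+x. ennreal (cmod (\<integral>z. (f (x - z) - f x) * box_density c z \<partial>lborel)) \<partial>lborel)" by simp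
  also have "\<dots> \<le> ennreal (C * c)"
  proof (rule nn_integral_average_le[OF _ c])
    fix z assume "\<bar>z\<bar> \<le> c"
    then have "C * \<bar>z\<bar> \<le> C * c" using C by (rule mult_left_mono)
    then show "(\<integral>\<^sup>+x. ennreal (cmod (f (x - z) - f x)) \<partial>lborel) \<le> ennreal (C * c)"
      using lip[of z] by (meson ennreal_leI order_trans)
  qed measurable
  finally show "(\<integral>\<^sup>+x. ennreal (cmod (convolve f (box_density c) x - f x)) \<partial>lborel) \<le> ennreal (C * c)" .
qed

text \<open>The \<open>L\<^sup>1\<close> Lipschitz constant of the widest factor is inherited by all partial convolutions; a
  further factor of half-width \<open>c\<close> therefore moves them by at most a constant times \<open>c\<close>.\<close>

lemma infinite_convolution_close:
  assumes c0: "c0 > 0" and q: "0 < q" "q < 1"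
    and k: "\<And>s. k s = box_density (q ^ s * c0)"
  shows "integrable lebesgue (infinite_convolution k)"
    and "(\<integral>\<^sup>+x. ennreal (cmod (infinite_convolution k x - box_density c0 x)) \<partial>lebesgue) \<le> ennreal (2 * q / (1 - q))"
proof -
  define P where "P = partial_convolution k"
  have cs: "q ^ s * c0 > 0" for s using c0 q by simp
  have C: "2 / c0 \<ge> 0" using c0 by simp
  have lip: "L1_lipschitz (2 / c0) (P N)" for N
  proof (induction N)
    case 0
    show ?case using L1_lipschitz_box_density[OF c0] by (simp add: P_def k)
  next
    case (Suc N)
    show ?case using L1_lipschitz_convolve[OF Suc cs[of "Suc N"] C] by (simp add: P_def k)
  qed
  then have [measurable]: "P N \<in> borel_measurable borel" and P1: "integrable lborel (P N)" for N
    unfolding L1_lipschitz_def by auto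
  \<comment> \<open>The constant \<open>2 / c0\<close> times the half-width
    \<open>q ^ Suc N * c0\<close> of the next factor.\<close>
  have step: "(\<integral>\<^sup>+x. ennreal (cmod (P (Suc N) x - P N x)) \<partial>lborel) \<le> ennreal (2 * q ^ Suc N)" for N
  proof -
    have "P (Suc N) = convolve (P N) (box_density (q ^ Suc N * c0))" by (simp add: P_def k)
    then show ?thesis using convolve_box_density_close[OF lip cs[of "Suc N"] C, of N] c0 by simp
  qed
  \<comment> \<open>Tails of the series of increments. In L1 the increments are dominated by a
    geometric series, so the series converges absolutely almost everywhere and its pointwise limit
    \<open>F\<close> is also the L1 limit.\<close>
  define T where "T N x = (\<Sum>i. ennreal (cmod (P (Suc (i + N)) x - P (i + N) x)))" for N x
  have [measurable]: "T N \<in> borel_measurable borel" for N unfolding T_def by measurable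
  have T: "(\<integral>\<^sup>+x. T N x \<partial>lborel) \<le> ennreal (2 * q ^ Suc N / (1 - q))" for N
  proof -
    have sums: "(\<lambda>i. 2 * q ^ Suc (i + N)) sums (2 * q ^ Suc N / (1 - q))"
      using sums_mult[OF geometric_sums[of q], of "2 * q ^ Suc N"] q by (simp add: power_add mult_ac)
    have "(\<integral>\<^sup>+x. T N x \<partial>lborel) = (\<Sum>i. \<integral>\<^sup>+x. ennreal (cmod (P (Suc (i + N)) x - P (i + N) x)) \<partial>lborel)"
      unfolding T_def by (rule nn_integral_suminf) measurable
    also have "\<dots> \<le> (\<Sum>i. ennreal (2 * q ^ Suc (i + N)))"
      by (intro suminf_le step summableI)
    also have "\<dots> = ennreal (2 * q ^ Suc N / (1 - q))"
      using sums q by (subst suminf_ennreal2) (auto simp: sums_iff)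
    finally show ?thesis .
  qed
  define F where "F x = P 0 x + (\<Sum>i. P (Suc i) x - P i x)" for x
  have [measurable]: "F \<in> borel_measurable borel" unfolding F_def by measurable
  have "(\<integral>\<^sup>+x. T 0 x \<partial>lborel) \<noteq> \<infinity>" using T[of 0] by (auto simp: top_unique)
  then have AE_fin: "AE x in lborel. T 0 x \<noteq> \<infinity>" by (rule nn_integral_PInf_AE[rotated]) simp
  have close: "(\<integral>\<^sup>+x. ennreal (cmod (P N x - F x)) \<partial>lborel) \<le> ennreal (2 * q ^ Suc N / (1 - q))" for N
  proof -
    have "AE x in lborel. ennreal (cmod (P N x - F x)) \<le> T N x"
      using AE_fin
    proof eventually_elim
      case (elim x)
      define D where "D i = P (Suc i) x - P i x" for i
      have "summable (\<lambda>i. cmod (D i))"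
        by (rule summable_suminf_not_top) (use elim in \<open>auto simp: T_def D_def\<close>)
      then have sD: "summable D" and sn: "summable (\<lambda>i. cmod (D (i + N)))"
        using summable_norm_cancel summable_ignore_initial_segment by blast+
      have "P N x = P 0 x + (\<Sum>i<N. D i)" by (induction N) (auto simp: D_def)
      then have "F x - P N x = (\<Sum>i. D (i + N))"
        using suminf_split_initial_segment[OF sD, of N] by (simp add: F_def D_def[symmetric])
      then have "cmod (P N x - F x) \<le> (\<Sum>i. cmod (D (i + N)))"
        using summable_norm[OF sn] by (simp add: norm_minus_commute)
      then have "ennreal (cmod (P N x - F x)) \<le> ennreal (\<Sum>i. cmod (D (i + N)))" by (rule ennreal_leI)
      also have "\<dots> = T N x" unfolding T_def using sn by (subst suminf_ennreal2[symmetric]) (auto simp: D_def)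
      finally show ?case .
    qed
    then have "(\<integral>\<^sup>+x. ennreal (cmod (P N x - F x)) \<partial>lborel) \<le> (\<integral>\<^sup>+x. T N x \<partial>lborel)"
      by (rule nn_integral_mono_AE)
    with T[of N] show ?thesis by simp
  qed
  have F1: "integrable lborel F"
  proof -
    have "integrable lborel (\<lambda>x. P 0 x - F x)"
      using close[of 0] by (intro integrableI_bounded) (auto simp: less_top[symmetric] top_unique)
    from Bochner_Integration.integrable_diff[OF P1[of 0] this] show ?thesis by simp
  qed
  have tail0: "(\<lambda>N. ennreal (2 * q ^ Suc N / (1 - q))) \<longlonglongrightarrow> 0"
  proof -
    have "(\<lambda>N. 2 * q * q ^ N / (1 - q)) \<longlonglongrightarrow> 2 * q * 0 / (1 - q)"
      using q by (intro tendsto_intros LIMSEQ_power_zero) auto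
    then show ?thesis by (simp add: mult.assoc flip: ennreal_0 power_Suc)
  qed
  let ?Q = "\<lambda>f. integrable lebesgue f \<and> (\<lambda>N. \<integral>\<^sup>+x. norm (partial_convolution k N x - f x) \<partial>lebesgue) \<longlonglongrightarrow> 0"
  have "?Q F"
  proof
    show "integrable lebesgue F" using F1 by (simp add: integrable_completion)
    show "(\<lambda>N. \<integral>\<^sup>+x. norm (partial_convolution k N x - F x) \<partial>lebesgue) \<longlonglongrightarrow> 0"
      unfolding nn_integral_completion P_def[symmetric]
      by (rule tendsto_sandwich[OF _ _ tendsto_const tail0]) (use close in auto)
  qed
  \<comment> \<open>The explicit limit \<open>F\<close> shows that the choice is not void. The
    chosen function is known through this property alone, so its distance to the first factor is
    recovered by a triangle inequality through \<open>P N\<close> and \<open>F\<close>.\<close>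
  from someI[of ?Q, OF this] have Q: "?Q (infinite_convolution k)"
    unfolding infinite_convolution_def .
  let ?I = "infinite_convolution k"
  show Im: "integrable lebesgue ?I" using Q by blast
  have [measurable]: "?I \<in> borel_measurable lebesgue" "P N \<in> borel_measurable lebesgue"
    "F \<in> borel_measurable lebesgue" "box_density c0 \<in> borel_measurable lebesgue" for N
    using Im by (auto intro: measurable_completion)
  have le: "(\<integral>\<^sup>+x. ennreal (cmod (?I x - P 0 x)) \<partial>lebesgue) \<le>
     (\<integral>\<^sup>+x. ennreal (cmod (P N x - ?I x)) \<partial>lebesgue) + (ennreal (2 * q ^ Suc N / (1 - q)) + ennreal (2 * q ^ Suc 0 / (1 - q)))" for N
  proof -
    have "(\<integral>\<^sup>+x. ennreal (cmod (?I x - P 0 x)) \<partial>lebesgue) \<le>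
      (\<integral>\<^sup>+x. ennreal (cmod (P N x - ?I x)) + (ennreal (cmod (P N x - F x)) + ennreal (cmod (P 0 x - F x))) \<partial>lebesgue)"
    proof (rule nn_integral_mono)
      fix x
      have "?I x - P 0 x = - (P N x - ?I x) + (P N x - F x) + - (P 0 x - F x)" by simp
      then have "cmod (?I x - P 0 x) \<le> cmod (P N x - ?I x) + (cmod (P N x - F x) + cmod (P 0 x - F x))"
        using norm_triangle_ineq[of "- (P N x - ?I x) + (P N x - F x)" "- (P 0 x - F x)"]
          norm_triangle_ineq[of "- (P N x - ?I x)" "P N x - F x"] by (simp only: norm_minus_cancel)
      then show "ennreal (cmod (?I x - P 0 x)) \<le> ennreal (cmod (P N x - ?I x)) + (ennreal (cmod (P N x - F x)) + ennreal (cmod (P 0 x - F x)))"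
        by (simp add: ennreal_leI flip: ennreal_plus)
    qed
    also have "\<dots> = (\<integral>\<^sup>+x. ennreal (cmod (P N x - ?I x)) \<partial>lebesgue) +
        ((\<integral>\<^sup>+x. ennreal (cmod (P N x - F x)) \<partial>lebesgue) + (\<integral>\<^sup>+x. ennreal (cmod (P 0 x - F x)) \<partial>lebesgue))"
      by (simp add: nn_integral_add)
    also have "\<dots> \<le> (\<integral>\<^sup>+x. ennreal (cmod (P N x - ?I x)) \<partial>lebesgue) + (ennreal (2 * q ^ Suc N / (1 - q)) + ennreal (2 * q ^ Suc 0 / (1 - q)))"
      unfolding nn_integral_completion by (intro add_mono order_refl close)
    finally show ?thesis .
  qed
  have "(\<lambda>N. (\<integral>\<^sup>+x. ennreal (cmod (P N x - ?I x)) \<partial>lebesgue) + (ennreal (2 * q ^ Suc N / (1 - q)) + ennreal (2 * q ^ Suc 0 / (1 - q)))) \<longlonglongrightarrow>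
     0 + (0 + ennreal (2 * q ^ Suc 0 / (1 - q)))"
    using Q tail0 by (intro tendsto_add tendsto_const) (auto simp: P_def)
  then have "(\<integral>\<^sup>+x. ennreal (cmod (?I x - P 0 x)) \<partial>lebesgue) \<le> 0 + (0 + ennreal (2 * q ^ Suc 0 / (1 - q)))"
    by (rule LIMSEQ_le_const) (use le in auto)
  then show "(\<integral>\<^sup>+x. ennreal (cmod (?I x - box_density c0 x)) \<partial>lebesgue) \<le> ennreal (2 * q / (1 - q))"
    by (simp add: P_def k)
qed

text \<open>The narrow density is at least the wide one on [-c, c] and lies below it on the rest of
  [-w, w]; both have mass 1, so each part contributes 1 - c/w.\<close>

lemma box_density_dist:
  assumes "0 < c" "c \<le> w"
  shows "(\<integral>\<^sup>+x. ennreal (cmod (box_density c x - box_density w x)) \<partial>lborel) \<le> ennreal (2 * (1 - c / w))"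
proof -
  have w: "w > 0" using assms by linarith
  let ?a = "1 / (2 * c) - 1 / (2 * w)" and ?b = "1 / (2 * w)"
  have a: "?a \<ge> 0" using assms w by (simp add: field_simps)
  have "(\<integral>\<^sup>+x. ennreal (cmod (box_density c x - box_density w x)) \<partial>lborel) \<le>
     (\<integral>\<^sup>+x. ennreal ?a * indicator {- c..c} x + ennreal ?b * indicator ({- w..- c} \<union> {c..w}) x \<partial>lborel)"
  proof (rule nn_integral_mono)
    fix x
    have eq: "box_density c x - box_density w x = of_real (indicator {- c..c} x / (2 * c) - indicator {- w..w} x / (2 * w))"
      using assms w by (simp add: box_density_eq)
    have "cmod (box_density c x - box_density w x) \<le> ?a * indicator {- c..c} x + ?b * indicator ({- w..- c} \<union> {c..w}) x"
      unfolding eq norm_of_real using assms w a by (auto simp: indicator_def)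
    then have "ennreal (cmod (box_density c x - box_density w x)) \<le> ennreal (?a * indicator {- c..c} x + ?b * indicator ({- w..- c} \<union> {c..w}) x)"
      by (rule ennreal_leI)
    also have "\<dots> = ennreal ?a * indicator {- c..c} x + ennreal ?b * indicator ({- w..- c} \<union> {c..w}) x"
      using a w by (subst ennreal_plus) (auto simp: ennreal_mult ennreal_indicator indicator_def)
    finally show "ennreal (cmod (box_density c x - box_density w x)) \<le> ennreal ?a * indicator {- c..c} x + ennreal ?b * indicator ({- w..- c} \<union> {c..w}) x" .
  qed
  also have "\<dots> = ennreal ?a * ennreal (2 * c) + ennreal ?b * emeasure lborel ({- w..- c} \<union> {c..w})"
    using assms by (subst nn_integral_add) (auto simp: nn_integral_cmult_indicator)
  also have "emeasure lborel ({- w..- c} \<union> {c..w}) \<le> ennreal (w - c) + ennreal (w - c)"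
    using assms emeasure_subadditive[of "{- w..- c}" lborel "{c..w}"] by simp
  also have "ennreal ?a * ennreal (2 * c) + ennreal ?b * (ennreal (w - c) + ennreal (w - c)) = ennreal (2 * (1 - c / w))"
  proof -
    have "ennreal ?a * ennreal (2 * c) + ennreal ?b * (ennreal (w - c) + ennreal (w - c)) =
      ennreal (?a * (2 * c) + ?b * ((w - c) + (w - c)))"
      using a assms w by (simp flip: ennreal_mult ennreal_plus)
    also have "?a * (2 * c) + ?b * ((w - c) + (w - c)) = 2 * (1 - c / w)"
      using assms w by (simp add: field_simps)
    finally show ?thesis .
  qed
  finally show ?thesis by (simp add: mult_left_mono add_mono)
qed

text \<open>Two errors add up, with \<open>q = \<epsilon> ^ n\<close>: the further convolution
  factors, whose widths have ratio q, cost 2q/(1-q), and replacing the shrunk window of half-width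
  (1-q)w by the full one costs 2q. The degenerate window at n = 0 is excluded.\<close>

lemma psi_close:
  assumes w: "w > 0" and e: "0 < \<epsilon>" "\<epsilon> < 1" and n: "n \<ge> 1"
  shows "cmod (fourier (psi \<epsilon> {- w..w} n) t - fourier (box_density w) t) \<le> 2 * \<epsilon> ^ n / (1 - \<epsilon> ^ n) + 2 * \<epsilon> ^ n"
proof -
  define q where "q = \<epsilon> ^ n"
  have q: "0 < q" "q < 1" using e n by (auto simp: q_def power_less_one_iff)
  define c0 where "c0 = (1 - q) * w"
  have c0: "c0 > 0" "c0 \<le> w" using q w by (auto simp: c0_def mult_le_cancel_right1)
  define k where "k s = normalized_indicator ((\<lambda>x. \<epsilon> ^ (n * s) * ((1 - \<epsilon> ^ n) * x)) ` {- w..w})" for s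
  have k: "k s = box_density (q ^ s * c0)" for s
  proof -
    have "(\<lambda>x. \<epsilon> ^ (n * s) * ((1 - \<epsilon> ^ n) * x)) ` {- w..w} = (\<lambda>x. (q ^ s * (1 - q)) * x) ` {- w..w}"
      by (simp add: q_def power_mult mult.assoc)
    also have "\<dots> = {- (q ^ s * c0)..q ^ s * c0}"
      using q w by (subst image_mult_atLeastAtMost) (auto simp: c0_def mult.assoc)
    finally show ?thesis by (simp add: k_def)
  qed
  let ?I = "infinite_convolution k"
  have psi: "psi \<epsilon> {- w..w} n = ?I" by (simp add: psi_def k_def[abs_def])
  note I = infinite_convolution_close[OF c0(1) q k]
  have [measurable]: "?I \<in> borel_measurable lebesgue" "box_density w \<in> borel_measurable lebesgue" "box_density c0 \<in> borel_measurable lebesgue"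
    using I(1) by (auto intro: measurable_completion)
  have Bw: "integrable lebesgue (box_density w)"
    using integrable_box_density[OF w] by (simp add: integrable_completion)
  have mc: "(\<lambda>x. cis (- 2 * pi * (x \<bullet> t))) \<in> borel_measurable lebesgue"
    by (rule measurable_completion) simp
  have ic: "integrable lebesgue (\<lambda>x. h x * cis (- 2 * pi * (x \<bullet> t)))" if "integrable lebesgue h" for h :: "real \<Rightarrow> complex"
  proof (rule Bochner_Integration.integrable_bound[OF that])
    show "(\<lambda>x. h x * cis (- 2 * pi * (x \<bullet> t))) \<in> borel_measurable lebesgue"
      by (rule borel_measurable_times[OF borel_measurable_integrable[OF that] mc])
  qed (simp add: norm_mult)
  have "fourier ?I t - fourier (box_density w) t = (\<integral>x. (?I x - box_density w x) * cis (- 2 * pi * (x \<bullet> t)) \<partial>lebesgue)"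
    unfolding fourier_def left_diff_distrib by (rule Bochner_Integration.integral_diff[symmetric, OF ic[OF I(1)] ic[OF Bw]])
  then have "ennreal (cmod (fourier ?I t - fourier (box_density w) t)) \<le> (\<integral>\<^sup>+x. norm ((?I x - box_density w x) * cis (- 2 * pi * (x \<bullet> t))) \<partial>lebesgue)"
    using integral_norm_bound_ennreal[OF ic[of "\<lambda>x. ?I x - box_density w x"]] I(1) Bw by simp
  also have "\<dots> \<le> (\<integral>\<^sup>+x. ennreal (cmod (?I x - box_density c0 x)) + ennreal (cmod (box_density c0 x - box_density w x)) \<partial>lebesgue)"
  proof (rule nn_integral_mono)
    fix x
    have "cmod (?I x - box_density w x) \<le> cmod (?I x - box_density c0 x) + cmod (box_density c0 x - box_density w x)"
      by (rule norm_diff_triangle_ineq[of "?I x" "box_density c0 x" "box_density c0 x" "box_density w x", simplified add_diff_cancel_left', THEN order_trans[rotated]]) simp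
    then show "ennreal (norm ((?I x - box_density w x) * cis (- 2 * pi * (x \<bullet> t)))) \<le> ennreal (cmod (?I x - box_density c0 x)) + ennreal (cmod (box_density c0 x - box_density w x))"
      by (simp add: norm_mult ennreal_leI flip: ennreal_plus)
  qed
  also have "\<dots> = (\<integral>\<^sup>+x. ennreal (cmod (?I x - box_density c0 x)) \<partial>lebesgue) + (\<integral>\<^sup>+x. ennreal (cmod (box_density c0 x - box_density w x)) \<partial>lebesgue)"
    by (rule nn_integral_add) measurable
  also have "\<dots> \<le> ennreal (2 * q / (1 - q)) + ennreal (2 * q)"
  proof (rule add_mono[OF I(2)])
    have "1 - c0 / w = q" using w by (simp add: c0_def)
    then show "(\<integral>\<^sup>+x. ennreal (cmod (box_density c0 x - box_density w x)) \<partial>lebesgue) \<le> ennreal (2 * q)"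
      using box_density_dist[OF c0] by (simp add: nn_integral_completion)
  qed
  also have "\<dots> = ennreal (2 * q / (1 - q) + 2 * q)" using q by simp
  finally show ?thesis using q unfolding psi by (subst (asm) ennreal_le_iff) (auto simp: q_def)
qed

lemma Psi_eq:
  assumes w: "w > 0" and e: "0 < \<epsilon>" "\<epsilon> < 1"
  shows "Psi \<epsilon> {- w..w} = fourier (box_density w)"
proof -
  have lim: "uniform_limit UNIV (\<lambda>n. fourier (psi \<epsilon> {- w..w} n)) (fourier (box_density w)) sequentially"
  proof (rule uniform_limitI)
    fix r :: real assume r: "r > 0"
    have "(\<lambda>n. 2 * \<epsilon> ^ n / (1 - \<epsilon> ^ n) + 2 * \<epsilon> ^ n) \<longlonglongrightarrow> 2 * 0 / (1 - 0) + 2 * 0"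
      using e by (intro tendsto_intros LIMSEQ_power_zero) auto
    then have "\<forall>\<^sub>F n in sequentially. 2 * \<epsilon> ^ n / (1 - \<epsilon> ^ n) + 2 * \<epsilon> ^ n < r"
      using r by (intro order_tendstoD) auto
    then show "\<forall>\<^sub>F n in sequentially. \<forall>t\<in>UNIV. dist (fourier (psi \<epsilon> {- w..w} n) t) (fourier (box_density w) t) < r"
      using eventually_ge_at_top[of 1]
      by eventually_elim (use psi_close[OF w e] in \<open>auto simp: dist_norm intro: le_less_trans\<close>)
  qed
  show ?thesis unfolding Psi_def
  proof (rule the_equality)
    show "uniform_limit UNIV (\<lambda>n. fourier (psi \<epsilon> {- w..w} n)) (fourier (box_density w)) sequentially" by (rule lim)
    fix P assume P: "uniform_limit UNIV (\<lambda>n. fourier (psi \<epsilon> {- w..w} n)) P sequentially"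
    show "P = fourier (box_density w)"
    proof (rule ext)
    fix t
    have "(\<lambda>n. fourier (psi \<epsilon> {- w..w} n) t) \<longlonglongrightarrow> P t"
      using P by (rule tendsto_uniform_limitI) simp
    moreover have "(\<lambda>n. fourier (psi \<epsilon> {- w..w} n) t) \<longlonglongrightarrow> fourier (box_density w) t"
      using lim by (rule tendsto_uniform_limitI) simp
    ultimately show "P t = fourier (box_density w) t" by (rule LIMSEQ_unique)
    qed
  qed
qed

text \<open>The square of the normalized indicator is the normalized indicator divided by
  |\<Omega>|, which cancels the factor |\<Omega>| of \<open>Phi\<close>: by Parseval, the
  self-convolution of its transform is the transform of this square.\<close>

lemma Phi_eq:
  assumes w: "w > 0" and e: "0 < \<epsilon>" "\<epsilon> < 1"
  shows "Phi \<epsilon> {- w..w} t = fourier (box_density w) t"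
proof -
  let ?\<chi> = "box_density w" and ?\<chi>t = "\<lambda>x. box_density w x * cis (2 * pi * (x \<bullet> t))"
  have b: "cmod (?\<chi> x) \<le> 1 / (2 * w)" for x using w by (auto simp: cmod_box_density indicator_def)
  have \<chi>1: "integrable lborel ?\<chi>" by (rule integrable_box_density[OF w])
  have \<chi>2: "integrable lborel (\<lambda>x. (cmod (?\<chi> x))\<^sup>2)"
  proof (rule Bochner_Integration.integrable_bound)
    show "integrable lborel (\<lambda>x. (1 / (2 * w)) *\<^sub>R ?\<chi> x)" using \<chi>1 by simp
    show "AE x in lborel. norm ((cmod (?\<chi> x))\<^sup>2) \<le> norm ((1 / (2 * w)) *\<^sub>R ?\<chi> x)"
    proof (rule AE_I2)
      fix x
      show "norm ((cmod (?\<chi> x))\<^sup>2) \<le> norm ((1 / (2 * w)) *\<^sub>R ?\<chi> x)"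
        using mult_right_mono[OF b[of x] norm_ge_zero[of "?\<chi> x"]] w by (simp add: power2_eq_square)
    qed
  qed simp
  have \<chi>t: "integrable lborel ?\<chi>t" "integrable lborel (\<lambda>x. (cmod (?\<chi>t x))\<^sup>2)"
    using \<chi>2 by (auto intro!: integrable_mult_cis \<chi>1 simp: norm_mult)
  \<comment> \<open>The density is real, so the reflected and shifted transform is the conjugate of
    the transform of the modulated density; this gives the convolution the form that Parseval
    needs.\<close>
  have cnjF: "fourier ?\<chi> (t - y) = cnj (fourier ?\<chi>t y)" for y
  proof -
    have "cnj (fourier ?\<chi>t y) = cnj (fourier ?\<chi> (y - t))" by (subst fourier_mult_cis) simp_all
    also have "\<dots> = (\<integral>x. cnj (?\<chi> x * cis (- 2 * pi * (x \<bullet> (y - t)))) \<partial>lborel)"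
      by (subst fourier_eq_lborel) (simp_all del: complex_cnj_mult)
    also have "\<dots> = fourier ?\<chi> (t - y)"
      by (subst fourier_eq_lborel) (auto simp: box_density_eq[OF w] cis_cnj algebra_simps intro!: Bochner_Integration.integral_cong)
    finally show ?thesis ..
  qed
  have "Phi \<epsilon> {- w..w} t = of_real (2 * w) * convolve (fourier ?\<chi>) (fourier ?\<chi>) t"
    using w by (simp add: Phi_def Psi_eq[OF w e])
  also have "convolve (fourier ?\<chi>) (fourier ?\<chi>) t = (\<integral>y. fourier ?\<chi> y * cnj (fourier ?\<chi>t y) \<partial>lborel)"
    unfolding convolve_def cnjF by (rule integral_completion) simp
  also have "\<dots> = (\<integral>x. ?\<chi> x * cnj (?\<chi>t x) \<partial>lborel)"
    by (rule parseval[OF \<chi>1 \<chi>2 \<chi>t])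
  also have "\<dots> = (\<integral>x. of_real (1 / (2 * w)) * (?\<chi> x * cis (- 2 * pi * (x \<bullet> t))) \<partial>lborel)"
    using w by (intro Bochner_Integration.integral_cong) (auto simp: box_density_eq cis_cnj indicator_def)
  also have "\<dots> = of_real (1 / (2 * w)) * fourier ?\<chi> t"
    by (subst fourier_eq_lborel) simp_all
  finally show ?thesis using w by simp
qed

section \<open>Energies: sums of squared Gabor coefficients over the frequencies\<close>

text \<open>Unconditional summability of complex numbers is absolute summability, that is
  integrability for counting measure, and both sides are 0 when it fails. Sums over \<Delta> become
  integrals to which Fubini applies.\<close>

lemma infsum_eq_integral_count_space:
  fixes f :: "'i \<Rightarrow> complex"
  shows "infsum f A = (\<integral>i. f i \<partial>count_space A)"
proof (cases "f summable_on A")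
  case True
  then have "(\<lambda>i. norm (f i)) summable_on A" by (simp add: summable_on_iff_abs_summable_on_complex)
  then have "Infinite_Set_Sum.abs_summable_on f A" by (simp add: abs_summable_equivalent)
  then show ?thesis using infsetsum_infsum[of f A] by (simp add: infsetsum_def)
next
  case False
  then have "\<not> Infinite_Set_Sum.abs_summable_on f A"
    using abs_summable_equivalent[of f A] by (simp add: summable_on_iff_abs_summable_on_complex)
  then have "\<not> integrable (count_space A) f" by (simp add: Infinite_Set_Sum.abs_summable_on_def)
  then show ?thesis using False by (simp add: infsum_not_exists not_integrable_integral_eq)
qed

lemma
  fixes F :: "'i \<Rightarrow> 'a::euclidean_space \<Rightarrow> complex"
  assumes I: "countable I" and [measurable]: "\<And>i. i \<in> I \<Longrightarrow> F i \<in> borel_measurable borel"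
    and fin: "(\<integral>\<^sup>+i. \<integral>\<^sup>+x. ennreal (cmod (F i x)) \<partial>lborel \<partial>count_space I) < \<infinity>"
  shows integrable_integral_count_space: "integrable lborel (\<lambda>x. \<integral>i. F i x \<partial>count_space I)"
    and AE_integrable_count_space: "AE x in lborel. integrable (count_space I) (\<lambda>i. F i x)"
    and integral_count_space_swap:
      "(\<integral>x. (\<integral>i. F i x \<partial>count_space I) \<partial>lborel) = (\<integral>i. (\<integral>x. F i x \<partial>lborel) \<partial>count_space I)"
proof -
  interpret C: sigma_finite_measure "count_space I" by (rule sigma_finite_measure_count_space_countable[OF I])
  interpret P: pair_sigma_finite "count_space I" "lborel :: 'a measure" ..
  have m: "(\<lambda>(i, x). F i x) \<in> borel_measurable (count_space I \<Otimes>\<^sub>M lborel)"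
    by (rule measurable_pair_measure_countable1[OF I]) simp
  have "(\<integral>\<^sup>+p. ennreal (norm ((\<lambda>(i, x). F i x) p)) \<partial>(count_space I \<Otimes>\<^sub>M lborel)) =
      (\<integral>\<^sup>+i. \<integral>\<^sup>+x. ennreal (norm (F i x)) \<partial>lborel \<partial>count_space I)"
    using lborel.nn_integral_fst[of "\<lambda>p. ennreal (norm (case_prod F p))" "count_space I"] m by simp
  then have int: "integrable (count_space I \<Otimes>\<^sub>M lborel) (\<lambda>(i, x). F i x)"
    using m fin by (intro integrableI_bounded) auto
  have int': "integrable (lborel \<Otimes>\<^sub>M count_space I) (\<lambda>(x, i). F i x)"
    using P.integrable_product_swap[OF int] by (simp add: case_prod_beta')
  interpret P': pair_sigma_finite "lborel :: 'a measure" "count_space I" ..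
  show "integrable lborel (\<lambda>x. \<integral>i. F i x \<partial>count_space I)"
    using P'.integrable_fst[OF int'] by simp
  show "AE x in lborel. integrable (count_space I) (\<lambda>i. F i x)"
    using P'.AE_integrable_fst[OF int'] by simp
  show "(\<integral>x. (\<integral>i. F i x \<partial>count_space I) \<partial>lborel) = (\<integral>i. (\<integral>x. F i x \<partial>lborel) \<partial>count_space I)"
    using P.Fubini_integral[OF int] by simp
qed

text \<open>Expand the square of u + (v - u); Cauchy-Schwarz disposes of the cross term. The measure
  is left open because the lemma serves Lebesgue measure and counting measures on index sets
  alike.\<close>

lemma L2_norm_tendsto:
  fixes u :: "'a \<Rightarrow> complex" and v :: "nat \<Rightarrow> 'a \<Rightarrow> complex"
  assumes [measurable]: "u \<in> borel_measurable M" "\<And>n. v n \<in> borel_measurable M"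
    and u: "integrable M (\<lambda>x. (cmod (u x))\<^sup>2)" and v: "\<And>n. integrable M (\<lambda>x. (cmod (v n x))\<^sup>2)"
    and limD: "(\<lambda>n. \<integral>x. (cmod (v n x - u x))\<^sup>2 \<partial>M) \<longlonglongrightarrow> 0"
  shows "(\<lambda>n. \<integral>x. (cmod (v n x))\<^sup>2 \<partial>M) \<longlonglongrightarrow> (\<integral>x. (cmod (u x))\<^sup>2 \<partial>M)"
proof -
  let ?D = "\<lambda>n. \<integral>x. (cmod (v n x - u x))\<^sup>2 \<partial>M" and ?A = "\<integral>x. (cmod (u x))\<^sup>2 \<partial>M"
  let ?X = "\<lambda>n. \<integral>x. u x * cnj (v n x - u x) \<partial>M"
  have d2: "integrable M (\<lambda>x. (cmod (v n x - u x))\<^sup>2)" for n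
    by (rule square_integrable_diff[OF _ _ v u]) simp_all
  have "(\<integral>x. (cmod (v n x))\<^sup>2 \<partial>M) = ?A + ?D n + 2 * Re (?X n)" for n
    using integral_norm_add_scaled[of u M "\<lambda>x. v n x - u x" 1] u d2 by simp
  moreover have "?X \<longlonglongrightarrow> 0"
  proof -
    have le: "(cmod (?X n))\<^sup>2 \<le> ?A * ?D n" for n
      using cauchy_schwarz_integral[of u M "\<lambda>x. cnj (v n x - u x)"] u d2[of n]
      by (simp del: complex_cnj_diff)
    have lim: "(\<lambda>n. ?A * ?D n) \<longlonglongrightarrow> 0"
      using tendsto_mult[OF tendsto_const limD, of ?A] by simp
    have "(\<lambda>n. (cmod (?X n))\<^sup>2) \<longlonglongrightarrow> 0"
      by (rule tendsto_sandwich[OF _ _ tendsto_const lim]) (use le in auto)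
    then have "(\<lambda>n. sqrt ((cmod (?X n))\<^sup>2)) \<longlonglongrightarrow> sqrt 0" by (intro tendsto_intros)
    then show ?thesis by (simp add: tendsto_norm_zero_iff)
  qed
  ultimately have "(\<lambda>n. \<integral>x. (cmod (v n x))\<^sup>2 \<partial>M) \<longlonglongrightarrow> ?A + 0 + 2 * Re 0"
    using limD by (simp only:) (intro tendsto_intros)
  then show ?thesis by simp
qed

text \<open>The form in which windows are used: Borel measurable representatives, so that product
  measures over \<open>lborel\<close> can be used without completion.\<close>

definition L1L2 :: "('a::euclidean_space \<Rightarrow> complex) \<Rightarrow> bool" where
  "L1L2 f \<longleftrightarrow> f \<in> borel_measurable borel \<and> integrable lborel f \<and> integrable lborel (\<lambda>t. (cmod (f t))\<^sup>2)"

lemma L1L2D: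
  assumes "L1L2 f"
  shows "f \<in> borel_measurable borel" "integrable lborel f" "integrable lborel (\<lambda>t. (cmod (f t))\<^sup>2)"
  using assms by (auto simp: L1L2_def)

text \<open>Bound and radius are explicit parameters since the Bessel constant depends on the radius
  of the support.\<close>

definition test_fun :: "real \<Rightarrow> real \<Rightarrow> ('a::euclidean_space \<Rightarrow> complex) \<Rightarrow> bool" where
  "test_fun M r f \<longleftrightarrow> f \<in> borel_measurable borel \<and> (\<forall>t. cmod (f t) \<le> M) \<and> (\<forall>t. f t \<noteq> 0 \<longrightarrow> norm t \<le> r)"

lemma test_funD:
  assumes "test_fun M r f"
  shows "f \<in> borel_measurable borel" "cmod (f t) \<le> M" "f t \<noteq> 0 \<Longrightarrow> norm t \<le> r" "0 \<le> M"
  using assms order_trans[OF norm_ge_zero, of "f undefined" M] by (auto simp: test_fun_def)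

lemma test_fun_L1L2:
  assumes f: "test_fun M r f"
  shows "L1L2 f"
  unfolding L1L2_def
proof (intro conjI)
  show [measurable]: "f \<in> borel_measurable borel" by (rule test_funD(1)[OF f])
  show "integrable lborel f"
    by (rule bounded_support_integrable[of _ M r]) (use test_funD[OF f] in auto)
  show "integrable lborel (\<lambda>t. (cmod (f t))\<^sup>2)"
  proof (rule bounded_support_integrable[of _ "M\<^sup>2" r])
    show "norm ((cmod (f x))\<^sup>2) \<le> M\<^sup>2" for x
      using power_mono[OF test_funD(2)[OF f, of x], of 2] by simp
  qed (use test_funD[OF f] in auto)
qed

lemma modulate_L1L2: "L1L2 g \<Longrightarrow> L1L2 (modulate b g)"
  unfolding L1L2_def modulate_def[abs_def]
  by (auto simp: norm_mult mult.commute[of "cis _"] intro!: integrable_mult_cis)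

lemma fourier_modulate:
  assumes "L1L2 g"
  shows "fourier (modulate b g) w = fourier g (w - b)"
  using fourier_mult_cis[OF L1L2D(1)[OF assms], of b w]
  by (simp add: modulate_def[abs_def] mult.commute inner_commute)

text \<open>Up to a phase, the coefficient at position \<open>x\<close> and frequency
  \<open>b\<close> is the Fourier transform at \<open>b\<close> of \<open>f\<close> times the
  conjugate of the translated window. For \<open>f\<close> of bounded support, summing over
  \<open>b\<close> thus samples the transform of a function of bounded support.\<close>

lemma correlation_modulate:
  assumes f: "L1L2 f" and g: "L1L2 g"
  shows "cmod (correlation f (modulate b g) x) = cmod (fourier (\<lambda>t. f t * cnj (g (t - x))) b)"
proof -
  have [measurable]: "f \<in> borel_measurable borel" "g \<in> borel_measurable borel" using f g by (auto dest: L1L2D)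
  have "correlation f (modulate b g) x =
      (\<integral>t. cis (2 * pi * (b \<bullet> x)) * (f t * cnj (g (t - x)) * cis (- 2 * pi * (t \<bullet> b))) \<partial>lborel)"
    unfolding correlation_def
  proof (intro Bochner_Integration.integral_cong refl)
    fix t
    have "cnj (cis (2 * pi * (b \<bullet> (t - x)))) = cis (2 * pi * (b \<bullet> x)) * cis (- 2 * pi * (t \<bullet> b))"
      by (simp add: cis_cnj cis_mult inner_diff_right right_diff_distrib inner_commute)
    then show "f t * cnj (modulate b g (t - x)) = cis (2 * pi * (b \<bullet> x)) * (f t * cnj (g (t - x)) * cis (- 2 * pi * (t \<bullet> b)))"
      by (simp add: modulate_def)
  qed
  also have "\<dots> = cis (2 * pi * (b \<bullet> x)) * fourier (\<lambda>t. f t * cnj (g (t - x))) b"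
    by (subst fourier_eq_lborel) simp_all
  finally show ?thesis by (simp add: norm_mult)
qed

definition energy :: "('a::euclidean_space \<Rightarrow> complex) \<Rightarrow> ('a \<Rightarrow> complex) \<Rightarrow> 'a set \<Rightarrow> 'a \<Rightarrow> real" where
  "energy f g S x = (\<integral>b. (cmod (correlation f (modulate b g) x))\<^sup>2 \<partial>count_space S)"

text \<open>The mass of the window that a function supported in the ball of radius \<open>R\<close>
  at 0 meets at position \<open>x\<close>: t lies in that ball exactly when u = t - x lies in the
  ball at -x. It carries the decay of the energy in \<open>x\<close>.\<close>

definition local_energy :: "('a::euclidean_space \<Rightarrow> complex) \<Rightarrow> real \<Rightarrow> 'a \<Rightarrow> real" where
  "local_energy g R x = (\<integral>u. indicator (cball (- x) R) u * (cmod (g u))\<^sup>2 \<partial>lborel)"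

text \<open>The local bound leads to summability over the lattice, the global one to continuity of
  the energy in \<open>x\<close>.\<close>

lemma test_fun_mult_shift:
  fixes g :: "'a::euclidean_space \<Rightarrow> complex"
  assumes f: "test_fun M r f" and g[measurable]: "g \<in> borel_measurable borel"
    and g2: "integrable lborel (\<lambda>t. (cmod (g t))\<^sup>2)"
  shows "integrable lborel (\<lambda>t. (cmod (f t * cnj (g (t - x))))\<^sup>2)"
    and "integrable lborel (\<lambda>t. f t * cnj (g (t - x)))"
    and "(\<integral>t. (cmod (f t * cnj (g (t - x))))\<^sup>2 \<partial>lborel) \<le> M\<^sup>2 * local_energy g r x"
    and "(\<integral>t. (cmod (f t * cnj (g (t - x))))\<^sup>2 \<partial>lborel) \<le> M\<^sup>2 * (\<integral>t. (cmod (g t))\<^sup>2 \<partial>lborel)"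
proof -
  have [measurable]: "f \<in> borel_measurable borel" by (rule test_funD(1)[OF f])
  have le: "(cmod (f t * cnj (g (t - x))))\<^sup>2 \<le> M\<^sup>2 * (indicator (cball 0 r) t * (cmod (g (t - x)))\<^sup>2)" for t
  proof (cases "f t = 0")
    case False
    have "(cmod (f t))\<^sup>2 * (cmod (g (t - x)))\<^sup>2 \<le> M\<^sup>2 * (cmod (g (t - x)))\<^sup>2"
      using test_funD(2)[OF f] by (intro mult_right_mono power_mono) auto
    then show ?thesis using False test_funD(3)[OF f] by (simp add: norm_mult power_mult_distrib)
  qed simp
  have [measurable]: "cball (0::'a) r \<in> sets borel" by simp
  have gs: "integrable lborel (\<lambda>t. (cmod (g (t - x)))\<^sup>2)" by (rule square_integrable_shift(1)[OF g g2])
  have gi: "integrable lborel (\<lambda>t. indicator (cball 0 r) t * (cmod (g (t - x)))\<^sup>2)"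
    by (rule Bochner_Integration.integrable_bound[OF gs]) (auto simp: indicator_def)
  show i: "integrable lborel (\<lambda>t. (cmod (f t * cnj (g (t - x))))\<^sup>2)"
    by (rule Bochner_Integration.integrable_bound[where f="\<lambda>t. M\<^sup>2 * (indicator (cball 0 r) t * (cmod (g (t - x)))\<^sup>2)"])
      (use gi le in auto)
  show "integrable lborel (\<lambda>t. f t * cnj (g (t - x)))"
    using square_integrable_mult[of f lborel "\<lambda>t. cnj (g (t - x))"] gs L1L2D(3)[OF test_fun_L1L2[OF f]] by simp
  have "(\<integral>t. (cmod (f t * cnj (g (t - x))))\<^sup>2 \<partial>lborel) \<le> (\<integral>t. M\<^sup>2 * (indicator (cball 0 r) t * (cmod (g (t - x)))\<^sup>2) \<partial>lborel)"
    using i gi le by (intro integral_mono) auto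
  also have "\<dots> = M\<^sup>2 * (\<integral>t. indicator (cball 0 r) t * (cmod (g (t - x)))\<^sup>2 \<partial>lborel)" by simp
  also have "(\<integral>t. indicator (cball 0 r) t * (cmod (g (t - x)))\<^sup>2 \<partial>lborel) = local_energy g r x"
  proof -
    have "(\<integral>t. indicator (cball 0 r) t * (cmod (g (t - x)))\<^sup>2 \<partial>lborel) = (\<integral>t. indicator (cball 0 r) (x + t) * (cmod (g (x + t - x)))\<^sup>2 \<partial>lborel)"
      by (rule lborel_shift(1)) measurable
    also have "\<dots> = local_energy g r x"
      unfolding local_energy_def by (intro Bochner_Integration.integral_cong) (auto simp: indicator_def dist_norm add.commute norm_minus_commute)
    finally show ?thesis .
  qed
  finally show b: "(\<integral>t. (cmod (f t * cnj (g (t - x))))\<^sup>2 \<partial>lborel) \<le> M\<^sup>2 * local_energy g r x" .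
  also have "local_energy g r x \<le> (\<integral>t. (cmod (g t))\<^sup>2 \<partial>lborel)"
    unfolding local_energy_def
  proof (rule integral_mono)
    show "integrable lborel (\<lambda>u. indicator (cball (- x) r) u * (cmod (g u))\<^sup>2)"
      by (rule Bochner_Integration.integrable_bound[OF g2]) (auto simp: indicator_def)
  qed (use g2 in \<open>auto simp: indicator_def\<close>)
  finally show "(\<integral>t. (cmod (f t * cnj (g (t - x))))\<^sup>2 \<partial>lborel) \<le> M\<^sup>2 * (\<integral>t. (cmod (g t))\<^sup>2 \<partial>lborel)"
    by (simp add: mult_left_mono)
qed

locale bessel_set =
  fixes S :: "'a::euclidean_space set" and r C :: real
  assumes countable: "countable S" and C: "C > 0" and r: "r > 0"
    and bessel: "\<And>h. \<lbrakk>h \<in> borel_measurable borel; integrable lborel (\<lambda>t. (cmod (h t))\<^sup>2); \<And>t. h t \<noteq> 0 \<Longrightarrow> norm t \<le> r\<rbrakk>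
       \<Longrightarrow> (\<integral>\<^sup>+b. ennreal ((cmod (fourier h b))\<^sup>2) \<partial>count_space S) \<le> ennreal (C * (\<integral>t. (cmod (h t))\<^sup>2 \<partial>lborel))"
begin

lemma
  assumes "h \<in> borel_measurable borel" "integrable lborel (\<lambda>t. (cmod (h t))\<^sup>2)" "\<And>t. h t \<noteq> 0 \<Longrightarrow> norm t \<le> r"
  shows bessel_integrable: "integrable (count_space S) (\<lambda>b. (cmod (fourier h b))\<^sup>2)"
    and bessel_le: "(\<integral>b. (cmod (fourier h b))\<^sup>2 \<partial>count_space S) \<le> C * (\<integral>t. (cmod (h t))\<^sup>2 \<partial>lborel)"
proof -
  show i: "integrable (count_space S) (\<lambda>b. (cmod (fourier h b))\<^sup>2)"
    using bessel[OF assms] by (intro integrableI_bounded) (auto simp: less_top[symmetric] top_unique)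
  have "ennreal (\<integral>b. (cmod (fourier h b))\<^sup>2 \<partial>count_space S) = (\<integral>\<^sup>+b. ennreal ((cmod (fourier h b))\<^sup>2) \<partial>count_space S)"
    using i by (intro nn_integral_eq_integral[symmetric]) auto
  with bessel[OF assms] have "ennreal (\<integral>b. (cmod (fourier h b))\<^sup>2 \<partial>count_space S) \<le> ennreal (C * (\<integral>t. (cmod (h t))\<^sup>2 \<partial>lborel))"
    by simp
  then show "(\<integral>b. (cmod (fourier h b))\<^sup>2 \<partial>count_space S) \<le> C * (\<integral>t. (cmod (h t))\<^sup>2 \<partial>lborel)"
    using C by (subst (asm) ennreal_le_iff) auto
qed

context
  fixes M :: real and f g :: "'a \<Rightarrow> complex"
  assumes f: "test_fun M r f" and g: "L1L2 g"
begin

lemma f_measurable[measurable]: "f \<in> borel_measurable borel" and g_measurable[measurable]: "g \<in> borel_measurable borel"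
  using f g by (auto dest: test_funD L1L2D)

lemma mult_shift_window:
  "(\<lambda>t. f t * cnj (g (t - x))) \<in> borel_measurable borel"
  "integrable lborel (\<lambda>t. (cmod (f t * cnj (g (t - x))))\<^sup>2)"
  "f t * cnj (g (t - x)) \<noteq> 0 \<Longrightarrow> norm t \<le> r"
  using test_fun_mult_shift(1)[OF f g_measurable L1L2D(3)[OF g]] test_funD(3)[OF f] by auto

lemma energy_eq: "energy f g S x = (\<integral>b. (cmod (fourier (\<lambda>t. f t * cnj (g (t - x))) b))\<^sup>2 \<partial>count_space S)"
  unfolding energy_def by (simp add: correlation_modulate[OF test_fun_L1L2[OF f] g])

lemma energy_integrable: "integrable (count_space S) (\<lambda>b. (cmod (correlation f (modulate b g) x))\<^sup>2)"
  unfolding correlation_modulate[OF test_fun_L1L2[OF f] g] by (rule bessel_integrable[OF mult_shift_window])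

lemma nn_integral_energy: "(\<integral>\<^sup>+b. ennreal ((cmod (correlation f (modulate b g) x))\<^sup>2) \<partial>count_space S) = ennreal (energy f g S x)"
  unfolding energy_def by (rule nn_integral_eq_integral[OF energy_integrable]) simp

lemma energy_le: "energy f g S x \<le> C * M\<^sup>2 * local_energy g r x"
proof -
  have "energy f g S x \<le> C * (\<integral>t. (cmod (f t * cnj (g (t - x))))\<^sup>2 \<partial>lborel)"
    unfolding energy_eq by (rule bessel_le[OF mult_shift_window])
  also have "\<dots> \<le> C * (M\<^sup>2 * local_energy g r x)"
    using C test_fun_mult_shift(3)[OF f g_measurable L1L2D(3)[OF g]] by (intro mult_left_mono) auto
  finally show ?thesis by (simp add: mult.assoc)
qed

text \<open>A change of \<open>x\<close> is a change of the translated window, on which the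
  coefficients depend conjugate-linearly. The Bessel bound controls their difference in l2 over
  \<open>S\<close> by the L2 modulus of continuity of \<open>g\<close>.\<close>

lemma energy_tendsto:
  assumes x: "x \<longlonglongrightarrow> x0"
  shows "(\<lambda>n. energy f g S (x n)) \<longlonglongrightarrow> energy f g S x0"
proof -
  define h where "h y t = f t * cnj (g (t - y))" for y t
  have [measurable]: "h y \<in> borel_measurable borel" for y unfolding h_def by measurable
  define v where "v y b = fourier (h y) b" for y b
  have v2: "integrable (count_space S) (\<lambda>b. (cmod (v y b))\<^sup>2)" for y
    unfolding v_def h_def by (rule bessel_integrable[OF mult_shift_window])
  have E: "energy f g S y = (\<integral>b. (cmod (v y b))\<^sup>2 \<partial>count_space S)" for y
    unfolding energy_eq v_def h_def ..
  let ?D = "\<lambda>n. \<integral>b. (cmod (v (x n) b - v x0 b))\<^sup>2 \<partial>count_space S"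
  let ?T = "\<lambda>n. \<integral>t. (cmod (g (t - (x n - x0)) - g t))\<^sup>2 \<partial>lborel"
  have D: "?D n \<le> C * (M\<^sup>2 * ?T n)" for n
  proof -
    define G where "G t = g (t - (x n - x0)) - g t" for t
    have [measurable]: "G \<in> borel_measurable borel" unfolding G_def by measurable
    have G2: "integrable lborel (\<lambda>t. (cmod (G t))\<^sup>2)"
      unfolding G_def using square_integrable_shift(1)[OF g_measurable L1L2D(3)[OF g]] L1L2D(3)[OF g]
      by (intro square_integrable_diff) auto
    have hd: "h (x n) t + (- 1) * h x0 t = f t * cnj (G (t - x0))" for t
      by (simp add: h_def G_def algebra_simps)
    have hi: "integrable lborel (h y)" for y
      unfolding h_def by (rule test_fun_mult_shift(2)[OF f g_measurable L1L2D(3)[OF g]])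
    have "fourier (\<lambda>t. h (x n) t + (- 1) * h x0 t) b = fourier (h (x n)) b + (- 1) * fourier (h x0) b" for b
      by (rule fourier_add_scaled[OF hi hi])
    then have "v (x n) b - v x0 b = fourier (\<lambda>t. f t * cnj (G (t - x0))) b" for b
      unfolding hd v_def by simp
    then have "?D n = (\<integral>b. (cmod (fourier (\<lambda>t. f t * cnj (G (t - x0))) b))\<^sup>2 \<partial>count_space S)" by simp
    also have "\<dots> \<le> C * (\<integral>t. (cmod (f t * cnj (G (t - x0))))\<^sup>2 \<partial>lborel)"
      by (rule bessel_le) (use test_fun_mult_shift(1)[OF f _ G2] test_funD(3)[OF f] in auto)
    also have "\<dots> \<le> C * (M\<^sup>2 * ?T n)"
      using C test_fun_mult_shift(4)[OF f _ G2, of x0] by (intro mult_left_mono) (auto simp: G_def)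
    finally show ?thesis .
  qed
  have "(\<lambda>n. x n - x0) \<longlonglongrightarrow> 0" using x by (simp add: LIM_zero)
  from L2_translation[OF g_measurable L1L2D(3)[OF g] this]
  have "(\<lambda>n. C * (M\<^sup>2 * ?T n)) \<longlonglongrightarrow> C * (M\<^sup>2 * 0)" by (intro tendsto_intros)
  then have limT: "(\<lambda>n. C * (M\<^sup>2 * ?T n)) \<longlonglongrightarrow> 0" by simp
  have limD: "?D \<longlonglongrightarrow> 0"
    by (rule tendsto_sandwich[OF _ _ tendsto_const limT]) (use D in auto)
  show ?thesis
    unfolding E by (rule L2_norm_tendsto[OF _ _ v2 v2 limD]) simp_all
qed

lemma energy_measurable[measurable]: "energy f g S \<in> borel_measurable borel"
proof -
  have "continuous_on UNIV (energy f g S)"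
    unfolding continuous_on_sequentially using energy_tendsto by (auto simp: comp_def)
  then show ?thesis by (rule borel_measurable_continuous_onI)
qed

lemma L1L2_correlation_modulate: "L1L2 (correlation f (modulate b g))"
proof -
  have L: "L1L2 f" "L1L2 (modulate b g)" using test_fun_L1L2[OF f] modulate_L1L2[OF g] by auto
  have i: "integrable lborel (correlation f (modulate b g))" by (rule correlation_integrable[OF L1L2D(2)[OF L(1)] L1L2D(2)[OF L(2)]])
  define K where "K = sqrt ((\<integral>t. (cmod (f t))\<^sup>2 \<partial>lborel) * (\<integral>t. (cmod (modulate b g t))\<^sup>2 \<partial>lborel))"
  have K: "cmod (correlation f (modulate b g) x) \<le> K" for x
    unfolding K_def by (rule real_le_rsqrt) (rule norm_correlation_le[OF L1L2D(1)[OF L(1)] L1L2D(1)[OF L(2)] L1L2D(3)[OF L(1)] L1L2D(3)[OF L(2)]])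
  have "integrable lborel (\<lambda>x. (cmod (correlation f (modulate b g) x))\<^sup>2)"
  proof (rule Bochner_Integration.integrable_bound)
    show "integrable lborel (\<lambda>x. K *\<^sub>R correlation f (modulate b g) x)" using i by simp
    show "AE x in lborel. norm ((cmod (correlation f (modulate b g) x))\<^sup>2) \<le> norm (K *\<^sub>R correlation f (modulate b g) x)"
    proof (rule AE_I2)
      fix x
      show "norm ((cmod (correlation f (modulate b g) x))\<^sup>2) \<le> norm (K *\<^sub>R correlation f (modulate b g) x)"
        using mult_right_mono[OF K[of x] norm_ge_zero[of "correlation f (modulate b g) x"]] order_trans[OF norm_ge_zero K[of x]]
        by (simp add: power2_eq_square)
    qed
  qed (use i in auto)
  then show ?thesis using i by (auto simp: L1L2_def)
qed

lemma fourier_correlation_modulate: "fourier (correlation f (modulate b g)) w = fourier f w * cnj (fourier g (w - b))"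
  by (simp add: fourier_correlation[OF L1L2D(2)[OF test_fun_L1L2[OF f]] L1L2D(2)[OF modulate_L1L2[OF g]]] fourier_modulate[OF g])

text \<open>Bessel for each \<open>x\<close>, then Tonelli in (x, t): the total is at most
  \<open>C\<close> times the product of the squared norms. It justifies exchanging sum and integral
  in the Fourier transform of the energy.\<close>

lemma nn_energy_total:
  "(\<integral>\<^sup>+b. \<integral>\<^sup>+x. ennreal ((cmod (correlation f (modulate b g) x))\<^sup>2) \<partial>lborel \<partial>count_space S) < \<infinity>"
proof -
  have [measurable]: "correlation f (modulate b g) \<in> borel_measurable borel" for b using L1L2_correlation_modulate by (rule L1L2D)
  have "(\<integral>\<^sup>+b. \<integral>\<^sup>+x. ennreal ((cmod (correlation f (modulate b g) x))\<^sup>2) \<partial>lborel \<partial>count_space S) =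
     (\<integral>\<^sup>+x. \<integral>\<^sup>+b. ennreal ((cmod (correlation f (modulate b g) x))\<^sup>2) \<partial>count_space S \<partial>lborel)"
    by (rule nn_integral_count_space_nn_integral[OF countable, symmetric]) measurable
  also have "\<dots> \<le> (\<integral>\<^sup>+x. ennreal C * (\<integral>\<^sup>+t. ennreal ((cmod (f t))\<^sup>2) * ennreal ((cmod (g (t - x)))\<^sup>2) \<partial>lborel) \<partial>lborel)"
  proof (rule nn_integral_mono)
    fix x
    have "(\<integral>\<^sup>+b. ennreal ((cmod (correlation f (modulate b g) x))\<^sup>2) \<partial>count_space S) \<le> ennreal (C * (\<integral>t. (cmod (f t * cnj (g (t - x))))\<^sup>2 \<partial>lborel))"
      unfolding correlation_modulate[OF test_fun_L1L2[OF f] g] by (rule bessel[OF mult_shift_window])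
    also have "\<dots> = ennreal C * (\<integral>\<^sup>+t. ennreal ((cmod (f t * cnj (g (t - x))))\<^sup>2) \<partial>lborel)"
      using C mult_shift_window(2) by (simp add: ennreal_mult nn_integral_eq_integral)
    also have "\<dots> = ennreal C * (\<integral>\<^sup>+t. ennreal ((cmod (f t))\<^sup>2) * ennreal ((cmod (g (t - x)))\<^sup>2) \<partial>lborel)"
      by (simp add: norm_mult power_mult_distrib ennreal_mult)
    finally show "(\<integral>\<^sup>+b. ennreal ((cmod (correlation f (modulate b g) x))\<^sup>2) \<partial>count_space S) \<le> \<dots>" .
  qed
  also have "\<dots> = ennreal C * (\<integral>\<^sup>+x. \<integral>\<^sup>+t. ennreal ((cmod (f t))\<^sup>2) * ennreal ((cmod (g (t - x)))\<^sup>2) \<partial>lborel \<partial>lborel)"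
    by (rule nn_integral_cmult) measurable
  also have "(\<integral>\<^sup>+x. \<integral>\<^sup>+t. ennreal ((cmod (f t))\<^sup>2) * ennreal ((cmod (g (t - x)))\<^sup>2) \<partial>lborel \<partial>lborel) =
     (\<integral>\<^sup>+t. \<integral>\<^sup>+x. ennreal ((cmod (f t))\<^sup>2) * ennreal ((cmod (g (t - x)))\<^sup>2) \<partial>lborel \<partial>lborel)"
    by (rule lborel_pair.Fubini') measurable
  also have "\<dots> = (\<integral>\<^sup>+t. ennreal ((cmod (f t))\<^sup>2) * (\<integral>\<^sup>+x. ennreal ((cmod (g x))\<^sup>2) \<partial>lborel) \<partial>lborel)"
  proof (rule nn_integral_cong)
    fix t
    have "(\<integral>\<^sup>+x. ennreal ((cmod (g (t - x)))\<^sup>2) \<partial>lborel) = (\<integral>\<^sup>+x. ennreal ((cmod (g x))\<^sup>2) \<partial>lborel)"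
      by (rule lborel_reflect(3)[symmetric]) measurable
    then show "(\<integral>\<^sup>+x. ennreal ((cmod (f t))\<^sup>2) * ennreal ((cmod (g (t - x)))\<^sup>2) \<partial>lborel) = ennreal ((cmod (f t))\<^sup>2) * (\<integral>\<^sup>+x. ennreal ((cmod (g x))\<^sup>2) \<partial>lborel)"
      by (subst nn_integral_cmult) simp_all
  qed
  also have "\<dots> = ennreal ((\<integral>t. (cmod (f t))\<^sup>2 \<partial>lborel) * (\<integral>t. (cmod (g t))\<^sup>2 \<partial>lborel))"
    using L1L2D(3)[OF test_fun_L1L2[OF f]] L1L2D(3)[OF g] by (simp add: nn_integral_multc nn_integral_eq_integral ennreal_mult)
  also have "ennreal C * \<dots> < \<infinity>" by (simp add: ennreal_mult_less_top)
  finally show ?thesis .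
qed

text \<open>For a single frequency \<open>b\<close>, Parseval turns the transform of |V b|^2 at
  \<open>p\<close> into the integral of the transform of \<open>V b\<close> against the conjugate of
  its own shift by \<open>p\<close>, and that transform factors into those of \<open>f\<close> and
  \<open>g\<close>. The sum over \<open>b\<close> is then pulled inside.\<close>

lemma
  shows energy_lborel_integrable: "integrable lborel (energy f g S)"
    and cross_integrable: "integrable lborel (\<lambda>w. fourier f w * cnj (fourier f (w - p)) *
         (\<Sum>\<^sub>\<infinity>b\<in>S. cnj (fourier g (w - b)) * fourier g (w - b - p)))"
    and fourier_energy: "(\<integral>x. of_real (energy f g S x) * cis (- 2 * pi * (x \<bullet> p)) \<partial>lborel) =
       (\<integral>w. fourier f w * cnj (fourier f (w - p)) *
         (\<Sum>\<^sub>\<infinity>b\<in>S. cnj (fourier g (w - b)) * fourier g (w - b - p)) \<partial>lborel)"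
proof -
  define V where "V b = correlation f (modulate b g)" for b
  have VL: "L1L2 (V b)" for b unfolding V_def by (rule L1L2_correlation_modulate)
  have [measurable]: "V b \<in> borel_measurable borel" for b using VL by (rule L1L2D)
  have FV: "fourier (V b) w = fourier f w * cnj (fourier g (w - b))" for b w unfolding V_def by (rule fourier_correlation_modulate)
  define F where "F b x = of_real ((cmod (V b x))\<^sup>2) * cis (- 2 * pi * (x \<bullet> p))" for b x
  define G where "G b w = fourier (V b) w * cnj (fourier (V b) (w - p))" for b w
  have [measurable]: "F b \<in> borel_measurable borel" "G b \<in> borel_measurable borel" for b
    unfolding F_def G_def by measurable
  have tot: "(\<integral>\<^sup>+b. ennreal (\<integral>x. (cmod (V b x))\<^sup>2 \<partial>lborel) \<partial>count_space S) < \<infinity>"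
    using nn_energy_total L1L2D(3)[OF VL] by (simp add: V_def nn_integral_eq_integral)
  have finF: "(\<integral>\<^sup>+b. \<integral>\<^sup>+x. ennreal (cmod (F b x)) \<partial>lborel \<partial>count_space S) < \<infinity>"
    using nn_energy_total by (simp add: F_def V_def norm_mult norm_power)
  \<comment> \<open>A product is at most the sum of the two squares, each of which integrates to the
    squared norm of \<open>V b\<close>; the sum over \<open>b\<close> is finite by
    \<open>tot\<close>.\<close>
  have finG: "(\<integral>\<^sup>+b. \<integral>\<^sup>+w. ennreal (cmod (G b w)) \<partial>lborel \<partial>count_space S) < \<infinity>"
  proof -
    have "(\<integral>\<^sup>+w. ennreal (cmod (G b w)) \<partial>lborel) \<le> 2 * ennreal (\<integral>x. (cmod (V b x))\<^sup>2 \<partial>lborel)" for b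
    proof -
      have FV2: "integrable lborel (\<lambda>w. (cmod (fourier (V b) w))\<^sup>2)"
        by (rule fourier_square_integrable[OF L1L2D(2)[OF VL] L1L2D(3)[OF VL]])
      have Pl: "(\<integral>w. (cmod (fourier (V b) w))\<^sup>2 \<partial>lborel) = (\<integral>x. (cmod (V b x))\<^sup>2 \<partial>lborel)"
        by (rule plancherel[OF L1L2D(2)[OF VL] L1L2D(3)[OF VL]])
      have "(\<integral>\<^sup>+w. ennreal (cmod (G b w)) \<partial>lborel) \<le> (\<integral>\<^sup>+w. ennreal ((cmod (fourier (V b) w))\<^sup>2) + ennreal ((cmod (fourier (V b) (w - p)))\<^sup>2) \<partial>lborel)"
      proof (rule nn_integral_mono)
        fix w
        have ab: "a * c \<le> a\<^sup>2 + c\<^sup>2" if "0 \<le> a" "0 \<le> c" for a c :: real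
        proof -
          have "0 \<le> a * c" using that by simp
          then show ?thesis using sum_squares_bound[of a c] by linarith
        qed
        show "ennreal (cmod (G b w)) \<le> ennreal ((cmod (fourier (V b) w))\<^sup>2) + ennreal ((cmod (fourier (V b) (w - p)))\<^sup>2)"
          using ab[of "cmod (fourier (V b) w)" "cmod (fourier (V b) (w - p))"]
          by (simp add: G_def norm_mult ennreal_leI flip: ennreal_plus)
      qed
      also have "\<dots> = (\<integral>\<^sup>+w. ennreal ((cmod (fourier (V b) w))\<^sup>2) \<partial>lborel) + (\<integral>\<^sup>+w. ennreal ((cmod (fourier (V b) (w - p)))\<^sup>2) \<partial>lborel)"
        by (rule nn_integral_add) measurable
      also have "\<dots> = ennreal (\<integral>x. (cmod (V b x))\<^sup>2 \<partial>lborel) + ennreal (\<integral>x. (cmod (V b x))\<^sup>2 \<partial>lborel)"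
        using FV2 square_integrable_shift[OF _ FV2, of p] by (simp add: nn_integral_eq_integral Pl)
      finally show ?thesis by (simp add: mult_2)
    qed
    then have "(\<integral>\<^sup>+b. \<integral>\<^sup>+w. ennreal (cmod (G b w)) \<partial>lborel \<partial>count_space S) \<le> (\<integral>\<^sup>+b. 2 * ennreal (\<integral>x. (cmod (V b x))\<^sup>2 \<partial>lborel) \<partial>count_space S)"
      by (intro nn_integral_mono)
    also have "\<dots> = 2 * (\<integral>\<^sup>+b. ennreal (\<integral>x. (cmod (V b x))\<^sup>2 \<partial>lborel) \<partial>count_space S)"
      by (rule nn_integral_cmult) simp
    also have "\<dots> < \<infinity>" using tot by (simp add: ennreal_mult_less_top)
    finally show ?thesis .
  qed
  have Fsum: "(\<integral>b. F b x \<partial>count_space S) = of_real (energy f g S x) * cis (- 2 * pi * (x \<bullet> p))" for x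
    unfolding F_def energy_def V_def by (simp only: integral_mult_left_zero integral_complex_of_real)
  have Gsum: "(\<integral>b. G b w \<partial>count_space S) = fourier f w * cnj (fourier f (w - p)) *
         (\<Sum>\<^sub>\<infinity>b\<in>S. cnj (fourier g (w - b)) * fourier g (w - b - p))" for w
  proof -
    have eq: "w - p - b = w - b - p" for b by simp
    have "G b w = (fourier f w * cnj (fourier f (w - p))) * (cnj (fourier g (w - b)) * fourier g (w - b - p))" for b
      unfolding G_def FV eq by simp
    then show ?thesis by (simp add: infsum_eq_integral_count_space)
  qed
  have FG: "(\<integral>x. F b x \<partial>lborel) = (\<integral>w. G b w \<partial>lborel)" for b
  proof -
    have L: "integrable lborel (\<lambda>x. V b x * cis (2 * pi * (x \<bullet> p)))" "integrable lborel (\<lambda>x. (cmod (V b x * cis (2 * pi * (x \<bullet> p))))\<^sup>2)"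
      using L1L2D(2,3)[OF VL] by (auto simp: norm_mult intro!: integrable_mult_cis)
    have "(\<integral>w. G b w \<partial>lborel) = (\<integral>w. fourier (V b) w * cnj (fourier (\<lambda>x. V b x * cis (2 * pi * (x \<bullet> p))) w) \<partial>lborel)"
      unfolding G_def by (simp add: fourier_mult_cis)
    also have "\<dots> = (\<integral>x. V b x * cnj (V b x * cis (2 * pi * (x \<bullet> p))) \<partial>lborel)"
      by (rule parseval[OF L1L2D(2)[OF VL] L1L2D(3)[OF VL] L])
    also have "\<dots> = (\<integral>x. F b x \<partial>lborel)"
      by (intro Bochner_Integration.integral_cong) (simp_all add: F_def complex_norm_square cis_cnj mult.assoc del: of_real_power)
    finally show ?thesis ..
  qed
  show "integrable lborel (\<lambda>w. fourier f w * cnj (fourier f (w - p)) *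
         (\<Sum>\<^sub>\<infinity>b\<in>S. cnj (fourier g (w - b)) * fourier g (w - b - p)))"
    using integrable_integral_count_space[OF countable _ finG] by (simp add: Gsum)
  show "integrable lborel (energy f g S)"
  proof (rule integrable_norm_cancel)
    have "integrable lborel (\<lambda>x. of_real (energy f g S x) * cis (- 2 * pi * (x \<bullet> p)))"
      using integrable_integral_count_space[OF countable _ finF] unfolding Fsum by simp
    then have "integrable lborel (\<lambda>x. cmod (of_real (energy f g S x) * cis (- 2 * pi * (x \<bullet> p))))" by (rule integrable_norm)
    then show "integrable lborel (\<lambda>x. norm (energy f g S x))" by (simp add: norm_mult)
  qed simp
  have "(\<integral>x. of_real (energy f g S x) * cis (- 2 * pi * (x \<bullet> p)) \<partial>lborel) = (\<integral>b. (\<integral>x. F b x \<partial>lborel) \<partial>count_space S)"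
    using integral_count_space_swap[OF countable _ finF] by (simp only: Fsum) simp
  also have "\<dots> = (\<integral>w. (\<integral>b. G b w \<partial>count_space S) \<partial>lborel)"
    using integral_count_space_swap[OF countable _ finG] by (simp add: FG)
  finally show "(\<integral>x. of_real (energy f g S x) * cis (- 2 * pi * (x \<bullet> p)) \<partial>lborel) =
       (\<integral>w. fourier f w * cnj (fourier f (w - p)) *
         (\<Sum>\<^sub>\<infinity>b\<in>S. cnj (fourier g (w - b)) * fourier g (w - b - p)) \<partial>lborel)"
    by (simp only: Gsum)
qed

end

end

section \<open>Polarization and the recovery of pointwise conditions\<close>

lemma fourier_translate:
  fixes f :: "'a::euclidean_space \<Rightarrow> complex"
  assumes [measurable]: "f \<in> borel_measurable borel"
  shows "fourier (translate a f) w = cis (- 2 * pi * (w \<bullet> a)) * fourier f w"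
proof -
  have "(\<lambda>t. f (t - a)) \<in> borel_measurable borel" by measurable
  then have "fourier (translate a f) w = (\<integral>t. f (t - a) * cis (- 2 * pi * (t \<bullet> w)) \<partial>lborel)"
    unfolding translate_def[abs_def] by (rule fourier_eq_lborel)
  also have "\<dots> = (\<integral>t. f (a + t - a) * cis (- 2 * pi * ((a + t) \<bullet> w)) \<partial>lborel)"
    by (rule lborel_shift(1)) measurable
  also have "\<dots> = (\<integral>t. cis (- 2 * pi * (w \<bullet> a)) * (f t * cis (- 2 * pi * (t \<bullet> w))) \<partial>lborel)"
  proof (intro Bochner_Integration.integral_cong refl)
    fix t
    have "cis (- 2 * pi * ((a + t) \<bullet> w)) = cis (- 2 * pi * (w \<bullet> a)) * cis (- 2 * pi * (t \<bullet> w))"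
      by (simp add: cis_mult inner_add_left distrib_left inner_commute[of a w])
    then show "f (a + t - a) * cis (- 2 * pi * ((a + t) \<bullet> w)) = cis (- 2 * pi * (w \<bullet> a)) * (f t * cis (- 2 * pi * (t \<bullet> w)))"
      by simp
  qed
  also have "\<dots> = cis (- 2 * pi * (w \<bullet> a)) * fourier f w"
    by (simp add: fourier_eq_lborel)
  finally show ?thesis .
qed

lemma test_fun_translate:
  assumes f: "test_fun M r f"
  shows "test_fun M (r + norm a) (translate a f)"
  unfolding test_fun_def
proof (intro conjI allI impI)
  have [measurable]: "f \<in> borel_measurable borel" by (rule test_funD(1)[OF f])
  show "translate a f \<in> borel_measurable borel" unfolding translate_def[abs_def] by measurable
  show "cmod (translate a f t) \<le> M" for t using test_funD(2)[OF f] by (simp add: translate_def)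
  fix t assume "translate a f t \<noteq> 0"
  then have "norm (t - a) \<le> r" using test_funD(3)[OF f] by (simp add: translate_def)
  then show "norm t \<le> r + norm a" using norm_triangle_ineq2[of t a] by linarith
qed

lemma test_fun_add_scaled:
  assumes f: "test_fun M r f" and g: "test_fun M' r' g"
  shows "test_fun (M + cmod c * M') (max r r') (\<lambda>t. f t + c * g t)"
  unfolding test_fun_def
proof (intro conjI allI impI)
  have [measurable]: "f \<in> borel_measurable borel" "g \<in> borel_measurable borel" using f g by (auto dest: test_funD)
  show "(\<lambda>t. f t + c * g t) \<in> borel_measurable borel" by measurable
  show "cmod (f t + c * g t) \<le> M + cmod c * M'" for t
    using test_funD(2)[OF f, of t] mult_left_mono[OF test_funD(2)[OF g, of t], of "cmod c"] norm_triangle_ineq[of "f t" "c * g t"]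
    by (simp add: norm_mult)
  fix t assume "f t + c * g t \<noteq> 0"
  then have "f t \<noteq> 0 \<or> g t \<noteq> 0" by auto
  then show "norm t \<le> max r r'" using test_funD(3)[OF f, of t] test_funD(3)[OF g, of t] by auto
qed

text \<open>After polarization, translating one of the functions multiplies its transform by a character, so
  an integrable function with the factor \<open>U\<close> has vanishing Fourier transform.\<close>

lemma vanishing_cross_terms_imp_AE_zero:
  fixes U :: "'a::euclidean_space \<Rightarrow> complex"
  assumes int: "\<And>M r f. test_fun M r f \<Longrightarrow> integrable lborel (\<lambda>w. fourier f w * cnj (fourier f (w - p)) * U w)"
    and zero: "\<And>M r f. test_fun M r f \<Longrightarrow> (\<integral>w. fourier f w * cnj (fourier f (w - p)) * U w \<partial>lborel) = 0"
  shows "AE w in lborel. U w = 0"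
proof -
  have polar: "integrable lborel (\<lambda>w. fourier f w * cnj (fourier g (w - p)) * U w) \<and>
      (\<integral>w. fourier f w * cnj (fourier g (w - p)) * U w \<partial>lborel) = 0"
    if f: "test_fun M r f" and g: "test_fun M' r' g" for M r f M' r' g
  proof -
    define X where "X c w = fourier (\<lambda>t. f t + c * g t) w * cnj (fourier (\<lambda>t. f t + c * g t) (w - p)) * U w" for c w
    have X: "integrable lborel (X c)" "(\<integral>w. X c w \<partial>lborel) = 0" for c
      unfolding X_def using int[OF test_fun_add_scaled[OF f g]] zero[OF test_fun_add_scaled[OF f g]] by auto
    have F: "fourier (\<lambda>t. f t + c * g t) w = fourier f w + c * fourier g w" for c w
      by (rule fourier_add_scaled[OF L1L2D(2)[OF test_fun_L1L2[OF f]] L1L2D(2)[OF test_fun_L1L2[OF g]]])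
    \<comment> \<open>The polarization identity for a sesquilinear form, from its quadratic values
      at \<open>f + c * g\<close> with c = 1, -1, \<i>, -\<i>.\<close>
    have eq: "fourier f w * cnj (fourier g (w - p)) * U w =
        (1/4) * (X 1 w + (- 1) * X (- 1) w + \<i> * X \<i> w + (- \<i>) * X (- \<i>) w)" for w
      unfolding X_def F by (simp add: algebra_simps)
    show ?thesis unfolding eq using X by simp
  qed
  have "AE w in lborel. norm w \<le> real n \<longrightarrow> U w = 0" for n
  proof -
    \<comment> \<open>Large enough for both \<open>w\<close> and \<open>w - p\<close> to lie where
      the transform of the small ball does not vanish.\<close>
    define R where "R = real n + norm p + 1"
    have R: "R > 0" by (simp add: R_def add_nonneg_pos)
    define \<delta> where "\<delta> = 1 / (8 * R)"
    have \<delta>: "\<delta> > 0" "R * \<delta> \<le> 1/8" using R by (auto simp: \<delta>_def)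
    define u :: "'a \<Rightarrow> complex" where "u = indicator (ball 0 \<delta>)"
    have u: "test_fun 1 \<delta> u"
      unfolding test_fun_def u_def
      by (intro conjI borel_measurable_indicator) (auto simp: indicator_def)
    have [measurable]: "u \<in> borel_measurable borel" by (rule test_funD(1)[OF u])
    have unz: "fourier u w \<noteq> 0" if "norm w \<le> R" for w
    proof -
      have "measure lborel (ball (0::'a) \<delta>) / 2 \<le> cmod (fourier u w)"
        unfolding u_def by (rule fourier_indicator_ball_ge[OF \<delta> that])
      moreover have "0 < measure lborel (ball (0::'a) \<delta>) / 2" using content_ball_pos[OF \<delta>(1), of "0::'a"] by simp
      ultimately have "0 < cmod (fourier u w)" by linarith
      then show ?thesis by simp
    qed
    define W where "W w = fourier u w * cnj (fourier u (w - p)) * U w" for w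
    have W: "integrable lborel W" unfolding W_def using polar[OF u u] by blast
    have [measurable]: "W \<in> borel_measurable borel" using W by auto
    have "fourier W a = 0" for a
    proof -
      have "fourier W a = (\<integral>w. fourier (translate a u) w * cnj (fourier u (w - p)) * U w \<partial>lborel)"
        by (subst fourier_eq_lborel) (simp_all add: fourier_translate W_def mult_ac)
      then show ?thesis using polar[OF test_fun_translate[OF u, of a] u] by simp
    qed
    then have "AE w in lborel. W w = 0" by (rule fourier_eq_0_imp_AE_eq_0[OF W])
    then show ?thesis
    proof eventually_elim
      case (elim w)
      show ?case
      proof
        assume w: "norm w \<le> real n"
        have "norm (w - p) \<le> R" using w norm_triangle_ineq4[of w p] by (simp add: R_def)
        moreover have "norm w \<le> R" using w by (simp add: R_def add.assoc add_increasing2)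
        ultimately show "U w = 0" using elim unz by (auto simp: W_def)
      qed
    qed
  qed
  then have "AE w in lborel. \<forall>n. norm w \<le> real n \<longrightarrow> U w = 0" unfolding AE_all_countable by blast
  then show ?thesis
  proof eventually_elim
    case (elim w)
    obtain n where "norm w \<le> real n" using real_arch_simple by blast
    then show ?case using elim by blast
  qed
qed

section \<open>The weight on the product space and its periodization\<close>

text \<open>Moving the centre is paid for by enlarging the radius, which allows a majorant that is
  uniform over unit balls.\<close>

lemma local_energy_mono:
  fixes g :: "'a::euclidean_space \<Rightarrow> complex"
  assumes g: "L1L2 g" and x: "norm (x - x') \<le> e"
  shows "local_energy g r x \<le> local_energy g (r + e) x'"
  unfolding local_energy_def
proof (rule integral_mono)
  have [measurable]: "g \<in> borel_measurable borel" using g by (rule L1L2D)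
  show "integrable lborel (\<lambda>u. indicator (cball y R) u * (cmod (g u))\<^sup>2)" for y R
    by (rule Bochner_Integration.integrable_bound[OF L1L2D(3)[OF g]]) (auto simp: indicator_def)
  then show "integrable lborel (\<lambda>u. indicator (cball y R) u * (cmod (g u))\<^sup>2)" for y R .
  fix u
  have "u \<in> cball (- x') (r + e)" if "u \<in> cball (- x) r"
  proof -
    have "dist (- x') u \<le> dist (- x') (- x) + dist (- x) u" by (rule dist_triangle)
    moreover have "dist (- x') (- x) = norm (x - x')" by (simp add: dist_norm)
    ultimately show ?thesis using that x by simp
  qed
  then show "indicator (cball (- x) r) u * (cmod (g u))\<^sup>2 \<le> indicator (cball (- x') (r + e)) u * (cmod (g u))\<^sup>2"
    by (auto simp: indicator_def)
qed

lemma correlation_translate: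
  fixes f g :: "'a::euclidean_space \<Rightarrow> complex"
  assumes [measurable]: "f \<in> borel_measurable borel" "g \<in> borel_measurable borel"
  shows "correlation (translate (- y) f) g x = correlation f g (y + x)"
proof -
  have "correlation f g (y + x) = (\<integral>t. f (y + t) * cnj (g (y + t - (y + x))) \<partial>lborel)"
    unfolding correlation_def by (rule lborel_shift(1)) measurable
  then show ?thesis by (simp add: correlation_def translate_def add.commute)
qed

lemma energy_translate:
  assumes "f \<in> borel_measurable borel" "L1L2 g"
  shows "energy (translate (- y) f) g S x = energy f g S (y + x)"
  unfolding energy_def
  by (simp add: correlation_translate[OF assms(1) L1L2D(1)[OF modulate_L1L2[OF assms(2)]]])

lemma fst_borel_measurable[measurable]: "fst \<in> borel_measurable (borel :: ('a::euclidean_space \<times> 'b::euclidean_space) measure)"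
  by (rule borel_measurable_continuous_onI) (intro continuous_intros)

lemma snd_borel_measurable[measurable]: "snd \<in> borel_measurable (borel :: ('a::euclidean_space \<times> 'b::euclidean_space) measure)"
  by (rule borel_measurable_continuous_onI) (intro continuous_intros)

lemma fourier_box_density:
  assumes "w > 0"
  shows "(\<integral>s. indicator {- w..w} s *\<^sub>R cis (- 2 * pi * (s * u)) \<partial>lborel) = of_real (2 * w) * fourier (box_density w) u"
proof -
  have "of_real (2 * w) * fourier (box_density w) u = (\<integral>s. of_real (2 * w) * (box_density w s * cis (- 2 * pi * (s \<bullet> u))) \<partial>lborel)"
    by (subst fourier_eq_lborel) simp_all
  also have "\<dots> = (\<integral>s. indicator {- w..w} s *\<^sub>R cis (- 2 * pi * (s * u)) \<partial>lborel)"
    using assms by (intro Bochner_Integration.integral_cong) (auto simp: box_density_eq indicator_def)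
  finally show ?thesis ..
qed

lemma fourier_box_density_minus: "w > 0 \<Longrightarrow> fourier (box_density w) (- u) = fourier (box_density w) u"
proof -
  assume w: "w > 0"
  have "fourier (box_density w) (- u) = (\<integral>s. box_density w s * cis (- 2 * pi * (s \<bullet> (- u))) \<partial>lborel)"
    by (subst fourier_eq_lborel) simp_all
  also have "\<dots> = (\<integral>s. box_density w (0 - s) * cis (- 2 * pi * ((0 - s) \<bullet> (- u))) \<partial>lborel)"
    by (rule lborel_reflect(1)) simp
  also have "\<dots> = (\<integral>s. box_density w s * cis (- 2 * pi * (s \<bullet> u)) \<partial>lborel)"
    using w by (intro Bochner_Integration.integral_cong) (auto simp: box_density_eq indicator_def)
  finally show ?thesis by (simp add: fourier_eq_lborel)
qed

lemma fourier_box_density_0: "w > 0 \<Longrightarrow> fourier (box_density w) 0 = 1"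
  by (simp add: fourier_eq_lborel integral_box_density)

lemma integral_lborel_times:
  fixes f :: "'a::euclidean_space \<Rightarrow> complex" and g :: "'b::euclidean_space \<Rightarrow> complex"
  assumes f: "integrable lborel f" and g: "integrable lborel g"
  shows "(\<integral>y. f (fst y) * g (snd y) \<partial>lborel) = (\<integral>x. f x \<partial>lborel) * (\<integral>x. g x \<partial>lborel)"
proof -
  have [measurable]: "f \<in> borel_measurable borel" "g \<in> borel_measurable borel" using f g by auto
  have "integrable (lborel \<Otimes>\<^sub>M lborel) (\<lambda>(x, y). f x * g y)"
    by (rule lborel_pair.Fubini_integrable) (use f g in \<open>auto simp: norm_mult case_prod_beta\<close>)
  from lborel_pair.integral_fst[OF this]
  have "(\<integral>y. f (fst y) * g (snd y) \<partial>lborel) = (\<integral>x. (\<integral>y. f x * g y \<partial>lborel) \<partial>lborel)"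
    by (simp add: lborel_prod case_prod_beta')
  then show ?thesis by simp
qed

text \<open>The bound is uniform in the centre \<open>z\<close>, because the enlarged ball of radius
  \<open>R + \<rho>\<close> has the same volume everywhere.\<close>

lemma (in lattice_frame) lat_ball_bound:
  obtains n where "n \<ge> 0" "\<And>z. (\<integral>\<^sup>+\<gamma>. indicator (cball z R) \<gamma> \<partial>count_space lat) \<le> ennreal n"
proof -
  obtain \<rho> where \<rho>: "\<rho> > 0" "\<And>y. norm (reduce 0 y) \<le> \<rho>" using cell_size by blast
  define V where "V = measure lborel (cball (0::'a) (R + \<rho>))"
  have em: "emeasure lborel (cball z (R + \<rho>)) = ennreal V" for z :: 'a
  proof -
    have "emeasure lborel (cball z (R + \<rho>)) = (\<integral>\<^sup>+y. indicator (cball z (R + \<rho>)) (z + y) \<partial>lborel)"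
      using lborel_shift(3)[of "indicator (cball z (R + \<rho>)) :: 'a \<Rightarrow> ennreal" z, OF borel_measurable_indicator] by simp
    also have "\<dots> = (\<integral>\<^sup>+y. indicator (cball (0::'a) (R + \<rho>)) y \<partial>lborel)"
      by (intro nn_integral_cong) (auto simp: indicator_def dist_norm)
    also have "\<dots> = ennreal V"
      using emeasure_bounded_finite[of "cball (0::'a) (R + \<rho>)"] by (simp add: V_def emeasure_eq_ennreal_measure less_top)
    finally show ?thesis .
  qed
  have "(\<integral>\<^sup>+\<gamma>. indicator (cball z R) \<gamma> \<partial>count_space lat) \<le> ennreal (V / vol)" for z
  proof -
    have sub: "y \<in> cball z (R + \<rho>)" if "y - reduce 0 y \<in> cball z R" for y
    proof -
      have "dist z y \<le> dist z (y - reduce 0 y) + dist (y - reduce 0 y) y" by (rule dist_triangle)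
      then show ?thesis using that \<rho>(2)[of y] by (simp add: dist_norm)
    qed
    have "finite (lat \<inter> cball z R)" "vol * card (lat \<inter> cball z R) \<le> V"
      using card_lat_le[of "cball z (R + \<rho>)" V "cball z R"] em sub by (auto simp: V_def)
    then have "real (card (lat \<inter> cball z R)) \<le> V / vol" using vol_pos by (simp add: field_simps)
    moreover have "(\<integral>\<^sup>+\<gamma>. indicator (cball z R) \<gamma> \<partial>count_space lat) = ennreal (card (lat \<inter> cball z R))"
    proof -
      have "(\<integral>\<^sup>+\<gamma>. indicator (cball z R) \<gamma> \<partial>count_space lat) = (\<integral>\<^sup>+\<gamma>. indicator (lat \<inter> cball z R) \<gamma> \<partial>count_space lat)"
        by (intro nn_integral_cong) (auto simp: indicator_def)
      also have "\<dots> = emeasure (count_space lat) (lat \<inter> cball z R)"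
        by (rule nn_integral_indicator) simp
      finally show ?thesis using \<open>finite (lat \<inter> cball z R)\<close> by (simp add: ennreal_of_nat_eq_real_of_nat)
    qed
    ultimately show ?thesis by (simp add: ennreal_leI)
  qed
  then show ?thesis using vol_pos by (intro that[of "V / vol"]) (auto simp: V_def)
qed

text \<open>The setting after normalization: the window of the model set is [-w, w], genericity says
  that no lattice point lies over an endpoint, \<open>S\<close> is \<Delta>, and the
  \<open>g l\<close> are Borel representatives.\<close>

locale gabor_model = lattice_frame_strip B d
  for B :: "((real ^ 'm) \<times> real) set" and d +
  fixes S :: "(real ^ 'm) set" and g :: "nat \<Rightarrow> real ^ 'm \<Rightarrow> complex" and L :: nat and w :: real
  assumes g: "\<And>l. l \<in> {1..L} \<Longrightarrow> L1L2 (g l)"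
    and S: "uniform_discrete S"
    and w: "w > 0"
    and generic: "\<And>\<gamma>. \<gamma> \<in> lat \<Longrightarrow> \<bar>snd \<gamma>\<bar> \<noteq> w"
    and dense: "closure (snd ` lat) = UNIV"
begin

text \<open>In the terms of the overview, \<open>total\<close> is q, \<open>weight\<close> its
  product with the indicator of the window, \<open>folded\<close> the periodization and
  \<open>kernel\<close> the double sum in the frame condition.\<close>

definition total :: "(real ^ 'm \<Rightarrow> complex) \<Rightarrow> real ^ 'm \<Rightarrow> real" where
  "total f x = (\<Sum>l=1..L. energy f (g l) S x)"

definition weight :: "(real ^ 'm \<Rightarrow> complex) \<Rightarrow> (real ^ 'm) \<times> real \<Rightarrow> real" where
  "weight f y = total f (fst y) * indicator {- w..w} (snd y)"

definition folded :: "(real ^ 'm \<Rightarrow> complex) \<Rightarrow> (real ^ 'm) \<times> real \<Rightarrow> real" where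
  "folded f y = (\<integral>\<gamma>. weight f (y + \<gamma>) \<partial>count_space lat)"

definition kernel :: "real ^ 'm \<Rightarrow> real ^ 'm \<Rightarrow> complex" where
  "kernel p t = (\<Sum>l=1..L. \<Sum>\<^sub>\<infinity>b\<in>S. cnj (fourier (g l) (t - b)) * fourier (g l) (t - b - p))"

lemma obtain_bessel:
  assumes "test_fun M r f"
  obtains R C where "bessel_set S R C" "test_fun M R f"
proof -
  \<comment> \<open>The Bessel bound asks for a positive radius, while \<open>r\<close> may be zero
    or negative.\<close>
  define R where "R = \<bar>r\<bar> + 1"
  have R: "R > 0" "test_fun M R f" using assms by (auto simp: R_def test_fun_def)
  obtain C where "C > 0"
    "\<And>h. \<lbrakk>h \<in> borel_measurable borel; integrable lborel (\<lambda>t. (cmod (h t))\<^sup>2); \<And>t. h t \<noteq> 0 \<Longrightarrow> norm t \<le> R\<rbrakk>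
       \<Longrightarrow> (\<integral>\<^sup>+\<beta>. ennreal ((cmod (fourier h \<beta>))\<^sup>2) \<partial>count_space S) \<le> ennreal (C * (\<integral>t. (cmod (h t))\<^sup>2 \<partial>lborel))"
    using bessel_exponentials[OF S R(1)] by blast
  then have "bessel_set S R C"
    using R(1) uniform_discrete_imp_countable[OF S] by unfold_locales auto
  then show ?thesis using R(2) that by blast
qed

context
  fixes f :: "real ^ 'm \<Rightarrow> complex" and M r :: real
  assumes f: "test_fun M r f"
begin

lemma total_nonneg: "0 \<le> total f x"
  unfolding total_def by (intro sum_nonneg) (simp add: energy_def)

lemma weight_nonneg: "0 \<le> weight f y"
  unfolding weight_def by (simp add: total_nonneg)

lemma total_tendsto:
  assumes "x \<longlonglongrightarrow> x0"
  shows "(\<lambda>n. total f (x n)) \<longlonglongrightarrow> total f x0"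
proof -
  obtain R C where "bessel_set S R C" and fR: "test_fun M R f" using obtain_bessel[OF f] .
  then interpret bessel_set S R C by simp
  show ?thesis unfolding total_def
    by (intro tendsto_sum energy_tendsto[OF fR g assms])
qed

lemma total_measurable[measurable]: "total f \<in> borel_measurable borel"
proof -
  have "continuous_on UNIV (total f)"
    unfolding continuous_on_sequentially using total_tendsto by (auto simp: comp_def)
  then show ?thesis by (rule borel_measurable_continuous_onI)
qed

lemma weight_measurable[measurable]: "weight f \<in> borel_measurable borel"
  unfolding weight_def by measurable

lemma total_integrable: "integrable lborel (total f)"
proof -
  obtain R C where "bessel_set S R C" and fR: "test_fun M R f" using obtain_bessel[OF f] .
  then interpret bessel_set S R C by simp
  show ?thesis unfolding total_def[abs_def]
    by (intro Bochner_Integration.integrable_sum energy_lborel_integrable[OF fR g])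
qed

lemma
  shows kernel_integrable: "integrable lborel (\<lambda>t. fourier f t * cnj (fourier f (t - p)) * kernel p t)"
    and fourier_total: "(\<integral>x. of_real (total f x) * cis (- 2 * pi * (x \<bullet> p)) \<partial>lborel) =
      (\<integral>t. fourier f t * cnj (fourier f (t - p)) * kernel p t \<partial>lborel)"
proof -
  obtain R C where "bessel_set S R C" and fR: "test_fun M R f" using obtain_bessel[OF f] .
  then interpret bessel_set S R C by simp
  have eq: "fourier f t * cnj (fourier f (t - p)) * kernel p t = (\<Sum>l=1..L. fourier f t * cnj (fourier f (t - p)) *
      (\<Sum>\<^sub>\<infinity>b\<in>S. cnj (fourier (g l) (t - b)) * fourier (g l) (t - b - p)))" for t
    by (simp add: kernel_def sum_distrib_left)
  note ci = cross_integrable[OF fR g, of _ p]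
  show "integrable lborel (\<lambda>t. fourier f t * cnj (fourier f (t - p)) * kernel p t)"
    unfolding eq by (intro Bochner_Integration.integrable_sum ci)
  have ei: "integrable lborel (\<lambda>x. complex_of_real (energy f (g l) S x) * cis (- 2 * pi * (x \<bullet> p)))" if "l \<in> {1..L}" for l
    using energy_lborel_integrable[OF fR g[OF that]] by (intro integrable_mult_cis integrable_of_real) auto
  have "(\<integral>x. of_real (total f x) * cis (- 2 * pi * (x \<bullet> p)) \<partial>lborel) =
      (\<integral>x. (\<Sum>l=1..L. of_real (energy f (g l) S x) * cis (- 2 * pi * (x \<bullet> p))) \<partial>lborel)"
    by (simp add: total_def sum_distrib_right)
  also have "\<dots> = (\<Sum>l=1..L. \<integral>x. of_real (energy f (g l) S x) * cis (- 2 * pi * (x \<bullet> p)) \<partial>lborel)"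
    by (intro Bochner_Integration.integral_sum ei)
  also have "\<dots> = (\<Sum>l=1..L. \<integral>t. fourier f t * cnj (fourier f (t - p)) *
      (\<Sum>\<^sub>\<infinity>b\<in>S. cnj (fourier (g l) (t - b)) * fourier (g l) (t - b - p)) \<partial>lborel)"
    by (intro sum.cong refl fourier_energy[OF fR g])
  also have "\<dots> = (\<integral>t. fourier f t * cnj (fourier f (t - p)) * kernel p t \<partial>lborel)"
    unfolding eq by (intro Bochner_Integration.integral_sum[symmetric] ci)
  finally show "(\<integral>x. of_real (total f x) * cis (- 2 * pi * (x \<bullet> p)) \<partial>lborel) =
      (\<integral>t. fourier f t * cnj (fourier f (t - p)) * kernel p t \<partial>lborel)" .
qed

text \<open>A majorant valid on the whole unit ball around \<open>y'\<close>, as continuity of the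
  periodization requires; enlarging radius and window by 1 absorbs the movement of \<open>y\<close>.
  Summing the local masses over the lattice counts each point \<open>u\<close> at most as often as
  there are lattice points in a ball of fixed radius.\<close>

lemma weight_dominated:
  obtains h K where "K \<ge> 0" "\<And>y \<gamma>. 0 \<le> h y \<gamma>"
    "\<And>y y' \<gamma>. norm (y - y') \<le> 1 \<Longrightarrow> weight f (y + \<gamma>) \<le> h y' \<gamma>"
    "\<And>y. (\<integral>\<^sup>+\<gamma>. ennreal (h y \<gamma>) \<partial>count_space lat) \<le> ennreal K"
proof -
  obtain R C where bs: "bessel_set S R C" and fR: "test_fun M R f" using obtain_bessel[OF f] .
  then interpret bessel_set S R C by simp
  \<comment> \<open>A lattice vector that contributes at \<open>u\<close> has its first part within
    \<open>R + 1\<close> and its second part within \<open>w + 1\<close> of the parts of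
    \<open>(- fst y - u, - snd y)\<close>; the norm of a pair is at most the sum of the
    norms.\<close>
  obtain n where n: "n \<ge> 0" "\<And>z. (\<integral>\<^sup>+\<gamma>. indicator (cball z (R + 1 + (w + 1))) \<gamma> \<partial>count_space lat) \<le> ennreal n"
    using lat_ball_bound by blast
  define A where "A = C * M\<^sup>2"
  have A: "A \<ge> 0" using C by (simp add: A_def)
  define h where "h y \<gamma> = A * (\<Sum>l=1..L. local_energy (g l) (R + 1) (fst y + fst \<gamma>)) * indicator {- (w + 1)..w + 1} (snd y + snd \<gamma>)" for y \<gamma> :: "(real ^ 'm) \<times> real"
  define K where "K = A * (\<Sum>l=1..L. n * (\<integral>t. (cmod (g l t))\<^sup>2 \<partial>lborel))"
  have le0: "0 \<le> local_energy u r x" for u :: "real ^ 'm \<Rightarrow> complex" and r x by (simp add: local_energy_def)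
  show ?thesis
  proof (rule that)
    show "K \<ge> 0" unfolding K_def using A n by (intro mult_nonneg_nonneg sum_nonneg) auto
    show h0: "0 \<le> h y \<gamma>" for y \<gamma> unfolding h_def using A le0 by (intro mult_nonneg_nonneg sum_nonneg) auto
    show "weight f (y + \<gamma>) \<le> h y' \<gamma>" if y: "norm (y - y') \<le> 1" for y y' \<gamma>
    proof (cases "snd (y + \<gamma>) \<in> {- w..w}")
      case True
      have n1: "norm (fst y - fst y') \<le> 1" "\<bar>snd y - snd y'\<bar> \<le> 1"
        using y norm_fst_le[of "fst (y - y')" "snd (y - y')"] norm_snd_le[of "snd (y - y')" "fst (y - y')"]
        unfolding prod.collapse by auto
      then have "snd y' + snd \<gamma> \<in> {- (w + 1)..w + 1}" using True by auto
      moreover have "energy f (g l) S (fst y + fst \<gamma>) \<le> A * local_energy (g l) (R + 1) (fst y' + fst \<gamma>)" if l: "l \<in> {1..L}" for l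
      proof -
        have "energy f (g l) S (fst y + fst \<gamma>) \<le> A * local_energy (g l) R (fst y + fst \<gamma>)"
          unfolding A_def by (rule energy_le[OF fR g[OF l]])
        also have "\<dots> \<le> A * local_energy (g l) (R + 1) (fst y' + fst \<gamma>)"
          using n1 by (intro mult_left_mono[OF local_energy_mono[OF g[OF l]] A]) simp
        finally show ?thesis .
      qed
      then have "(\<Sum>l=1..L. energy f (g l) S (fst y + fst \<gamma>)) \<le> (\<Sum>l=1..L. A * local_energy (g l) (R + 1) (fst y' + fst \<gamma>))"
        by (rule sum_mono)
      ultimately show ?thesis using True by (simp add: weight_def total_def h_def sum_distrib_left)
    next
      case False
      then have "weight f (y + \<gamma>) = 0" by (simp add: weight_def)
      then show ?thesis using h0 by simp
    qed
    fix y :: "(real ^ 'm) \<times> real"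
    have single: "(\<integral>\<^sup>+\<gamma>. ennreal (local_energy (g l) (R + 1) (fst y + fst \<gamma>) * indicator {- (w + 1)..w + 1} (snd y + snd \<gamma>)) \<partial>count_space lat)
        \<le> ennreal (n * (\<integral>t. (cmod (g l t))\<^sup>2 \<partial>lborel))" if l: "l \<in> {1..L}" for l
    proof -
      have gl[measurable]: "g l \<in> borel_measurable borel" and g2: "integrable lborel (\<lambda>t. (cmod (g l t))\<^sup>2)"
        using L1L2D[OF g[OF l]] by auto
      have "ennreal (local_energy (g l) (R + 1) (fst y + fst \<gamma>) * indicator {- (w + 1)..w + 1} (snd y + snd \<gamma>)) \<le>
          (\<integral>\<^sup>+u. ennreal ((cmod (g l u))\<^sup>2) * indicator (cball (- fst y - u, - snd y) (R + 1 + (w + 1))) \<gamma> \<partial>lborel)" for \<gamma>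
      proof (cases "snd y + snd \<gamma> \<in> {- (w + 1)..w + 1}")
        case True
        have i: "integrable lborel (\<lambda>u. indicator (cball (- (fst y + fst \<gamma>)) (R + 1)) u * (cmod (g l u))\<^sup>2)"
          by (rule Bochner_Integration.integrable_bound[OF g2]) (auto simp: indicator_def)
        have "ennreal (local_energy (g l) (R + 1) (fst y + fst \<gamma>)) = (\<integral>\<^sup>+u. ennreal (indicator (cball (- (fst y + fst \<gamma>)) (R + 1)) u * (cmod (g l u))\<^sup>2) \<partial>lborel)"
          unfolding local_energy_def using i by (intro nn_integral_eq_integral[symmetric]) auto
        also have "\<dots> \<le> (\<integral>\<^sup>+u. ennreal ((cmod (g l u))\<^sup>2) * indicator (cball (- fst y - u, - snd y) (R + 1 + (w + 1))) \<gamma> \<partial>lborel)"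
        proof (rule nn_integral_mono)
          fix u
          have "\<gamma> \<in> cball (- fst y - u, - snd y) (R + 1 + (w + 1))" if u: "u \<in> cball (- (fst y + fst \<gamma>)) (R + 1)"
          proof -
            have "norm ((- fst y - u, - snd y) - \<gamma>) \<le> norm (- fst y - u - fst \<gamma>) + norm (- snd y - snd \<gamma>)"
              using norm_Pair_le[of "- fst y - u - fst \<gamma>" "- snd y - snd \<gamma>"] by (simp add: minus_prod_def)
            moreover have "norm (- fst y - u - fst \<gamma>) \<le> R + 1"
            proof -
              have "- (fst y + fst \<gamma>) - u = - fst y - u - fst \<gamma>" by (simp add: algebra_simps)
              then show ?thesis using u by (simp only: mem_cball dist_norm)
            qed
            moreover have "\<bar>- snd y - snd \<gamma>\<bar> \<le> w + 1" using True by auto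
            ultimately show ?thesis unfolding mem_cball dist_norm real_norm_def by linarith
          qed
          then show "ennreal (indicator (cball (- (fst y + fst \<gamma>)) (R + 1)) u * (cmod (g l u))\<^sup>2) \<le>
              ennreal ((cmod (g l u))\<^sup>2) * indicator (cball (- fst y - u, - snd y) (R + 1 + (w + 1))) \<gamma>"
            by (cases "u \<in> cball (- (fst y + fst \<gamma>)) (R + 1)") auto
        qed
        finally show ?thesis using True by simp
      qed simp
      then have "(\<integral>\<^sup>+\<gamma>. ennreal (local_energy (g l) (R + 1) (fst y + fst \<gamma>) * indicator {- (w + 1)..w + 1} (snd y + snd \<gamma>)) \<partial>count_space lat) \<le>
         (\<integral>\<^sup>+\<gamma>. \<integral>\<^sup>+u. ennreal ((cmod (g l u))\<^sup>2) * indicator (cball (- fst y - u, - snd y) (R + 1 + (w + 1))) \<gamma> \<partial>lborel \<partial>count_space lat)"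
        by (intro nn_integral_mono)
      also have "\<dots> = (\<integral>\<^sup>+u. \<integral>\<^sup>+\<gamma>. ennreal ((cmod (g l u))\<^sup>2) * indicator (cball (- fst y - u, - snd y) (R + 1 + (w + 1))) \<gamma> \<partial>count_space lat \<partial>lborel)"
      proof (rule nn_integral_count_space_nn_integral[OF countable_lat, symmetric])
        fix \<gamma>
        have "(\<lambda>u. indicator (cball (- fst y - u, - snd y) (R + 1 + (w + 1))) \<gamma> :: ennreal) =
            (\<lambda>u. indicator {u. dist (- fst y - u, - snd y) \<gamma> \<le> R + 1 + (w + 1)} u)" by (auto simp: indicator_def)
        moreover have "closed {u. dist (- fst y - u, - snd y) \<gamma> \<le> R + 1 + (w + 1)}"
          by (intro closed_Collect_le continuous_intros)
        ultimately have [measurable]: "(\<lambda>u. indicator (cball (- fst y - u, - snd y) (R + 1 + (w + 1))) \<gamma> :: ennreal) \<in> borel_measurable borel"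
          by (simp add: borel_closed)
        show "(\<lambda>u. ennreal ((cmod (g l u))\<^sup>2) * indicator (cball (- fst y - u, - snd y) (R + 1 + (w + 1))) \<gamma>) \<in> borel_measurable lborel"
          by measurable
      qed
      also have "\<dots> \<le> (\<integral>\<^sup>+u. ennreal ((cmod (g l u))\<^sup>2) * ennreal n \<partial>lborel)"
      proof (rule nn_integral_mono)
        fix u
        have "(\<integral>\<^sup>+\<gamma>. ennreal ((cmod (g l u))\<^sup>2) * indicator (cball (- fst y - u, - snd y) (R + 1 + (w + 1))) \<gamma> \<partial>count_space lat) =
          ennreal ((cmod (g l u))\<^sup>2) * (\<integral>\<^sup>+\<gamma>. indicator (cball (- fst y - u, - snd y) (R + 1 + (w + 1))) \<gamma> \<partial>count_space lat)"
          by (rule nn_integral_cmult) simp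
        also have "\<dots> \<le> ennreal ((cmod (g l u))\<^sup>2) * ennreal n" by (intro mult_left_mono n(2)) simp
        finally show "(\<integral>\<^sup>+\<gamma>. ennreal ((cmod (g l u))\<^sup>2) * indicator (cball (- fst y - u, - snd y) (R + 1 + (w + 1))) \<gamma> \<partial>count_space lat) \<le> ennreal ((cmod (g l u))\<^sup>2) * ennreal n" .
      qed
      also have "\<dots> = ennreal (\<integral>t. (cmod (g l t))\<^sup>2 \<partial>lborel) * ennreal n"
        using g2 by (simp add: nn_integral_multc nn_integral_eq_integral)
      also have "\<dots> = ennreal (n * (\<integral>t. (cmod (g l t))\<^sup>2 \<partial>lborel))"
        using n(1) by (simp add: mult.commute flip: ennreal_mult)
      finally show ?thesis .
    qed
    have "(\<integral>\<^sup>+\<gamma>. ennreal (h y \<gamma>) \<partial>count_space lat) =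
      (\<integral>\<^sup>+\<gamma>. ennreal A * (\<Sum>l=1..L. ennreal (local_energy (g l) (R + 1) (fst y + fst \<gamma>) * indicator {- (w + 1)..w + 1} (snd y + snd \<gamma>))) \<partial>count_space lat)"
    proof (rule nn_integral_cong)
      fix \<gamma>
      define a where "a l = local_energy (g l) (R + 1) (fst y + fst \<gamma>) * indicator {- (w + 1)..w + 1} (snd y + snd \<gamma>)" for l
      have a0: "0 \<le> a l" for l by (simp add: a_def le0)
      have "h y \<gamma> = A * (\<Sum>l=1..L. a l)"
        unfolding h_def a_def by (simp only: sum_distrib_right mult.assoc)
      then have "ennreal (h y \<gamma>) = ennreal A * (\<Sum>l=1..L. ennreal (a l))"
        by (simp only: ennreal_mult[OF A sum_nonneg[OF a0]] sum_ennreal[OF a0])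
      then show "ennreal (h y \<gamma>) = ennreal A * (\<Sum>l=1..L. ennreal (local_energy (g l) (R + 1) (fst y + fst \<gamma>) * indicator {- (w + 1)..w + 1} (snd y + snd \<gamma>)))"
        by (simp only: a_def)
    qed
    also have "\<dots> = ennreal A * (\<Sum>l=1..L. (\<integral>\<^sup>+\<gamma>. ennreal (local_energy (g l) (R + 1) (fst y + fst \<gamma>) * indicator {- (w + 1)..w + 1} (snd y + snd \<gamma>)) \<partial>count_space lat))"
      by (simp add: nn_integral_cmult nn_integral_sum)
    also have "\<dots> \<le> ennreal A * (\<Sum>l=1..L. ennreal (n * (\<integral>t. (cmod (g l t))\<^sup>2 \<partial>lborel)))"
      by (intro mult_left_mono sum_mono single) auto
    also have "\<dots> = ennreal K"
    proof -
      have a0: "0 \<le> n * (\<integral>t. (cmod (g l t))\<^sup>2 \<partial>lborel)" for l using n(1) by simp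
      show ?thesis unfolding K_def by (simp only: ennreal_mult[OF A sum_nonneg[OF a0]] sum_ennreal[OF a0])
    qed
    finally show "(\<integral>\<^sup>+\<gamma>. ennreal (h y \<gamma>) \<partial>count_space lat) \<le> ennreal K" .
  qed
qed

lemma
  shows weight_integrable: "integrable (count_space lat) (\<lambda>\<gamma>. weight f (y + \<gamma>))"
    and nn_integral_folded: "(\<integral>\<^sup>+\<gamma>. ennreal (weight f (y + \<gamma>)) \<partial>count_space lat) = ennreal (folded f y)"
    and folded_nonneg: "0 \<le> folded f y"
proof -
  obtain h K where h: "K \<ge> 0" "\<And>y \<gamma>. 0 \<le> h y \<gamma>" "\<And>y y' \<gamma>. norm (y - y') \<le> 1 \<Longrightarrow> weight f (y + \<gamma>) \<le> h y' \<gamma>"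
    "\<And>y. (\<integral>\<^sup>+\<gamma>. ennreal (h y \<gamma>) \<partial>count_space lat) \<le> ennreal K"
    by (rule weight_dominated[OF that])
  have "(\<integral>\<^sup>+\<gamma>. ennreal (weight f (y + \<gamma>)) \<partial>count_space lat) \<le> (\<integral>\<^sup>+\<gamma>. ennreal (h y \<gamma>) \<partial>count_space lat)"
    using h(3)[of y y] by (intro nn_integral_mono ennreal_leI) simp
  also have "\<dots> \<le> ennreal K" by (rule h)
  also have "\<dots> < \<infinity>" by simp
  finally show i: "integrable (count_space lat) (\<lambda>\<gamma>. weight f (y + \<gamma>))"
    using weight_nonneg by (intro integrableI_bounded) auto
  show "(\<integral>\<^sup>+\<gamma>. ennreal (weight f (y + \<gamma>)) \<partial>count_space lat) = ennreal (folded f y)"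
    unfolding folded_def using i weight_nonneg by (intro nn_integral_eq_integral) auto
  show "0 \<le> folded f y" unfolding folded_def using weight_nonneg by simp
qed

lemma folded_bounded: "\<exists>K. \<forall>y. \<bar>folded f y\<bar> \<le> K"
proof -
  obtain h K where h: "K \<ge> 0" "\<And>y \<gamma>. 0 \<le> h y \<gamma>" "\<And>y y' \<gamma>. norm (y - y') \<le> 1 \<Longrightarrow> weight f (y + \<gamma>) \<le> h y' \<gamma>"
    "\<And>y. (\<integral>\<^sup>+\<gamma>. ennreal (h y \<gamma>) \<partial>count_space lat) \<le> ennreal K"
    by (rule weight_dominated[OF that])
  have "folded f y \<le> K" for y
  proof -
    have "ennreal (folded f y) \<le> (\<integral>\<^sup>+\<gamma>. ennreal (h y \<gamma>) \<partial>count_space lat)"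
      unfolding nn_integral_folded[symmetric] using h(3)[of y y] by (intro nn_integral_mono ennreal_leI) simp
    also have "\<dots> \<le> ennreal K" by (rule h)
    finally show ?thesis using h(1) by simp
  qed
  then show ?thesis using folded_nonneg by (intro exI[of _ K]) simp
qed

lemma folded_measurable[measurable]: "folded f \<in> borel_measurable borel"
proof -
  have "folded f = (\<lambda>y. enn2real (\<integral>\<^sup>+\<gamma>. ennreal (weight f (y + \<gamma>)) \<partial>count_space lat))"
    by (simp add: fun_eq_iff nn_integral_folded folded_nonneg)
  also have "\<dots> \<in> borel_measurable borel"
    by (intro borel_measurable_enn2real borel_measurable_nn_integral_count_space[OF countable_lat]) measurable
  finally show ?thesis .
qed

text \<open>Each term is continuous at \<open>y0\<close>: \<open>total\<close> is continuous, and
  the second coordinate avoids the two jumps of the window. The majorant then allows the limit under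
  the sum.\<close>

lemma folded_isCont:
  assumes y0: "\<And>\<gamma>. \<gamma> \<in> lat \<Longrightarrow> \<bar>snd y0 + snd \<gamma>\<bar> \<noteq> w"
  shows "isCont (folded f) y0"
  unfolding continuous_at_sequentially
proof (intro allI impI)
  fix y :: "nat \<Rightarrow> (real ^ 'm) \<times> real" assume y: "y \<longlonglongrightarrow> y0"
  obtain h K where h: "K \<ge> 0" "\<And>y \<gamma>. 0 \<le> h y \<gamma>" "\<And>y y' \<gamma>. norm (y - y') \<le> 1 \<Longrightarrow> weight f (y + \<gamma>) \<le> h y' \<gamma>"
    "\<And>y. (\<integral>\<^sup>+\<gamma>. ennreal (h y \<gamma>) \<partial>count_space lat) \<le> ennreal K"
    by (rule weight_dominated[OF that])
  \<comment> \<open>The majorant holds within distance 1 of \<open>y0\<close>; the finitely many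
    terms outside are replaced by \<open>y0\<close>, so that domination holds for all
    \<open>n\<close>.\<close>
  define z where "z n = (if norm (y n - y0) \<le> 1 then y n else y0)" for n
  have ev: "\<forall>\<^sub>F n in sequentially. z n = y n"
    using tendstoD[OF y, of 1] by (auto simp: z_def dist_norm elim!: eventually_mono)
  have z: "z \<longlonglongrightarrow> y0" using y ev by (simp add: tendsto_cong)
  have "(\<lambda>n. folded f (z n)) \<longlonglongrightarrow> folded f y0"
    unfolding folded_def
  proof (rule integral_dominated_convergence[where w="h y0"])
    show "integrable (count_space lat) (h y0)"
      using h(4)[of y0] h(2) by (intro integrableI_bounded) (auto simp: less_top[symmetric] top_unique)
    show "AE \<gamma> in count_space lat. norm (weight f (z n + \<gamma>)) \<le> h y0 \<gamma>" for n
      using h(3)[of "z n" y0] weight_nonneg by (auto simp: AE_count_space z_def)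
    show "AE \<gamma> in count_space lat. (\<lambda>n. weight f (z n + \<gamma>)) \<longlonglongrightarrow> weight f (y0 + \<gamma>)"
      unfolding AE_count_space
    proof
      fix \<gamma> assume \<gamma>: "\<gamma> \<in> lat"
      have t: "(\<lambda>n. total f (fst (z n + \<gamma>))) \<longlonglongrightarrow> total f (fst (y0 + \<gamma>))"
        by (rule total_tendsto) (intro tendsto_intros z)
      have s: "(\<lambda>n. \<bar>snd (z n + \<gamma>)\<bar>) \<longlonglongrightarrow> \<bar>snd (y0 + \<gamma>)\<bar>" by (intro tendsto_intros z)
      have "\<forall>\<^sub>F n in sequentially. (indicator {- w..w} (snd (z n + \<gamma>)) :: real) = indicator {- w..w} (snd (y0 + \<gamma>))"
      proof (cases "\<bar>snd (y0 + \<gamma>)\<bar> < w")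
        case True
        from order_tendstoD(2)[OF s True] show ?thesis
          by eventually_elim (use True in \<open>auto simp: indicator_def\<close>)
      next
        case False
        then have gt: "\<bar>snd (y0 + \<gamma>)\<bar> > w" using y0[OF \<gamma>] by simp
        from order_tendstoD(1)[OF s gt] show ?thesis
          by eventually_elim (use gt in \<open>auto simp: indicator_def\<close>)
      qed
      then have "(\<lambda>n. indicator {- w..w} (snd (z n + \<gamma>)) :: real) \<longlonglongrightarrow> indicator {- w..w} (snd (y0 + \<gamma>))"
        by (rule tendsto_eventually)
      with t show "(\<lambda>n. weight f (z n + \<gamma>)) \<longlonglongrightarrow> weight f (y0 + \<gamma>)"
        unfolding weight_def by (rule tendsto_mult)
    qed
  qed simp_all
  moreover have "\<forall>\<^sub>F n in sequentially. folded f (z n) = (folded f \<circ> y) n" using ev by eventually_elim simp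
  ultimately show "(folded f \<circ> y) \<longlonglongrightarrow> folded f y0" by (rule Lim_transform_eventually)
qed

text \<open>Unfolding replaces the cell by the whole product space, where weight and character are
  products and the integral splits into one factor for each projection.\<close>

lemma folded_coefficient:
  assumes \<eta>: "\<eta> \<in> dual_lattice lat"
  shows "(\<integral>y. (indicator (cell z) y * folded f y) *\<^sub>R cis (- 2 * pi * (y \<bullet> \<eta>)) \<partial>lborel) =
     (\<integral>t. fourier f t * cnj (fourier f (t - fst \<eta>)) * kernel (fst \<eta>) t \<partial>lborel) * (of_real (2 * w) * fourier (box_density w) (snd \<eta>))"
proof -
  have m\<eta>: "- \<eta> \<in> dual_lattice lat" using \<eta> by (auto simp: dual_lattice_def)
  have per: "cis (- 2 * pi * ((y + \<gamma>) \<bullet> \<eta>)) = cis (- 2 * pi * (y \<bullet> \<eta>))" if "\<gamma> \<in> lat" for y \<gamma>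
    using periodic_cis[OF m\<eta> that, of y] by simp
  have "(\<integral>y. (indicator (cell z) y * folded f y) *\<^sub>R cis (- 2 * pi * (y \<bullet> \<eta>)) \<partial>lborel) =
      (\<integral>y. weight f y *\<^sub>R cis (- 2 * pi * (y \<bullet> \<eta>)) \<partial>lborel)"
    by (rule fold_integral[symmetric]) (use per weight_nonneg folded_nonneg nn_integral_folded in auto)
  also have "\<dots> = (\<integral>y. (of_real (total f (fst y)) * cis (- 2 * pi * (fst y \<bullet> fst \<eta>))) *
      (indicator {- w..w} (snd y) *\<^sub>R cis (- 2 * pi * (snd y * snd \<eta>))) \<partial>lborel)"
  proof (intro Bochner_Integration.integral_cong refl)
    fix y :: "(real ^ 'm) \<times> real"
    have "cis (- 2 * pi * (y \<bullet> \<eta>)) = cis (- 2 * pi * (fst y \<bullet> fst \<eta>)) * cis (- 2 * pi * (snd y * snd \<eta>))"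
      by (simp add: cis_mult inner_prod_def distrib_left)
    then show "weight f y *\<^sub>R cis (- 2 * pi * (y \<bullet> \<eta>)) = (of_real (total f (fst y)) * cis (- 2 * pi * (fst y \<bullet> fst \<eta>))) *
      (indicator {- w..w} (snd y) *\<^sub>R cis (- 2 * pi * (snd y * snd \<eta>)))"
      by (simp add: weight_def scaleR_conv_of_real mult_ac)
  qed
  also have "\<dots> = (\<integral>x. of_real (total f x) * cis (- 2 * pi * (x \<bullet> fst \<eta>)) \<partial>lborel) *
      (\<integral>s. indicator {- w..w} s *\<^sub>R cis (- 2 * pi * (s * snd \<eta>)) \<partial>lborel)"
  proof (rule integral_lborel_times)
    show "integrable lborel (\<lambda>x. complex_of_real (total f x) * cis (- 2 * pi * (x \<bullet> fst \<eta>)))"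
      using total_integrable by (intro integrable_mult_cis integrable_of_real) auto
    have "integrable lborel (\<lambda>s. complex_of_real (indicator {- w..w} s) * cis (- 2 * pi * (s * snd \<eta>)))"
      by (intro integrable_mult_cis integrable_of_real) (use w in \<open>auto simp: integrable_indicator_iff\<close>)
    then show "integrable lborel (\<lambda>s. indicator {- w..w} s *\<^sub>R cis (- 2 * pi * (s * snd \<eta>)))"
      by (simp add: scaleR_conv_of_real)
  qed
  finally show ?thesis by (simp only: fourier_total fourier_box_density[OF w])
qed

end

end

section \<open>Borel representatives and the passage from test functions to L2\<close>

lemma AE_lborel_shift:
  assumes "AE u in lborel. P (u :: 'a::euclidean_space)"
  shows "AE t in lborel. P (t - x)"
proof -
  obtain N where N: "N \<in> sets lborel" "emeasure lborel N = 0" "{u. \<not> P u} \<subseteq> N"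
    using AE_E[OF assms] by auto
  have [measurable]: "N \<in> sets borel" using N(1) by simp
  have "(\<integral>\<^sup>+t. indicator N (t - x) \<partial>lborel) = 0"
    using lborel_shift(3)[of "indicator N" "- x"] N(2) by simp
  then have "AE t in lborel. indicator N (t - x) = (0::ennreal)"
    by (subst (asm) nn_integral_0_iff_AE) measurable
  then show ?thesis
    by eventually_elim (use N(3) in \<open>auto simp: indicator_def split: if_splits\<close>)
qed

lemma lebesgue_measurable_obtain_borel:
  fixes f :: "'a::euclidean_space \<Rightarrow> complex"
  assumes [measurable]: "f \<in> borel_measurable lebesgue"
  obtains f' where "f' \<in> borel_measurable borel" "AE x in lborel. f x = f' x"
proof -
  have "(\<lambda>x. Re (f x)) \<in> borel_measurable lebesgue" "(\<lambda>x. Im (f x)) \<in> borel_measurable lebesgue" by measurable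
  then obtain a b where [measurable]: "a \<in> borel_measurable lborel" "b \<in> borel_measurable lborel"
    and ab: "AE x in lborel. Re (f x) = a x" "AE x in lborel. Im (f x) = b x"
    using completion_ex_borel_measurable_real by metis
  show ?thesis
  proof (rule that[of "\<lambda>x. Complex (a x) (b x)"])
    have "(\<lambda>x. complex_of_real (a x) + \<i> * complex_of_real (b x)) \<in> borel_measurable borel" by measurable
    then show "(\<lambda>x. Complex (a x) (b x)) \<in> borel_measurable borel" by (simp add: Complex_eq)
    show "AE x in lborel. f x = Complex (a x) (b x)"
      using ab by eventually_elim (simp add: complex_eq_iff)
  qed
qed

lemma integral_lebesgue_cong_AE:
  fixes f :: "'a::euclidean_space \<Rightarrow> complex"
  assumes f': "f' \<in> borel_measurable borel" and AE: "AE x in lborel. f x = f' x"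
  shows "(\<integral>x. f x \<partial>lebesgue) = (\<integral>x. f' x \<partial>lborel)"
proof -
  have m: "f' \<in> borel_measurable lebesgue" using f' by (simp add: measurable_completion)
  have AE': "AE x in lebesgue. f x = f' x" using AE by (rule AE_completion)
  have "f \<in> borel_measurable lebesgue"
    by (rule borel_measurable_AE[OF m]) (use AE' in \<open>auto elim: eventually_mono\<close>)
  then have "(\<integral>x. f x \<partial>lebesgue) = (\<integral>x. f' x \<partial>lebesgue)" using m AE' by (intro integral_cong_AE)
  also have "\<dots> = (\<integral>x. f' x \<partial>lborel)" using f' by (intro integral_completion) simp
  finally show ?thesis .
qed

lemma fourier_cong_AE:
  fixes g :: "'a::euclidean_space \<Rightarrow> complex"
  assumes [measurable]: "g' \<in> borel_measurable borel" and AE: "AE x in lborel. g x = g' x"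
  shows "fourier g = fourier g'"
proof
  fix w
  show "fourier g w = fourier g' w"
    unfolding fourier_eq_lborel[OF assms(1)] unfolding fourier_def
    by (rule integral_lebesgue_cong_AE) (use AE in \<open>auto elim: eventually_mono\<close>)
qed

lemma L2_inner_gabor:
  fixes f g :: "'a::euclidean_space \<Rightarrow> complex"
  assumes f'[measurable]: "f' \<in> borel_measurable borel" and f: "AE x in lborel. f x = f' x"
    and g': "L1L2 g'" and g: "AE x in lborel. g x = g' x"
  shows "L2_inner f (translate x (modulate b g)) = correlation f' (modulate b g') x"
  unfolding correlation_def L2_inner_def
proof (rule integral_lebesgue_cong_AE)
  have [measurable]: "modulate b g' \<in> borel_measurable borel" using L1L2D(1)[OF modulate_L1L2[OF g']] .
  show "(\<lambda>t. f' t * cnj (modulate b g' (t - x))) \<in> borel_measurable borel" by measurable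
  show "AE t in lborel. f t * cnj (translate x (modulate b g) t) = f' t * cnj (modulate b g' (t - x))"
    using f AE_lborel_shift[OF g, of x] by eventually_elim (simp add: translate_def modulate_def)
qed

text \<open>Frame sums are computed as nonnegative integrals, which can be rearranged before
  convergence is known; this ties them to \<open>has_sum\<close>.\<close>

lemma has_sum_iff_nn_integral:
  fixes a :: "'j \<Rightarrow> real"
  assumes a: "\<And>j. j \<in> A \<Longrightarrow> 0 \<le> a j" and s: "0 \<le> s"
  shows "(a has_sum s) A \<longleftrightarrow> (\<integral>\<^sup>+j. ennreal (a j) \<partial>count_space A) = ennreal s"
proof -
  have eq: "a summable_on A \<longleftrightarrow> integrable (count_space A) a"
  proof -
    have "a summable_on A \<longleftrightarrow> (\<lambda>j. norm (a j)) summable_on A"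
      using a by (intro summable_on_cong) simp
    then show ?thesis
      using abs_summable_equivalent[of a A] by (simp add: Infinite_Set_Sum.abs_summable_on_def)
  qed
  have inf: "infsum a A = (\<integral>j. a j \<partial>count_space A)" if "integrable (count_space A) a"
    using infsetsum_infsum[of a A] that by (simp add: infsetsum_def Infinite_Set_Sum.abs_summable_on_def)
  have nn: "(\<integral>\<^sup>+j. ennreal (a j) \<partial>count_space A) = ennreal (\<integral>j. a j \<partial>count_space A)" if "integrable (count_space A) a"
    using that a by (intro nn_integral_eq_integral) (auto simp: AE_count_space)
  show ?thesis
  proof
    assume hs: "(a has_sum s) A"
    then have i: "integrable (count_space A) a" using eq by (auto simp: summable_on_def)
    then show "(\<integral>\<^sup>+j. ennreal (a j) \<partial>count_space A) = ennreal s"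
      using nn inf infsumI[OF hs] by simp
  next
    assume nns: "(\<integral>\<^sup>+j. ennreal (a j) \<partial>count_space A) = ennreal s"
    have "(\<integral>\<^sup>+j. ennreal (norm (a j)) \<partial>count_space A) = (\<integral>\<^sup>+j. ennreal (a j) \<partial>count_space A)"
      using a by (intro nn_integral_cong) simp
    then have i: "integrable (count_space A) a" using nns by (intro integrableI_bounded) auto
    have "0 \<le> (\<integral>j. a j \<partial>count_space A)" using a by (intro integral_nonneg_AE) (auto simp: AE_count_space)
    then have "infsum a A = s" using nn[OF i] nns inf[OF i] s by simp
    moreover have "a summable_on A" using eq i by simp
    ultimately show "(a has_sum s) A" using has_sum_infsum by blast
  qed
qed

text \<open>Equality on truncations gives Bessel's inequality on all of L2 by Fatou's lemma. So the
  coefficient map is a contraction into l2, and both norms pass to the limit along the truncations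
  of \<open>f\<close>.\<close>

lemma tight_on_test_functions_imp_tight:
  fixes \<phi> :: "'j \<Rightarrow> 'a::euclidean_space \<Rightarrow> complex"
  assumes \<phi>m: "\<And>j. j \<in> J \<Longrightarrow> \<phi> j \<in> borel_measurable borel"
    and \<phi>2: "\<And>j. j \<in> J \<Longrightarrow> integrable lborel (\<lambda>t. (cmod (\<phi> j t))\<^sup>2)"
    and tight: "\<And>M r f. test_fun M r f \<Longrightarrow>
      (\<integral>\<^sup>+j. ennreal ((cmod (\<integral>t. f t * cnj (\<phi> j t) \<partial>lborel))\<^sup>2) \<partial>count_space J) = ennreal (\<integral>t. (cmod (f t))\<^sup>2 \<partial>lborel)"
    and f[measurable]: "f \<in> borel_measurable borel" and f2: "integrable lborel (\<lambda>t. (cmod (f t))\<^sup>2)"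
  shows "(\<integral>\<^sup>+j. ennreal ((cmod (\<integral>t. f t * cnj (\<phi> j t) \<partial>lborel))\<^sup>2) \<partial>count_space J) = ennreal (\<integral>t. (cmod (f t))\<^sup>2 \<partial>lborel)"
proof -
  define a where "a h j = (\<integral>t. h t * cnj (\<phi> j t) \<partial>lborel)" for h :: "'a \<Rightarrow> complex" and j
  have trunc: "test_fun (real n) (real n) (truncation n h)" if "h \<in> borel_measurable borel" for n and h :: "'a \<Rightarrow> complex"
    using that truncation_support[of n h] by (auto simp: test_fun_def truncation_bound)
  have trunc2: "integrable lborel (\<lambda>t. (cmod (truncation n h t))\<^sup>2)" if "h \<in> borel_measurable borel" for n and h :: "'a \<Rightarrow> complex"
    using L1L2D(3)[OF test_fun_L1L2[OF trunc[OF that]]] .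
  have a_diff: "a u j - a v j = a (\<lambda>t. u t - v t) j"
    if [measurable]: "u \<in> borel_measurable borel" "v \<in> borel_measurable borel"
    and "integrable lborel (\<lambda>t. (cmod (u t))\<^sup>2)" "integrable lborel (\<lambda>t. (cmod (v t))\<^sup>2)" and j: "j \<in> J" for u v j
  proof -
    have [measurable]: "\<phi> j \<in> borel_measurable borel" using \<phi>m[OF j] .
    have "integrable lborel (\<lambda>t. u t * cnj (\<phi> j t))" "integrable lborel (\<lambda>t. v t * cnj (\<phi> j t))"
      using that \<phi>2[OF j] by (auto intro!: square_integrable_mult)
    then show ?thesis by (simp add: a_def left_diff_distrib)
  qed
  have a_cs: "(cmod (a u j))\<^sup>2 \<le> (\<integral>t. (cmod (u t))\<^sup>2 \<partial>lborel) * (\<integral>t. (cmod (\<phi> j t))\<^sup>2 \<partial>lborel)"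
    if [measurable]: "u \<in> borel_measurable borel" and "integrable lborel (\<lambda>t. (cmod (u t))\<^sup>2)" and j: "j \<in> J" for u j
  proof -
    have [measurable]: "\<phi> j \<in> borel_measurable borel" using \<phi>m[OF j] .
    show ?thesis unfolding a_def
      using cauchy_schwarz_integral[of u lborel "\<lambda>t. cnj (\<phi> j t)"] that \<phi>2[OF j] by simp
  qed
  have a_lim: "(\<lambda>n. a (truncation n h) j) \<longlonglongrightarrow> a h j"
    if h[measurable]: "h \<in> borel_measurable borel" and h2: "integrable lborel (\<lambda>t. (cmod (h t))\<^sup>2)" and j: "j \<in> J" for h j
  proof -
    let ?K = "\<integral>t. (cmod (\<phi> j t))\<^sup>2 \<partial>lborel"
    have d2: "integrable lborel (\<lambda>t. (cmod (h t - truncation n h t))\<^sup>2)" for n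
      using square_integrable_diff[of h lborel "truncation n h"] h2 trunc2[OF h] by simp
    have le: "(cmod (a h j - a (truncation n h) j))\<^sup>2 \<le> (\<integral>t. (cmod (h t - truncation n h t))\<^sup>2 \<partial>lborel) * ?K" for n
      using a_cs[OF _ d2 j] a_diff[OF h _ h2 trunc2[OF h] j] by simp
    have lim: "(\<lambda>n. (\<integral>t. (cmod (h t - truncation n h t))\<^sup>2 \<partial>lborel) * ?K) \<longlonglongrightarrow> 0"
      using tendsto_mult_right[OF truncation_L2[OF h h2], of ?K] by simp
    have "(\<lambda>n. (cmod (a h j - a (truncation n h) j))\<^sup>2) \<longlonglongrightarrow> 0"
      by (rule tendsto_sandwich[OF _ _ tendsto_const lim]) (use le in auto)
    then have "(\<lambda>n. sqrt ((cmod (a h j - a (truncation n h) j))\<^sup>2)) \<longlonglongrightarrow> sqrt 0" by (intro tendsto_intros)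
    then have "(\<lambda>n. cmod (a (truncation n h) j - a h j)) \<longlonglongrightarrow> 0" by (simp add: norm_minus_commute)
    then have "(\<lambda>n. a (truncation n h) j - a h j) \<longlonglongrightarrow> 0" by (simp add: tendsto_norm_zero_iff)
    then show ?thesis by (simp add: LIM_zero_iff)
  qed
  have bessel: "(\<integral>\<^sup>+j. ennreal ((cmod (a h j))\<^sup>2) \<partial>count_space J) \<le> ennreal (\<integral>t. (cmod (h t))\<^sup>2 \<partial>lborel)"
    if h[measurable]: "h \<in> borel_measurable borel" and h2: "integrable lborel (\<lambda>t. (cmod (h t))\<^sup>2)" for h
  proof -
    have "(\<integral>\<^sup>+j. ennreal ((cmod (a h j))\<^sup>2) \<partial>count_space J) = (\<integral>\<^sup>+j. liminf (\<lambda>n. ennreal ((cmod (a (truncation n h) j))\<^sup>2)) \<partial>count_space J)"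
    proof (rule nn_integral_cong)
      fix j assume "j \<in> space (count_space J)"
      then have "(\<lambda>n. ennreal ((cmod (a (truncation n h) j))\<^sup>2)) \<longlonglongrightarrow> ennreal ((cmod (a h j))\<^sup>2)"
        by (intro tendsto_ennrealI tendsto_intros a_lim h h2) simp
      then show "ennreal ((cmod (a h j))\<^sup>2) = liminf (\<lambda>n. ennreal ((cmod (a (truncation n h) j))\<^sup>2))"
        by (rule lim_imp_Liminf[OF trivial_limit_sequentially, symmetric])
    qed
    also have "\<dots> \<le> liminf (\<lambda>n. \<integral>\<^sup>+j. ennreal ((cmod (a (truncation n h) j))\<^sup>2) \<partial>count_space J)"
      by (rule nn_integral_liminf) simp
    also have "\<dots> = liminf (\<lambda>n. ennreal (\<integral>t. (cmod (truncation n h t))\<^sup>2 \<partial>lborel))"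
      unfolding a_def by (simp add: tight[OF trunc[OF h]])
    also have "\<dots> \<le> liminf (\<lambda>n::nat. ennreal (\<integral>t. (cmod (h t))\<^sup>2 \<partial>lborel))"
    proof (rule Liminf_mono, rule always_eventually, rule allI)
      fix n
      have "(\<integral>t. (cmod (truncation n h t))\<^sup>2 \<partial>lborel) \<le> (\<integral>t. (cmod (h t))\<^sup>2 \<partial>lborel)"
        using trunc2[OF h] h2 truncation_le(1) by (intro integral_mono) (auto intro!: power_mono)
      then show "ennreal (\<integral>t. (cmod (truncation n h t))\<^sup>2 \<partial>lborel) \<le> ennreal (\<integral>t. (cmod (h t))\<^sup>2 \<partial>lborel)"
        by (rule ennreal_leI)
    qed
    also have "\<dots> = ennreal (\<integral>t. (cmod (h t))\<^sup>2 \<partial>lborel)" by (rule Liminf_const) simp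
    finally show ?thesis .
  qed
  have bi: "integrable (count_space J) (\<lambda>j. (cmod (a h j))\<^sup>2)"
    if "h \<in> borel_measurable borel" "integrable lborel (\<lambda>t. (cmod (h t))\<^sup>2)" for h
    using bessel[OF that] by (intro integrableI_bounded) (auto simp: less_top[symmetric] top_unique)
  have bl: "(\<integral>\<^sup>+j. ennreal ((cmod (a h j))\<^sup>2) \<partial>count_space J) = ennreal (\<integral>j. (cmod (a h j))\<^sup>2 \<partial>count_space J)"
    if "h \<in> borel_measurable borel" "integrable lborel (\<lambda>t. (cmod (h t))\<^sup>2)" for h
    using bi[OF that] by (intro nn_integral_eq_integral) auto
  define u where "u n = truncation n f" for n
  have um[measurable]: "u n \<in> borel_measurable borel" for n by (simp add: u_def)
  have u2: "integrable lborel (\<lambda>t. (cmod (u n t))\<^sup>2)" for n unfolding u_def by (rule trunc2[OF f])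
  have d2: "integrable lborel (\<lambda>t. (cmod (u n t - f t))\<^sup>2)" for n
    using square_integrable_diff[of "u n" lborel f] f2 u2 by simp
  have limd: "(\<lambda>n. \<integral>t. (cmod (u n t - f t))\<^sup>2 \<partial>lborel) \<longlonglongrightarrow> 0"
    using truncation_L2[OF f f2] by (simp add: u_def norm_minus_commute)
  have "(\<lambda>n. \<integral>j. (cmod (a (u n) j))\<^sup>2 \<partial>count_space J) \<longlonglongrightarrow> (\<integral>j. (cmod (a f j))\<^sup>2 \<partial>count_space J)"
  proof (rule L2_norm_tendsto[OF _ _ bi[OF f f2] bi[OF um u2]])
    have le: "(\<integral>j. (cmod (a (u n) j - a f j))\<^sup>2 \<partial>count_space J) \<le> (\<integral>t. (cmod (u n t - f t))\<^sup>2 \<partial>lborel)" for n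
    proof -
      have dm: "(\<lambda>t. u n t - f t) \<in> borel_measurable borel" by measurable
      have "(\<integral>j. (cmod (a (u n) j - a f j))\<^sup>2 \<partial>count_space J) = (\<integral>j. (cmod (a (\<lambda>t. u n t - f t) j))\<^sup>2 \<partial>count_space J)"
        by (intro Bochner_Integration.integral_cong refl) (simp add: a_diff[OF um f u2 f2])
      moreover have "ennreal (\<integral>j. (cmod (a (\<lambda>t. u n t - f t) j))\<^sup>2 \<partial>count_space J) \<le> ennreal (\<integral>t. (cmod (u n t - f t))\<^sup>2 \<partial>lborel)"
        using bessel[OF dm d2] bl[OF dm d2] by simp
      ultimately show ?thesis by (simp add: ennreal_le_iff)
    qed
    show "(\<lambda>n. \<integral>j. (cmod (a (u n) j - a f j))\<^sup>2 \<partial>count_space J) \<longlonglongrightarrow> 0"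
      by (rule tendsto_sandwich[OF _ _ tendsto_const limd]) (use le in auto)
  qed simp_all
  moreover have "(\<integral>j. (cmod (a (u n) j))\<^sup>2 \<partial>count_space J) = (\<integral>t. (cmod (u n t))\<^sup>2 \<partial>lborel)" for n
  proof -
    have "ennreal (\<integral>j. (cmod (a (u n) j))\<^sup>2 \<partial>count_space J) = ennreal (\<integral>t. (cmod (u n t))\<^sup>2 \<partial>lborel)"
      using tight[OF trunc[OF f, of n]] bl[OF um u2, of n] by (simp add: a_def u_def)
    then show ?thesis by simp
  qed
  moreover have "(\<lambda>n. \<integral>t. (cmod (u n t))\<^sup>2 \<partial>lborel) \<longlonglongrightarrow> (\<integral>t. (cmod (f t))\<^sup>2 \<partial>lborel)"
    by (rule L2_norm_tendsto[OF _ _ f2 u2 limd]) simp_all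
  ultimately have "(\<integral>j. (cmod (a f j))\<^sup>2 \<partial>count_space J) = (\<integral>t. (cmod (f t))\<^sup>2 \<partial>lborel)"
    using LIMSEQ_unique by simp
  then show ?thesis using bl[OF f f2] by (simp add: a_def)
qed

section \<open>Equivalence of the frame property with the conditions on the Fourier side\<close>

context gabor_model
begin

lemma folded_periodic:
  assumes "\<gamma>0 \<in> lat"
  shows "folded f (y + \<gamma>0) = folded f y"
proof -
  have "bij_betw (\<lambda>\<gamma>. \<gamma>0 + \<gamma>) lat lat"
    by (rule bij_betwI[where g="\<lambda>\<gamma>. \<gamma> - \<gamma>0"]) (use assms lat_add lat_diff in auto)
  from integral_bij_count_space[OF this, of "\<lambda>\<gamma>. weight f (y + \<gamma>)"]
  show ?thesis by (simp add: folded_def add.assoc)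
qed

lemma folded_translate:
  assumes "f \<in> borel_measurable borel"
  shows "folded f (x, 0) = folded (translate (- x) f) 0"
proof -
  have "total (translate (- x) f) z = total f (x + z)" for z
    unfolding total_def by (intro sum.cong refl energy_translate[OF assms g])
  then show ?thesis unfolding folded_def weight_def by simp
qed

text \<open>The condition of the theorem with density and \<Phi> replaced by their computed values;
  as the transform of the box is even, \<open>snd \<eta>\<close> stands in for its negative.\<close>

definition tight_condition :: bool where
  "tight_condition \<longleftrightarrow> (\<forall>\<eta>\<in>dual_lattice lat. AE t in lborel.
     of_real (2 * w / vol) * fourier (box_density w) (snd \<eta>) * kernel (fst \<eta>) t = (if \<eta> = 0 then 1 else 0))"

text \<open>The difference between the periodization and the constant \<open>E\<close> is tested at
  the single point 0, through the cell centred there.\<close>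

lemma tight_condition_imp_folded:
  assumes cond: tight_condition and f: "test_fun M r f"
  shows "folded f 0 = (\<integral>t. (cmod (f t))\<^sup>2 \<partial>lborel)"
proof -
  define E where "E = (\<integral>t. (cmod (f t))\<^sup>2 \<partial>lborel)"
  have fL: "L1L2 f" by (rule test_fun_L1L2[OF f])
  have [measurable]: "f \<in> borel_measurable borel" by (rule L1L2D(1)[OF fL])
  let ?z = "0 - mid"
  obtain K where K: "\<And>y. \<bar>folded f y\<bar> \<le> K" using folded_bounded[OF f] by blast
  have coeff: "(\<integral>y. (indicator (cell ?z) y * folded f y) *\<^sub>R cis (- 2 * pi * (y \<bullet> \<eta>)) \<partial>lborel) = (if \<eta> = 0 then of_real (vol * E) else 0)"
    if \<eta>: "\<eta> \<in> dual_lattice lat" for \<eta>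
  proof -
    let ?c = "of_real (2 * w) * fourier (box_density w) (snd \<eta>)"
    have "(\<integral>y. (indicator (cell ?z) y * folded f y) *\<^sub>R cis (- 2 * pi * (y \<bullet> \<eta>)) \<partial>lborel) =
       (\<integral>t. fourier f t * cnj (fourier f (t - fst \<eta>)) * kernel (fst \<eta>) t * ?c \<partial>lborel)"
      unfolding folded_coefficient[OF f \<eta>] by (rule integral_mult_left_zero[symmetric])
    also have "\<dots> = (\<integral>t. fourier f t * cnj (fourier f (t - fst \<eta>)) * (if \<eta> = 0 then of_real vol else 0) \<partial>lborel)"
    proof (rule integral_cong_AE)
      show "(\<lambda>t. fourier f t * cnj (fourier f (t - fst \<eta>)) * kernel (fst \<eta>) t * ?c) \<in> borel_measurable lborel"
        using borel_measurable_integrable[OF kernel_integrable[OF f, of "fst \<eta>"]] by (rule borel_measurable_times) simp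
      have "AE t in lborel. of_real (2 * w / vol) * fourier (box_density w) (snd \<eta>) * kernel (fst \<eta>) t = (if \<eta> = 0 then 1 else 0)"
        using cond \<eta> unfolding tight_condition_def by blast
      then show "AE t in lborel. fourier f t * cnj (fourier f (t - fst \<eta>)) * kernel (fst \<eta>) t * ?c =
         fourier f t * cnj (fourier f (t - fst \<eta>)) * (if \<eta> = 0 then of_real vol else 0)"
      proof eventually_elim
        case (elim t)
        have "kernel (fst \<eta>) t * ?c = of_real vol * (of_real (2 * w / vol) * fourier (box_density w) (snd \<eta>) * kernel (fst \<eta>) t)"
          using vol_pos by (simp add: field_simps)
        also have "\<dots> = (if \<eta> = 0 then of_real vol else 0)" unfolding elim by simp
        finally show ?case by (simp only: mult.assoc)
      qed
    qed measurable
    also have "\<dots> = (if \<eta> = 0 then of_real (vol * E) else 0)"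
    proof (cases "\<eta> = 0")
      case True
      have "(\<integral>t. fourier f t * cnj (fourier f t) * of_real vol \<partial>lborel) = (\<integral>t. f t * cnj (f t) \<partial>lborel) * of_real vol"
        by (simp add: parseval[OF L1L2D(2,3)[OF fL] L1L2D(2,3)[OF fL]])
      also have "(\<integral>t. f t * cnj (f t) \<partial>lborel) = of_real E"
        unfolding E_def complex_norm_square[symmetric] integral_complex_of_real ..
      finally show ?thesis using True by (simp add: mult.commute)
    qed simp
    finally show ?thesis .
  qed
  have "folded f 0 - E = 0"
  proof (rule zero_fourier_coeffs_imp_zero[where H="\<lambda>y. folded f y - E" and x=0 and M="K + \<bar>E\<bar>"])
    show "(\<lambda>y. folded f y - E) \<in> borel_measurable borel" using folded_measurable[OF f] by measurable
    show "\<bar>folded f y - E\<bar> \<le> K + \<bar>E\<bar>" for y using K[of y] by linarith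
    have "isCont (folded f) 0" by (rule folded_isCont[OF f]) (use generic in simp)
    then show "isCont (\<lambda>y. folded f y - E) 0" by (intro continuous_intros)
    fix \<eta> assume \<eta>: "\<eta> \<in> dual_lattice lat"
    then have m\<eta>: "- \<eta> \<in> dual_lattice lat" by (auto simp: dual_lattice_def)
    let ?c = "\<lambda>y. cis (2 * pi * (y \<bullet> \<eta>))"
    have i1: "integrable lborel (\<lambda>y. (indicator (cell ?z) y * folded f y) *\<^sub>R ?c y)"
      by (rule integrable_cell_cis[OF folded_measurable[OF f] K]) auto
    have i2: "integrable lborel (\<lambda>y. (indicator (cell ?z) y * E) *\<^sub>R ?c y)"
      by (rule integrable_cell_cis[of "\<lambda>_. E" "\<bar>E\<bar>"]) auto
    have "(\<integral>y. (indicator (cell ?z) y * (folded f y - E)) *\<^sub>R ?c y \<partial>lborel) =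
      (\<integral>y. (indicator (cell ?z) y * folded f y) *\<^sub>R ?c y \<partial>lborel) - (\<integral>y. (indicator (cell ?z) y * E) *\<^sub>R ?c y \<partial>lborel)"
      unfolding right_diff_distrib scaleR_diff_left by (rule Bochner_Integration.integral_diff[OF i1 i2])
    \<comment> \<open>\<open>coeff\<close> carries the opposite sign of the frequency; the dual
      lattice is symmetric, so it is applied to -\<eta>.\<close>
    also have "(\<integral>y. (indicator (cell ?z) y * folded f y) *\<^sub>R ?c y \<partial>lborel) = (if \<eta> = 0 then of_real (vol * E) else 0)"
      using coeff[OF m\<eta>] by simp
    also have "(\<integral>y. (indicator (cell ?z) y * E) *\<^sub>R ?c y \<partial>lborel) = E *\<^sub>R (\<integral>y. indicator (cell ?z) y *\<^sub>R ?c y \<partial>lborel)"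
      by (subst integral_scaleR_right[symmetric]) (simp_all add: mult.commute)
    also have "\<dots> = (if \<eta> = 0 then of_real (vol * E) else 0)"
      unfolding integral_cell_cis[OF \<eta>] by (simp add: scaleR_conv_of_real)
    finally show "(\<integral>y. (indicator (cell ?z) y * (folded f y - E)) *\<^sub>R ?c y \<partial>lborel) = 0" by simp
  qed
  then show ?thesis by (simp add: E_def)
qed

lemma AE_generic: "AE y in (lborel :: ((real ^ 'm) \<times> real) measure). \<forall>\<gamma>\<in>lat. \<bar>snd y + snd \<gamma>\<bar> \<noteq> w"
proof -
  have "AE y in (lborel :: ((real ^ 'm) \<times> real) measure). snd y \<noteq> c" for c :: real
  proof (rule AE_I')
    have "emeasure (lborel :: ((real ^ 'm) \<times> real) measure) (UNIV \<times> {c}) = 0"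
      by (simp add: lborel_prod[symmetric] lborel.emeasure_pair_measure_Times)
    then show "UNIV \<times> {c} \<in> null_sets (lborel :: ((real ^ 'm) \<times> real) measure)"
      by (auto simp: null_sets_def intro!: borel_closed closed_Times)
    show "{y \<in> space (lborel :: ((real ^ 'm) \<times> real) measure). \<not> snd y \<noteq> c} \<subseteq> UNIV \<times> {c}" by auto
  qed
  then have "AE y in (lborel :: ((real ^ 'm) \<times> real) measure). snd y \<noteq> w - snd \<gamma> \<and> snd y \<noteq> - w - snd \<gamma>" for \<gamma> :: "(real ^ 'm) \<times> real"
    by (intro AE_conjI)
  then have "AE y in (lborel :: ((real ^ 'm) \<times> real) measure). \<bar>snd y + snd \<gamma>\<bar> \<noteq> w" for \<gamma> :: "(real ^ 'm) \<times> real"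
    by (rule eventually_mono) (auto simp: abs_if split: if_splits)
  then show ?thesis by (simp add: AE_ball_countable[OF countable_lat])
qed

text \<open>Periodicity and translation of \<open>f\<close> give the value of the folded energy on all slices over the
  second projection of the lattice; these are dense, and the folded energy is continuous at
  generic points.\<close>

lemma folded_imp_tight_condition:
  assumes folded0: "\<And>M r f. test_fun M r f \<Longrightarrow> folded f 0 = (\<integral>t. (cmod (f t))\<^sup>2 \<partial>lborel)"
  shows tight_condition
  unfolding tight_condition_def
proof
  fix \<eta> assume \<eta>: "\<eta> \<in> dual_lattice lat"
  let ?\<beta> = "fourier (box_density w) (snd \<eta>)"
  have AE_const: "AE y in lborel. folded f y = (\<integral>t. (cmod (f t))\<^sup>2 \<partial>lborel)" if f: "test_fun M r f" for M r f
    using AE_generic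
  proof eventually_elim
    case (elim y)
    have fm: "f \<in> borel_measurable borel" by (rule test_funD(1)[OF f])
    have lattice_level: "folded f (x, snd \<gamma>) = (\<integral>t. (cmod (f t))\<^sup>2 \<partial>lborel)" if \<gamma>: "\<gamma> \<in> lat" for x \<gamma>
    proof -
      let ?v = "x - fst \<gamma>"
      have "(x, snd \<gamma>) = (?v, 0) + \<gamma>" by (simp add: prod_eq_iff)
      then have "folded f (x, snd \<gamma>) = folded (translate (- ?v) f) 0"
        using folded_periodic[OF \<gamma>, of f "(?v, 0)"] folded_translate[OF fm, of ?v] by simp
      also have "\<dots> = (\<integral>t. (cmod (translate (- ?v) f t))\<^sup>2 \<partial>lborel)" by (rule folded0[OF test_fun_translate[OF f]])
      also have "\<dots> = (\<integral>t. (cmod (f t))\<^sup>2 \<partial>lborel)"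
        using square_integrable_shift(2)[OF fm L1L2D(3)[OF test_fun_L1L2[OF f]], of "- ?v"] by (simp add: translate_def)
      finally show ?thesis .
    qed
    have "snd y \<in> closure (snd ` lat)" using dense by simp
    then obtain s where s: "\<And>n. s n \<in> snd ` lat" "s \<longlonglongrightarrow> snd y" unfolding closure_sequential by blast
    have "(\<lambda>n. (fst y, s n)) \<longlonglongrightarrow> (fst y, snd y)" by (intro tendsto_intros s)
    then have "(\<lambda>n. folded f (fst y, s n)) \<longlonglongrightarrow> folded f y"
      using folded_isCont[OF f, of y] elim by (intro isCont_tendsto_compose[where g="folded f"]) auto
    moreover have "folded f (fst y, s n) = (\<integral>t. (cmod (f t))\<^sup>2 \<partial>lborel)" for n
      using s(1)[of n] lattice_level by auto
    ultimately show ?case by (simp add: LIMSEQ_const_iff)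
  qed
  have eq: "(\<integral>t. fourier f t * cnj (fourier f (t - fst \<eta>)) * kernel (fst \<eta>) t \<partial>lborel) * (of_real (2 * w) * ?\<beta>) =
      (if \<eta> = 0 then of_real (vol * (\<integral>t. (cmod (f t))\<^sup>2 \<partial>lborel)) else 0)" if f: "test_fun M r f" for M r f
  proof -
    define E where "E = (\<integral>t. (cmod (f t))\<^sup>2 \<partial>lborel)"
    have m\<eta>: "- \<eta> \<in> dual_lattice lat" using \<eta> by (auto simp: dual_lattice_def)
    have [measurable]: "folded f \<in> borel_measurable borel" by (rule folded_measurable[OF f])
    have "(\<integral>t. fourier f t * cnj (fourier f (t - fst \<eta>)) * kernel (fst \<eta>) t \<partial>lborel) * (of_real (2 * w) * ?\<beta>) =
      (\<integral>y. (indicator (cell 0) y * folded f y) *\<^sub>R cis (- 2 * pi * (y \<bullet> \<eta>)) \<partial>lborel)"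
      by (rule folded_coefficient[OF f \<eta>, symmetric])
    also have "\<dots> = (\<integral>y. E *\<^sub>R (indicator (cell 0) y *\<^sub>R cis (2 * pi * (y \<bullet> (- \<eta>)))) \<partial>lborel)"
    proof (rule integral_cong_AE)
      show "AE y in lborel. (indicator (cell 0) y * folded f y) *\<^sub>R cis (- 2 * pi * (y \<bullet> \<eta>)) = E *\<^sub>R (indicator (cell 0) y *\<^sub>R cis (2 * pi * (y \<bullet> (- \<eta>))))"
        using AE_const[OF f] by eventually_elim (simp add: E_def mult.commute)
    qed measurable
    also have "\<dots> = (if \<eta> = 0 then of_real (vol * E) else 0)"
      by (subst integral_scaleR_right) (simp_all only: integral_cell_cis[OF m\<eta>], auto simp: scaleR_conv_of_real)
    finally show ?thesis by (simp only: E_def)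
  qed
  show "AE t in lborel. of_real (2 * w / vol) * ?\<beta> * kernel (fst \<eta>) t = (if \<eta> = 0 then 1 else 0)"
  \<comment> \<open>If this factor vanishes, then \<eta> is not 0, since the transform at 0 is 1,
    and the condition reads 0 = 0 whatever the kernel is.\<close>
  proof (cases "?\<beta> = 0")
    case True
    then have "\<eta> \<noteq> 0" using fourier_box_density_0[OF w] by auto
    then show ?thesis using True by simp
  next
    case False
    \<comment> \<open>The constant that the kernel must equal almost everywhere; subtracting it
      turns the integral identity into a vanishing one, as polarization requires.\<close>
    define c where "c = (if \<eta> = 0 then of_real vol else 0) / (of_real (2 * w) * ?\<beta>)"
    have nz: "of_real (2 * w) * ?\<beta> \<noteq> 0" using False w by simp
    have "AE t in lborel. kernel (fst \<eta>) t - c = 0"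
    proof (rule vanishing_cross_terms_imp_AE_zero[where p="fst \<eta>"])
      fix M r and f :: "real ^ 'm \<Rightarrow> complex" assume f: "test_fun M r f"
      have fL: "L1L2 f" by (rule test_fun_L1L2[OF f])
      have [measurable]: "f \<in> borel_measurable borel" by (rule L1L2D(1)[OF fL])
      have F2: "integrable lborel (\<lambda>t. (cmod (fourier f t))\<^sup>2)" by (rule fourier_square_integrable[OF L1L2D(2,3)[OF fL]])
      have i1: "integrable lborel (\<lambda>t. fourier f t * cnj (fourier f (t - fst \<eta>)) * kernel (fst \<eta>) t)"
        by (rule kernel_integrable[OF f])
      have i0: "integrable lborel (\<lambda>t. fourier f t * cnj (fourier f (t - fst \<eta>)))"
        by (rule square_integrable_mult) (use F2 square_integrable_shift(1)[OF _ F2] in auto)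
      then have i2: "integrable lborel (\<lambda>t. fourier f t * cnj (fourier f (t - fst \<eta>)) * c)" by (rule integrable_mult_left)
      show "integrable lborel (\<lambda>t. fourier f t * cnj (fourier f (t - fst \<eta>)) * (kernel (fst \<eta>) t - c))"
        unfolding right_diff_distrib by (rule Bochner_Integration.integrable_diff[OF i1 i2])
      define X where "X = (\<integral>t. fourier f t * cnj (fourier f (t - fst \<eta>)) * kernel (fst \<eta>) t \<partial>lborel)"
      define Y where "Y = (\<integral>t. fourier f t * cnj (fourier f (t - fst \<eta>)) \<partial>lborel)"
      have "(\<integral>t. fourier f t * cnj (fourier f (t - fst \<eta>)) * (kernel (fst \<eta>) t - c) \<partial>lborel) = X - Y * c"
        unfolding right_diff_distrib X_def Y_def
        by (subst Bochner_Integration.integral_diff[OF i1 i2]) (simp only: integral_mult_left_zero)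
      also have "X = Y * c"
      proof -
        have "X * (of_real (2 * w) * ?\<beta>) = Y * (if \<eta> = 0 then of_real vol else 0)"
        proof (cases "\<eta> = 0")
          case True
          have "Y = (\<integral>t. f t * cnj (f t) \<partial>lborel)"
            unfolding Y_def using True by (simp add: parseval[OF L1L2D(2,3)[OF fL] L1L2D(2,3)[OF fL]])
          also have "\<dots> = of_real (\<integral>t. (cmod (f t))\<^sup>2 \<partial>lborel)"
            unfolding complex_norm_square[symmetric] integral_complex_of_real ..
          finally show ?thesis using eq[OF f] True by (simp add: X_def mult.commute)
        qed (use eq[OF f] in \<open>simp add: X_def\<close>)
        then show ?thesis using nz by (simp add: c_def field_simps)
      qed
      finally show "(\<integral>t. fourier f t * cnj (fourier f (t - fst \<eta>)) * (kernel (fst \<eta>) t - c) \<partial>lborel) = 0" by simp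
    qed
    then show ?thesis
    proof eventually_elim
      case (elim t)
      then have k: "kernel (fst \<eta>) t = c" by simp
      show ?case
      proof (cases "\<eta> = 0")
        case True
        then have "?\<beta> = 1" using fourier_box_density_0[OF w] by simp
        then show ?thesis unfolding k using True vol_pos w by (simp add: c_def)
      qed (simp add: k c_def)
    qed
  qed
qed

lemma countable_model_set: "countable (model_set lat {- w..w})"
proof -
  have "model_set lat {- w..w} \<subseteq> fst ` lat" by (force simp: model_set_def)
  then show ?thesis using countable_lat by (meson countable_image countable_subset)
qed

text \<open>Tonelli sums over the frequencies first; injectivity of the first projection then
  indexes the model set by the lattice points over the window, and extension by 0 to the whole
  lattice gives the periodization at 0.\<close>

lemma frame_sum:
  assumes inj: "inj_on fst lat" and f: "test_fun M r f"
  shows "(\<integral>\<^sup>+(l, x, b). ennreal ((cmod (correlation f (modulate b (g l)) x))\<^sup>2) \<partial>count_space (gabor_index L (model_set lat {- w..w}) S)) =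
    ennreal (folded f 0)"
proof -
  let ?X = "model_set lat {- w..w}" and ?F = "\<lambda>l x b. ennreal ((cmod (correlation f (modulate b (g l)) x))\<^sup>2)"
  have cS: "countable S" by (rule uniform_discrete_imp_countable[OF S])
  obtain R C where "bessel_set S R C" and fR: "test_fun M R f" using obtain_bessel[OF f] .
  then interpret bessel_set S R C by simp
  interpret S: sigma_finite_measure "count_space S" by (rule sigma_finite_measure_count_space_countable[OF cS])
  interpret XS: sigma_finite_measure "count_space (?X \<times> S)"
    by (rule sigma_finite_measure_count_space_countable) (use cS countable_model_set in auto)
  have "(\<integral>\<^sup>+(l, x, b). ?F l x b \<partial>count_space (gabor_index L ?X S)) =
     (\<integral>\<^sup>+p. (\<lambda>(l, x, b). ?F l x b) p \<partial>(count_space {1..L} \<Otimes>\<^sub>M count_space (?X \<times> S)))"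
    unfolding gabor_index_def using cS countable_model_set by (subst pair_measure_countable) auto
  also have "\<dots> = (\<integral>\<^sup>+l. \<integral>\<^sup>+q. (\<lambda>(x, b). ?F l x b) q \<partial>count_space (?X \<times> S) \<partial>count_space {1..L})"
    using cS countable_model_set by (subst XS.nn_integral_fst[symmetric]) (auto simp: pair_measure_countable case_prod_beta')
  also have "\<dots> = (\<integral>\<^sup>+l. \<integral>\<^sup>+x. \<integral>\<^sup>+b. ?F l x b \<partial>count_space S \<partial>count_space ?X \<partial>count_space {1..L})"
  proof (rule nn_integral_cong)
    fix l
    have "(\<integral>\<^sup>+q. (\<lambda>(x, b). ?F l x b) q \<partial>(count_space ?X \<Otimes>\<^sub>M count_space S)) = (\<integral>\<^sup>+x. \<integral>\<^sup>+b. ?F l x b \<partial>count_space S \<partial>count_space ?X)"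
      using cS countable_model_set by (subst S.nn_integral_fst[symmetric]) (auto simp: pair_measure_countable)
    then show "(\<integral>\<^sup>+q. (\<lambda>(x, b). ?F l x b) q \<partial>count_space (?X \<times> S)) = (\<integral>\<^sup>+x. \<integral>\<^sup>+b. ?F l x b \<partial>count_space S \<partial>count_space ?X)"
      using cS countable_model_set by (simp add: pair_measure_countable)
  qed
  also have "\<dots> = (\<Sum>l=1..L. \<integral>\<^sup>+x. ennreal (energy f (g l) S x) \<partial>count_space ?X)"
    by (subst nn_integral_count_space_finite) (auto intro!: sum.cong simp: nn_integral_energy[OF fR g])
  also have "\<dots> = (\<integral>\<^sup>+x. (\<Sum>l=1..L. ennreal (energy f (g l) S x)) \<partial>count_space ?X)"
    by (rule nn_integral_sum[symmetric]) simp
  also have "\<dots> = (\<integral>\<^sup>+x. ennreal (total f x) \<partial>count_space ?X)"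
    by (intro nn_integral_cong) (simp add: total_def sum_ennreal energy_def)
  also have "\<dots> = (\<integral>\<^sup>+\<gamma>. ennreal (total f (fst \<gamma>)) \<partial>count_space {\<gamma>\<in>lat. snd \<gamma> \<in> {- w..w}})"
  proof (rule nn_integral_bij_count_space[symmetric])
    show "bij_betw fst {\<gamma>\<in>lat. snd \<gamma> \<in> {- w..w}} ?X"
    proof (rule bij_betw_imageI)
      show "inj_on fst {\<gamma>\<in>lat. snd \<gamma> \<in> {- w..w}}" by (rule inj_on_subset[OF inj]) blast
      show "fst ` {\<gamma>\<in>lat. snd \<gamma> \<in> {- w..w}} = ?X" unfolding model_set_def by blast
    qed
  qed
  also have "\<dots> = (\<integral>\<^sup>+\<gamma>. ennreal (weight f (0 + \<gamma>)) \<partial>count_space lat)"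
  proof -
    have "(\<integral>\<^sup>+\<gamma>. ennreal (total f (fst \<gamma>)) \<partial>count_space {\<gamma>\<in>lat. snd \<gamma> \<in> {- w..w}}) = (\<integral>\<^sup>+\<gamma>. ennreal (weight f (0 + \<gamma>)) \<partial>count_space {\<gamma>\<in>lat. snd \<gamma> \<in> {- w..w}})"
      by (intro nn_integral_cong) (simp add: weight_def)
    also have "\<dots> = (\<integral>\<^sup>+\<gamma>. ennreal (weight f (0 + \<gamma>)) \<partial>count_space lat)"
      by (rule nn_integral_count_space_eq) (auto simp: weight_def)
    finally show ?thesis .
  qed
  also have "\<dots> = ennreal (folded f 0)" by (rule nn_integral_folded[OF f])
  finally show ?thesis .
qed

text \<open>The frame is formed with windows \<open>G\<close>, the analysis with their Borel
  representatives \<open>g\<close>; inner products ignore null sets. By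
  \<open>tight_on_test_functions_imp_tight\<close> it suffices to test with bounded functions of
  bounded support.\<close>

lemma tight_frame_iff:
  fixes G :: "nat \<Rightarrow> real ^ 'm \<Rightarrow> complex"
  assumes inj: "inj_on fst lat" and G: "\<And>l. l \<in> {1..L} \<Longrightarrow> AE t in lborel. G l t = g l t"
  shows "normalized_tight_frame (gabor_index L (model_set lat {- w..w}) S) (gabor_system G) \<longleftrightarrow> tight_condition"
proof -
  let ?J = "gabor_index L (model_set lat {- w..w}) S"
  have inner: "L2_inner f (gabor_system G j) = (\<lambda>(l, x, b). correlation f' (modulate b (g l)) x) j"
    if "f' \<in> borel_measurable borel" "AE t in lborel. f t = f' t" "j \<in> ?J" for f f' j
    using that L2_inner_gabor[OF that(1,2) g G] by (auto simp: gabor_index_def gabor_system_def)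
  have norm2: "(Lp_norm 2 f)\<^sup>2 = (\<integral>t. (cmod (f' t))\<^sup>2 \<partial>lborel)"
    if f': "f' \<in> borel_measurable borel" and AE: "AE t in lborel. f t = f' t" and fm: "f \<in> borel_measurable lebesgue" for f f' :: "real ^ 'm \<Rightarrow> complex"
  proof -
    have [measurable]: "f' \<in> borel_measurable borel" "f \<in> borel_measurable lebesgue" "f' \<in> borel_measurable lebesgue"
      using f' fm by (auto intro: measurable_completion)
    have "(\<integral>t. cmod (f t) powr 2 \<partial>lebesgue) = (\<integral>t. (cmod (f' t))\<^sup>2 \<partial>lebesgue)"
      using AE_completion[OF AE] by (intro integral_cong_AE) (auto elim: eventually_mono)
    also have "\<dots> = (\<integral>t. (cmod (f' t))\<^sup>2 \<partial>lborel)" by (rule integral_completion) simp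
    finally have *: "(\<integral>t. cmod (f t) powr 2 \<partial>lebesgue) = (\<integral>t. (cmod (f' t))\<^sup>2 \<partial>lborel)" .
    have "0 \<le> (\<integral>t. (cmod (f' t))\<^sup>2 \<partial>lborel)" by simp
    then show ?thesis unfolding Lp_norm_def * by (simp add: powr_half_sqrt)
  qed
  have sum_iff: "((\<lambda>j. (cmod (L2_inner f (gabor_system G j)))\<^sup>2) has_sum (Lp_norm 2 f)\<^sup>2) ?J \<longleftrightarrow>
      (\<integral>\<^sup>+(l, x, b). ennreal ((cmod (correlation f' (modulate b (g l)) x))\<^sup>2) \<partial>count_space ?J) = ennreal (\<integral>t. (cmod (f' t))\<^sup>2 \<partial>lborel)"
    if f': "f' \<in> borel_measurable borel" and AE: "AE t in lborel. f t = f' t" and fm: "f \<in> borel_measurable lebesgue" for f f'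
  proof -
    have "(\<integral>\<^sup>+j. ennreal ((cmod (L2_inner f (gabor_system G j)))\<^sup>2) \<partial>count_space ?J) =
      (\<integral>\<^sup>+(l, x, b). ennreal ((cmod (correlation f' (modulate b (g l)) x))\<^sup>2) \<partial>count_space ?J)"
      by (intro nn_integral_cong) (simp add: inner[OF f' AE] case_prod_beta)
    then show ?thesis by (subst has_sum_iff_nn_integral) (simp_all add: norm2[OF f' AE fm])
  qed
  have "normalized_tight_frame ?J (gabor_system G) \<longleftrightarrow>
     (\<forall>M r f. test_fun M r f \<longrightarrow> folded f 0 = (\<integral>t. (cmod (f t))\<^sup>2 \<partial>lborel))"
  proof (intro iffI allI impI)
    fix M r and f :: "real ^ 'm \<Rightarrow> complex" assume tf: "normalized_tight_frame ?J (gabor_system G)" and f: "test_fun M r f"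
    have fL: "L1L2 f" by (rule test_fun_L1L2[OF f])
    have fm: "f \<in> borel_measurable borel" "f \<in> borel_measurable lebesgue"
      using L1L2D(1)[OF fL] by (auto intro: measurable_completion)
    have "f \<in> Lp_space 2"
      using fm L1L2D(3)[OF fL] by (simp add: Lp_space_def integrable_completion)
    then have "((\<lambda>j. (cmod (L2_inner f (gabor_system G j)))\<^sup>2) has_sum (Lp_norm 2 f)\<^sup>2) ?J"
      using tf unfolding normalized_tight_frame_def by blast
    then have "ennreal (folded f 0) = ennreal (\<integral>t. (cmod (f t))\<^sup>2 \<partial>lborel)"
      using sum_iff[OF fm(1) _ fm(2)] frame_sum[OF inj f] by simp
    then show "folded f 0 = (\<integral>t. (cmod (f t))\<^sup>2 \<partial>lborel)" using folded_nonneg[OF f] by simp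
  next
    assume *: "\<forall>M r f. test_fun M r f \<longrightarrow> folded f 0 = (\<integral>t. (cmod (f t))\<^sup>2 \<partial>lborel)"
    show "normalized_tight_frame ?J (gabor_system G)"
      unfolding normalized_tight_frame_def
    proof
      fix f :: "real ^ 'm \<Rightarrow> complex" assume "f \<in> Lp_space 2"
      then have fm[measurable]: "f \<in> borel_measurable lebesgue" and fi: "integrable lebesgue (\<lambda>t. cmod (f t) powr 2)"
        by (auto simp: Lp_space_def)
      obtain f' where f'[measurable]: "f' \<in> borel_measurable borel" and AE: "AE t in lborel. f t = f' t"
        using lebesgue_measurable_obtain_borel[OF fm] .
      have [measurable]: "f' \<in> borel_measurable lebesgue" using f' by (simp add: measurable_completion)
      have "integrable lebesgue (\<lambda>t. (cmod (f' t))\<^sup>2)"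
        by (rule Bochner_Integration.integrable_cong_AE[THEN iffD1, OF _ _ _ fi])
          (use AE_completion[OF AE] in \<open>auto elim: eventually_mono\<close>)
      then have f2: "integrable lborel (\<lambda>t. (cmod (f' t))\<^sup>2)" by (simp add: integrable_completion)
      define \<phi> where "\<phi> = (\<lambda>(l, x, b) t. modulate b (g l) (t - x))"
      have \<phi>: "\<phi> j \<in> borel_measurable borel \<and> integrable lborel (\<lambda>t. (cmod (\<phi> j t))\<^sup>2)" if j: "j \<in> ?J" for j
      proof -
        obtain l x b where j': "j = (l, x, b)" "l \<in> {1..L}" using j by (auto simp: gabor_index_def)
        have L: "L1L2 (modulate b (g l))" by (rule modulate_L1L2[OF g[OF j'(2)]])
        have [measurable]: "modulate b (g l) \<in> borel_measurable borel" by (rule L1L2D(1)[OF L])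
        show ?thesis using square_integrable_shift(1)[OF _ L1L2D(3)[OF L], of x] by (simp add: \<phi>_def j'(1))
      qed
      have corr: "(\<integral>t. h t * cnj (\<phi> j t) \<partial>lborel) = (\<lambda>(l, x, b). correlation h (modulate b (g l)) x) j" for h j
        by (cases j) (simp add: \<phi>_def correlation_def)
      have "(\<integral>\<^sup>+j. ennreal ((cmod (\<integral>t. f' t * cnj (\<phi> j t) \<partial>lborel))\<^sup>2) \<partial>count_space ?J) = ennreal (\<integral>t. (cmod (f' t))\<^sup>2 \<partial>lborel)"
      proof (rule tight_on_test_functions_imp_tight)
        fix M r and h :: "real ^ 'm \<Rightarrow> complex" assume h: "test_fun M r h"
        show "(\<integral>\<^sup>+j. ennreal ((cmod (\<integral>t. h t * cnj (\<phi> j t) \<partial>lborel))\<^sup>2) \<partial>count_space ?J) = ennreal (\<integral>t. (cmod (h t))\<^sup>2 \<partial>lborel)"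
          using frame_sum[OF inj h] * h by (simp add: corr case_prod_beta')
      qed (use \<phi> f2 in auto)
      then show "((\<lambda>j. (cmod (L2_inner f (gabor_system G j)))\<^sup>2) has_sum (Lp_norm 2 f)\<^sup>2) ?J"
        unfolding sum_iff[OF f' AE fm] by (simp add: corr case_prod_beta')
    qed
  qed
  then show ?thesis
    using tight_condition_imp_folded folded_imp_tight_condition by blast
qed

end

section \<open>The amalgam space and the proof of the theorem\<close>

lemma countable_integer_points: "countable (integer_points :: (real ^ 'm) set)"
proof -
  have "(integer_points :: (real ^ 'm) set) \<subseteq> range (\<lambda>c :: 'm \<Rightarrow> int. \<chi> i. of_int (c i))"
  proof
    fix k :: "real ^ 'm" assume "k \<in> integer_points"
    then have "k $ i = of_int \<lfloor>k $ i\<rfloor>" for i by (simp add: integer_points_def)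
    then have "k = (\<chi> i. of_int \<lfloor>k $ i\<rfloor>)" by (simp add: vec_eq_iff)
    then show "k \<in> range (\<lambda>c :: 'm \<Rightarrow> int. \<chi> i. of_int (c i))" by (rule image_eqI[where x="\<lambda>i. \<lfloor>k $ i\<rfloor>"]) simp
  qed
  then show ?thesis by (rule countable_subset) simp
qed

text \<open>An inequality, because the closed unit cubes overlap on their faces and are only used as
  a cover.\<close>

lemma nn_integral_le_sum_unit_cubes:
  fixes f :: "real ^ 'm \<Rightarrow> ennreal"
  assumes [measurable]: "f \<in> borel_measurable borel"
  shows "(\<integral>\<^sup>+t. f t \<partial>lborel) \<le> (\<integral>\<^sup>+k. (\<integral>\<^sup>+t. f t * indicator (cube k 1) t \<partial>lborel) \<partial>count_space integer_points)"
proof -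
  have [measurable]: "cube k 1 \<in> sets borel" for k :: "real ^ 'm" by (rule cube_measurable) simp
  have "(\<integral>\<^sup>+t. f t \<partial>lborel) \<le> (\<integral>\<^sup>+t. (\<integral>\<^sup>+k. f t * indicator (cube k 1) t \<partial>count_space integer_points) \<partial>lborel)"
  proof (rule nn_integral_mono)
    fix t :: "real ^ 'm"
    let ?k = "(\<chi> i. of_int \<lfloor>t $ i\<rfloor>) :: real ^ 'm"
    have k: "?k \<in> integer_points" "t \<in> cube ?k 1" by (auto simp: integer_points_def mem_cube intro: less_imp_le)
    have "f t = (\<integral>\<^sup>+k. f t * indicator {?k} k \<partial>count_space integer_points)"
      using k(1) by (simp add: nn_integral_cmult one_ennreal_def[symmetric])
    also have "\<dots> \<le> (\<integral>\<^sup>+k. f t * indicator (cube k 1) t \<partial>count_space integer_points)"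
      using k(2) by (intro nn_integral_mono) (auto simp: indicator_def)
    finally show "f t \<le> (\<integral>\<^sup>+k. f t * indicator (cube k 1) t \<partial>count_space integer_points)" .
  qed
  also have "\<dots> = (\<integral>\<^sup>+k. (\<integral>\<^sup>+t. f t * indicator (cube k 1) t \<partial>lborel) \<partial>count_space integer_points)"
    by (rule nn_integral_count_space_nn_integral[OF countable_integer_points]) measurable
  finally show ?thesis .
qed

text \<open>On a cube of measure 1 the L1 norm is at most the L2 norm, so the sum of the local norms
  bounds the L1 norm. The same sum bounds every single local norm, whence the squares are summable
  as well.\<close>

lemma wiener_amalgam_2_1_imp_L1L2:
  fixes g :: "real ^ 'm \<Rightarrow> complex"
  assumes g: "g \<in> wiener_amalgam 2 1"
  obtains g' where "L1L2 g'" "AE t in lborel. g t = g' t"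
proof -
  have [measurable]: "g \<in> borel_measurable lebesgue" using g by (simp add: wiener_amalgam_def)
  obtain g' where [measurable]: "g' \<in> borel_measurable borel" and AE: "AE t in lborel. g t = g' t"
    using lebesgue_measurable_obtain_borel[OF \<open>g \<in> borel_measurable lebesgue\<close>] .
  have [measurable]: "cube k 1 \<in> sets borel" for k :: "real ^ 'm" by (rule cube_measurable) simp
  define N where "N k = Lp_norm 2 (\<lambda>t. g t * indicator (cube k 1) t)" for k
  have N0: "0 \<le> N k" for k by (simp add: N_def Lp_norm_def)
  have N: "(\<integral>\<^sup>+t. ennreal ((cmod (g' t))\<^sup>2) * indicator (cube k 1) t \<partial>lborel) = ennreal ((N k)\<^sup>2)"
    if k: "k \<in> integer_points" for k
  proof -
    have m[measurable]: "(\<lambda>t. (cmod (g' t))\<^sup>2 * indicator (cube k 1) t) \<in> borel_measurable borel" by measurable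
    have i: "integrable lebesgue (\<lambda>t. cmod (g t * indicator (cube k 1) t) powr 2)"
      using g k by (simp add: wiener_amalgam_def Lp_space_def)
    have AE': "AE t in lebesgue. cmod (g t * indicator (cube k 1) t) powr 2 = (cmod (g' t))\<^sup>2 * indicator (cube k 1) t"
      using AE_completion[OF AE] by eventually_elim (simp add: indicator_def)
    have m': "(\<lambda>t. (cmod (g' t))\<^sup>2 * indicator (cube k 1) t) \<in> borel_measurable lebesgue" using m by (simp add: measurable_completion)
    have "integrable lebesgue (\<lambda>t. (cmod (g' t))\<^sup>2 * indicator (cube k 1) t)"
      by (rule Bochner_Integration.integrable_cong_AE[THEN iffD1, OF borel_measurable_integrable[OF i] m' AE' i])
    then have i': "integrable lborel (\<lambda>t. (cmod (g' t))\<^sup>2 * indicator (cube k 1) t)" by (simp add: integrable_completion)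
    have "(\<integral>t. cmod (g t * indicator (cube k 1) t) powr 2 \<partial>lebesgue) = (\<integral>t. (cmod (g' t))\<^sup>2 * indicator (cube k 1) t \<partial>lebesgue)"
      by (rule integral_cong_AE[OF borel_measurable_integrable[OF i] m' AE'])
    also have "\<dots> = (\<integral>t. (cmod (g' t))\<^sup>2 * indicator (cube k 1) t \<partial>lborel)" by (rule integral_completion) simp
    finally have eq: "N k = sqrt (\<integral>t. (cmod (g' t))\<^sup>2 * indicator (cube k 1) t \<partial>lborel)"
      by (simp add: N_def Lp_norm_def powr_half_sqrt)
    have nn: "0 \<le> (\<integral>t. (cmod (g' t))\<^sup>2 * indicator (cube k 1) t \<partial>lborel)" by simp
    have "(\<integral>\<^sup>+t. ennreal ((cmod (g' t))\<^sup>2) * indicator (cube k 1) t \<partial>lborel) = (\<integral>\<^sup>+t. ennreal ((cmod (g' t))\<^sup>2 * indicator (cube k 1) t) \<partial>lborel)"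
      by (intro nn_integral_cong) (simp add: indicator_def)
    also have "\<dots> = ennreal (\<integral>t. (cmod (g' t))\<^sup>2 * indicator (cube k 1) t \<partial>lborel)"
      by (rule nn_integral_eq_integral[OF i']) simp
    finally show ?thesis using nn by (simp add: eq)
  qed
  have sum: "N summable_on integer_points"
  proof -
    have "(\<lambda>k. N k powr 1) summable_on integer_points" using g by (simp add: wiener_amalgam_def N_def)
    then show ?thesis using N0 by simp
  qed
  define A where "A = infsum N integer_points"
  have A0: "0 \<le> A" unfolding A_def by (rule infsum_nonneg) (rule N0)
  have A: "(\<integral>\<^sup>+k. ennreal (N k) \<partial>count_space integer_points) = ennreal A"
    by (subst has_sum_iff_nn_integral[symmetric]) (use N0 A0 sum in \<open>auto simp: A_def\<close>)
  have "(\<integral>\<^sup>+t. ennreal (cmod (g' t)) * indicator (cube k 1) t \<partial>lborel) \<le> ennreal (N k)"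
    if k: "k \<in> integer_points" for k
  proof -
    have "emeasure lborel (cube k 1) = 1"
      by (simp add: emeasure_cube)
    moreover have "(\<integral>\<^sup>+t. ennreal (cmod (g' t)) * indicator (cube k 1) t \<partial>lborel)\<^sup>2 \<le>
        (\<integral>\<^sup>+t. (ennreal (cmod (g' t)) * indicator (cube k 1) t)\<^sup>2 \<partial>lborel) * (\<integral>\<^sup>+t. (indicator (cube k 1) t)\<^sup>2 \<partial>lborel)"
      using Cauchy_Schwarz_nn_integral[of "\<lambda>t. ennreal (cmod (g' t)) * indicator (cube k 1) t" lborel "indicator (cube k 1)"]
      by (simp add: mult.assoc indicator_inter_arith[symmetric])
    moreover have "(\<integral>\<^sup>+t. (ennreal (cmod (g' t)) * indicator (cube k 1) t)\<^sup>2 \<partial>lborel) = ennreal ((N k)\<^sup>2)"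
      unfolding N[OF k, symmetric] by (intro nn_integral_cong) (simp add: indicator_def ennreal_power)
    moreover have "(\<integral>\<^sup>+t. (indicator (cube k 1) t)\<^sup>2 \<partial>lborel) = emeasure lborel (cube k 1)"
    proof -
      have "(\<integral>\<^sup>+t. (indicator (cube k 1) t)\<^sup>2 \<partial>lborel) = (\<integral>\<^sup>+t. indicator (cube k 1) t \<partial>lborel)"
        by (intro nn_integral_cong) (simp split: split_indicator)
      then show ?thesis by simp
    qed
    ultimately have "(\<integral>\<^sup>+t. ennreal (cmod (g' t)) * indicator (cube k 1) t \<partial>lborel)\<^sup>2 \<le> (ennreal (N k))\<^sup>2"
      using N0 by (simp add: ennreal_power)
    then show ?thesis using N0[of k]
      by (cases "\<integral>\<^sup>+t. ennreal (cmod (g' t)) * indicator (cube k 1) t \<partial>lborel" rule: ennreal_cases)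
        (auto simp: ennreal_power power_mono_iff ennreal_le_iff top_unique)
  qed
  then have "(\<integral>\<^sup>+k. (\<integral>\<^sup>+t. ennreal (cmod (g' t)) * indicator (cube k 1) t \<partial>lborel) \<partial>count_space integer_points) \<le> ennreal A"
    unfolding A[symmetric] by (intro nn_integral_mono) simp
  then have "(\<integral>\<^sup>+t. ennreal (cmod (g' t)) \<partial>lborel) \<le> ennreal A"
    using nn_integral_le_sum_unit_cubes[of "\<lambda>t. ennreal (cmod (g' t))"] by (simp add: order_trans)
  then have i1: "integrable lborel g'" by (intro integrableI_bounded) (auto simp: order_le_less_trans)
  \<comment> \<open>With each local norm at most the sum \<open>A\<close>,
    \<open>(N k)\<^sup>2\<close> is at most \<open>A * N k\<close>, which is summable.\<close>
  have NA: "N k \<le> A" if "k \<in> integer_points" for k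
    using finite_sum_le_infsum[OF sum, of "{k}"] that N0 by (simp add: A_def)
  have "(\<integral>\<^sup>+t. ennreal ((cmod (g' t))\<^sup>2) \<partial>lborel) \<le>
      (\<integral>\<^sup>+k. (\<integral>\<^sup>+t. ennreal ((cmod (g' t))\<^sup>2) * indicator (cube k 1) t \<partial>lborel) \<partial>count_space integer_points)"
    by (rule nn_integral_le_sum_unit_cubes) simp
  also have "\<dots> = (\<integral>\<^sup>+k. ennreal ((N k)\<^sup>2) \<partial>count_space integer_points)"
    by (intro nn_integral_cong) (simp add: N)
  also have "\<dots> \<le> (\<integral>\<^sup>+k. ennreal A * ennreal (N k) \<partial>count_space integer_points)"
  proof (rule nn_integral_mono)
    fix k :: "real ^ 'm" assume "k \<in> space (count_space integer_points)"
    then have "N k * N k \<le> A * N k" using NA N0 by (intro mult_right_mono) auto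
    then show "ennreal ((N k)\<^sup>2) \<le> ennreal A * ennreal (N k)"
      using A0 N0 by (simp add: power2_eq_square ennreal_mult[symmetric] ennreal_leI)
  qed
  also have "\<dots> = ennreal A * ennreal A" by (simp add: nn_integral_cmult A)
  also have "\<dots> < \<infinity>" by (simp add: ennreal_mult_less_top)
  finally have "integrable lborel (\<lambda>t. (cmod (g' t))\<^sup>2)" by (intro integrableI_bounded) auto
  with i1 have "L1L2 g'" by (simp add: L1L2_def)
  then show ?thesis using that AE by blast
qed

lemma symmetric_compact_interval:
  fixes W :: "real set"
  assumes "is_interval W" "compact W" "interior W \<noteq> {}" "uminus ` W = W"
  obtains w where "w > 0" "W = {- w..w}"
proof -
  obtain a b where W: "W = {a..b}" using assms(1,2) is_interval_compact[of W] by (auto simp: cbox_interval)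
  then have ab: "a < b" using assms(3) by (auto simp: interior_atLeastAtMost_real)
  have "{- b..- a} = {a..b}" using assms(4) unfolding W by (simp add: image_uminus_atLeastAtMost)
  then have "a = - b" using ab by (simp add: Icc_eq_Icc)
  with W ab show ?thesis by (intro that[of b]) auto
qed

theorem corollary5p1:
  fixes \<Gamma> :: "((real ^ 'm) \<times> real) set"
    and \<Omega> :: "real set"
    and \<Delta> :: "(real ^ 'm) set"
    and g :: "nat \<Rightarrow> real ^ 'm \<Rightarrow> complex"
    and L :: nat
    and \<epsilon> :: real
  assumes lattice: "is_lattice \<Gamma>"
    and p1: "inj_on fst \<Gamma>" "closure (fst ` \<Gamma>) = UNIV"
    and p2: "inj_on snd \<Gamma>" "closure (snd ` \<Gamma>) = UNIV"
    and window: "is_interval \<Omega>" "compact \<Omega>" "interior \<Omega> \<noteq> {}"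
    and symmetric: "uminus ` \<Omega> = \<Omega>"
    and generic: "snd ` \<Gamma> \<inter> frontier \<Omega> = {}"
    and generic_dual: "snd ` dual_lattice \<Gamma> \<inter> frontier \<Omega> = {}"
    and eps: "0 < \<epsilon>" "\<epsilon> < 1"
    and Delta: "relatively_dense \<Delta>" "uniform_discrete \<Delta>"
    and g: "\<And>l. l \<in> {1..L} \<Longrightarrow> g l \<in> wiener_amalgam 2 1"
  shows "normalized_tight_frame (gabor_index L (model_set \<Gamma> \<Omega>) \<Delta>) (gabor_system g) \<longleftrightarrow>
    (\<forall>\<eta>\<in>dual_lattice \<Gamma>. AE t in lebesgue.
       of_real (point_density (model_set \<Gamma> \<Omega>)) * Phi \<epsilon> \<Omega> (- snd \<eta>) *
         (\<Sum>l=1..L. \<Sum>\<^sub>\<infinity>\<beta>\<in>\<Delta>. cnj (fourier (g l) (t - \<beta>)) * fourier (g l) (t - \<beta> - fst \<eta>))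
       = (if \<eta> = 0 then 1 else 0))"
proof -
  obtain w where w: "w > 0" and \<Omega>: "\<Omega> = {- w..w}"
    using symmetric_compact_interval[OF window symmetric] .
  obtain B d where Bd: "lattice_frame B d" and \<Gamma>: "\<Gamma> = lattice_frame.lat B"
    using is_lattice_imp_lattice_frame[OF lattice] .
  interpret F: lattice_frame B d by (rule Bd)
  \<comment> \<open>Replacing the windows by Borel representatives changes neither inner products
    nor Fourier transforms, so both sides of the equivalence are kept.\<close>
  have "\<forall>l. \<exists>g'. l \<in> {1..L} \<longrightarrow> L1L2 g' \<and> (AE t in lborel. g l t = g' t)"
    using wiener_amalgam_2_1_imp_L1L2[OF g] by metis
  then obtain g' where g': "\<And>l. l \<in> {1..L} \<Longrightarrow> L1L2 (g' l)" "\<And>l. l \<in> {1..L} \<Longrightarrow> AE t in lborel. g l t = g' l t"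
    by metis
  \<comment> \<open>The frontier consists of the two endpoints; genericity thus says that no lattice
    point lies over a jump of the window.\<close>
  have "frontier \<Omega> = {- w, w}" using w by (auto simp: \<Omega> frontier_def interior_atLeastAtMost_real)
  then have gen: "\<bar>snd \<gamma>\<bar> \<noteq> w" if "\<gamma> \<in> F.lat" for \<gamma>
    using generic that unfolding \<Gamma> by (auto simp: abs_if)
  interpret gabor_model B d \<Delta> g' L w
    by unfold_locales (use g'(1) Delta(2) w gen p2(2) in \<open>auto simp: \<Gamma>\<close>)
  have dens: "point_density (model_set \<Gamma> \<Omega>) = 2 * w / F.vol"
    unfolding \<Gamma> \<Omega> using point_density_model_set[of "- w" w] p1(1) p2(2) w by (simp add: \<Gamma>)
  have Phi: "Phi \<epsilon> \<Omega> (- u) = fourier (box_density w) u" for u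
    unfolding \<Omega> Phi_eq[OF w eps] by (rule fourier_box_density_minus[OF w])
  have four: "fourier (g l) = fourier (g' l)" if "l \<in> {1..L}" for l
    by (rule fourier_cong_AE[OF L1L2D(1)[OF g'(1)[OF that]] g'(2)[OF that]])
  have ker: "(\<Sum>l=1..L. \<Sum>\<^sub>\<infinity>\<beta>\<in>\<Delta>. cnj (fourier (g l) (t - \<beta>)) * fourier (g l) (t - \<beta> - p)) = kernel p t" for p t
    unfolding kernel_def by (intro sum.cong refl) (simp add: four)
  \<comment> \<open>Almost everywhere means the same for Lebesgue measure on Borel sets and for its
    completion.\<close>
  show ?thesis
    unfolding dens Phi ker AE_completion_iff unfolding \<Omega> \<Gamma>
    using tight_frame_iff[of g, OF _ g'(2)] p1(1) unfolding tight_condition_def \<Gamma> by simp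
qed

end
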